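(* Let $\Gamma$ be the free group on a finite set $S$ with $|S| = r$, and let $k$ be a positive integer. For every positive definite map $\phi:\Gamma\to \mathrm{M}_k$, the annealed AP entropy $\mathrm{h}^{\mathrm{ann}}(\phi)$ lies in $[-\infty,\infty)$, and it is equal to both \[\lim_{n\to\infty}\Big(\log\det\phi[B_n] - \sum_{s \in S}\log\det\phi[B_n\cap sB_n]\Big)\] and \[\lim_{n\to\infty}\Big(\sum_{s \in S}\log\det\phi[B_n\cup sB_n] - (2r-1)\log\det\phi[B_n]\Big),\] where each expression inside a limit is interpreted as $-\infty$ if any of the determinants appearing in it equals $0$.
   Context: A map $\phi:\Gamma\to\mathrm{M}_k$ is positive definite if it is bounded and $\sum_{g,h\in\Gamma}\sum_{i,j=1}^k \overline{a_{i,h}}a_{j,g}\phi_{ij}(h^{-1}g)\ge 0$ for all finitely supported $a_1,\dots,a_k:\Gamma\to\mathbf{C}$; equivalently $\phi(g) = [\langle \pi(g)v_j,v_i\rangle]_{i,j=1}^k$ for some unitary representation $\pi$ and vectors $v_1,\dots,v_k$. The space of positive definite maps $\Gamma\to\mathrm{M}_k$ carries the topology of pointwise convergence on $\Gamma$. For finite $F\subset\Gamma$, $\phi[F]$ is the positive semidefinite $F$-by-$F$ block matrix $[\phi(g^{-1}h)]_{g,h\in F}$ with blocks in $\mathrm{M}_k$. $B_n$ is the closed ball of radius $n$ about $e$ in the left Cayley graph of $\Gamma$ (edges $\{g,sg\}$, $s\in S\cup S^{-1}$), i.e. the set of elements whose reduced word in $S\cup S^{-1}$ has length at most $n$. The uniformly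 random AP sequence: for each $n$, $\pi_n$ is the random unitary representation of $\Gamma$ on $\mathbf{C}^n$ whose generators $\pi_n(s)$, $s\in S$, are independent Haar-distributed elements of $\mathrm{U}(n)$. For a representation $\pi$ on $\mathbf{C}^n$ and a set $O$ of maps $\Gamma\to\mathrm{M}_k$, let $\mathcal{X}(\pi,O)$ be the set of $k$-tuples $(v_1,\dots,v_k)\in(\mathbf{C}^n)^k$ such that $g\mapsto[\langle\pi(g)v_j,v_i\rangle]_{i,j}$ lies in $O$. Let $v(n) := \pi^n/n!$ (volume of the unit ball of $\mathbf{C}^n$). The annealed AP entropy is \[\mathrm{h}^{\mathrm{ann}}(\phi) := \inf_O\limsup_{n\to\infty}\frac{1}{n}\log\mathbf{E}\frac{\mathrm{vol}_{2kn}\mathcal{X}(\pi_n,O)}{v(n)^k},\] the infimum over all neighbourhoods $O$ of $\phi$, where $\mathrm{vol}_{2kn}$ is Lebesgue measure on $(\mathbf{C}^n)^k\cong\mathbf{R}^{2kn}$. *)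

theory Defs
  imports "HOL-Analysis.Analysis" "HOL-Probability.Probability"
begin

text \<open>Letters are pairs (s, b): b = False means the generator s, b = True means s inverse.\<close>

fun reduced :: "('s \<times> bool) list \<Rightarrow> bool" where
  "reduced (x # y # xs) = (\<not> (fst x = fst y \<and> snd x \<noteq> snd y) \<and> reduced (y # xs))"
| "reduced _ = True"

definition red_cons :: "'s \<times> bool \<Rightarrow> ('s \<times> bool) list \<Rightarrow> ('s \<times> bool) list" where
  "red_cons x ys = (case ys of [] \<Rightarrow> [x]
     | y # ys' \<Rightarrow> (if fst y = fst x \<and> snd y \<noteq> snd x then ys' else x # ys))"

typedef 's fword = "{xs :: ('s \<times> bool) list. reduced xs}"
  morphisms word Abs_fword
  by (rule exI[of _ "[]"]) simp

definition fmul :: "'s fword \<Rightarrow> 's fword \<Rightarrow> 's fword" where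
  "fmul g h = Abs_fword (foldr red_cons (word g) (word h))"

definition finv :: "'s fword \<Rightarrow> 's fword" where
  "finv g = Abs_fword (rev (map (\<lambda>(a, b). (a, \<not> b)) (word g)))"

definition fgen :: "'s \<Rightarrow> 's fword" where
  "fgen s = Abs_fword [(s, False)]"

definition fball :: "nat \<Rightarrow> 's fword set" where
  "fball n = {g. length (word g) \<le> n}"

definition posdef :: "('s fword \<Rightarrow> complex^'k^'k) \<Rightarrow> bool" where
  "posdef \<phi> \<longleftrightarrow>
     (\<exists>C. \<forall>g i j. cmod (\<phi> g $ i $ j) \<le> C) \<and>
     (\<forall>F (a :: 'k \<Rightarrow> 's fword \<Rightarrow> complex). finite F \<longrightarrow>
        (let z = (\<Sum>g\<in>F. \<Sum>h\<in>F. \<Sum>i\<in>UNIV. \<Sum>j\<in>UNIV.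
                    cnj (a i h) * a j g * (\<phi> (fmul (finv h) g) $ i $ j))
         in Im z = 0 \<and> Re z \<ge> 0))"

definition det_on :: "'a set \<Rightarrow> ('a \<Rightarrow> 'a \<Rightarrow> complex) \<Rightarrow> complex" where
  "det_on I A = (\<Sum>p\<in>{p. p permutes I}. of_int (sign p) * (\<Prod>i\<in>I. A i (p i)))"

definition blockdet :: "('s fword \<Rightarrow> complex^'k^'k) \<Rightarrow> 's fword set \<Rightarrow> complex" where
  "blockdet \<phi> F = det_on (F \<times> (UNIV :: 'k set))
      (\<lambda>(g, i) (h, j). \<phi> (fmul (finv g) h) $ i $ j)"

definition seq1 :: "('s::finite fword \<Rightarrow> complex^'k::finite^'k) \<Rightarrow> nat \<Rightarrow> ereal" where
  "seq1 \<phi> n =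
    (if blockdet \<phi> (fball n) = 0 \<or>
        (\<exists>s. blockdet \<phi> (fball n \<inter> fmul (fgen s) ` fball n) = 0)
     then -\<infinity>
     else ereal (ln (Re (blockdet \<phi> (fball n)))
          - (\<Sum>s\<in>UNIV. ln (Re (blockdet \<phi> (fball n \<inter> fmul (fgen s) ` fball n))))))"

definition seq2 :: "('s::finite fword \<Rightarrow> complex^'k::finite^'k) \<Rightarrow> nat \<Rightarrow> ereal" where
  "seq2 \<phi> n =
    (if blockdet \<phi> (fball n) = 0 \<or>
        (\<exists>s. blockdet \<phi> (fball n \<union> fmul (fgen s) ` fball n) = 0)
     then -\<infinity>
     else ereal ((\<Sum>s\<in>UNIV. ln (Re (blockdet \<phi> (fball n \<union> fmul (fgen s) ` fball n))))
          - (2 * real CARD('s) - 1) * ln (Re (blockdet \<phi> (fball n)))))"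

definition mat_meas :: "nat \<Rightarrow> (nat \<times> nat \<Rightarrow> complex) measure" where
  "mat_meas n = PiM ({..<n} \<times> {..<n}) (\<lambda>_. borel)"

definition umat :: "nat \<Rightarrow> (nat \<times> nat \<Rightarrow> complex) set" where
  "umat n = {A \<in> PiE ({..<n} \<times> {..<n}) (\<lambda>_. UNIV).
     \<forall>i<n. \<forall>j<n. (\<Sum>l<n. cnj (A (l, i)) * A (l, j)) = (if i = j then 1 else 0)}"

definition mmul :: "nat \<Rightarrow> (nat \<times> nat \<Rightarrow> complex) \<Rightarrow> (nat \<times> nat \<Rightarrow> complex) \<Rightarrow> (nat \<times> nat \<Rightarrow> complex)" where
  "mmul n A B = restrict (\<lambda>(i, j). \<Sum>l<n. A (i, l) * B (l, j)) ({..<n} \<times> {..<n})"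

text \<open>Haar probability measure on U(n): the (unique) left-invariant Borel probability measure.\<close>
definition haar :: "nat \<Rightarrow> (nat \<times> nat \<Rightarrow> complex) measure" where
  "haar n = (THE M. sets M = sets (restrict_space (mat_meas n) (umat n)) \<and> prob_space M \<and>
      (\<forall>B\<in>umat n. \<forall>X\<in>sets M. emeasure M (mmul n B ` X) = emeasure M X))"

definition rand_meas :: "nat \<Rightarrow> ('s::finite \<Rightarrow> (nat \<times> nat \<Rightarrow> complex)) measure" where
  "rand_meas n = PiM UNIV (\<lambda>_. haar n)"

definition act_letter :: "nat \<Rightarrow> ('s \<Rightarrow> (nat \<times> nat \<Rightarrow> complex)) \<Rightarrow> 's \<times> bool
      \<Rightarrow> (nat \<Rightarrow> complex) \<Rightarrow> (nat \<Rightarrow> complex)" where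
  "act_letter n U x v = (\<lambda>l. \<Sum>m<n.
      (if snd x then cnj (U (fst x) (m, l)) else U (fst x) (l, m)) * v m)"

definition rep_act :: "nat \<Rightarrow> ('s \<Rightarrow> (nat \<times> nat \<Rightarrow> complex)) \<Rightarrow> 's fword
      \<Rightarrow> (nat \<Rightarrow> complex) \<Rightarrow> (nat \<Rightarrow> complex)" where
  "rep_act n U g v = foldr (act_letter n U) (word g) v"

definition cinner :: "nat \<Rightarrow> (nat \<Rightarrow> complex) \<Rightarrow> (nat \<Rightarrow> complex) \<Rightarrow> complex" where
  "cinner n x y = (\<Sum>l<n. x l * cnj (y l))"

text \<open>k-tuples of vectors in C^n, as extensional functions on 'k x {..<n}; Lebesgue measure on R^(2kn).\<close>
definition vec_meas :: "nat \<Rightarrow> ('k \<times> nat \<Rightarrow> complex) measure" where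
  "vec_meas n = PiM (UNIV \<times> {..<n}) (\<lambda>_. lborel)"

definition coeff_map :: "nat \<Rightarrow> ('s \<Rightarrow> (nat \<times> nat \<Rightarrow> complex)) \<Rightarrow> ('k \<times> nat \<Rightarrow> complex)
      \<Rightarrow> 's fword \<Rightarrow> complex^'k^'k" where
  "coeff_map n U V = (\<lambda>g. \<chi> i j. cinner n (rep_act n U g (\<lambda>l. V (j, l))) (\<lambda>l. V (i, l)))"

definition Xset :: "nat \<Rightarrow> ('s \<Rightarrow> (nat \<times> nat \<Rightarrow> complex)) \<Rightarrow> ('s fword \<Rightarrow> complex^'k^'k) set
      \<Rightarrow> ('k \<times> nat \<Rightarrow> complex) set" where
  "Xset n U W = {V \<in> space (vec_meas n). coeff_map n U V \<in> W}"

definition vball :: "nat \<Rightarrow> real" where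
  "vball n = pi ^ n / fact n"

definition elog :: "ennreal \<Rightarrow> ereal" where
  "elog x = (if x = 0 then -\<infinity> else if x = \<top> then \<infinity> else ereal (ln (enn2real x)))"

definition ann_term :: "nat \<Rightarrow> ('s::finite fword \<Rightarrow> complex^'k::finite^'k) set \<Rightarrow> ereal" where
  "ann_term n W = ereal (1 / real n) *
     elog ((\<integral>\<^sup>+ U. emeasure (vec_meas n) (Xset n U W) \<partial>(rand_meas n))
           / ennreal (vball n ^ CARD('k)))"

text \<open>Annealed AP entropy: infimum over (open) neighbourhoods of phi in the space of positive
  definite maps with the topology of pointwise convergence.\<close>
definition hann :: "('s::finite fword \<Rightarrow> complex^'k::finite^'k) \<Rightarrow> ereal" where
  "hann \<phi> = (INF W \<in> {W. openin (top_of_set {\<psi>. posdef \<psi>}) W \<and> \<phi> \<in> W}.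
               limsup (\<lambda>n. ann_term n W))"

end

theory Submission
  imports Defs
begin

text \<open>
  Replace a \<open>k\<close>-tuple \<open>v\<close> by its orbit along a finite suffix-closed set \<open>F\<close>, which is a tree in the left
  Cayley graph. Orbits form a null set, so they are thickened: a tuple \<open>Y\<close> of vectors indexed by
  \<open>F \<times> k\<close> is admitted when every edge \<open>g, s g\<close> of the tree satisfies \<open>|U\<^sub>s Y\<^sub>g - Y\<^sub>s\<^sub>g| \<le> \<epsilon>\<close>.
  By Fubini along the tree the thickening multiplies volumes by \<open>v(n) \<epsilon>\<^bsup>2n\<^esup>\<close> for each edge and each of the
  \<open>k\<close> coordinates, and moves Gram kernels only by \<open>O(\<epsilon>)\<close>. For fixed \<open>Y\<close> the conditions for different
  generators are independent over the random \<open>U\<close>, and the condition for \<open>s\<close> says that a Haar unitary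
  carries one tuple \<open>\<epsilon>\<close>-close to another one of nearly equal Gram kernel. By invariance the
  probability of this is about \<open>(v(n) \<epsilon>\<^bsup>2n\<^esup>)\<^sup>m\<close>, where \<open>m\<close> is the number of vectors, divided by the volume of a
  neighbourhood in the space of tuples with the given Gram kernel. That volume is
  \<open>det\<^sup>n v(n)\<^sup>m\<close> to first exponential order: a Cholesky change of variables reduces it to the case of
  orthonormal tuples, where independent points of the unit ball are nearly orthonormal with high probability.
  All powers of \<open>\<epsilon>\<close> cancel, because a tree on \<open>F\<close> has \<open>card F - 1\<close> edges, and the annealed entropy
  at scale \<open>F\<close> is the log-determinant of \<open>\<phi>[F]\<close> minus the sum over \<open>s\<close> of those of \<open>\<phi>[F \<inter> s F]\<close>.

  Strong subadditivity of the log-determinant interlaces the two sequences of the theorem and makes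
  the first one decrease, so both converge to the infimum over balls. If some determinant vanishes,
  a minimal singular suffix-closed set \<open>F\<close> still has nonsingular edge sets, and the upper bound at that
  scale is \<open>-\<infinity>\<close>.
\<close>

subsection \<open>Determinants of positive semidefinite kernels\<close>

text \<open>Only exponential rates in \<open>n\<close> matter. Constant factors, such as the halves
  and twos in the volume estimates, are harmless, but a factor \<open>1 + \<delta>\<close> or
  \<open>1 - \<delta>\<close> on a radius enters to the power \<open>2 * n\<close> for every vector
  and disappears only when \<delta> tends to 0 after \<open>n\<close> has gone to infinity. This
  dictates the order of choices: \<open>F\<close>, \<delta> and \<epsilon> are fixed while
  \<open>n\<close> grows, and moving one tuple to another whose Gram kernel is \<eta>-close must
  cost O(\<eta>) with a constant that is independent of \<open>n\<close> and locally uniform in the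
  kernel. Hence the quantitative Cholesky factors \<open>bounded_chol\<close>. The two bounds on the
  transition probability are not symmetric. The upper one needs only a small \<eta>. In the lower
  one a random displacement by \<epsilon> itself perturbs the Gram kernel, so \<eta> is tied to
  \<epsilon>: it is of order \<epsilon> squared, which covers the Gram error and keeps the transport
  cost negligible against \<epsilon>. Upper volume bounds use the kernel plus \<open>t\<close> times
  the identity. It is invertible even if the kernel is singular, so one estimate serves both the
  finite values and the value -infinity.\<close>

lemma det_on_identical_rows:
  assumes fin: "finite I" and xy: "x \<in> I" "y \<in> I" "x \<noteq> y" and eq: "\<And>b. b \<in> I \<Longrightarrow> A x b = A y b"
  shows "det_on I A = 0"
proof -
  define t where "t = Transposition.transpose x y"
  have t: "t permutes I" unfolding t_def using xy by (intro permutes_swap_id)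
  let ?g = "\<lambda>p. of_int (sign p) * (\<Prod>i\<in>I. A i (p i)) :: complex"
  \<comment> \<open>Composition with \<open>t\<close> permutes the summands, flips each sign and,
    since rows \<open>x\<close> and \<open>y\<close> agree, keeps each product.\<close>
  have "det_on I A = (\<Sum>p\<in>{p. p permutes I}. ?g (p \<circ> t))"
    unfolding det_on_def by (rule sum_permutations_compose_right[OF t])
  also have "\<dots> = (\<Sum>p\<in>{p. p permutes I}. - ?g p)"
  proof (rule sum.cong, simp)
    fix p assume "p \<in> {p. p permutes I}"
    then have p: "p permutes I" by simp
    have "permutation p" "permutation t"
      using permutation_permutes fin p t by blast+
    then have "sign (p \<circ> t) = sign p * sign t" by (rule sign_compose)
    moreover have "sign t = -1" unfolding t_def using xy by (simp add: sign_swap_id)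
    ultimately have s: "sign (p \<circ> t) = - sign p" by simp
    have tt: "t (t i) = i" for i by (simp add: t_def)
    have "(\<Prod>i\<in>I. A i ((p \<circ> t) i)) = (\<Prod>i\<in>I. A (t i) (p i))"
      by (subst prod.permute[OF t]) (simp add: o_def tt)
    also have "\<dots> = (\<Prod>i\<in>I. A i (p i))"
    proof (rule prod.cong[OF refl])
      fix i assume "i \<in> I"
      then have "p i \<in> I" using p by (simp add: permutes_in_image)
      then show "A (t i) (p i) = A i (p i)"
        unfolding t_def using eq by (auto simp: Transposition.transpose_def)
    qed
    finally show "?g (p \<circ> t) = - ?g p" using s by simp
  qed
  also have "\<dots> = - det_on I A" by (simp add: det_on_def sum_negf)
  finally show ?thesis by simp
qed

lemma det_on_empty [simp]: "det_on {} A = 1"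
  by (simp add: det_on_def)

text \<open>Once the combination of the rows of \<open>A\<close> is subtracted from row
  \<open>x\<close>, only the entry in column \<open>x\<close> survives; it is the factor in front
  and will be the Schur complement of \<open>x\<close>.\<close>

lemma det_on_insert_combination:
  assumes fin: "finite A" and x: "x \<notin> A"
    and comb: "\<And>b. b \<in> A \<Longrightarrow> Q x b = (\<Sum>a\<in>A. c a * Q a b)"
  shows "det_on (insert x A) Q = (Q x x - (\<Sum>a\<in>A. c a * Q a x)) * det_on A Q"
proof -
  let ?I = "insert x A"
  \<comment> \<open>\<open>L r\<close> is the determinant with row \<open>x\<close> replaced by
    \<open>r\<close>, seen as a linear function of \<open>r\<close>.\<close>
  define L where "L r = (\<Sum>p\<in>{p. p permutes ?I}. of_int (sign p) * (r (p x) * (\<Prod>i\<in>A. Q i (p i))))"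
    for r :: "'a \<Rightarrow> complex"
  have L_row: "L r = det_on ?I (Q(x := r))" for r
  proof -
    have "(\<Prod>i\<in>A. (Q(x := r)) i (p i)) = (\<Prod>i\<in>A. Q i (p i))" for p
      using x by (intro prod.cong) auto
    then show ?thesis unfolding L_def det_on_def using fin x by simp
  qed
  define r0 where "r0 b = Q x b - (\<Sum>a\<in>A. c a * Q a b)" for b
  have lin: "L (Q x) = L r0 + (\<Sum>a\<in>A. c a * L (Q a))"
    unfolding L_def sum_distrib_left
    apply (subst sum.swap)
    apply (simp add: sum.distrib[symmetric] r0_def algebra_simps sum_distrib_left sum_distrib_right)
    done
  have "L (Q a) = 0" if "a \<in> A" for a
    unfolding L_row using that x fin by (intro det_on_identical_rows[of ?I x a]) auto
  then have "L (Q x) = L r0" using lin by simp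
  \<comment> \<open>A permutation of the larger set that moves \<open>x\<close> sends it into
    \<open>A\<close>, where \<open>r0\<close> vanishes; only permutations of \<open>A\<close>
    contribute.\<close>
  also have "L r0 = (\<Sum>p\<in>{p. p permutes A}. of_int (sign p) * (r0 (p x) * (\<Prod>i\<in>A. Q i (p i))))"
    unfolding L_def
  proof (rule sum.mono_neutral_right)
    show "finite {p. p permutes ?I}" using fin by (simp add: finite_permutations)
    show "{p. p permutes A} \<subseteq> {p. p permutes ?I}" by (auto intro: permutes_subset)
    show "\<forall>p\<in>{p. p permutes ?I} - {p. p permutes A}. of_int (sign p) * (r0 (p x) * (\<Prod>i\<in>A. Q i (p i))) = 0"
    proof
      fix p assume p: "p \<in> {p. p permutes ?I} - {p. p permutes A}"
      have "p x \<noteq> x"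
      proof
        assume "p x = x"
        then have "p permutes A" using p
          by (auto intro!: permutes_superset[of p ?I A])
        then show False using p by simp
      qed
      moreover have "p x \<in> ?I" using p permutes_in_image[of p ?I x] by auto
      ultimately have "p x \<in> A" by simp
      then show "of_int (sign p) * (r0 (p x) * (\<Prod>i\<in>A. Q i (p i))) = 0" using comb by (simp add: r0_def)
    qed
  qed
  also have "\<dots> = r0 x * det_on A Q"
    unfolding det_on_def sum_distrib_left
    using x by (intro sum.cong) (auto simp: permutes_not_in)
  finally show ?thesis using L_row[of "Q x"] by (simp add: r0_def)
qed

text \<open>Needed with \<open>f\<close> a left translation of the group, under which block
  determinants do not change.\<close>

lemma det_on_reindex:
  assumes fin: "finite I" and inj: "inj_on f I"
  shows "det_on (f ` I) A = det_on I (\<lambda>i j. A (f i) (f j))"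
proof -
  let ?g = "\<lambda>p. of_int (sign p) * (\<Prod>i\<in>f ` I. A i (p i)) :: complex"
  have bij: "bij_betw f I (f ` I)" using inj by (rule inj_on_imp_bij_betw)
  have eq: "map_permutation I f = (\<lambda>\<pi> x. if x \<in> f ` I then f (\<pi> (inv_into I f x)) else x)"
    by (auto simp: fun_eq_iff map_permutation_def restrict_id_def)
  have "det_on (f ` I) A = (\<Sum>p\<in>{p. p permutes I}. ?g (map_permutation I f p))"
    unfolding det_on_def eq
    by (rule sum.reindex_bij_betw[OF bij_betw_permutations[OF bij], symmetric])
  also have "\<dots> = det_on I (\<lambda>i j. A (f i) (f j))"
    unfolding det_on_def
  proof (rule sum.cong[OF refl])
    fix p assume "p \<in> {p. p permutes I}"
    then have p: "p permutes I" by simp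
    have "sign (map_permutation I f p) = sign p"
      using p inj fin by (intro sign_map_permutation)
    moreover have "(\<Prod>i\<in>f ` I. A i (map_permutation I f p i)) = (\<Prod>i\<in>I. A (f i) (f (p i)))"
      by (subst prod.reindex[OF inj]) (auto simp: eq inv_into_f_f[OF inj] intro!: prod.cong)
    ultimately show "?g (map_permutation I f p) = of_int (sign p) * (\<Prod>i\<in>I. A (f i) (f (p i)))" by simp
  qed
  finally show ?thesis .
qed

section \<open>Positive semidefinite kernels and their null vectors\<close>

definition qf :: "'i set \<Rightarrow> ('i \<Rightarrow> 'i \<Rightarrow> complex) \<Rightarrow> ('i \<Rightarrow> complex) \<Rightarrow> complex" where
  "qf I Q a = (\<Sum>p\<in>I. \<Sum>q\<in>I. cnj (a p) * a q * Q p q)"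

text \<open>Reality of the form is demanded instead of Hermitian symmetry because this is what
  \<open>posdef\<close> provides; symmetry follows in \<open>psd_hermitian\<close>.\<close>

definition psd :: "'i set \<Rightarrow> ('i \<Rightarrow> 'i \<Rightarrow> complex) \<Rightarrow> bool" where
  "psd I Q \<longleftrightarrow> (\<forall>a. Im (qf I Q a) = 0 \<and> 0 \<le> Re (qf I Q a))"

lemma qf_support:
  assumes "finite I" "J \<subseteq> I" "\<And>i. i \<in> I - J \<Longrightarrow> a i = 0"
  shows "qf I Q a = qf J Q a"
proof -
  have "(\<Sum>q\<in>I. cnj (a p) * a q * Q p q) = (\<Sum>q\<in>J. cnj (a p) * a q * Q p q)" for p
    using assms by (intro sum.mono_neutral_right) auto
  then show ?thesis unfolding qf_def
    using assms by (simp, intro sum.mono_neutral_right) auto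
qed

lemma qf_cong: "(\<And>i. i \<in> I \<Longrightarrow> a i = b i) \<Longrightarrow> qf I Q a = qf I Q b"
  unfolding qf_def by (intro sum.cong) auto

lemma psd_mono:
  assumes "finite I" "J \<subseteq> I" "psd I Q"
  shows "psd J Q"
  unfolding psd_def
proof
  fix a
  have "qf J Q a = qf J Q (\<lambda>i. if i \<in> J then a i else 0)" by (intro qf_cong) auto
  also have "\<dots> = qf I Q (\<lambda>i. if i \<in> J then a i else 0)"
    using assms by (intro qf_support[symmetric]) auto
  finally show "Im (qf J Q a) = 0 \<and> 0 \<le> Re (qf J Q a)"
    using assms(3) unfolding psd_def by metis
qed

lemma psd_diag:
  assumes "finite I" "psd I Q" "p \<in> I"
  shows "Im (Q p p) = 0" "0 \<le> Re (Q p p)"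
proof -
  have "psd {p} Q" using psd_mono[of I "{p}" Q] assms by auto
  then have "Im (qf {p} Q (\<lambda>_. 1)) = 0 \<and> 0 \<le> Re (qf {p} Q (\<lambda>_. 1))" unfolding psd_def by blast
  then show "Im (Q p p) = 0" "0 \<le> Re (Q p p)" by (simp_all add: qf_def)
qed

text \<open>Polarization: reality of the form at the vectors (1, 1) and (1, i) on
  \<open>{p, q}\<close> compares first the imaginary and then the real parts.\<close>

lemma psd_hermitian:
  assumes "finite I" "psd I Q" "p \<in> I" "q \<in> I"
  shows "Q q p = cnj (Q p q)"
proof (cases "p = q")
  case True
  then show ?thesis using psd_diag[OF assms(1,2,3)] by (simp add: complex_eq_iff)
next
  case False
  have "psd {p, q} Q" using psd_mono[of I "{p, q}" Q] assms by auto
  then have *: "Im (qf {p,q} Q a) = 0" for a unfolding psd_def by blast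
  show ?thesis
    using *[of "\<lambda>_. 1"] *[of "\<lambda>i. if i = p then 1 else \<i>"] False
      psd_diag[OF assms(1,2,3)] psd_diag[OF assms(1,2,4)]
    by (simp add: qf_def complex_eq_iff)
qed

lemma qf_add:
  assumes "finite I" "psd I Q"
  shows "qf I Q (\<lambda>p. a p + b p) = qf I Q a + qf I Q b
     + 2 * complex_of_real (Re (\<Sum>p\<in>I. cnj (b p) * (\<Sum>q\<in>I. Q p q * a q)))"
proof -
  let ?z = "\<Sum>p\<in>I. cnj (b p) * (\<Sum>q\<in>I. Q p q * a q)"
  have z: "(\<Sum>p\<in>I. \<Sum>q\<in>I. cnj (b p) * a q * Q p q) = ?z"
    by (simp add: sum_distrib_left mult_ac)
  have "(\<Sum>p\<in>I. \<Sum>q\<in>I. cnj (a p) * b q * Q p q) = (\<Sum>q\<in>I. \<Sum>p\<in>I. cnj (a p) * b q * Q p q)"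
    by (rule sum.swap)
  also have "\<dots> = (\<Sum>q\<in>I. \<Sum>p\<in>I. cnj (cnj (b q) * a p * Q q p))"
  proof (intro sum.cong refl)
    fix p q assume "p \<in> I" "q \<in> I"
    then show "cnj (a p) * b q * Q p q = cnj (cnj (b q) * a p * Q q p)"
      by (subst psd_hermitian[OF assms, of q p]) (simp_all add: mult_ac)
  qed
  also have "\<dots> = cnj ?z" unfolding z[symmetric] by simp
  finally have z': "(\<Sum>p\<in>I. \<Sum>q\<in>I. cnj (a p) * b q * Q p q) = cnj ?z" .
  have "qf I Q (\<lambda>p. a p + b p) = qf I Q a + qf I Q b
      + ((\<Sum>p\<in>I. \<Sum>q\<in>I. cnj (b p) * a q * Q p q) + (\<Sum>p\<in>I. \<Sum>q\<in>I. cnj (a p) * b q * Q p q))"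
    by (simp add: qf_def sum.distrib[symmetric] algebra_simps)
  also have "\<dots> = qf I Q a + qf I Q b + (?z + cnj ?z)" unfolding z z' ..
  also have "?z + cnj ?z = 2 * complex_of_real (Re ?z)" by (simp only: complex_add_cnj of_real_mult of_real_numeral)
  finally show ?thesis .
qed

text \<open>If the entry \<open>z\<close> of \<open>Q u\<close> at \<open>b\<close> were nonzero, a
  small step from \<open>u\<close> along \<open>-z\<close> at \<open>b\<close> would change the form
  by a negative first-order term that beats the quadratic one.\<close>

lemma psd_null_vector:
  assumes "finite I" "psd I Q" "qf I Q u = 0" "b \<in> I"
  shows "(\<Sum>q\<in>I. Q b q * u q) = 0"
proof (rule ccontr)
  define z where "z = (\<Sum>q\<in>I. Q b q * u q)"
  assume "\<not> ?thesis"
  then have z: "z \<noteq> 0" by (simp add: z_def)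
  define K where "K = Re (Q b b)"
  have K: "K \<ge> 0" using psd_diag assms by (auto simp: K_def)
  \<comment> \<open>With this step length \<open>\<tau> * K\<close> is at most 1, while
    nonnegativity of the form forces it to be at least 2.\<close>
  define \<tau> where "\<tau> = 1 / (K + 1)"
  have \<tau>: "\<tau> > 0" using K by (simp add: \<tau>_def)
  define v where "v i = (if i = b then - of_real \<tau> * z else 0)" for i
  have "(\<Sum>p\<in>I. cnj (v p) * (\<Sum>q\<in>I. Q p q * u q)) = (\<Sum>p\<in>{b}. cnj (v p) * (\<Sum>q\<in>I. Q p q * u q))"
    using assms by (intro sum.mono_neutral_right) (auto simp: v_def)
  also have "\<dots> = - of_real \<tau> * (cnj z * z)" by (simp add: v_def z_def)
  also have "\<dots> = - of_real (\<tau> * (cmod z)\<^sup>2)"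
    by (metis complex_norm_square mult.commute mult_minus_left of_real_mult)
  finally have c0: "(\<Sum>p\<in>I. cnj (v p) * (\<Sum>q\<in>I. Q p q * u q)) = of_real (- \<tau> * (cmod z)\<^sup>2)" by simp
  have c: "Re (\<Sum>p\<in>I. cnj (v p) * (\<Sum>q\<in>I. Q p q * u q)) = - \<tau> * (cmod z)\<^sup>2"
    unfolding c0 by (rule Re_complex_of_real)
  have "qf I Q v = qf {b} Q v" using assms by (intro qf_support) (auto simp: v_def)
  also have "\<dots> = of_real (\<tau>\<^sup>2) * (z * cnj z) * Q b b" by (simp add: qf_def v_def power2_eq_square)
  also have "\<dots> = of_real (\<tau>\<^sup>2 * (cmod z)\<^sup>2) * Q b b" by (simp only: complex_norm_square of_real_mult)
  finally have qv: "Re (qf I Q v) = \<tau>\<^sup>2 * (cmod z)\<^sup>2 * K" by (simp add: K_def)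
  have "0 \<le> Re (qf I Q (\<lambda>p. u p + v p))" using assms unfolding psd_def by blast
  also have "\<dots> = \<tau>\<^sup>2 * (cmod z)\<^sup>2 * K - 2 * \<tau> * (cmod z)\<^sup>2"
    by (subst qf_add[OF assms(1,2)]) (simp add: assms qv c del: Re_sum)
  also have "\<dots> = \<tau> * (cmod z)\<^sup>2 * (\<tau> * K - 2)" by (simp add: power2_eq_square algebra_simps)
  finally have "0 \<le> \<tau> * (cmod z)\<^sup>2 * (\<tau> * K - 2)" .
  moreover have "\<tau> * (cmod z)\<^sup>2 > 0" using \<tau> z by simp
  ultimately have "\<tau> * K \<ge> 2" by (metis diff_ge_0_iff_ge not_less mult_pos_neg linorder_not_le)
  moreover have "\<tau> * K \<le> 1" using K by (simp add: \<tau>_def)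
  ultimately show False by simp
qed

section \<open>Cholesky factors and Schur complements\<close>

text \<open>Upper triangular with positive real diagonal, relative to the order in which indices are
  inserted: a new row vanishes on all earlier columns. No linear order on the index type has to be
  chosen.\<close>

inductive tri :: "('i \<Rightarrow> 'i \<Rightarrow> complex) \<Rightarrow> 'i set \<Rightarrow> bool" for R where
  tri_empty: "tri R {}"
| tri_insert: "tri R A \<Longrightarrow> finite A \<Longrightarrow> x \<notin> A \<Longrightarrow> (\<And>a. a \<in> A \<Longrightarrow> R x a = 0) \<Longrightarrow> Im (R x x) = 0 \<Longrightarrow> 0 < Re (R x x)
     \<Longrightarrow> tri R (insert x A)"

lemma tri_cong: "tri R A \<Longrightarrow> (\<And>p q. p \<in> A \<Longrightarrow> q \<in> A \<Longrightarrow> R p q = R' p q) \<Longrightarrow> tri R' A"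
proof (induction rule: tri.induct)
  case (tri_insert A x)
  have e: "R' x a = R x a" if "a \<in> insert x A" for a
    using tri_insert.prems[of x a] that by simp
  show ?case
  proof (rule tri.tri_insert)
    show "tri R' A" by (rule tri_insert.IH) (use tri_insert.prems in blast)
    show "R' x a = 0" if "a \<in> A" for a
      unfolding e[OF insertI2[OF that]] using that by (rule tri_insert.hyps(4))
    show "Im (R' x x) = 0" "0 < Re (R' x x)"
      unfolding e[OF insertI1] by (rule tri_insert.hyps)+
  qed (rule tri_insert.hyps)+
qed (rule tri.tri_empty)

text \<open>\<open>R\<close> is a Cholesky factor of \<open>Q\<close> and \<open>S\<close> is the
  inverse of \<open>R\<close>. The inverse and the determinant are carried along because the same
  induction over the index set produces them.\<close>

definition chol :: "'i set \<Rightarrow> ('i \<Rightarrow> 'i \<Rightarrow> complex) \<Rightarrow> ('i \<Rightarrow> 'i \<Rightarrow> complex) \<Rightarrow> ('i \<Rightarrow> 'i \<Rightarrow> complex) \<Rightarrow> bool" where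
  "chol I Q R S \<longleftrightarrow> tri R I
     \<and> (\<forall>p\<in>I. \<forall>q\<in>I. Q p q = (\<Sum>l\<in>I. cnj (R l p) * R l q))
     \<and> (\<forall>p\<in>I. \<forall>q\<in>I. (\<Sum>l\<in>I. R p l * S l q) = (if p = q then 1 else 0))
     \<and> (\<forall>p\<in>I. \<forall>q\<in>I. (\<Sum>l\<in>I. S p l * R l q) = (if p = q then 1 else 0))
     \<and> det_on I Q = complex_of_real (\<Prod>l\<in>I. (cmod (R l l))\<^sup>2)"

lemma chol_nonzero: "finite I \<Longrightarrow> chol I Q R S \<Longrightarrow> (\<Prod>l\<in>I. (cmod (R l l))\<^sup>2) > 0"
proof -
  have "tri R I \<Longrightarrow> \<forall>l\<in>I. R l l \<noteq> 0" by (induction rule: tri.induct) (auto simp: complex_eq_iff)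
  then show "finite I \<Longrightarrow> chol I Q R S \<Longrightarrow> ?thesis" by (auto simp: chol_def intro!: prod_pos)
qed

lemma chol_det_nonzero: "finite I \<Longrightarrow> chol I Q R S \<Longrightarrow> det_on I Q \<noteq> 0"
proof -
  assume "finite I" "chol I Q R S"
  then obtain t where "t > 0" "det_on I Q = complex_of_real t"
    using chol_nonzero[of I Q R S] unfolding chol_def by blast
  then show ?thesis by simp
qed

text \<open>Here \<open>d\<close> holds the coefficients of the orthogonal projection of the vector
  \<open>x\<close> on the span of \<open>A\<close>, that is the solution of the normal equations,
  and \<open>r\<close> is the column that \<open>x\<close> adds to the Cholesky factor.\<close>

lemma chol_projection:
  assumes fin: "finite A" and x: "x \<notin> A" and psd: "psd (insert x A) Q" and ch: "chol A Q R S"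
  obtains r d where
    "\<And>p. p \<in> A \<Longrightarrow> Q p x = (\<Sum>l\<in>A. cnj (R l p) * r l)"
    "\<And>l. l \<in> A \<Longrightarrow> (\<Sum>a\<in>A. R l a * d a) = r l"
    "\<And>a. d a = (\<Sum>l\<in>A. S a l * r l)"
    "\<And>p. p \<in> A \<Longrightarrow> Q p x = (\<Sum>a\<in>A. Q p a * d a)"
    "\<And>p. p \<in> A \<Longrightarrow> Q x p = (\<Sum>a\<in>A. cnj (d a) * Q a p)"
    "(\<Sum>a\<in>A. cnj (d a) * Q a x) = (\<Sum>l\<in>A. cnj (r l) * r l)"
proof -
  have Q: "Q p q = (\<Sum>l\<in>A. cnj (R l p) * R l q)" if "p \<in> A" "q \<in> A" for p q
    using ch that by (simp add: chol_def)
  have RS: "(\<Sum>l\<in>A. R p l * S l q) = (if p = q then 1 else 0)" if "p \<in> A" "q \<in> A" for p q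
    using ch that by (simp add: chol_def)
  have SR: "(\<Sum>l\<in>A. S p l * R l q) = (if p = q then 1 else 0)" if "p \<in> A" "q \<in> A" for p q
    using ch that by (simp add: chol_def)
  \<comment> \<open>\<open>r\<close> is the adjoint of \<open>S\<close> applied to the column of
    \<open>x\<close>; then \<open>d\<close> is the inverse of \<open>Q\<close> on \<open>A\<close>
    applied to that column.\<close>
  define r where "r l = (\<Sum>p\<in>A. cnj (S p l) * Q p x)" for l
  define d where "d a = (\<Sum>l\<in>A. S a l * r l)" for a
  have 1: "Q p x = (\<Sum>l\<in>A. cnj (R l p) * r l)" if p: "p \<in> A" for p
  proof -
    have "(\<Sum>l\<in>A. cnj (R l p) * r l) = (\<Sum>l\<in>A. \<Sum>q\<in>A. cnj (S q l * R l p) * Q q x)"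
      unfolding r_def sum_distrib_left by (intro sum.cong refl) (simp add: mult_ac)
    also have "\<dots> = (\<Sum>q\<in>A. cnj (\<Sum>l\<in>A. S q l * R l p) * Q q x)"
      by (subst sum.swap) (simp add: sum_distrib_right)
    also have "\<dots> = (\<Sum>q\<in>A. if q = p then Q p x else 0)"
      using p by (intro sum.cong refl) (simp add: SR)
    also have "\<dots> = Q p x" using fin p by simp
    finally show ?thesis by simp
  qed
  have 2: "(\<Sum>a\<in>A. R l a * d a) = r l" if l: "l \<in> A" for l
  proof -
    have "(\<Sum>a\<in>A. R l a * d a) = (\<Sum>a\<in>A. \<Sum>m\<in>A. R l a * S a m * r m)"
      unfolding d_def sum_distrib_left by (simp add: mult_ac)
    also have "\<dots> = (\<Sum>m\<in>A. (\<Sum>a\<in>A. R l a * S a m) * r m)"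
      by (subst sum.swap) (simp add: sum_distrib_right)
    also have "\<dots> = (\<Sum>m\<in>A. if l = m then r m else 0)"
      using l by (intro sum.cong refl) (simp add: RS)
    also have "\<dots> = r l" using fin l by simp
    finally show ?thesis .
  qed
  have 3: "Q p x = (\<Sum>a\<in>A. Q p a * d a)" if p: "p \<in> A" for p
  proof -
    have "(\<Sum>a\<in>A. Q p a * d a) = (\<Sum>a\<in>A. \<Sum>l\<in>A. cnj (R l p) * (R l a * d a))"
      using p by (intro sum.cong refl) (simp add: Q sum_distrib_left sum_distrib_right mult_ac)
    also have "\<dots> = (\<Sum>l\<in>A. cnj (R l p) * (\<Sum>a\<in>A. R l a * d a))"
      by (subst sum.swap) (simp add: sum_distrib_left)
    also have "\<dots> = (\<Sum>l\<in>A. cnj (R l p) * r l)" by (intro sum.cong refl) (simp add: 2)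
    finally show ?thesis using 1[OF p] by simp
  qed
  have herm: "Q q p = cnj (Q p q)" if "p \<in> insert x A" "q \<in> insert x A" for p q
    using psd_hermitian[OF _ psd that] fin by simp
  have 4: "Q x p = (\<Sum>a\<in>A. cnj (d a) * Q a p)" if p: "p \<in> A" for p
  proof -
    have "Q x p = cnj (Q p x)" using herm[of p x] p by simp
    also have "\<dots> = (\<Sum>a\<in>A. cnj (d a) * cnj (Q p a))" by (simp add: 3[OF p] mult.commute)
    also have "\<dots> = (\<Sum>a\<in>A. cnj (d a) * Q a p)" using p by (intro sum.cong refl) (simp add: herm[of p])
    finally show ?thesis .
  qed
  have 5: "(\<Sum>a\<in>A. cnj (d a) * Q a x) = (\<Sum>l\<in>A. cnj (r l) * r l)"
  proof -
    have "(\<Sum>a\<in>A. cnj (d a) * Q a x) = (\<Sum>a\<in>A. \<Sum>l\<in>A. cnj (R l a * d a) * r l)"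
      by (intro sum.cong refl) (simp add: 1 sum_distrib_left mult_ac)
    also have "\<dots> = (\<Sum>l\<in>A. cnj (\<Sum>a\<in>A. R l a * d a) * r l)"
      by (subst sum.swap) (simp add: sum_distrib_right)
    also have "\<dots> = (\<Sum>l\<in>A. cnj (r l) * r l)" by (intro sum.cong refl) (simp add: 2)
    finally show ?thesis .
  qed
  show ?thesis using that[of r d] 1 2 3 4 5 d_def by blast
qed

text \<open>The Schur complement of \<open>x\<close> is the minimum of the quadratic form over \<open>x + span A\<close>.\<close>

lemma schur_complement:
  assumes fin: "finite A" and x: "x \<notin> A" and psd: "psd (insert x A) Q" and ch: "chol A Q R S"
  obtains d where
    "det_on (insert x A) Q = qf (insert x A) Q (\<lambda>i. if i = x then 1 else - d i) * det_on A Q"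
    "\<And>e. Re (qf (insert x A) Q (\<lambda>i. if i = x then 1 else - d i))
        \<le> Re (qf (insert x A) Q (\<lambda>i. if i = x then 1 else - e i))"
    "\<And>p. p \<in> A \<Longrightarrow> (\<Sum>q\<in>insert x A. Q p q * (if q = x then 1 else - d q)) = 0"
proof -
  obtain r d where rd: "\<And>p. p \<in> A \<Longrightarrow> Q p x = (\<Sum>l\<in>A. cnj (R l p) * r l)"
    "\<And>l. l \<in> A \<Longrightarrow> (\<Sum>a\<in>A. R l a * d a) = r l"
    "\<And>a. d a = (\<Sum>l\<in>A. S a l * r l)"
    "\<And>p. p \<in> A \<Longrightarrow> Q p x = (\<Sum>a\<in>A. Q p a * d a)"
    "\<And>p. p \<in> A \<Longrightarrow> Q x p = (\<Sum>a\<in>A. cnj (d a) * Q a p)"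
    "(\<Sum>a\<in>A. cnj (d a) * Q a x) = (\<Sum>l\<in>A. cnj (r l) * r l)"
    using that by (rule chol_projection[OF assms])
  let ?u = "\<lambda>i. if i = x then 1 else - d i"
  have u0: "(\<Sum>q\<in>insert x A. Q p q * ?u q) = 0" if "p \<in> A" for p
  proof -
    have "(\<Sum>q\<in>A. Q p q * ?u q) = - (\<Sum>q\<in>A. Q p q * d q)"
      unfolding sum_negf[symmetric] using x by (intro sum.cong) auto
    then show ?thesis using fin x rd(4)[OF that] by simp
  qed
  have ux: "(\<Sum>q\<in>insert x A. Q x q * ?u q) = Q x x - (\<Sum>a\<in>A. cnj (d a) * Q a x)"
  proof -
    have "(\<Sum>q\<in>A. Q x q * ?u q) = - (\<Sum>q\<in>A. Q x q * d q)"
      unfolding sum_negf[symmetric] using x by (intro sum.cong) auto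
    also have "(\<Sum>q\<in>A. Q x q * d q) = (\<Sum>q\<in>A. \<Sum>a\<in>A. cnj (d a) * (Q a q * d q))"
      by (intro sum.cong refl) (simp add: rd(5) sum_distrib_left sum_distrib_right mult_ac)
    also have "\<dots> = (\<Sum>a\<in>A. cnj (d a) * Q a x)"
      by (subst sum.swap) (simp add: rd(4) sum_distrib_left)
    finally show ?thesis using fin x by simp
  qed
  have qu: "qf (insert x A) Q ?u = Q x x - (\<Sum>a\<in>A. cnj (d a) * Q a x)"
  proof -
    have "qf (insert x A) Q ?u = (\<Sum>p\<in>insert x A. cnj (?u p) * (\<Sum>q\<in>insert x A. Q p q * ?u q))"
      unfolding qf_def sum_distrib_left by (simp add: mult_ac)
    also have "\<dots> = cnj (?u x) * (\<Sum>q\<in>insert x A. Q x q * ?u q) + (\<Sum>p\<in>A. cnj (?u p) * (\<Sum>q\<in>insert x A. Q p q * ?u q))"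
      using fin x by (subst sum.insert) auto
    also have "(\<Sum>p\<in>A. cnj (?u p) * (\<Sum>q\<in>insert x A. Q p q * ?u q)) = 0"
      by (rule sum.neutral) (use u0 in \<open>metis mult_zero_right\<close>)
    finally show ?thesis unfolding ux by simp
  qed
  have det: "det_on (insert x A) Q = qf (insert x A) Q ?u * det_on A Q"
    unfolding qu using det_on_insert_combination[OF fin x, of Q "\<lambda>a. cnj (d a)"] rd(5) by simp
  have min: "Re (qf (insert x A) Q ?u) \<le> Re (qf (insert x A) Q (\<lambda>i. if i = x then 1 else - e i))" for e
  proof -
    \<comment> \<open>The difference of two competitors lives on \<open>A\<close>, to which the
      residual is orthogonal, so the form splits as in Pythagoras.\<close>
    let ?v = "\<lambda>i. if i = x then 0 else d i - e i"
    have "qf (insert x A) Q (\<lambda>i. if i = x then 1 else - e i) = qf (insert x A) Q (\<lambda>i. ?u i + ?v i)"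
      by (intro qf_cong) auto
    also have "\<dots> = qf (insert x A) Q ?u + qf (insert x A) Q ?v
      + 2 * complex_of_real (Re (\<Sum>p\<in>insert x A. cnj (?v p) * (\<Sum>q\<in>insert x A. Q p q * ?u q)))"
      using fin psd by (intro qf_add) auto
    also have "(\<Sum>p\<in>insert x A. cnj (?v p) * (\<Sum>q\<in>insert x A. Q p q * ?u q)) = 0"
    proof (rule sum.neutral, rule ballI)
      fix p assume "p \<in> insert x A"
      then show "cnj (?v p) * (\<Sum>q\<in>insert x A. Q p q * ?u q) = 0"
        using u0[of p] by (cases "p = x") auto
    qed
    finally have *: "qf (insert x A) Q (\<lambda>i. if i = x then 1 else - e i) = qf (insert x A) Q ?u + qf (insert x A) Q ?v"
      by simp
    have "0 \<le> Re (qf (insert x A) Q ?v)" using psd by (auto simp: psd_def)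
    then show ?thesis unfolding * by simp
  qed
  show ?thesis using that[of d] det min u0 by blast
qed

text \<open>The new diagonal entry is the square root of the Schur complement, which is nonnegative
  as a value of the form and nonzero because the determinant is.\<close>

lemma chol_insert:
  assumes fin: "finite A" and x: "x \<notin> A" and psd: "psd (insert x A) Q" and ch: "chol A Q R S"
    and nz: "det_on (insert x A) Q \<noteq> 0"
  shows "\<exists>R S. chol (insert x A) Q R S"
proof -
  obtain r d where rd: "\<And>p. p \<in> A \<Longrightarrow> Q p x = (\<Sum>l\<in>A. cnj (R l p) * r l)"
    "\<And>l. l \<in> A \<Longrightarrow> (\<Sum>a\<in>A. R l a * d a) = r l"
    "\<And>a. d a = (\<Sum>l\<in>A. S a l * r l)"
    "\<And>p. p \<in> A \<Longrightarrow> Q p x = (\<Sum>a\<in>A. Q p a * d a)"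
    "\<And>p. p \<in> A \<Longrightarrow> Q x p = (\<Sum>a\<in>A. cnj (d a) * Q a p)"
    "(\<Sum>a\<in>A. cnj (d a) * Q a x) = (\<Sum>l\<in>A. cnj (r l) * r l)"
    using that by (rule chol_projection[OF fin x psd ch])
  have Q: "Q p q = (\<Sum>l\<in>A. cnj (R l p) * R l q)" if "p \<in> A" "q \<in> A" for p q
    using ch that by (simp add: chol_def)
  have RS: "(\<Sum>l\<in>A. R p l * S l q) = (if p = q then 1 else 0)" if "p \<in> A" "q \<in> A" for p q
    using ch that by (simp add: chol_def)
  have SR: "(\<Sum>l\<in>A. S p l * R l q) = (if p = q then 1 else 0)" if "p \<in> A" "q \<in> A" for p q
    using ch that by (simp add: chol_def)
  obtain d' where d': "det_on (insert x A) Q = qf (insert x A) Q (\<lambda>i. if i = x then 1 else - d' i) * det_on A Q"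
    using schur_complement[OF fin x psd ch] by metis
  define q where "q = Q x x - (\<Sum>l\<in>A. cnj (r l) * r l)"
  have det: "det_on (insert x A) Q = q * det_on A Q"
    unfolding q_def using det_on_insert_combination[OF fin x, of Q "\<lambda>a. cnj (d a)"] rd(5,6) by simp
  have "q = qf (insert x A) Q (\<lambda>i. if i = x then 1 else - d' i)"
    using det d' nz by auto
  then have q: "Im q = 0" "Re q \<ge> 0" using psd unfolding psd_def by blast+
  have "q \<noteq> 0" using det nz by auto
  then have q': "Re q > 0" using q by (metis complex_eq_0 less_eq_real_def power_zero_numeral complex_eqI zero_complex.sel)
  define t where "t = sqrt (Re q)"
  have t: "t > 0" "t * t = Re q" using q' by (auto simp: t_def)
  have qt: "q = of_real t * of_real t" using q t(2) by (simp add: complex_eq_iff)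
  \<comment> \<open>In block form \<open>R'\<close> has rows \<open>R, r\<close> and
    \<open>0, t\<close>. Its inverse \<open>S'\<close> has rows \<open>S, -d / t\<close> and
    \<open>0, 1 / t\<close>, because \<open>S\<close> maps \<open>r\<close> to
    \<open>d\<close>.\<close>
  define R' where "R' l p = (if l = x then (if p = x then complex_of_real t else 0) else if p = x then r l else R l p)" for l p
  define S' where "S' l p = (if p = x then (if l = x then 1 / complex_of_real t else - d l / of_real t) else if l = x then 0 else S l p)" for l p
  have ne: "a \<noteq> x" if "a \<in> A" for a using that x by auto
  have sA: "(\<Sum>l\<in>insert x A. f l) = f x + (\<Sum>l\<in>A. f l)" for f :: "'a \<Rightarrow> complex" using fin x by simp
  have Q': "Q p q' = (\<Sum>l\<in>insert x A. cnj (R' l p) * R' l q')" if p: "p \<in> insert x A" and q'': "q' \<in> insert x A" for p q'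
  proof -
    consider "p = x" "q' = x" | "p = x" "q' \<in> A" | "p \<in> A" "q' = x" | "p \<in> A" "q' \<in> A" using p q'' by auto
    then show ?thesis
    proof cases
      case 1
      have "(\<Sum>l\<in>A. cnj (R' l x) * R' l x) = (\<Sum>l\<in>A. cnj (r l) * r l)"
        by (intro sum.cong refl) (simp add: R'_def ne)
      then show ?thesis unfolding sA using 1 qt q_def by (simp add: R'_def algebra_simps)
    next
      case 2
      have "(\<Sum>l\<in>A. cnj (R' l x) * R' l q') = (\<Sum>l\<in>A. cnj (r l) * R l q')"
        using 2 by (intro sum.cong refl) (simp add: R'_def ne)
      also have "\<dots> = cnj (Q q' x)" using 2 rd(1)[of q'] by (simp add: mult.commute)
      also have "\<dots> = Q x q'" using psd_hermitian[OF _ psd, of q' x] fin 2 by simp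
      finally show ?thesis unfolding sA using 2 ne by (simp add: R'_def)
    next
      case 3
      have "(\<Sum>l\<in>A. cnj (R' l p) * R' l x) = (\<Sum>l\<in>A. cnj (R l p) * r l)"
        using 3 by (intro sum.cong refl) (simp add: R'_def ne)
      then show ?thesis unfolding sA using 3 ne rd(1)[of p] by (simp add: R'_def)
    next
      case 4
      have "(\<Sum>l\<in>A. cnj (R' l p) * R' l q') = (\<Sum>l\<in>A. cnj (R l p) * R l q')"
        using 4 by (intro sum.cong refl) (simp add: R'_def ne)
      then show ?thesis unfolding sA using 4 ne Q[of p q'] by (simp add: R'_def)
    qed
  qed
  have RS': "(\<Sum>l\<in>insert x A. R' p l * S' l q') = (if p = q' then 1 else 0)" if p: "p \<in> insert x A" and q'': "q' \<in> insert x A" for p q'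
  proof -
    consider "p = x" "q' = x" | "p = x" "q' \<in> A" | "p \<in> A" "q' = x" | "p \<in> A" "q' \<in> A" using p q'' by auto
    then show ?thesis
    proof cases
      case 1
      have "(\<Sum>l\<in>A. R' x l * S' l x) = 0"
        by (intro sum.neutral) (simp add: R'_def ne)
      then show ?thesis unfolding sA using 1 t by (simp add: R'_def S'_def)
    next
      case 2
      have "(\<Sum>l\<in>A. R' x l * S' l q') = 0"
        by (intro sum.neutral) (simp add: R'_def ne)
      then show ?thesis unfolding sA using 2 t ne by (auto simp: R'_def S'_def)
    next
      case 3
      have "(\<Sum>l\<in>A. R' p l * S' l x) = (\<Sum>l\<in>A. - (R p l * d l) / of_real t)"
        using 3 by (intro sum.cong refl) (simp add: R'_def S'_def ne)
      also have "\<dots> = - (\<Sum>l\<in>A. R p l * d l) / of_real t"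
        unfolding sum_negf[symmetric] sum_divide_distrib ..
      also have "\<dots> = - r p / of_real t" using 3 rd(2) by simp
      finally show ?thesis unfolding sA using 3 ne by (simp add: R'_def S'_def)
    next
      case 4
      have "(\<Sum>l\<in>A. R' p l * S' l q') = (\<Sum>l\<in>A. R p l * S l q')"
        using 4 by (intro sum.cong refl) (simp add: R'_def S'_def ne)
      then show ?thesis unfolding sA using 4 ne RS[of p q'] by (simp add: R'_def S'_def)
    qed
  qed
  have SR': "(\<Sum>l\<in>insert x A. S' p l * R' l q') = (if p = q' then 1 else 0)" if p: "p \<in> insert x A" and q'': "q' \<in> insert x A" for p q'
  proof -
    consider "p = x" "q' = x" | "p = x" "q' \<in> A" | "p \<in> A" "q' = x" | "p \<in> A" "q' \<in> A" using p q'' by auto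
    then show ?thesis
    proof cases
      case 1
      have "(\<Sum>l\<in>A. S' x l * R' l x) = 0"
        by (intro sum.neutral) (simp add: S'_def ne)
      then show ?thesis unfolding sA using 1 t by (simp add: R'_def S'_def)
    next
      case 2
      have "(\<Sum>l\<in>A. S' x l * R' l q') = 0"
        by (intro sum.neutral) (simp add: S'_def ne)
      then show ?thesis unfolding sA using 2 t ne by (auto simp: R'_def S'_def)
    next
      case 3
      have "(\<Sum>l\<in>A. S' p l * R' l x) = (\<Sum>l\<in>A. S p l * r l)"
        using 3 by (intro sum.cong refl) (simp add: R'_def S'_def ne)
      also have "\<dots> = d p" using rd(3) by simp
      finally show ?thesis unfolding sA using 3 ne t by (simp add: R'_def S'_def)
    next
      case 4
      have "(\<Sum>l\<in>A. S' p l * R' l q') = (\<Sum>l\<in>A. S p l * R l q')"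
        using 4 by (intro sum.cong refl) (simp add: R'_def S'_def ne)
      then show ?thesis unfolding sA using 4 ne SR[of p q'] by (simp add: R'_def S'_def)
    qed
  qed
  have "tri R' A" using ch unfolding chol_def by (auto intro: tri_cong simp: R'_def ne)
  then have tri: "tri R' (insert x A)"
    using fin x t by (intro tri_insert) (auto simp: R'_def ne)
  have "(\<Prod>l\<in>A. (cmod (R' l l))\<^sup>2) = (\<Prod>l\<in>A. (cmod (R l l))\<^sup>2)"
    by (intro prod.cong refl) (simp add: R'_def ne)
  moreover have "(cmod (R' x x))\<^sup>2 = t * t" by (simp add: R'_def power2_eq_square)
  ultimately have "det_on (insert x A) Q = complex_of_real (\<Prod>l\<in>insert x A. (cmod (R' l l))\<^sup>2)"
    using ch fin x unfolding det qt by (simp add: chol_def)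
  then show ?thesis unfolding chol_def using tri Q' RS' SR' by (intro exI[of _ R'] exI[of _ S']) auto
qed

text \<open>If adding \<open>x\<close> to \<open>A\<close> makes the determinant vanish, the
  residual of \<open>x\<close> is a null vector, hence in the kernel of the form on all of
  \<open>I\<close>, and row \<open>x\<close> is a combination of the rows of \<open>A\<close> in
  every larger set. This yields both Cholesky factors of nonsingular kernels and the inheritance of
  nonsingularity by subsets.\<close>

lemma psd_dichotomy:
  assumes fin: "finite I" and psd: "psd I Q" and "A \<subseteq> I"
  shows "(\<exists>R S. chol A Q R S) \<or> (\<forall>B. A \<subseteq> B \<and> B \<subseteq> I \<longrightarrow> det_on B Q = 0)"
proof -
  have "finite A" using assms finite_subset by blast
  then show ?thesis using \<open>A \<subseteq> I\<close>
  proof (induction A rule: finite_induct)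
    case empty
    then show ?case by (auto simp: chol_def intro: tri_empty)
  next
    case (insert x A)
    then consider R S where "chol A Q R S" | "\<forall>B. A \<subseteq> B \<and> B \<subseteq> I \<longrightarrow> det_on B Q = 0" by auto
    then show ?case
    proof cases
      case 2
      then show ?thesis by auto
    next
      case 1
      have psA: "psd (insert x A) Q" using psd_mono[OF fin _ psd] insert.prems by auto
      show ?thesis
      proof (cases "det_on (insert x A) Q = 0")
        case False
        then show ?thesis using chol_insert[OF insert.hyps psA 1] by blast
      next
        case True
        obtain d where d: "det_on (insert x A) Q = qf (insert x A) Q (\<lambda>i. if i = x then 1 else - d i) * det_on A Q"
          using schur_complement[OF insert.hyps psA 1] by metis
        have "det_on A Q \<noteq> 0" using chol_det_nonzero[OF insert.hyps(1) 1] .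
        then have q0: "qf (insert x A) Q (\<lambda>i. if i = x then 1 else - d i) = 0" using d True by simp
        let ?u = "\<lambda>i. if i = x then 1 else if i \<in> A then - d i else 0"
        have "qf I Q ?u = qf (insert x A) Q ?u"
          using fin insert.prems by (intro qf_support) auto
        also have "\<dots> = 0" using q0 by (subst qf_cong[of _ _ "\<lambda>i. if i = x then 1 else - d i"]) auto
        finally have z: "\<And>b. b \<in> I \<Longrightarrow> (\<Sum>q\<in>I. Q b q * ?u q) = 0"
          using psd_null_vector[OF fin psd] by blast
        have zz: "Q b x = (\<Sum>a\<in>A. d a * Q b a)" if "b \<in> I" for b
        proof -
          have "0 = (\<Sum>q\<in>I. Q b q * ?u q)" using z[OF that] by simp
          also have "\<dots> = (\<Sum>q\<in>insert x A. Q b q * ?u q)"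
            using fin insert.prems by (intro sum.mono_neutral_right) auto
          also have "\<dots> = Q b x + (\<Sum>q\<in>A. Q b q * ?u q)" using insert.hyps by simp
          also have "(\<Sum>q\<in>A. Q b q * ?u q) = - (\<Sum>a\<in>A. d a * Q b a)"
            unfolding sum_negf[symmetric] using insert.hyps by (intro sum.cong) auto
          finally show ?thesis by simp
        qed
        have row: "Q x b = (\<Sum>a\<in>A. cnj (d a) * Q a b)" if b: "b \<in> I" for b
        proof -
          have "Q x b = cnj (Q b x)" using psd_hermitian[OF fin psd b, of x] insert.prems by simp
          also have "\<dots> = (\<Sum>a\<in>A. cnj (d a) * cnj (Q b a))" using zz[OF b] by simp
          also have "\<dots> = (\<Sum>a\<in>A. cnj (d a) * Q a b)"
            using psd_hermitian[OF fin psd b] insert.prems by (intro sum.cong refl) auto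
          finally show ?thesis .
        qed
        have "det_on B Q = 0" if B: "insert x A \<subseteq> B" "B \<subseteq> I" for B
        proof -
          have fB: "finite (B - {x})" using B fin finite_subset by blast
          have s: "(\<Sum>a\<in>B - {x}. (if a \<in> A then cnj (d a) else 0) * Q a b) = (\<Sum>a\<in>A. cnj (d a) * Q a b)" for b
            using B insert.hyps fB by (intro sum.mono_neutral_cong_right) auto
          have "det_on (insert x (B - {x})) Q
            = (Q x x - (\<Sum>a\<in>B - {x}. (if a \<in> A then cnj (d a) else 0) * Q a x)) * det_on (B - {x}) Q"
            using fB B row by (intro det_on_insert_combination) (auto simp: s)
          also have "\<dots> = 0" unfolding s using row[of x] insert.prems by simp
          also have "insert x (B - {x}) = B" using B by auto
          finally show ?thesis .
        qed
        then show ?thesis by blast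
      qed
    qed
  qed
qed

lemma psd_chol:
  assumes "finite I" "psd I Q" "det_on I Q \<noteq> 0"
  obtains R S where "chol I Q R S"
  using psd_dichotomy[OF assms(1,2), of I] assms(3) by auto

lemma psd_det_mono:
  assumes "finite I" "psd I Q" "A \<subseteq> I" "det_on I Q \<noteq> 0"
  shows "det_on A Q \<noteq> 0"
proof -
  have "finite A" using assms finite_subset by blast
  moreover obtain R S where "chol A Q R S" using psd_dichotomy[OF assms(1-3)] assms by auto
  ultimately show ?thesis using chol_det_nonzero[of A Q R S] by blast
qed

lemma psd_det_real:
  assumes "finite I" "psd I Q"
  shows "det_on I Q = complex_of_real (Re (det_on I Q))" "Re (det_on I Q) \<ge> 0"
    "det_on I Q \<noteq> 0 \<Longrightarrow> Re (det_on I Q) > 0"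
proof -
  have *: "det_on I Q = 0 \<or> (\<exists>r>0. det_on I Q = complex_of_real r)"
  proof (cases "det_on I Q = 0")
    case False
    then obtain R S where c: "chol I Q R S" using psd_chol[OF assms] by blast
    then show ?thesis using chol_nonzero[OF assms(1) c] unfolding chol_def by blast
  qed simp
  then show "det_on I Q = complex_of_real (Re (det_on I Q))" "Re (det_on I Q) \<ge> 0"
    "det_on I Q \<noteq> 0 \<Longrightarrow> Re (det_on I Q) > 0" by auto
qed

section \<open>Strong subadditivity of the log-determinant\<close>

text \<open>The ratio gained by adding \<open>x\<close> is the minimum of the form over
  \<open>x\<close> plus a span, and minimizing over the larger span of \<open>B\<close> cannot give
  more.\<close>

lemma det_ratio_antimono:
  assumes fin: "finite I" and psd: "psd I Q" and nz: "det_on I Q \<noteq> 0"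
    and AB: "A \<subseteq> B" "insert x B \<subseteq> I" "x \<notin> B"
  shows "Re (det_on (insert x B) Q) * Re (det_on A Q) \<le> Re (det_on (insert x A) Q) * Re (det_on B Q)"
proof -
  have fB: "finite B" "finite A" using AB fin by (meson finite_insert finite_subset)+
  have ps: "psd (insert x B) Q" "psd (insert x A) Q" "psd A Q" "psd B Q"
    using AB psd_mono[OF fin _ psd] by auto
  have nzA: "det_on A Q \<noteq> 0" and nzB: "det_on B Q \<noteq> 0" using psd_det_mono[OF fin psd _ nz] AB by auto
  obtain R S where cA: "chol A Q R S" using psd_chol[OF fB(2) ps(3) nzA] .
  obtain R' S' where cB: "chol B Q R' S'" using psd_chol[OF fB(1) ps(4) nzB] .
  have xA: "x \<notin> A" using AB by auto
  obtain d where d: "det_on (insert x A) Q = qf (insert x A) Q (\<lambda>i. if i = x then 1 else - d i) * det_on A Q"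
    using schur_complement[OF fB(2) xA ps(2) cA] by metis
  obtain e where e: "det_on (insert x B) Q = qf (insert x B) Q (\<lambda>i. if i = x then 1 else - e i) * det_on B Q"
    "\<And>e'. Re (qf (insert x B) Q (\<lambda>i. if i = x then 1 else - e i))
        \<le> Re (qf (insert x B) Q (\<lambda>i. if i = x then 1 else - e' i))"
    "\<And>p. p \<in> B \<Longrightarrow> (\<Sum>q\<in>insert x B. Q p q * (if q = x then 1 else - e q)) = 0"
    using that by (rule schur_complement[OF fB(1) AB(3) ps(1) cB])
  let ?d = "\<lambda>i. if i \<in> A then d i else 0"
  have "qf (insert x B) Q (\<lambda>i. if i = x then 1 else - ?d i) = qf (insert x A) Q (\<lambda>i. if i = x then 1 else - ?d i)"
    using fB AB by (intro qf_support) auto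
  also have "\<dots> = qf (insert x A) Q (\<lambda>i. if i = x then 1 else - d i)" by (intro qf_cong) auto
  finally have le: "Re (qf (insert x B) Q (\<lambda>i. if i = x then 1 else - e i))
     \<le> Re (qf (insert x A) Q (\<lambda>i. if i = x then 1 else - d i))" using e(2)[of ?d] by simp
  have rA: "Im (det_on A Q) = 0" "Re (det_on A Q) \<ge> 0" and rB: "Im (det_on B Q) = 0" "Re (det_on B Q) \<ge> 0"
    using psd_det_real(1,2)[OF fB(2) ps(3)] psd_det_real(1,2)[OF fB(1) ps(4)] by (auto simp: complex_eq_iff)
  have "Re (det_on (insert x B) Q) = Re (qf (insert x B) Q (\<lambda>i. if i = x then 1 else - e i)) * Re (det_on B Q)"
    unfolding e(1) using rB by simp
  moreover have "Re (det_on (insert x A) Q) = Re (qf (insert x A) Q (\<lambda>i. if i = x then 1 else - d i)) * Re (det_on A Q)"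
    unfolding d using rA by simp
  ultimately show ?thesis
    using mult_right_mono[OF le, of "Re (det_on A Q) * Re (det_on B Q)"] rA rB by (simp add: mult_ac)
qed

definition ldet :: "('i \<Rightarrow> 'i \<Rightarrow> complex) \<Rightarrow> 'i set \<Rightarrow> real" where
  "ldet Q A = ln (Re (det_on A Q))"

text \<open>Adding the points of \<open>C\<close> one by one to \<open>det_ratio_antimono\<close>.
  Read as entropies: conditioning on more lowers the conditional entropy of
  \<open>C\<close>.\<close>

lemma ldet_conditional:
  assumes fin: "finite I" and psd: "psd I Q" and nz: "det_on I Q \<noteq> 0"
    and AB: "A \<subseteq> B" "B \<union> C \<subseteq> I" "C \<inter> B = {}"
  shows "ldet Q (B \<union> C) - ldet Q B \<le> ldet Q (A \<union> C) - ldet Q A"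
proof -
  have "finite C" using AB fin finite_subset by blast
  then show ?thesis using AB(2,3)
  proof (induction C rule: finite_induct)
    case (insert x C)
    have pos: "Re (det_on X Q) > 0" if "X \<subseteq> I" for X
      using psd_det_real(3)[OF finite_subset[OF that fin] psd_mono[OF fin that psd]] psd_det_mono[OF fin psd that nz] by blast
    have "Re (det_on (insert x (B \<union> C)) Q) * Re (det_on (A \<union> C) Q) \<le> Re (det_on (insert x (A \<union> C)) Q) * Re (det_on (B \<union> C) Q)"
      using insert AB(1) by (intro det_ratio_antimono[OF fin psd nz]) auto
    moreover have "insert x (B \<union> C) \<subseteq> I" "A \<union> C \<subseteq> I" "insert x (A \<union> C) \<subseteq> I" "B \<union> C \<subseteq> I" using insert.prems AB(1) by auto
    note this[THEN pos]
    ultimately have "ldet Q (insert x (B \<union> C)) + ldet Q (A \<union> C) \<le> ldet Q (insert x (A \<union> C)) + ldet Q (B \<union> C)"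
      unfolding ldet_def by (simp flip: ln_mult_pos)
    moreover have "ldet Q (B \<union> C) - ldet Q B \<le> ldet Q (A \<union> C) - ldet Q A"
      using insert by auto
    ultimately show ?case by simp
  qed simp
qed

subsection \<open>The free group\<close>

definition linv :: "'s \<times> bool \<Rightarrow> 's \<times> bool" where
  "linv x = (fst x, \<not> snd x)"

lemma linv_linv [simp]: "linv (linv x) = x"
  by (simp add: linv_def)

lemma linv_eq_iff: "y = linv x \<longleftrightarrow> fst y = fst x \<and> snd y \<noteq> snd x"
  by (auto simp: linv_def prod_eq_iff)

lemma reduced_Cons: "reduced (x # xs) \<longleftrightarrow> reduced xs \<and> (xs = [] \<or> hd xs \<noteq> linv x)"
  by (cases xs) (auto simp: linv_eq_iff)

lemma red_cons_eq: "red_cons x ys = (if ys \<noteq> [] \<and> hd ys = linv x then tl ys else x # ys)"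
  by (cases ys) (auto simp: red_cons_def linv_eq_iff)

lemma reduced_red_cons: "reduced ys \<Longrightarrow> reduced (red_cons x ys)"
  by (cases ys) (auto simp: red_cons_eq reduced_Cons)

lemma red_cons_linv [simp]:
  assumes "reduced ys" shows "red_cons (linv x) (red_cons x ys) = ys" "red_cons x (red_cons (linv x) ys) = ys"
  using assms by (cases ys; cases "tl ys"; auto simp: red_cons_eq reduced_Cons)+

lemma red_cons_reduced: "reduced (x # ys) \<Longrightarrow> red_cons x ys = x # ys"
  by (auto simp: red_cons_eq reduced_Cons)

lemma reduced_foldr: "reduced ys \<Longrightarrow> reduced (foldr red_cons xs ys)"
  by (induction xs) (auto intro: reduced_red_cons)

lemma reduced_word [simp]: "reduced (word g)"
  using word by blast

lemma word_Abs: "reduced xs \<Longrightarrow> word (Abs_fword xs) = xs"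
  by (simp add: Abs_fword_inverse)

lemma foldr_red_cons_Nil: "reduced xs \<Longrightarrow> foldr red_cons xs [] = xs"
  by (induction xs) (auto simp: reduced_Cons red_cons_reduced)

lemma word_fmul: "word (fmul g h) = foldr red_cons (word g) (word h)"
  by (simp add: fmul_def word_Abs reduced_foldr)

text \<open>If \<open>x\<close> cancels against the head of \<open>v\<close>, the same pair cancels
  when both letters act on \<open>w\<close>. This is the step that makes the product
  associative.\<close>

lemma foldr_red_cons_foldr:
  assumes "reduced w"
  shows "foldr red_cons (red_cons x v) w = red_cons x (foldr red_cons v w)"
proof (cases "v \<noteq> [] \<and> hd v = linv x")
  case True
  then obtain v' where v: "v = linv x # v'" by (cases v) auto
  have "red_cons x v = v'" by (simp add: v red_cons_eq)
  then show ?thesis using assms by (simp add: v reduced_foldr)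
qed (auto simp: red_cons_eq[of x v])

lemma fmul_assoc: "fmul (fmul g h) k = fmul g (fmul h k)"
proof -
  have "reduced w \<Longrightarrow> foldr red_cons (foldr red_cons u v) w = foldr red_cons u (foldr red_cons v w)" for u v w :: "('a \<times> bool) list"
    by (induction u) (auto simp: foldr_red_cons_foldr)
  then show ?thesis by (metis word_fmul word_inject reduced_word)
qed

definition fone :: "'s fword" where "fone = Abs_fword []"

lemma word_fone [simp]: "word fone = []" by (simp add: fone_def word_Abs)

lemma reduced_append_single:
  "reduced (xs @ [x]) \<longleftrightarrow> reduced xs \<and> (xs = [] \<or> last xs \<noteq> linv x)"
  by (induction xs) (auto simp: reduced_Cons linv_eq_iff)

lemma reduced_inverse: "reduced xs \<Longrightarrow> reduced (rev (map linv xs))"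
proof (induction xs)
  case (Cons x xs)
  have "last (rev (map linv xs)) \<noteq> linv (linv x)" if "xs \<noteq> []"
  proof -
    have "last (rev (map linv xs)) = linv (hd xs)" using that by (simp add: last_rev hd_map)
    moreover have "hd xs \<noteq> linv x" using Cons.prems that by (simp add: reduced_Cons)
    ultimately show ?thesis by (metis linv_linv)
  qed
  then show ?case using Cons by (auto simp: reduced_Cons reduced_append_single)
qed simp

lemma word_finv: "word (finv g) = rev (map linv (word g))"
proof -
  have eq: "(\<lambda>(a, b). (a, \<not> b)) = linv" by (auto simp: linv_def)
  show ?thesis unfolding finv_def eq using reduced_inverse[OF reduced_word[of g]] by (rule word_Abs)
qed

lemma fmul_finv: "fmul (finv g) g = fone"
proof -
  have "foldr red_cons (rev (map linv xs)) (foldr red_cons xs w) = w" if "reduced w" for xs w :: "('a \<times> bool) list"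
    using that by (induction xs arbitrary: w) (auto simp: reduced_foldr)
  from this[of "[]" "word g"] have "word (fmul (finv g) g) = []"
    by (simp add: word_fmul word_finv foldr_red_cons_Nil)
  then show ?thesis by (metis word_fone word_inject)
qed

lemma fmul_fone: "fmul fone g = g" "fmul g fone = g"
  by (simp_all add: word_inject[symmetric] word_fmul foldr_red_cons_Nil)

interpretation fgroup: group fmul fone finv
  by unfold_locales (auto simp: fmul_assoc fmul_fone fmul_finv)

lemma fmul_cancel: "fmul (finv g) (fmul g h) = h" "fmul g (fmul (finv g) h) = h"
  by (metis fmul_assoc fmul_finv fmul_fone(1)) (metis fmul_assoc fgroup.right_inverse fmul_fone(1))

lemma inj_fmul: "inj_on (fmul g) A"
  by (metis fmul_cancel(1) inj_onI)

lemma finv_translate: "fmul (finv (fmul s g)) (fmul s h) = fmul (finv g) h"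
  by (metis fmul_assoc fgroup.inverse_distrib_swap fmul_cancel(1))

lemma word_fgen: "word (fgen s) = [(s, False)]"
  by (simp add: fgen_def word_Abs)

lemma word_gen_fmul: "word (fmul (fgen s) g) = red_cons (s, False) (word g)"
  by (simp add: word_fmul word_fgen)

lemma word_gen_inverse_fmul: "word (fmul (finv (fgen s)) g) = red_cons (s, True) (word g)"
  by (simp add: word_fmul word_fgen word_finv linv_def)

lemma finite_fball: "finite (fball n :: 's::finite fword set)"
proof -
  have "word ` fball n \<subseteq> {xs. set xs \<subseteq> UNIV \<and> length xs \<le> n}" by (auto simp: fball_def)
  then have "finite (word ` fball n :: ('s \<times> bool) list set)"
    by (rule finite_subset) (rule finite_lists_length_le, simp)
  moreover have "inj_on word (fball n)" by (auto simp: inj_on_def word_inject)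
  ultimately show ?thesis by (rule finite_imageD)
qed

lemma fball_mono: "m \<le> n \<Longrightarrow> fball m \<subseteq> fball n"
  by (auto simp: fball_def)

lemma mem_translate: "h \<in> fmul (fgen s) ` F \<longleftrightarrow> fmul (finv (fgen s)) h \<in> F"
proof
  assume "fmul (finv (fgen s)) h \<in> F"
  then show "h \<in> fmul (fgen s) ` F" by (rule rev_image_eqI) (simp add: fmul_cancel)
qed (auto simp: fmul_cancel)

text \<open>A word of length \<open>n + 1\<close> stays in the ball of that radius after
  multiplication by the inverse of \<open>s\<close> exactly if it begins with \<open>s\<close>. The
  identity matches intersections at radius \<open>n + 1\<close> with unions at radius
  \<open>n\<close>.\<close>

lemma fball_Suc_inter: "fball (Suc n) \<inter> fmul (fgen s) ` fball (Suc n) = fball n \<union> fmul (fgen s) ` fball n"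
proof (rule set_eqI)
  fix g :: "'a fword"
  show "g \<in> fball (Suc n) \<inter> fmul (fgen s) ` fball (Suc n) \<longleftrightarrow> g \<in> fball n \<union> fmul (fgen s) ` fball n"
    by (cases "word g") (auto simp: mem_translate fball_def word_gen_inverse_fmul red_cons_eq linv_def)
qed

text \<open>\<open>fparent g\<close> is the neighbour of \<open>g\<close> on the geodesic to the identity in the left Cayley tree.\<close>

definition fparent :: "'s fword \<Rightarrow> 's fword" where
  "fparent g = Abs_fword (tl (word g))"

lemma word_fparent: "word (fparent g) = tl (word g)"
  using reduced_word[of g] unfolding fparent_def
  by (cases "word g") (auto simp: word_Abs reduced_Cons)

text \<open>Deleting first letters walks down the left Cayley tree to the identity, so the nonempty
  sets of this kind are the subtrees through the identity.\<close>

definition suffix_closed :: "'s fword set \<Rightarrow> bool" where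
  "suffix_closed F \<longleftrightarrow> (\<forall>g\<in>F. fparent g \<in> F)"

lemma suffix_closed_fball: "suffix_closed (fball n)"
  by (auto simp: suffix_closed_def fball_def word_fparent)

lemma fone_iff: "g = fone \<longleftrightarrow> word g = []"
  by (metis word_fone word_inject)

lemma fone_in_suffix_closed:
  assumes "suffix_closed F" "F \<noteq> {}" shows "fone \<in> F"
proof -
  have "g \<in> F \<Longrightarrow> fone \<in> F" for g
  proof (induction "length (word g)" arbitrary: g)
    case 0
    then show ?case using fone_iff[of g] by simp
  next
    case (Suc n)
    then show ?case using assms(1) word_fparent[of g] unfolding suffix_closed_def by (metis diff_Suc_1 length_tl)
  qed
  then show ?thesis using assms(2) by auto
qed

text \<open>A longest word is nobody's parent, so it can be pruned. The identity is excluded because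
  it is its own parent.\<close>

lemma suffix_closed_remove:
  assumes "suffix_closed F" "\<And>g. g \<in> F \<Longrightarrow> length (word g) \<le> length (word x)" "x \<noteq> fone"
  shows "suffix_closed (F - {x})"
  unfolding suffix_closed_def
proof
  fix g assume g: "g \<in> F - {x}"
  have "fparent g \<noteq> x"
  proof
    assume eq: "fparent g = x"
    then have "length (word x) = length (word g) - 1" by (metis word_fparent length_tl)
    with assms(2)[of g] g assms(3) have "length (word g) = 0" "length (word x) = 0"
      by (auto simp: fone_iff)
    then show False using assms(3) fone_iff by auto
  qed
  then show "fparent g \<in> F - {x}" using g assms(1) by (auto simp: suffix_closed_def)
qed

text \<open>The sources of the edges labelled \<open>s\<close> inside \<open>F\<close>. The random
  unitary of \<open>s\<close> will have to carry the vectors at these vertices to the vectors at the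
  targets.\<close>

definition fdom :: "'s fword set \<Rightarrow> 's \<Rightarrow> 's fword set" where
  "fdom F s = {g \<in> F. fmul (fgen s) g \<in> F}"

lemma fdom_image: "fmul (fgen s) ` fdom F s = F \<inter> fmul (fgen s) ` F"
  by (auto simp: fdom_def)

text \<open>Each non-identity vertex of a suffix-closed set owns exactly one edge, the one towards its parent.\<close>

lemma edges_parent:
  assumes "suffix_closed F"
  shows "(\<forall>s. \<forall>g\<in>fdom F s. P s g (fmul (fgen s) g)) \<longleftrightarrow>
    (\<forall>h\<in>F - {fone}. (if snd (hd (word h)) then P (fst (hd (word h))) h (fparent h)
        else P (fst (hd (word h))) (fparent h) h))" (is "?L \<longleftrightarrow> ?R")
proof
  assume L: ?L
  show ?R
  proof
    fix h assume h: "h \<in> F - {fone}"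
    then obtain s b w where w: "word h = (s, b) # w" by (cases "word h") (auto simp: fone_iff)
    have p: "fparent h \<in> F" "word (fparent h) = w" using h assms w by (auto simp: suffix_closed_def word_fparent)
    have rw: "reduced ((s, b) # w)" using reduced_word[of h] w by simp
    show "if snd (hd (word h)) then P (fst (hd (word h))) h (fparent h)
        else P (fst (hd (word h))) (fparent h) h"
    proof (cases b)
      case True
      have "fmul (fgen s) h = fparent h"
        using True p w by (simp add: word_inject[symmetric] word_gen_fmul red_cons_eq linv_def)
      then show ?thesis using L h p w True by (auto simp: fdom_def dest!: spec[of _ s] bspec[of _ _ h])
    next
      case False
      have "fmul (fgen s) (fparent h) = h"
        using False p w rw red_cons_reduced[of "(s, False)" w] by (simp add: word_inject[symmetric] word_gen_fmul)
      then have "P s (fparent h) (fmul (fgen s) (fparent h))" 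
        using L[THEN spec, of s, THEN bspec, of "fparent h"] h p \<open>fmul (fgen s) (fparent h) = h\<close> by (simp add: fdom_def)
      then show ?thesis using \<open>fmul (fgen s) (fparent h) = h\<close> w False by simp
    qed
  qed
next
  assume R: ?R
  show ?L
  proof (intro allI ballI)
    fix s g assume g: "g \<in> fdom F s"
    let ?h = "fmul (fgen s) g"
    have F: "g \<in> F" "?h \<in> F" using g by (auto simp: fdom_def)
    show "P s g ?h"
    proof (cases "word g \<noteq> [] \<and> hd (word g) = (s, True)")
      case True
      then have "word ?h = tl (word g)" by (simp add: word_gen_fmul red_cons_eq linv_def)
      then have "?h = fparent g" by (simp add: word_inject[symmetric] word_fparent)
      then show ?thesis using R F True fone_iff[of g] by force
    next
      case False
      then have w: "word ?h = (s, False) # word g" by (auto simp: word_gen_fmul red_cons_eq linv_def)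
      then have "fparent ?h = g" by (simp add: word_inject[symmetric] word_fparent)
      then show ?thesis using R F w fone_iff[of ?h] by force
    qed
  qed
qed

lemma card_fdom:
  assumes fin: "finite F" and sc: "suffix_closed F" and one: "fone \<in> F"
  shows "(\<Sum>s\<in>UNIV. card (fdom F (s::'s::finite))) = card F - 1"
proof -
  \<comment> \<open>\<open>own\<close> sends an edge to its endpoint farther from the identity, and
    \<open>edge\<close> is the inverse map.\<close>
  define own where "own e = (case e of (s, g) \<Rightarrow>
      if word g \<noteq> [] \<and> hd (word g) = (s, True) then g else fmul (fgen s) g)" for e :: "'s \<times> 's fword"
  define edge where "edge h = (if snd (hd (word h)) then (fst (hd (word h)), h) else (fst (hd (word h)), fparent h))" for h :: "'s fword"
  let ?E = "SIGMA s:UNIV. fdom F s"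
  have "bij_betw own ?E (F - {fone})"
  proof (rule bij_betw_byWitness[where f' = edge])
    show "\<forall>e\<in>?E. edge (own e) = e"
    proof
      fix e assume "e \<in> ?E"
      then obtain s g where e: "e = (s, g)" "g \<in> fdom F s" by auto
      show "edge (own e) = e"
      proof (cases "word g \<noteq> [] \<and> hd (word g) = (s, True)")
        case True
        then show ?thesis by (simp add: e own_def edge_def)
      next
        case False
        then have w: "word (fmul (fgen s) g) = (s, False) # word g"
          by (auto simp: word_gen_fmul red_cons_eq linv_def)
        then have "fparent (fmul (fgen s) g) = g" by (simp add: word_inject[symmetric] word_fparent)
        moreover have "own e = fmul (fgen s) g" using False by (auto simp: e own_def)
        ultimately show ?thesis using w by (simp add: e edge_def)
      qed
    qed
    have key: "own (edge h) = h \<and> edge h \<in> ?E" if h: "h \<in> F - {fone}" for h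
    proof -
      obtain s b w where w: "word h = (s, b) # w" using h by (cases "word h") (auto simp: fone_iff)
      have p: "fparent h \<in> F" "word (fparent h) = w" using h sc w by (auto simp: suffix_closed_def word_fparent)
      have rw: "reduced ((s, b) # w)" using reduced_word[of h] w by simp
      show ?thesis
      proof (cases b)
        case True
        have "fmul (fgen s) h = fparent h"
          using True p w by (simp add: word_inject[symmetric] word_gen_fmul red_cons_eq linv_def)
        then show ?thesis using w True h p by (simp add: edge_def own_def fdom_def)
      next
        case False
        have m: "fmul (fgen s) (fparent h) = h"
          using False p w rw red_cons_reduced[of "(s, False)" w] by (simp add: word_inject[symmetric] word_gen_fmul)
        have "\<not> (w \<noteq> [] \<and> hd w = (s, True))" using rw False by (auto simp: reduced_Cons linv_def)
        then show ?thesis using w False h p m by (auto simp: edge_def own_def fdom_def)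
      qed
    qed
    then show "\<forall>h\<in>F - {fone}. own (edge h) = h" "edge ` (F - {fone}) \<subseteq> ?E" by blast+
    show "own ` ?E \<subseteq> F - {fone}"
    proof
      fix h assume "h \<in> own ` ?E"
      then obtain s g where g: "g \<in> fdom F s" "h = own (s, g)" by auto
      show "h \<in> F - {fone}"
      proof (cases "word g \<noteq> [] \<and> hd (word g) = (s, True)")
        case True
        then show ?thesis using g by (auto simp: own_def fdom_def fone_iff)
      next
        case False
        then have "word (fmul (fgen s) g) = (s, False) # word g"
          by (auto simp: word_gen_fmul red_cons_eq linv_def)
        then show ?thesis using g False by (auto simp: own_def fdom_def fone_iff)
      qed
    qed
  qed
  then have "card ?E = card (F - {fone})" by (rule bij_betw_same_card)
  moreover have "card ?E = (\<Sum>s\<in>UNIV. card (fdom F s))"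
    using fin by (subst card_SigmaI) (auto simp: fdom_def)
  ultimately show ?thesis using one by simp
qed

text \<open>A longest element of \<open>F\<close> is a leaf of the tree, so it is missing from one side of every edge set.\<close>

lemma fdom_leaf:
  assumes "\<And>g. g \<in> F \<Longrightarrow> length (word g) \<le> length (word x)"
  shows "x \<notin> fdom F s \<or> x \<notin> fmul (fgen s) ` fdom F s"
proof (rule ccontr)
  assume "\<not> ?thesis"
  then have "fmul (fgen s) x \<in> F" "fmul (finv (fgen s)) x \<in> F"
    by (auto simp: fdom_def fmul_cancel)
  then have "length (red_cons (s, False) (word x)) \<le> length (word x)" "length (red_cons (s, True) (word x)) \<le> length (word x)"
    using assms by (auto simp flip: word_gen_fmul word_gen_inverse_fmul)
  then show False by (cases "word x") (auto simp: red_cons_eq linv_def split: if_splits)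
qed

text \<open>With countably many coordinates, coordinatewise measurability of
  \<open>coeff_map\<close> suffices for Borel measurability.\<close>

instance fword :: (countable) countable
proof
  obtain f :: "('a \<times> bool) list \<Rightarrow> nat" where f: "inj f" by blast
  have "inj (\<lambda>g. f (word g))" by (auto simp: inj_def word_inject dest: injD[OF f])
  then show "\<exists>f::'a fword \<Rightarrow> nat. inj f" by blast
qed

subsection \<open>Gram kernels of positive definite maps\<close>

text \<open>The block matrix of \<phi> with its blocks flattened into the index set
  \<open>F \<times> UNIV\<close>. For a coefficient map it is the Gram kernel of an orbit, by
  \<open>gramker_coeff_map\<close>.\<close>

definition gramker :: "('s fword \<Rightarrow> complex^'k^'k) \<Rightarrow> ('s fword \<times> 'k) \<Rightarrow> ('s fword \<times> 'k) \<Rightarrow> complex" where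
  "gramker \<phi> = (\<lambda>(g, i) (h, j). \<phi> (fmul (finv g) h) $ i $ j)"

lemma blockdet_gramker: "blockdet \<phi> F = det_on (F \<times> UNIV) (gramker \<phi>)"
  by (simp add: blockdet_def gramker_def)

lemma qf_gramker:
  fixes \<phi> :: "'s fword \<Rightarrow> complex^'k::finite^'k"
  shows "qf (F \<times> UNIV) (gramker \<phi>) a = (\<Sum>g\<in>F. \<Sum>h\<in>F. \<Sum>i\<in>UNIV. \<Sum>j\<in>UNIV.
      cnj (a (h, i)) * a (g, j) * (\<phi> (fmul (finv h) g) $ i $ j))"
proof -
  have "qf (F \<times> UNIV) (gramker \<phi>) a = (\<Sum>h\<in>F. \<Sum>i\<in>UNIV. \<Sum>g\<in>F. \<Sum>j\<in>UNIV.
      cnj (a (h, i)) * a (g, j) * (\<phi> (fmul (finv h) g) $ i $ j))"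
    unfolding qf_def by (simp add: gramker_def sum.cartesian_product')
  also have "\<dots> = (\<Sum>h\<in>F. \<Sum>g\<in>F. \<Sum>i\<in>UNIV. \<Sum>j\<in>UNIV.
      cnj (a (h, i)) * a (g, j) * (\<phi> (fmul (finv h) g) $ i $ j))"
    by (intro sum.cong refl) (rule sum.swap)
  also have "\<dots> = (\<Sum>g\<in>F. \<Sum>h\<in>F. \<Sum>i\<in>UNIV. \<Sum>j\<in>UNIV.
      cnj (a (h, i)) * a (g, j) * (\<phi> (fmul (finv h) g) $ i $ j))"
    by (rule sum.swap)
  finally show ?thesis .
qed

lemma posdef_psd:
  fixes \<phi> :: "'s fword \<Rightarrow> complex^'k::finite^'k"
  assumes "posdef \<phi>" "finite F"
  shows "psd (F \<times> UNIV) (gramker \<phi>)"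
  using assms unfolding psd_def qf_gramker posdef_def Let_def
  by (auto dest!: spec[of _ F] spec[of _ "\<lambda>i g. _ (g, i)"])

lemma blockdet_translate:
  fixes \<phi> :: "'s fword \<Rightarrow> complex^'k::finite^'k"
  assumes "finite F"
  shows "blockdet \<phi> (fmul s ` F) = blockdet \<phi> F"
proof -
  have im: "fmul s ` F \<times> UNIV = map_prod (fmul s) id ` (F \<times> (UNIV :: 'k set))"
    by (rule map_prod_surj_on[OF refl, of id UNIV UNIV, symmetric]) simp
  have "inj_on (map_prod (fmul s) id) (F \<times> (UNIV :: 'k set))"
    using inj_fmul[of s F] by (auto simp: inj_on_def)
  then have "det_on (map_prod (fmul s) id ` (F \<times> (UNIV :: 'k set))) (gramker \<phi>)
    = det_on (F \<times> UNIV) (\<lambda>p q. gramker \<phi> (map_prod (fmul s) id p) (map_prod (fmul s) id q))"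
    using assms by (intro det_on_reindex) auto
  also have "(\<lambda>p q. gramker \<phi> (map_prod (fmul s) id p) (map_prod (fmul s) id q)) = gramker \<phi>"
    by (auto simp: fun_eq_iff gramker_def finv_translate)
  finally show ?thesis unfolding blockdet_gramker im .
qed

definition bent :: "('s fword \<Rightarrow> complex^'k^'k) \<Rightarrow> 's fword set \<Rightarrow> real" where
  "bent \<phi> F = ln (Re (blockdet \<phi> F))"

lemma bent_conditional:
  fixes \<phi> :: "'s fword \<Rightarrow> complex^'k::finite^'k"
  assumes pd: "posdef \<phi>" and nz: "\<And>F. finite F \<Longrightarrow> blockdet \<phi> F \<noteq> 0"
    and fin: "finite B" "finite C" and AB: "A \<subseteq> B" "C \<inter> B = {}"
  shows "bent \<phi> (B \<union> C) - bent \<phi> B \<le> bent \<phi> (A \<union> C) - bent \<phi> A"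
proof -
  let ?U = "UNIV :: 'k set"
  have "ldet (gramker \<phi>) (B \<times> ?U \<union> C \<times> ?U) - ldet (gramker \<phi>) (B \<times> ?U)
      \<le> ldet (gramker \<phi>) (A \<times> ?U \<union> C \<times> ?U) - ldet (gramker \<phi>) (A \<times> ?U)"
    using fin AB nz[of "B \<union> C"]
    by (intro ldet_conditional[of "(B \<union> C) \<times> ?U"] posdef_psd pd) (auto simp: blockdet_gramker)
  then show ?thesis by (simp add: bent_def ldet_def blockdet_gramker Sigma_Un_distrib1)
qed

lemma bent_translate:
  fixes \<phi> :: "'s fword \<Rightarrow> complex^'k::finite^'k"
  shows "finite F \<Longrightarrow> bent \<phi> (fmul s ` F) = bent \<phi> F"
  by (simp add: bent_def blockdet_translate)

section \<open>The two sequences and their interlacing\<close>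

definition bseq :: "('s::finite fword \<Rightarrow> complex^'k^'k) \<Rightarrow> nat \<Rightarrow> real" where
  "bseq \<phi> n = bent \<phi> (fball n) - (\<Sum>s\<in>UNIV. bent \<phi> (fball n \<inter> fmul (fgen s) ` fball n))"

definition bseq' :: "('s::finite fword \<Rightarrow> complex^'k^'k) \<Rightarrow> nat \<Rightarrow> real" where
  "bseq' \<phi> n = (\<Sum>s\<in>UNIV. bent \<phi> (fball n \<union> fmul (fgen s) ` fball n))
     - (2 * real CARD('s) - 1) * bent \<phi> (fball n)"

text \<open>Strong subadditivity for the ball and its translate by \<open>s\<close>, which have
  equal log-determinants, trades intersections for unions after summation over
  \<open>s\<close>.\<close>

lemma bseq'_le:
  fixes \<phi> :: "'s::finite fword \<Rightarrow> complex^'k::finite^'k"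
  assumes pd: "posdef \<phi>" and nz: "\<And>F. finite F \<Longrightarrow> blockdet \<phi> F \<noteq> 0"
  shows "bseq' \<phi> n \<le> bseq \<phi> n"
proof -
  let ?B = "fball n :: 's fword set"
  have "bent \<phi> (?B \<union> fmul (fgen s) ` ?B) + bent \<phi> (?B \<inter> fmul (fgen s) ` ?B) \<le> 2 * bent \<phi> ?B" for s
  proof -
    let ?T = "fmul (fgen s) ` ?B"
    have "bent \<phi> (?B \<union> (?T - ?B)) - bent \<phi> ?B \<le> bent \<phi> (?B \<inter> ?T \<union> (?T - ?B)) - bent \<phi> (?B \<inter> ?T)"
      using finite_fball by (intro bent_conditional pd nz) auto
    moreover have "?B \<union> (?T - ?B) = ?B \<union> ?T" "?B \<inter> ?T \<union> (?T - ?B) = ?T" by auto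
    moreover have "bent \<phi> ?T = bent \<phi> ?B" by (intro bent_translate finite_fball)
    ultimately show ?thesis by simp
  qed
  then have "(\<Sum>s\<in>UNIV. bent \<phi> (?B \<union> fmul (fgen s) ` ?B) + bent \<phi> (?B \<inter> fmul (fgen s) ` ?B)) \<le> (\<Sum>s\<in>(UNIV::'s set). 2 * bent \<phi> ?B)"
    by (intro sum_mono) auto
  then show ?thesis by (simp add: bseq_def bseq'_def sum.distrib algebra_simps)
qed

text \<open>The sphere of radius \<open>n + 1\<close> splits by first letter. Given the ball, the
  conditional entropies of the parts add up to at least that of the sphere, and each is the
  increment from the ball to its union with a translate. The intersections at radius
  \<open>n + 1\<close> are these same unions.\<close>

lemma bseq_Suc_le:
  fixes \<phi> :: "'s::finite fword \<Rightarrow> complex^'k::finite^'k"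
  assumes pd: "posdef \<phi>" and nz: "\<And>F. finite F \<Longrightarrow> blockdet \<phi> F \<noteq> 0"
  shows "bseq \<phi> (Suc n) \<le> bseq' \<phi> n"
proof -
  let ?B = "fball n :: 's fword set"
  define T where "T x = {h. word h \<noteq> [] \<and> hd (word h) = x \<and> h \<in> fball (Suc n)} - ?B" for x :: "'s \<times> bool"
  have finT: "finite (T x)" for x
    by (rule finite_subset[OF _ finite_fball[of "Suc n"]]) (auto simp: T_def)
  have B_un: "fball (Suc n) = ?B \<union> (\<Union>x\<in>UNIV. T x)"
  proof -
    have "g \<in> ?B" if "word g = []" for g using that by (simp add: fball_def)
    then show ?thesis using fball_mono[of n "Suc n"] by (auto simp: T_def)
  qed
  have disj: "T x \<inter> ?B = {}" "x \<noteq> y \<Longrightarrow> T x \<inter> T y = {}" for x y by (auto simp: T_def)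
  have sub: "bent \<phi> (?B \<union> (\<Union>x\<in>X. T x)) - bent \<phi> ?B \<le> (\<Sum>x\<in>X. bent \<phi> (?B \<union> T x) - bent \<phi> ?B)" if "finite X" for X
    using that
  proof (induction X rule: finite_induct)
    case (insert x X)
    have "bent \<phi> ((?B \<union> (\<Union>x\<in>X. T x)) \<union> T x) - bent \<phi> (?B \<union> (\<Union>x\<in>X. T x)) \<le> bent \<phi> (?B \<union> T x) - bent \<phi> ?B"
    proof (rule bent_conditional[OF pd nz])
      show "finite (?B \<union> (\<Union>x\<in>X. T x))" using finite_fball finT insert.hyps by blast
      show "T x \<inter> (?B \<union> (\<Union>x\<in>X. T x)) = {}"
      proof -
        have "T x \<inter> T y = {}" if "y \<in> X" for y using disj(2)[of x y] insert.hyps that by metis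
        then show ?thesis using disj(1)[of x] by blast
      qed
    qed (use finT in auto)
    moreover have "(?B \<union> (\<Union>x\<in>X. T x)) \<union> T x = ?B \<union> (\<Union>x\<in>insert x X. T x)" by auto
    ultimately show ?case using insert by simp
  qed simp
  have pos: "?B \<union> T (s, False) = ?B \<union> fmul (fgen s) ` ?B" for s
  proof (rule set_eqI)
    fix g
    show "g \<in> ?B \<union> T (s, False) \<longleftrightarrow> g \<in> ?B \<union> fmul (fgen s) ` ?B"
      by (cases "word g") (auto simp: T_def fball_def mem_translate word_gen_inverse_fmul red_cons_eq linv_def)
  qed
  have "?B \<union> T (s, True) = ?B \<union> fmul (finv (fgen s)) ` ?B" for s
  proof (rule set_eqI)
    fix g
    have "g \<in> fmul (finv (fgen s)) ` ?B" if "fmul (fgen s) g \<in> ?B"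
      using that by (rule rev_image_eqI) (simp add: fmul_cancel)
    then have "g \<in> fmul (finv (fgen s)) ` ?B \<longleftrightarrow> fmul (fgen s) g \<in> ?B" by (auto simp: fmul_cancel)
    then show "g \<in> ?B \<union> T (s, True) \<longleftrightarrow> g \<in> ?B \<union> fmul (finv (fgen s)) ` ?B"
      by (cases "word g") (auto simp: T_def fball_def word_gen_fmul red_cons_eq linv_def)
  qed
  \<comment> \<open>Translation by \<open>s\<close> turns the union for the inverse letter into the
    union for \<open>s\<close>, so both letters contribute the same increment.\<close>
  moreover have "fmul (fgen s) ` (?B \<union> fmul (finv (fgen s)) ` ?B) = ?B \<union> fmul (fgen s) ` ?B" for s
    by (auto simp: image_Un image_image fmul_cancel)
  ultimately have neg: "bent \<phi> (?B \<union> T (s, True)) = bent \<phi> (?B \<union> fmul (fgen s) ` ?B)" for s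
    using bent_translate[OF finite_UnI[OF finite_fball finT], of \<phi> "fgen s" n "(s, True)"] by simp
  have "bent \<phi> (fball (Suc n)) - bent \<phi> ?B \<le> (\<Sum>x\<in>UNIV \<times> UNIV. bent \<phi> (?B \<union> T x) - bent \<phi> ?B)"
    unfolding UNIV_Times_UNIV B_un by (rule sub) simp
  also have "\<dots> = (\<Sum>s\<in>UNIV. \<Sum>b\<in>UNIV. bent \<phi> (?B \<union> T (s, b)) - bent \<phi> ?B)"
    by (simp add: sum.cartesian_product)
  also have "\<dots> = (\<Sum>s\<in>UNIV. 2 * (bent \<phi> (?B \<union> fmul (fgen s) ` ?B) - bent \<phi> ?B))"
    by (simp add: UNIV_bool pos neg)
  finally show ?thesis
    by (simp add: bseq_def bseq'_def fball_Suc_inter sum_subtractf sum_distrib_left[symmetric] algebra_simps)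
qed

subsection \<open>The Hermitian norm\<close>

text \<open>Vectors of C^n are functions on all naturals of which only the first \<open>n\<close>
  values count. Identities between vectors are therefore stated for \<open>l < n\<close> and used
  through congruence rules such as \<open>nrm_cong\<close>.\<close>

definition nrm :: "nat \<Rightarrow> (nat \<Rightarrow> complex) \<Rightarrow> real" where
  "nrm n x = L2_set (\<lambda>l. cmod (x l)) {..<n}"

lemma nrm_nonneg [simp]: "0 \<le> nrm n x"
  by (simp add: nrm_def)

lemma nrm_sq: "(nrm n x)\<^sup>2 = (\<Sum>l<n. (cmod (x l))\<^sup>2)"
  by (simp add: nrm_def L2_set_def sum_nonneg)

lemma cinner_self: "cinner n x x = complex_of_real ((nrm n x)\<^sup>2)"
  by (simp only: nrm_sq cinner_def complex_norm_square of_real_sum)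

lemma cinner_le: "cmod (cinner n x y) \<le> nrm n x * nrm n y"
proof -
  have "cmod (cinner n x y) \<le> (\<Sum>l<n. cmod (x l * cnj (y l)))"
    unfolding cinner_def by (rule norm_sum)
  also have "\<dots> = (\<Sum>l<n. \<bar>cmod (x l)\<bar> * \<bar>cmod (y l)\<bar>)" by (simp add: norm_mult)
  also have "\<dots> \<le> nrm n x * nrm n y" unfolding nrm_def by (rule L2_set_mult_ineq)
  finally show ?thesis .
qed

lemma nrm_cong: "(\<And>l. l < n \<Longrightarrow> x l = y l) \<Longrightarrow> nrm n x = nrm n y"
  unfolding nrm_def by (intro L2_set_cong) auto

lemma cinner_cong: "(\<And>l. l < n \<Longrightarrow> x l = x' l) \<Longrightarrow> (\<And>l. l < n \<Longrightarrow> y l = y' l) \<Longrightarrow> cinner n x y = cinner n x' y'"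
  unfolding cinner_def by (intro sum.cong) auto

lemma cinner_commute: "cinner n y x = cnj (cinner n x y)"
  by (simp add: cinner_def mult.commute)

lemma cinner_add_left: "cinner n (\<lambda>l. x l + y l) z = cinner n x z + cinner n y z"
  and cinner_add_right: "cinner n z (\<lambda>l. x l + y l) = cinner n z x + cinner n z y"
  and cinner_diff_left: "cinner n (\<lambda>l. x l - y l) z = cinner n x z - cinner n y z"
  and cinner_diff_right: "cinner n z (\<lambda>l. x l - y l) = cinner n z x - cinner n z y"
  by (simp_all add: cinner_def sum.distrib[symmetric] sum_subtractf[symmetric] algebra_simps)

lemma cinner_scale_left: "cinner n (\<lambda>l. x l * c) z = c * cinner n x z"
  and cinner_scale_right: "cinner n z (\<lambda>l. x l * c) = cnj c * cinner n z x"
  by (simp_all add: cinner_def sum_distrib_left mult_ac)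

lemma cinner_sum_left: "cinner n (\<lambda>l. \<Sum>p\<in>I. x p l) z = (\<Sum>p\<in>I. cinner n (x p) z)"
  and cinner_sum_right: "cinner n z (\<lambda>l. \<Sum>p\<in>I. x p l) = (\<Sum>p\<in>I. cinner n z (x p))"
  unfolding cinner_def sum_distrib_right cnj_sum sum_distrib_left by (rule sum.swap)+

lemma nrm_add: "nrm n (\<lambda>l. x l + y l) \<le> nrm n x + nrm n y"
proof -
  have "nrm n (\<lambda>l. x l + y l) \<le> L2_set (\<lambda>l. cmod (x l) + cmod (y l)) {..<n}"
    unfolding nrm_def by (intro L2_set_mono norm_triangle_ineq) auto
  also have "\<dots> \<le> nrm n x + nrm n y" unfolding nrm_def by (rule L2_set_triangle_ineq)
  finally show ?thesis .
qed

lemma nrm_minus: "nrm n (\<lambda>l. - x l) = nrm n x"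
  by (simp add: nrm_def)

lemma nrm_diff: "nrm n (\<lambda>l. x l - y l) \<le> nrm n x + nrm n y"
  using nrm_add[of n x "\<lambda>l. - y l"] by (simp add: nrm_minus)

lemma nrm_diff_commute: "nrm n (\<lambda>l. x l - y l) = nrm n (\<lambda>l. y l - x l)"
  by (simp add: nrm_def norm_minus_commute)

lemma nrm_triangle: "nrm n (\<lambda>l. x l - z l) \<le> nrm n (\<lambda>l. x l - y l) + nrm n (\<lambda>l. y l - z l)"
  using nrm_add[of n "\<lambda>l. x l - y l" "\<lambda>l. y l - z l"] by simp

lemma nrm_scale: "nrm n (\<lambda>l. x l * c) = nrm n x * cmod c"
  by (simp add: nrm_def norm_mult L2_set_left_distrib)

lemma nrm_zero [simp]: "nrm n (\<lambda>l. 0) = 0"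
  by (simp add: nrm_def L2_set_def)

lemma nrm_eq_0: "nrm n x = 0 \<longleftrightarrow> (\<forall>l<n. x l = 0)"
  by (auto simp: nrm_def L2_set_eq_0_iff)

lemma nrm_sum: "finite I \<Longrightarrow> nrm n (\<lambda>l. \<Sum>p\<in>I. x p l) \<le> (\<Sum>p\<in>I. nrm n (x p))"
proof (induction I rule: finite_induct)
  case (insert p I)
  then show ?case using nrm_add[of n "x p" "\<lambda>l. \<Sum>p\<in>I. x p l"] by simp
qed simp

text \<open>The arguments are swapped because \<open>cinner\<close> is linear in its first slot: in
  this order the quadratic form is the squared norm of a combination, and the entries agree with
  those of \<open>coeff_map\<close>.\<close>

definition gram :: "nat \<Rightarrow> ('i \<Rightarrow> nat \<Rightarrow> complex) \<Rightarrow> 'i \<Rightarrow> 'i \<Rightarrow> complex" where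
  "gram n X p q = cinner n (X q) (X p)"

subsection \<open>Lebesgue measure on tuples of vectors\<close>

text \<open>Together with \<open>tn\<close> this gives nested products, so that Fubini can treat one
  whole vector at a time; \<open>distr_flat\<close> relates them to the flat product
  \<open>vec_meas\<close>.\<close>

definition cn :: "nat \<Rightarrow> (nat \<Rightarrow> complex) measure" where
  "cn n = PiM {..<n} (\<lambda>_. lborel)"

definition tn :: "'i set \<Rightarrow> nat \<Rightarrow> ('i \<Rightarrow> nat \<Rightarrow> complex) measure" where
  "tn I n = PiM I (\<lambda>_. cn n)"

interpretation cprod: product_sigma_finite "\<lambda>_. lborel :: complex measure"
  by standard

lemma sigma_finite_cn: "sigma_finite_measure (cn n)"
  unfolding cn_def by (intro cprod.sigma_finite) simp

interpretation cn: sigma_finite_measure "cn n" for n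
  by (rule sigma_finite_cn)

interpretation tprod: product_sigma_finite "\<lambda>_. cn n" for n
  by standard

lemma sigma_finite_tn: "finite I \<Longrightarrow> sigma_finite_measure (tn I n)"
  unfolding tn_def by (rule tprod.sigma_finite)

lemma cn_component [measurable (raw)]:
  assumes "f \<in> M \<rightarrow>\<^sub>M cn n" "l < n" shows "(\<lambda>x. f x l) \<in> borel_measurable M"
  using measurable_compose[OF assms(1)[unfolded cn_def] measurable_component_singleton[of l]] assms(2) by simp

lemma cn_restrict [measurable (raw)]:
  assumes "\<And>l. l < n \<Longrightarrow> (\<lambda>x. f x l) \<in> borel_measurable M"
  shows "(\<lambda>x. \<lambda>l\<in>{..<n}. f x l) \<in> M \<rightarrow>\<^sub>M cn n"
  unfolding cn_def using assms by (intro measurable_restrict) simp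

lemma tn_component [measurable (raw)]:
  assumes "f \<in> M \<rightarrow>\<^sub>M tn I n" "i \<in> I" shows "(\<lambda>x. f x i) \<in> M \<rightarrow>\<^sub>M cn n"
  using measurable_compose[OF assms(1)[unfolded tn_def] measurable_component_singleton[of i]] assms(2) by simp

lemma tn_restrict [measurable (raw)]:
  assumes "\<And>i. i \<in> I \<Longrightarrow> (\<lambda>x. f x i) \<in> M \<rightarrow>\<^sub>M cn n"
  shows "(\<lambda>x. \<lambda>i\<in>I. f x i) \<in> M \<rightarrow>\<^sub>M tn I n"
  unfolding tn_def using assms by (intro measurable_restrict) simp

lemma space_cn: "space (cn n) = PiE {..<n} (\<lambda>_. UNIV)"
  by (simp add: cn_def space_PiM)

lemma space_tn: "space (tn I n) = PiE I (\<lambda>_. space (cn n))"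
  by (simp add: tn_def space_PiM)

lemma measurable_cnj [measurable]: "cnj \<in> borel_measurable borel"
  by (intro borel_measurable_continuous_onI continuous_on_cnj continuous_on_id)

lemma cinner_measurable [measurable (raw)]:
  assumes "\<And>l. l < n \<Longrightarrow> (\<lambda>x. f x l) \<in> borel_measurable M" "\<And>l. l < n \<Longrightarrow> (\<lambda>x. g x l) \<in> borel_measurable M"
  shows "(\<lambda>x. cinner n (f x) (g x)) \<in> borel_measurable M"
  unfolding cinner_def
  by (intro borel_measurable_sum borel_measurable_times measurable_compose[OF _ measurable_cnj] assms) auto

lemma nrm_measurable [measurable (raw)]:
  assumes "\<And>l. l < n \<Longrightarrow> (\<lambda>x. f x l) \<in> borel_measurable M"
  shows "(\<lambda>x. nrm n (f x)) \<in> borel_measurable M"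
proof -
  have "(\<lambda>x. \<Sum>l<n. (cmod (f x l))\<^sup>2) \<in> borel_measurable M"
    using assms by (intro borel_measurable_sum borel_measurable_power borel_measurable_norm) auto
  then show ?thesis unfolding nrm_def L2_set_def by measurable
qed

text \<open>The image measure divided by the product of the constants gives every box its product
  measure, so it is the product measure by uniqueness.\<close>

lemma (in product_sigma_finite) nn_integral_componentwise:
  assumes fin: "finite I"
    and T [measurable]: "\<And>i. i \<in> I \<Longrightarrow> T i \<in> M i \<rightarrow>\<^sub>M M i"
    and c: "\<And>i. i \<in> I \<Longrightarrow> c i > 0"
    and em: "\<And>i A. i \<in> I \<Longrightarrow> A \<in> sets (M i) \<Longrightarrow> emeasure (M i) (T i -` A \<inter> space (M i)) = ennreal (c i) * emeasure (M i) A"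
    and f [measurable]: "f \<in> borel_measurable (PiM I M)"
  shows "(\<integral>\<^sup>+x. f (\<lambda>i\<in>I. T i (x i)) \<partial>PiM I M) = ennreal (\<Prod>i\<in>I. c i) * integral\<^sup>N (PiM I M) f"
proof -
  let ?T = "\<lambda>x. \<lambda>i\<in>I. T i (x i)"
  have mT [measurable]: "?T \<in> PiM I M \<rightarrow>\<^sub>M PiM I M" by measurable
  let ?D = "distr (PiM I M) (PiM I M) ?T"
  let ?C = "\<Prod>i\<in>I. c i"
  have C: "?C > 0" using c by (intro prod_pos) auto
  have eq: "scale_measure (ennreal (1 / ?C)) ?D = PiM I M"
  proof (rule PiM_eqI[OF fin])
    fix A assume A: "\<And>i. i \<in> I \<Longrightarrow> A i \<in> sets (M i)"
    have "emeasure ?D (Pi\<^sub>E I A) = emeasure (PiM I M) (?T -` Pi\<^sub>E I A \<inter> space (PiM I M))"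
      using A fin by (intro emeasure_distr mT sets_PiM_I_finite) auto
    also have "?T -` Pi\<^sub>E I A \<inter> space (PiM I M) = Pi\<^sub>E I (\<lambda>i. T i -` A i \<inter> space (M i))"
      by (auto simp: space_PiM PiE_iff)
    also have "emeasure (PiM I M) \<dots> = (\<Prod>i\<in>I. emeasure (M i) (T i -` A i \<inter> space (M i)))"
      using fin A by (intro emeasure_PiM) (auto intro: measurable_sets)
    also have "\<dots> = (\<Prod>i\<in>I. ennreal (c i) * emeasure (M i) (A i))"
      using A em by (intro prod.cong) auto
    also have "\<dots> = ennreal ?C * (\<Prod>i\<in>I. emeasure (M i) (A i))"
      using c by (simp add: prod.distrib prod_ennreal less_imp_le)
    finally have "emeasure (scale_measure (ennreal (1 / ?C)) ?D) (Pi\<^sub>E I A)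
       = ennreal (1 / ?C) * (ennreal ?C * (\<Prod>i\<in>I. emeasure (M i) (A i)))"
      by (simp only: emeasure_scale_measure)
    also have "\<dots> = (\<Prod>i\<in>I. emeasure (M i) (A i))"
      using C by (simp add: mult.assoc[symmetric] ennreal_mult[symmetric])
    finally show "emeasure (scale_measure (ennreal (1 / ?C)) ?D) (Pi\<^sub>E I A) = (\<Prod>i\<in>I. emeasure (M i) (A i))" .
  qed simp
  have "integral\<^sup>N (PiM I M) f = integral\<^sup>N (scale_measure (ennreal (1 / ?C)) ?D) f" by (simp add: eq)
  also have "\<dots> = ennreal (1 / ?C) * (\<integral>\<^sup>+x. f (?T x) \<partial>PiM I M)"
    by (simp add: nn_integral_scale_measure nn_integral_distr)
  finally have "ennreal ?C * integral\<^sup>N (PiM I M) f = ennreal ?C * ennreal (1 / ?C) * (\<integral>\<^sup>+x. f (?T x) \<partial>PiM I M)"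
    by (simp add: mult.assoc)
  also have "ennreal ?C * ennreal (1 / ?C) = 1" using C by (simp add: ennreal_mult[symmetric])
  finally show ?thesis by (simp only: mult_1_left)
qed

lemma emeasure_lborel_affine_complex:
  fixes A :: "complex set" and c :: real
  assumes "A \<in> sets borel" "c \<noteq> 0"
  shows "emeasure lborel ((\<lambda>z. a + c *\<^sub>R z) -` A) = ennreal (1 / c\<^sup>2) * emeasure lborel A"
proof -
  have "emeasure lborel A = emeasure (density (distr lborel borel (\<lambda>x. a + c *\<^sub>R x)) (\<lambda>_. ennreal (\<bar>c\<bar>^DIM(complex)))) A"
    by (subst lborel_affine[OF assms(2), of a]) simp
  also have "\<dots> = ennreal (c\<^sup>2) * emeasure lborel ((\<lambda>z. a + c *\<^sub>R z) -` A)"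
    using assms by (subst emeasure_density_const) (auto simp: emeasure_distr)
  finally have "ennreal (1 / c\<^sup>2) * emeasure lborel A
     = ennreal (1 / c\<^sup>2) * ennreal (c\<^sup>2) * emeasure lborel ((\<lambda>z. a + c *\<^sub>R z) -` A)"
    by (simp add: mult.assoc)
  also have "ennreal (1 / c\<^sup>2) * ennreal (c\<^sup>2) = 1" using assms by (simp add: ennreal_mult[symmetric])
  finally show ?thesis by simp
qed

text \<open>The exponent is the real dimension of C^n. Negative \<open>c\<close> is included:
  \<open>c = -1\<close> supplies the reflection in \<open>cn_unitary_invariant\<close>.\<close>

lemma cn_affine:
  assumes f: "f \<in> borel_measurable (cn n)" and c: "c \<noteq> 0"
  shows "ennreal (c ^ (2 * n)) * (\<integral>\<^sup>+x. f (\<lambda>l\<in>{..<n}. a l + complex_of_real c * x l) \<partial>cn n) = integral\<^sup>N (cn n) f"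
proof -
  have "(\<integral>\<^sup>+x. f (\<lambda>l\<in>{..<n}. a l + c *\<^sub>R x l) \<partial>cn n) = ennreal (\<Prod>l\<in>{..<n}. 1 / c\<^sup>2) * integral\<^sup>N (cn n) f"
    unfolding cn_def using c f
    by (intro cprod.nn_integral_componentwise[where T = "\<lambda>l z. a l + c *\<^sub>R z"])
       (auto simp: emeasure_lborel_affine_complex cn_def)
  moreover have "c ^ (2 * n) * (\<Prod>l\<in>{..<n}. 1 / c\<^sup>2) = 1"
    using c by (simp add: power_mult[symmetric] power_divide power_one_over)
  ultimately show ?thesis
    by (simp add: scaleR_conv_of_real mult.assoc[symmetric] ennreal_mult'[symmetric] zero_le_even_power')
qed

lemma cn_translate:
  assumes f: "f \<in> borel_measurable (cn n)"
  shows "(\<integral>\<^sup>+x. f (\<lambda>l\<in>{..<n}. a l + x l) \<partial>cn n) = integral\<^sup>N (cn n) f"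
  using cn_affine[OF f, of 1 a] by simp

text \<open>Right multiplication by \<open>R\<close> of the matrix whose columns are the vectors of
  \<open>X\<close>. The restrictions keep the result in the space of \<open>tn\<close>.\<close>

definition cmb :: "'i set \<Rightarrow> nat \<Rightarrow> ('i \<Rightarrow> 'i \<Rightarrow> complex) \<Rightarrow> ('i \<Rightarrow> nat \<Rightarrow> complex) \<Rightarrow> 'i \<Rightarrow> nat \<Rightarrow> complex" where
  "cmb I n R X = (\<lambda>q\<in>I. \<lambda>l\<in>{..<n}. \<Sum>p\<in>I. X p l * R p q)"

lemma cmb_measurable [measurable]: "cmb I n R \<in> tn I n \<rightarrow>\<^sub>M tn I n"
  unfolding cmb_def by measurable

text \<open>Only the column inserted last involves the last variable, and it does so by an affine
  map with dilation factor \<open>R x x\<close>; the other columns are treated by induction.\<close>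

lemma tri_change_of_variables:
  assumes "tri R I" "f \<in> borel_measurable (tn I n)"
  shows "ennreal (\<Prod>l\<in>I. (cmod (R l l)) ^ (2 * n)) * (\<integral>\<^sup>+X. f (cmb I n R X) \<partial>tn I n) = integral\<^sup>N (tn I n) f"
  using assms
proof (induction arbitrary: f rule: tri.induct)
  case tri_empty
  have "cmb {} n R X = X" if "X \<in> space (tn {} n)" for X
    using that by (auto simp: cmb_def space_tn)
  then show ?case by (simp cong: nn_integral_cong)
next
  case (tri_insert A x)
  note f [measurable] = \<open>f \<in> borel_measurable (tn (insert x A) n)\<close>
  note fin = \<open>finite A\<close> \<open>x \<notin> A\<close>
  define t where "t = Re (R x x)"
  have t: "t > 0" "R x x = complex_of_real t" "cmod (R x x) = t"
    using tri_insert by (auto simp: t_def complex_eq_iff norm_complex_def)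
  have upd [measurable]: "(\<lambda>(X, y). X(x := y)) \<in> tn A n \<Otimes>\<^sub>M cn n \<rightarrow>\<^sub>M tn (insert x A) n"
    unfolding tn_def by (rule measurable_add_dim)
  have fm: "(\<lambda>(X, y). f (X(x := y))) \<in> borel_measurable (tn A n \<Otimes>\<^sub>M cn n)"
    using measurable_compose[OF upd f] by (simp add: split_def)
  define g where "g X = (\<integral>\<^sup>+y. f (X(x := y)) \<partial>cn n)" for X
  have g [measurable]: "g \<in> borel_measurable (tn A n)"
    unfolding g_def using fm by (intro cn.borel_measurable_nn_integral) simp
  have split: "cmb (insert x A) n R (X(x := y)) = (cmb A n R X)(x := \<lambda>l\<in>{..<n}. (\<Sum>p\<in>A. X p l * R p x) + complex_of_real t * y l)"
    for X y
  proof
    fix q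
    have "(\<Sum>p\<in>A. (X(x := y)) p l * R p q) = (\<Sum>p\<in>A. X p l * R p q)" for l q
      using fin by (intro sum.cong) auto
    then show "cmb (insert x A) n R (X(x := y)) q = ((cmb A n R X)(x := \<lambda>l\<in>{..<n}. (\<Sum>p\<in>A. X p l * R p x) + complex_of_real t * y l)) q"
      using fin t tri_insert.hyps(4) by (auto simp: cmb_def fun_eq_iff)
  qed
  have inner: "ennreal (t ^ (2 * n)) * (\<integral>\<^sup>+y. f (cmb (insert x A) n R (X(x := y))) \<partial>cn n) = g (cmb A n R X)"
    if X: "X \<in> space (tn A n)" for X
    unfolding split g_def
  proof (rule cn_affine)
    have "cmb A n R X \<in> space (tn A n)" using X measurable_space[OF cmb_measurable] by blast
    then show "(\<lambda>y. f ((cmb A n R X)(x := y))) \<in> borel_measurable (cn n)"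
      using measurable_Pair2[OF fm] by simp
  qed (use t in simp)
  have fc: "(\<lambda>X. f (cmb (insert x A) n R X)) \<in> borel_measurable (PiM (insert x A) (\<lambda>_. cn n))"
    unfolding tn_def[symmetric] by measurable
  have "(\<integral>\<^sup>+X. f (cmb (insert x A) n R X) \<partial>tn (insert x A) n)
     = (\<integral>\<^sup>+X. \<integral>\<^sup>+y. f (cmb (insert x A) n R (X(x := y))) \<partial>cn n \<partial>tn A n)"
    unfolding tn_def using fin fc by (intro tprod.product_nn_integral_insert)
  then have "ennreal (t ^ (2 * n)) * (\<integral>\<^sup>+X. f (cmb (insert x A) n R X) \<partial>tn (insert x A) n)
     = ennreal (t ^ (2 * n)) * (\<integral>\<^sup>+X. \<integral>\<^sup>+y. f (cmb (insert x A) n R (X(x := y))) \<partial>cn n \<partial>tn A n)" by simp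
  also have "\<dots> = (\<integral>\<^sup>+X. ennreal (t ^ (2 * n)) * (\<integral>\<^sup>+y. f (cmb (insert x A) n R (X(x := y))) \<partial>cn n) \<partial>tn A n)"
  proof (rule nn_integral_cmult[symmetric])
    have "(\<lambda>(X, y). f (cmb (insert x A) n R (X(x := y)))) \<in> borel_measurable (tn A n \<Otimes>\<^sub>M cn n)"
      using measurable_compose[OF upd measurable_compose[OF cmb_measurable f]] by (simp add: split_def)
    then show "(\<lambda>X. \<integral>\<^sup>+y. f (cmb (insert x A) n R (X(x := y))) \<partial>cn n) \<in> borel_measurable (tn A n)"
      by (intro cn.borel_measurable_nn_integral) simp
  qed
  also have "\<dots> = (\<integral>\<^sup>+X. g (cmb A n R X) \<partial>tn A n)" by (intro nn_integral_cong inner)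
  finally have "ennreal (\<Prod>l\<in>A. (cmod (R l l)) ^ (2 * n)) * (ennreal (t ^ (2 * n)) * (\<integral>\<^sup>+X. f (cmb (insert x A) n R X) \<partial>tn (insert x A) n))
     = integral\<^sup>N (tn A n) g" using tri_insert.IH[OF g] by simp
  also have "\<dots> = integral\<^sup>N (tn (insert x A) n) f"
    unfolding g_def tn_def using fin f by (intro tprod.product_nn_integral_insert[symmetric]) (auto simp: tn_def)
  finally show ?case using fin t
    by (simp add: prod_nonneg ennreal_mult mult_ac)
qed

subsection \<open>Volumes of balls\<close>

text \<open>Discs of squared radius \<open>a\<close> have area \<open>\<pi> * a\<close>, so the
  squared modulus has constant density on the half line. Working with squared radii makes the
  recursion for ball volumes polynomial.\<close>

lemma nn_integral_cmod_square:
  assumes f [measurable]: "f \<in> borel_measurable borel"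
  shows "(\<integral>\<^sup>+z. f ((cmod z)\<^sup>2) \<partial>lborel) = (\<integral>\<^sup>+t. ennreal pi * indicator {0..} t * f t \<partial>lborel)"
proof -
  have eq: "distr lborel borel (\<lambda>z. (cmod z)\<^sup>2) = density lborel (\<lambda>t. ennreal pi * indicator {0..} t)" (is "?D = ?E")
  proof (rule measure_eqI_generator_eq[where \<Omega> = UNIV and E = "range (\<lambda>a. {..a})" and A = "\<lambda>i. {..real i}"])
    show "Int_stable (range (\<lambda>a::real. {..a}))" by (auto simp: Int_stable_def)
    have D: "emeasure ?D {..a} = ennreal (pi * max a 0)" for a
    proof -
      have "emeasure ?D {..a} = emeasure lborel {z::complex. (cmod z)\<^sup>2 \<le> a}"
        by (subst emeasure_distr) (auto simp: vimage_def)
      also have "\<dots> = ennreal (pi * max a 0)"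
      proof (cases "a \<ge> 0")
        case True
        have "{z::complex. (cmod z)\<^sup>2 \<le> a} = cball 0 (sqrt a)"
          using True by (auto simp: real_le_rsqrt sqrt_le_D dest: real_le_rsqrt)
            (metis norm_ge_zero power_mono real_sqrt_pow2)
        then show ?thesis using True by (simp add: emeasure_cball eval_unit_ball_vol)
      next
        case False
        then have "{z::complex. (cmod z)\<^sup>2 \<le> a} = {}"
          by (auto simp: not_le) (meson less_le_trans zero_le_power2)
        then show ?thesis using False by simp
      qed
      finally show ?thesis .
    qed
    have E: "emeasure ?E {..a} = ennreal (pi * max a 0)" for a
    proof -
      have "emeasure ?E {..a} = (\<integral>\<^sup>+t. ennreal pi * indicator {0..a} t \<partial>lborel)"
        by (subst emeasure_density) (auto intro!: nn_integral_cong simp: indicator_def)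
      also have "\<dots> = ennreal pi * emeasure lborel {0..a}" by (subst nn_integral_cmult_indicator) auto
      also have "\<dots> = ennreal (pi * max a 0)" by (auto simp: emeasure_lborel_Icc_eq ennreal_mult max_def)
      finally show ?thesis .
    qed
    show "emeasure ?D X = emeasure ?E X" if "X \<in> range (\<lambda>a. {..a})" for X using that D E by auto
    show "emeasure ?D {..real i} \<noteq> \<infinity>" for i by (simp add: D)
    show "(\<Union>i. {..real i}) = UNIV" using real_arch_simple by auto
  qed (auto simp: borel_eq_atMost)
  have "(\<integral>\<^sup>+z. f ((cmod z)\<^sup>2) \<partial>lborel) = integral\<^sup>N ?D f" by (simp add: nn_integral_distr)
  also have "\<dots> = (\<integral>\<^sup>+t. ennreal pi * indicator {0..} t * f t \<partial>lborel)"
    unfolding eq by (subst nn_integral_density) auto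
  finally show ?thesis .
qed

lemma vball_pos [simp]: "vball n > 0" by (simp add: vball_def)

lemma emeasure_ball_sq:
  "0 \<le> r \<Longrightarrow> emeasure (cn n) {x \<in> space (cn n). (nrm n x)\<^sup>2 \<le> r} = ennreal (vball n * r ^ n)"
proof (induction n arbitrary: r)
  case 0
  have "{x \<in> space (cn 0). (nrm 0 x)\<^sup>2 \<le> r} = {\<lambda>_. undefined}"
    using 0 by (auto simp: space_cn nrm_sq)
  then show ?case by (simp add: cn_def vball_def)
next
  case (Suc n)
  let ?B = "{x \<in> space (cn (Suc n)). (nrm (Suc n) x)\<^sup>2 \<le> r}"
  \<comment> \<open>The slice of the ball at last coordinate \<open>z\<close> is a ball of squared
    radius \<open>r - t\<close>, with \<open>t\<close> the squared modulus of \<open>z\<close>;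
    \<open>g\<close> is its volume.\<close>
  define g where "g t = (if t \<le> r then ennreal (vball n * (r - t) ^ n) else 0)" for t :: real
  have [measurable]: "g \<in> borel_measurable borel" unfolding g_def by measurable
  have S: "PiM {..<Suc n} (\<lambda>_. lborel) = PiM (insert n {..<n}) (\<lambda>_. lborel :: complex measure)"
    by (simp add: lessThan_Suc)
  have B: "?B \<in> sets (cn (Suc n))" by measurable
  have "emeasure (cn (Suc n)) ?B = integral\<^sup>N (cn (Suc n)) (indicator ?B)" using B by simp
  also have "\<dots> = (\<integral>\<^sup>+z. \<integral>\<^sup>+x. indicator ?B (x(n := z)) \<partial>cn n \<partial>lborel)"
    using B unfolding cn_def S by (intro cprod.product_nn_integral_insert_rev) auto
  also have "\<dots> = (\<integral>\<^sup>+z. g ((cmod z)\<^sup>2) \<partial>lborel)"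
  proof (rule nn_integral_cong)
    fix z :: complex
    have "(\<integral>\<^sup>+x. indicator ?B (x(n := z)) \<partial>cn n)
       = (\<integral>\<^sup>+x. indicator {x \<in> space (cn n). (nrm n x)\<^sup>2 \<le> r - (cmod z)\<^sup>2} x \<partial>cn n)"
    proof (rule nn_integral_cong)
      fix x assume x: "x \<in> space (cn n)"
      have "(nrm (Suc n) (x(n := z)))\<^sup>2 = (nrm n x)\<^sup>2 + (cmod z)\<^sup>2" by (simp add: nrm_sq)
      moreover have "x(n := z) \<in> space (cn (Suc n))"
        using x by (auto simp: space_cn PiE_iff extensional_def)
      ultimately show "(indicator ?B (x(n := z)) :: ennreal) = indicator {x \<in> space (cn n). (nrm n x)\<^sup>2 \<le> r - (cmod z)\<^sup>2} x"
        using x by (auto simp: indicator_def)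
    qed
    also have "\<dots> = emeasure (cn n) {x \<in> space (cn n). (nrm n x)\<^sup>2 \<le> r - (cmod z)\<^sup>2}"
      by (intro nn_integral_indicator) measurable
    also have "\<dots> = g ((cmod z)\<^sup>2)"
    proof (cases "(cmod z)\<^sup>2 \<le> r")
      case True
      then show ?thesis by (simp add: g_def Suc.IH)
    next
      case False
      then have "{x \<in> space (cn n). (nrm n x)\<^sup>2 \<le> r - (cmod z)\<^sup>2} = {}"
        by auto (smt (verit) zero_le_power2)
      then have "emeasure (cn n) {x \<in> space (cn n). (nrm n x)\<^sup>2 \<le> r - (cmod z)\<^sup>2} = 0" by (simp only: emeasure_empty)
      then show ?thesis using False by (simp only: g_def if_False)
    qed
    finally show "(\<integral>\<^sup>+x. indicator ?B (x(n := z)) \<partial>cn n) = g ((cmod z)\<^sup>2)" .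
  qed
  also have "\<dots> = (\<integral>\<^sup>+t. ennreal pi * indicator {0..} t * g t \<partial>lborel)"
    by (rule nn_integral_cmod_square) measurable
  also have "\<dots> = (\<integral>\<^sup>+t. ennreal (pi * vball n * (r - t) ^ n) * indicator {0..r} t \<partial>lborel)"
    by (intro nn_integral_cong) (auto simp: g_def indicator_def ennreal_mult[symmetric] vball_def mult_ac)
  also have "\<dots> = ennreal (- (pi * vball n * (r - r) ^ Suc n / Suc n) - - (pi * vball n * (r - 0) ^ Suc n / Suc n))"
  proof (rule nn_integral_FTC_Icc)
    show "0 \<le> pi * vball n * (r - t) ^ n" if "t \<in> {0..r}" for t
      using that by (simp add: vball_def)
    show "((\<lambda>t. - (pi * vball n * (r - t) ^ Suc n / Suc n)) has_real_derivative pi * vball n * (r - t) ^ n) (at t)"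
      if "t \<in> {0..r}" for t
      by (auto intro!: derivative_eq_intros simp: field_simps simp del: power_Suc of_nat_Suc)
  qed (use Suc.prems in auto)
  also have "\<dots> = ennreal (vball (Suc n) * r ^ Suc n)" by (simp add: vball_def field_simps)
  finally show ?case .
qed

lemma ball_sets [measurable]: "{x \<in> space (cn n). nrm n (\<lambda>l. x l - a l) \<le> r} \<in> sets (cn n)"
  by measurable

lemma emeasure_ball:
  assumes "0 \<le> r"
  shows "emeasure (cn n) {x \<in> space (cn n). nrm n (\<lambda>l. x l - a l) \<le> r} = ennreal (vball n * r ^ (2 * n))"
proof -
  have "emeasure (cn n) {x \<in> space (cn n). nrm n (\<lambda>l. x l - a l) \<le> r}
      = (\<integral>\<^sup>+x. indicator {x \<in> space (cn n). nrm n (\<lambda>l. x l - a l) \<le> r} x \<partial>cn n)" by simp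
  also have "\<dots> = (\<integral>\<^sup>+x. indicator {x \<in> space (cn n). nrm n (\<lambda>l. x l - a l) \<le> r} (\<lambda>l\<in>{..<n}. a l + x l) \<partial>cn n)"
    by (rule cn_translate[symmetric]) simp
  also have "\<dots> = (\<integral>\<^sup>+x. indicator {x \<in> space (cn n). (nrm n x)\<^sup>2 \<le> r\<^sup>2} x \<partial>cn n)"
  proof (rule nn_integral_cong)
    fix x assume "x \<in> space (cn n)"
    have "nrm n (\<lambda>l. (\<lambda>l\<in>{..<n}. a l + x l) l - a l) = nrm n x" by (intro nrm_cong) simp
    moreover have "nrm n x \<le> r \<longleftrightarrow> (nrm n x)\<^sup>2 \<le> r\<^sup>2" using assms by (simp add: abs_le_square_iff[symmetric])
    ultimately show "(indicator {x \<in> space (cn n). nrm n (\<lambda>l. x l - a l) \<le> r} (\<lambda>l\<in>{..<n}. a l + x l) :: ennreal)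
       = indicator {x \<in> space (cn n). (nrm n x)\<^sup>2 \<le> r\<^sup>2} x"
      using \<open>x \<in> space (cn n)\<close> by (auto simp: indicator_def space_cn)
  qed
  also have "\<dots> = emeasure (cn n) {x \<in> space (cn n). (nrm n x)\<^sup>2 \<le> r\<^sup>2}"
    by (intro nn_integral_indicator) measurable
  finally show ?thesis by (simp add: emeasure_ball_sq power_mult)
qed

text \<open>With all coordinates except \<open>l0\<close> fixed, at most one value of that
  coordinate solves the equation.\<close>

lemma emeasure_hyperplane:
  assumes l0: "l0 < n" "z l0 \<noteq> 0"
  shows "emeasure (cn n) {x \<in> space (cn n). cinner n x z = 0} = 0"
proof -
  let ?H = "{x \<in> space (cn n). cinner n x z = 0}"
  let ?J = "{..<n} - {l0}"
  have S: "{..<n} = insert l0 ?J" using l0 by auto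
  have H: "?H \<in> sets (cn n)" by measurable
  have H': "indicator ?H \<in> borel_measurable (PiM (insert l0 ?J) (\<lambda>_. lborel))"
    using H unfolding cn_def S[symmetric] by (intro borel_measurable_indicator)
  have "emeasure (cn n) ?H = integral\<^sup>N (PiM (insert l0 ?J) (\<lambda>_. lborel)) (indicator ?H)"
    using H unfolding S[symmetric] cn_def[symmetric] by simp
  also have "\<dots> = (\<integral>\<^sup>+x. \<integral>\<^sup>+y. indicator ?H (x(l0 := y)) \<partial>lborel \<partial>PiM ?J (\<lambda>_. lborel))"
    using H' by (intro cprod.product_nn_integral_insert) auto
  also have "\<dots> = (\<integral>\<^sup>+x. 0 \<partial>PiM ?J (\<lambda>_. lborel :: complex measure))"
  proof (rule nn_integral_cong)
    fix x :: "nat \<Rightarrow> complex"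
    define s where "s = (\<Sum>l\<in>?J. x l * cnj (z l))"
    have c: "cinner n (x(l0 := y)) z = y * cnj (z l0) + s" for y
    proof -
      have "(\<Sum>l\<in>?J. (x(l0 := y)) l * cnj (z l)) = s" unfolding s_def by (intro sum.cong) auto
      then show ?thesis unfolding cinner_def using sum.remove[OF finite_lessThan, of l0 n "\<lambda>l. (x(l0 := y)) l * cnj (z l)"] l0 by simp
    qed
    have "(\<integral>\<^sup>+y. indicator ?H (x(l0 := y)) \<partial>lborel) \<le> (\<integral>\<^sup>+y. indicator {- s / cnj (z l0)} y \<partial>lborel)"
      using l0 by (intro nn_integral_mono) (auto simp: indicator_def c field_simps eq_neg_iff_add_eq_0)
    also have "\<dots> = 0" by simp
    finally show "(\<integral>\<^sup>+y. indicator ?H (x(l0 := y)) \<partial>lborel) = 0" by simp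
  qed
  finally show ?thesis by simp
qed

subsection \<open>Orthonormal families and unitary matrices\<close>

definition orthon :: "nat \<Rightarrow> 'j set \<Rightarrow> ('j \<Rightarrow> nat \<Rightarrow> complex) \<Rightarrow> bool" where
  "orthon n J q \<longleftrightarrow> (\<forall>i\<in>J. \<forall>j\<in>J. cinner n (q i) (q j) = (if i = j then 1 else 0))"

definition resid :: "nat \<Rightarrow> 'j set \<Rightarrow> ('j \<Rightarrow> nat \<Rightarrow> complex) \<Rightarrow> (nat \<Rightarrow> complex) \<Rightarrow> nat \<Rightarrow> complex" where
  "resid n J q x = (\<lambda>l. x l - (\<Sum>j\<in>J. q j l * cinner n x (q j)))"

definition unitv :: "nat \<Rightarrow> nat \<Rightarrow> complex" where
  "unitv l = (\<lambda>m. if m = l then 1 else 0)"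

lemma cinner_sum_scaled_left: "cinner n (\<lambda>l. \<Sum>j\<in>J. q j l * c j) y = (\<Sum>j\<in>J. c j * cinner n (q j) y)"
  by (subst cinner_sum_left) (simp add: cinner_scale_left)

lemma cinner_sum_scaled_right: "cinner n y (\<lambda>l. \<Sum>j\<in>J. q j l * c j) = (\<Sum>j\<in>J. cnj (c j) * cinner n y (q j))"
  by (subst cinner_sum_right) (simp add: cinner_scale_right)

lemma resid_orthogonal:
  assumes "finite J" "orthon n J q" "i \<in> J"
  shows "cinner n (resid n J q x) (q i) = 0"
proof -
  have "cinner n (resid n J q x) (q i) = cinner n x (q i) - (\<Sum>j\<in>J. cinner n x (q j) * cinner n (q j) (q i))"
    unfolding resid_def by (simp add: cinner_diff_left cinner_sum_scaled_left)
  also have "(\<Sum>j\<in>J. cinner n x (q j) * cinner n (q j) (q i)) = (\<Sum>j\<in>J. if j = i then cinner n x (q i) else 0)"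
    using assms by (intro sum.cong) (auto simp: orthon_def)
  also have "\<dots> = cinner n x (q i)" using assms by simp
  finally show ?thesis by simp
qed

lemma resid_sq:
  assumes "finite J" "orthon n J q"
  shows "(nrm n (resid n J q x))\<^sup>2 = (nrm n x)\<^sup>2 - (\<Sum>j\<in>J. (cmod (cinner n x (q j)))\<^sup>2)"
proof -
  let ?r = "resid n J q x"
  have o: "cinner n ?r (\<lambda>l. \<Sum>j\<in>J. q j l * cinner n x (q j)) = 0"
    by (subst cinner_sum_scaled_right) (auto intro!: sum.neutral simp: resid_orthogonal[OF assms])
  have "complex_of_real ((nrm n ?r)\<^sup>2) = cinner n ?r ?r" by (simp add: cinner_self)
  also have "\<dots> = cinner n ?r (\<lambda>l. x l - (\<Sum>j\<in>J. q j l * cinner n x (q j)))" by (simp add: resid_def)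
  also have "\<dots> = cinner n ?r x" by (simp add: cinner_diff_right o)
  also have "\<dots> = cinner n x x - (\<Sum>j\<in>J. cinner n x (q j) * cinner n (q j) x)"
    unfolding resid_def by (simp add: cinner_diff_left cinner_sum_scaled_left)
  also have "\<dots> = complex_of_real ((nrm n x)\<^sup>2 - (\<Sum>j\<in>J. (cmod (cinner n x (q j)))\<^sup>2))"
    by (subst (2) cinner_commute) (simp only: cinner_self of_real_diff of_real_sum complex_norm_square)
  finally show ?thesis by (simp only: of_real_eq_iff)
qed

lemma nrm_unitv: "l < n \<Longrightarrow> nrm n (unitv l) = 1"
  using nrm_sq[of n "unitv l"] by (simp add: unitv_def if_distrib[of cmod] if_distrib[of "\<lambda>x. x\<^sup>2"] power2_eq_1_iff cong: if_cong)
    (smt (verit) nrm_nonneg)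

lemma cinner_unitv: "l < n \<Longrightarrow> cinner n (unitv l) y = cnj (y l)"
  by (simp add: cinner_def unitv_def if_distrib[of "\<lambda>x. x * _"] cong: if_cong)

text \<open>Bessel's identity summed over the standard basis, a trace computation of the
  codimension. Three facts follow from it: at most \<open>n\<close> vectors are orthonormal,
  \<open>n\<close> of them are complete, and fewer leave some basis vector outside their
  span.\<close>

lemma sum_resid_unitv:
  assumes "finite J" "orthon n J q"
  shows "(\<Sum>l<n. (nrm n (resid n J q (unitv l)))\<^sup>2) = real n - real (card J)"
proof -
  have "(\<Sum>l<n. (nrm n (resid n J q (unitv l)))\<^sup>2) = (\<Sum>l<n. 1 - (\<Sum>j\<in>J. (cmod (q j l))\<^sup>2))"
    by (intro sum.cong refl) (simp add: resid_sq[OF assms] nrm_unitv cinner_unitv)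
  also have "\<dots> = real n - (\<Sum>j\<in>J. (nrm n (q j))\<^sup>2)"
    unfolding nrm_sq by (simp add: sum_subtractf) (rule sum.swap)
  also have "(\<Sum>j\<in>J. (nrm n (q j))\<^sup>2) = (\<Sum>j\<in>J. 1)"
  proof (intro sum.cong refl)
    fix j assume "j \<in> J"
    then have "complex_of_real ((nrm n (q j))\<^sup>2) = 1" using assms unfolding cinner_self[symmetric] orthon_def by simp
    then show "(nrm n (q j))\<^sup>2 = 1" by (simp only: of_real_eq_1_iff)
  qed
  finally show ?thesis by simp
qed

lemma orthon_card_le: "finite J \<Longrightarrow> orthon n J q \<Longrightarrow> card J \<le> n"
  using sum_resid_unitv[of J n q] sum_nonneg[of "{..<n}" "\<lambda>l. (nrm n (resid n J q (unitv l)))\<^sup>2"] by simp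

text \<open>Read for the columns of a square matrix this is orthonormality of its rows, which makes
  the adjoint of a unitary a right inverse as well.\<close>

lemma orthon_complete:
  assumes "finite J" "orthon n J q" "card J = n" "l < n" "m < n"
  shows "(\<Sum>j\<in>J. q j m * cnj (q j l)) = (if m = l then 1 else 0)"
proof -
  have "(\<Sum>l<n. (nrm n (resid n J q (unitv l)))\<^sup>2) = 0" using sum_resid_unitv[OF assms(1,2)] assms by simp
  then have "nrm n (resid n J q (unitv l)) = 0"
    using assms by (subst (asm) sum_nonneg_eq_0_iff) auto
  then have "resid n J q (unitv l) m = 0" using assms by (simp add: nrm_eq_0)
  then have "(if m = l then 1 else 0) = (\<Sum>j\<in>J. q j m * cnj (q j l))"
    using assms by (simp add: resid_def cinner_unitv) (auto simp: unitv_def split: if_splits)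
  then show ?thesis by (rule sym)
qed

lemma orthon_incomplete:
  assumes "finite J" "orthon n J q" "card J < n"
  obtains l where "l < n" "nrm n (resid n J q (unitv l)) \<noteq> 0"
proof -
  have "(\<Sum>l<n. (nrm n (resid n J q (unitv l)))\<^sup>2) \<noteq> 0" using sum_resid_unitv[OF assms(1,2)] assms by simp
  then obtain l where "l < n" "(nrm n (resid n J q (unitv l)))\<^sup>2 \<noteq> 0" by (meson lessThan_iff sum.neutral)
  then show ?thesis using that by auto
qed

definition normalize_vec :: "nat \<Rightarrow> (nat \<Rightarrow> complex) \<Rightarrow> nat \<Rightarrow> complex" where
  "normalize_vec n w = (\<lambda>l. w l * (1 / complex_of_real (nrm n w)))"

lemma cinner_normalize_left: "cinner n (normalize_vec n w) y = cinner n w y / complex_of_real (nrm n w)"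
  by (simp only: normalize_vec_def cinner_scale_left) simp

lemma cinner_normalize_self:
  assumes "nrm n w \<noteq> 0" shows "cinner n (normalize_vec n w) (normalize_vec n w) = 1"
  using assms by (simp only: normalize_vec_def cinner_scale_left cinner_scale_right cinner_self)
    (simp add: power2_eq_square)

lemma orthon_insert:
  assumes "orthon n J q" "j \<notin> J" "finite J" "nrm n (resid n J q x) \<noteq> 0"
    and q': "\<And>i. i \<in> J \<Longrightarrow> q' i = q i" "q' j = normalize_vec n (resid n J q x)"
  shows "orthon n (insert j J) q'"
proof -
  have a: "cinner n (q' j) (q i) = 0" if "i \<in> J" for i
    unfolding q'(2) by (simp add: cinner_normalize_left resid_orthogonal[OF assms(3,1) that])
  have b: "cinner n (q i) (q' j) = 0" if "i \<in> J" for i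
    using a[OF that] by (subst cinner_commute) simp
  have c: "cinner n (q' j) (q' j) = 1" unfolding q'(2) using assms by (intro cinner_normalize_self)
  show ?thesis unfolding orthon_def
  proof (intro ballI)
    fix i k assume "i \<in> insert j J" "k \<in> insert j J"
    then show "cinner n (q' i) (q' k) = (if i = k then 1 else 0)"
      using a b c assms(1,2) q'(1) unfolding orthon_def by (cases "i = j"; cases "k = j"; auto)
  qed
qed

lemma orthon_extend:
  "m \<le> n \<Longrightarrow> orthon n {..<m} q \<Longrightarrow> \<exists>q'. orthon n {..<n} q' \<and> (\<forall>i<m. q' i = q i)"
proof (induction "n - m" arbitrary: m q)
  case 0
  then show ?case by auto
next
  case (Suc k)
  then have "card {..<m} < n" by simp
  then obtain l where "nrm n (resid n {..<m} q (unitv l)) \<noteq> 0"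
    using orthon_incomplete[OF _ Suc.prems(2)] by auto
  then have "orthon n (insert m {..<m}) (q(m := normalize_vec n (resid n {..<m} q (unitv l))))"
    using Suc.prems by (intro orthon_insert[where q = q]) auto
  then have "orthon n {..<Suc m} (q(m := normalize_vec n (resid n {..<m} q (unitv l))))"
    by (simp add: lessThan_Suc)
  then obtain q' where q': "orthon n {..<n} q'" "\<forall>i<Suc m. q' i = (q(m := normalize_vec n (resid n {..<m} q (unitv l)))) i"
    using Suc.hyps(1)[of "Suc m"] Suc.hyps(2) Suc.prems by (metis Suc_diff_Suc Suc_leI diff_Suc_1 nat_neq_iff zero_less_Suc zero_less_diff)
  then show ?case by (intro exI[of _ q']) auto
qed

section \<open>Unitary matrices acting on vectors\<close>

definition mult :: "nat \<Rightarrow> (nat \<times> nat \<Rightarrow> complex) \<Rightarrow> (nat \<Rightarrow> complex) \<Rightarrow> nat \<Rightarrow> complex" where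
  "mult n U x = (\<lambda>i. \<Sum>l<n. U (i, l) * x l)"

text \<open>Unlike \<open>mult\<close>, the value is extensional and lies in the space of
  \<open>cn n\<close>, as integrals over transformed vectors require.\<close>

definition mv :: "nat \<Rightarrow> (nat \<times> nat \<Rightarrow> complex) \<Rightarrow> (nat \<Rightarrow> complex) \<Rightarrow> nat \<Rightarrow> complex" where
  "mv n U x = restrict (mult n U x) {..<n}"

definition adj :: "nat \<Rightarrow> (nat \<times> nat \<Rightarrow> complex) \<Rightarrow> nat \<times> nat \<Rightarrow> complex" where
  "adj n U = restrict (\<lambda>(i, j). cnj (U (j, i))) ({..<n} \<times> {..<n})"

lemma umat_iff: "U \<in> umat n \<longleftrightarrow> U \<in> PiE ({..<n} \<times> {..<n}) (\<lambda>_. UNIV) \<and> orthon n {..<n} (\<lambda>j l. U (l, j))"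
  unfolding umat_def orthon_def cinner_def by (auto simp: mult.commute Ball_def)

lemma umat_columns: "U \<in> umat n \<Longrightarrow> orthon n {..<n} (\<lambda>j l. U (l, j))"
  by (simp add: umat_iff)

lemma umat_rows:
  assumes "U \<in> umat n" "l < n" "m < n"
  shows "(\<Sum>j<n. U (m, j) * cnj (U (l, j))) = (if m = l then 1 else 0)"
  using orthon_complete[OF _ umat_columns[OF assms(1)]] assms by simp

lemma adj_umat:
  assumes "U \<in> umat n" shows "adj n U \<in> umat n"
proof -
  have "(\<Sum>l<n. cnj (adj n U (l, i)) * adj n U (l, j)) = (if i = j then 1 else 0)" if "i < n" "j < n" for i j
  proof -
    have "(\<Sum>l<n. cnj (adj n U (l, i)) * adj n U (l, j)) = (\<Sum>l<n. U (i, l) * cnj (U (j, l)))"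
      using that by (intro sum.cong) (auto simp: adj_def)
    then show ?thesis using umat_rows[OF assms] that by simp
  qed
  then show ?thesis by (simp add: umat_def adj_def)
qed

lemma mult_mult_kronecker:
  assumes "\<And>i j. i < n \<Longrightarrow> j < n \<Longrightarrow> (\<Sum>l<n. A (i, l) * B (l, j)) = (if i = j then 1 else 0)" "i < n"
  shows "mult n A (mult n B x) i = x i"
proof -
  have "mult n A (mult n B x) i = (\<Sum>l<n. \<Sum>j<n. A (i, l) * B (l, j) * x j)"
    unfolding mult_def sum_distrib_left by (simp add: mult_ac)
  also have "\<dots> = (\<Sum>j<n. (\<Sum>l<n. A (i, l) * B (l, j)) * x j)"
    by (subst sum.swap) (simp add: sum_distrib_right)
  also have "\<dots> = (\<Sum>j<n. if i = j then x i else 0)"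
    using assms by (intro sum.cong refl) auto
  also have "\<dots> = x i" using assms by simp
  finally show ?thesis .
qed

lemma adj_mult:
  assumes U: "U \<in> umat n" and i: "i < n"
  shows "mult n (adj n U) (mult n U x) i = x i" "mult n U (mult n (adj n U) x) i = x i"
proof -
  have "(\<Sum>l<n. adj n U (i, l) * U (l, j)) = (if i = j then 1 else 0)" if "i < n" "j < n" for i j
  proof -
    have "(\<Sum>l<n. adj n U (i, l) * U (l, j)) = (\<Sum>l<n. cnj (U (l, i)) * U (l, j))"
      using that by (intro sum.cong) (auto simp: adj_def)
    then show ?thesis using U that by (simp add: umat_def)
  qed
  then show "mult n (adj n U) (mult n U x) i = x i" using i by (rule mult_mult_kronecker)
  have "(\<Sum>l<n. U (i, l) * adj n U (l, j)) = (if i = j then 1 else 0)" if "i < n" "j < n" for i j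
  proof -
    have "(\<Sum>l<n. U (i, l) * adj n U (l, j)) = (\<Sum>l<n. U (i, l) * cnj (U (j, l)))"
      using that by (intro sum.cong) (auto simp: adj_def)
    then show ?thesis using umat_rows[OF U] that by simp
  qed
  then show "mult n U (mult n (adj n U) x) i = x i" using i by (rule mult_mult_kronecker)
qed

lemma mult_cong: "(\<And>l. l < n \<Longrightarrow> x l = y l) \<Longrightarrow> mult n U x = mult n U y"
  unfolding mult_def by (intro ext sum.cong) auto

lemma cinner_mult:
  assumes "U \<in> umat n"
  shows "cinner n (mult n U x) (mult n U y) = cinner n x y"
proof -
  have "cinner n (mult n U x) (mult n U y) = (\<Sum>i<n. \<Sum>l<n. \<Sum>m<n. x l * cnj (y m) * (U (i, l) * cnj (U (i, m))))"
    unfolding cinner_def mult_def cnj_sum sum_product by (simp add: mult_ac)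
  also have "\<dots> = (\<Sum>l<n. \<Sum>i<n. \<Sum>m<n. x l * cnj (y m) * (U (i, l) * cnj (U (i, m))))"
    by (rule sum.swap)
  also have "\<dots> = (\<Sum>l<n. \<Sum>m<n. \<Sum>i<n. x l * cnj (y m) * (U (i, l) * cnj (U (i, m))))"
    by (rule sum.cong[OF refl], rule sum.swap)
  also have "\<dots> = (\<Sum>l<n. \<Sum>m<n. x l * cnj (y m) * cinner n (\<lambda>i. U (i, l)) (\<lambda>i. U (i, m)))"
    by (simp add: cinner_def sum_distrib_left)
  also have "\<dots> = (\<Sum>l<n. \<Sum>m<n. if l = m then x l * cnj (y l) else 0)"
    using umat_columns[OF assms] by (intro sum.cong refl) (auto simp: orthon_def)
  also have "\<dots> = cinner n x y" by (simp add: cinner_def)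
  finally show ?thesis .
qed

lemma nrm_mult: "U \<in> umat n \<Longrightarrow> nrm n (mult n U x) = nrm n x"
  using cinner_mult[of U n x x] unfolding cinner_self by (simp only: of_real_eq_iff) (simp add: power2_eq_iff_nonneg)

lemma nrm_mv: "U \<in> umat n \<Longrightarrow> nrm n (mv n U x) = nrm n x"
  using nrm_mult[of U n x] nrm_cong[of n "mv n U x" "mult n U x"] by (simp add: mv_def)

lemma mult_add: "mult n U (\<lambda>l. x l + y l) = (\<lambda>i. mult n U x i + mult n U y i)"
  and mult_diff: "mult n U (\<lambda>l. x l - y l) = (\<lambda>i. mult n U x i - mult n U y i)"
  by (simp_all add: mult_def sum.distrib[symmetric] sum_subtractf[symmetric] algebra_simps)

lemma mult_scale: "mult n U (\<lambda>l. x l * c) = (\<lambda>i. mult n U x i * c)"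
  by (simp add: mult_def sum_distrib_left mult_ac)

lemma mult_sum: "mult n U (\<lambda>l. \<Sum>p\<in>I. x p l) = (\<lambda>i. \<Sum>p\<in>I. mult n U (x p) i)"
  unfolding mult_def sum_distrib_left by (rule ext) (rule sum.swap)

lemma mv_measurable [measurable]: "mv n U \<in> cn n \<rightarrow>\<^sub>M cn n"
  unfolding mv_def mult_def by measurable

lemma mv_space: "mv n U x \<in> space (cn n)"
  by (simp add: mv_def space_cn)

text \<open>Both \<open>\<lambda>\<close> and its image under a unitary are translation invariant and agree on the unit ball,
  so a Tonelli argument identifies them.\<close>

lemma cn_unitary_invariant:
  assumes U: "U \<in> umat n" and A [measurable]: "A \<in> sets (cn n)"
  shows "emeasure (cn n) {y \<in> space (cn n). mv n U y \<in> A} = emeasure (cn n) A"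
proof -
  interpret pair_sigma_finite "cn n" "cn n" ..
  let ?V = "adj n U"
  have V: "?V \<in> umat n" using U by (rule adj_umat)
  define va where "va x y = (\<lambda>l\<in>{..<n}. x l + y l)" for x y :: "nat \<Rightarrow> complex"
  define B where "B = {x \<in> space (cn n). nrm n x \<le> 1}"
  have va_m [measurable (raw)]: "(\<lambda>z. va (f z) (g z)) \<in> M \<rightarrow>\<^sub>M cn n" if "f \<in> M \<rightarrow>\<^sub>M cn n" "g \<in> M \<rightarrow>\<^sub>M cn n" for f g and M :: "'z measure"
    unfolding va_def using that by measurable
  have B [measurable]: "B \<in> sets (cn n)" unfolding B_def by measurable
  have b: "emeasure (cn n) B = ennreal (vball n)"
    using emeasure_ball[of 1 n "\<lambda>_. 0"] by (simp add: B_def)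
  \<comment> \<open>Integrating over \<open>y\<close> first gives the measure of \<open>A\<close>
    times the volume of the unit ball, because \<open>x + U y\<close> has the norm of
    \<open>adj U x + y\<close>. Integrating over \<open>x\<close> first and translating by
    \<open>- U y\<close> leads to the measure of the preimage of \<open>A\<close> times the same
    volume.\<close>
  define h where "h x y = (indicator A x * indicator B (va x (mv n U y)) :: ennreal)" for x y
  have h: "(\<lambda>(x, y). h x y) \<in> borel_measurable (cn n \<Otimes>\<^sub>M cn n)"
    unfolding h_def split_def by measurable
  have one: "(\<integral>\<^sup>+y. h x y \<partial>cn n) = indicator A x * ennreal (vball n)" if x: "x \<in> space (cn n)" for x
  proof -
    have "indicator B (va x (mv n U y)) = (indicator B (va (mv n ?V x) y) :: ennreal)" if y: "y \<in> space (cn n)" for y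
    proof -
      have "nrm n (va x (mv n U y)) = nrm n (mult n U (va (mv n ?V x) y))"
      proof (rule nrm_cong)
        fix l assume l: "l < n"
        have "mult n U (va (mv n ?V x) y) l = mult n U (\<lambda>l. mult n ?V x l + y l) l"
          by (rule fun_cong[OF mult_cong]) (simp add: va_def mv_def)
        also have "\<dots> = x l + mult n U y l" using l by (simp add: mult_add adj_mult[OF U])
        finally show "va x (mv n U y) l = mult n U (va (mv n ?V x) y) l" using l by (simp add: va_def mv_def)
      qed
      then show ?thesis by (simp add: nrm_mult[OF U] B_def indicator_def va_def space_cn)
    qed
    then have "(\<integral>\<^sup>+y. h x y \<partial>cn n) = (\<integral>\<^sup>+y. indicator A x * indicator B (va (mv n ?V x) y) \<partial>cn n)"
      unfolding h_def by (intro nn_integral_cong) simp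
    also have "\<dots> = indicator A x * (\<integral>\<^sup>+y. indicator B (va (mv n ?V x) y) \<partial>cn n)"
      using mv_space[of n ?V x] by (intro nn_integral_cmult) measurable
    also have "(\<integral>\<^sup>+y. indicator B (va (mv n ?V x) y) \<partial>cn n) = (\<integral>\<^sup>+y. indicator B y \<partial>cn n)"
      unfolding va_def by (rule cn_translate) measurable
    finally show ?thesis using b by simp
  qed
  have two: "(\<integral>\<^sup>+x. h x y \<partial>cn n) = (\<integral>\<^sup>+x. indicator A (va x (\<lambda>l. - mv n U y l)) * indicator B x \<partial>cn n)" if y: "y \<in> space (cn n)" for y
  proof -
    have hm: "(\<lambda>x. h x y) \<in> borel_measurable (cn n)" using measurable_Pair1[OF h y] by simp
    have "(\<integral>\<^sup>+x. h x y \<partial>cn n) = (\<integral>\<^sup>+x. h (\<lambda>l\<in>{..<n}. - mv n U y l + x l) y \<partial>cn n)"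
      using hm by (rule cn_translate[symmetric])
    also have "\<dots> = (\<integral>\<^sup>+x. indicator A (va x (\<lambda>l. - mv n U y l)) * indicator B x \<partial>cn n)"
    proof (rule nn_integral_cong)
      fix x assume x: "x \<in> space (cn n)"
      have "va (\<lambda>l\<in>{..<n}. - mv n U y l + x l) (mv n U y) = x"
        using x by (auto simp: va_def space_cn fun_eq_iff PiE_iff extensional_def)
      moreover have "(\<lambda>l\<in>{..<n}. - mv n U y l + x l) = va x (\<lambda>l. - mv n U y l)" by (auto simp: va_def)
      ultimately show "h (\<lambda>l\<in>{..<n}. - mv n U y l + x l) y = indicator A (va x (\<lambda>l. - mv n U y l)) * indicator B x"
        by (simp add: h_def)
    qed
    finally show ?thesis .
  qed
  let ?k = "\<lambda>x y. indicator A (va x (\<lambda>l. - mv n U y l)) * indicator B x :: ennreal"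
  have vm: "(\<lambda>z. va (fst z) (\<lambda>l. - mv n U (snd z) l)) \<in> cn n \<Otimes>\<^sub>M cn n \<rightarrow>\<^sub>M cn n"
    unfolding va_def by measurable
  have k: "(\<lambda>(x, y). ?k x y) \<in> borel_measurable (cn n \<Otimes>\<^sub>M cn n)"
    using vm by (simp add: split_def) measurable
  let ?a = "emeasure (cn n) {y \<in> space (cn n). mv n U y \<in> A}"
  have three: "(\<integral>\<^sup>+y. ?k x y \<partial>cn n) = ?a * indicator B x" if x: "x \<in> space (cn n)" for x
  proof -
    have im: "(\<lambda>y. indicator A (va x (\<lambda>l. - mv n U y l)) :: ennreal) \<in> borel_measurable (cn n)"
    proof -
      have "(\<lambda>y. va x (\<lambda>l. - mv n U y l)) \<in> cn n \<rightarrow>\<^sub>M cn n" using measurable_Pair2[OF vm x] by simp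
      then show ?thesis by measurable
    qed
    have "(\<integral>\<^sup>+y. ?k x y \<partial>cn n) = (\<integral>\<^sup>+y. indicator A (va x (\<lambda>l. - mv n U y l)) \<partial>cn n) * indicator B x"
      using im by (rule nn_integral_multc)
    \<comment> \<open>Substituting \<open>adj U x - y\<close> for \<open>y\<close>, a reflection
      followed by a translation, turns \<open>x - U y\<close> into \<open>U y\<close>.\<close>
    also have "(\<integral>\<^sup>+y. indicator A (va x (\<lambda>l. - mv n U y l)) \<partial>cn n)
       = (\<integral>\<^sup>+y. indicator A (va x (\<lambda>l. - mv n U (\<lambda>l\<in>{..<n}. mv n ?V x l + complex_of_real (-1) * y l) l)) \<partial>cn n)"
      using cn_affine[OF im, of "-1" "mv n ?V x"] by simp
    also have "\<dots> = (\<integral>\<^sup>+y. indicator {y \<in> space (cn n). mv n U y \<in> A} y \<partial>cn n)"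
    proof (rule nn_integral_cong)
      fix y assume y: "y \<in> space (cn n)"
      have "mv n U (\<lambda>l\<in>{..<n}. mv n ?V x l + complex_of_real (-1) * y l) l = x l - mult n U y l" if l: "l < n" for l
      proof -
        have "mult n U (\<lambda>l\<in>{..<n}. mv n ?V x l + complex_of_real (-1) * y l) l = mult n U (\<lambda>l. mult n ?V x l - y l) l"
          by (rule fun_cong[OF mult_cong]) (simp add: mv_def)
        also have "\<dots> = x l - mult n U y l" using l by (simp add: mult_diff adj_mult[OF U])
        finally show ?thesis using l by (simp add: mv_def)
      qed
      then have "va x (\<lambda>l. - mv n U (\<lambda>l\<in>{..<n}. mv n ?V x l + complex_of_real (-1) * y l) l) = mv n U y"
        by (auto simp: va_def mv_def[of n U y])
      then show "indicator A (va x (\<lambda>l. - mv n U (\<lambda>l\<in>{..<n}. mv n ?V x l + complex_of_real (-1) * y l) l))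
        = (indicator {y \<in> space (cn n). mv n U y \<in> A} y :: ennreal)" using y by (simp add: indicator_def)
    qed
    also have "\<dots> = ?a" by (intro nn_integral_indicator) measurable
    finally show ?thesis .
  qed
  have "emeasure (cn n) A * ennreal (vball n) = (\<integral>\<^sup>+x. indicator A x * ennreal (vball n) \<partial>cn n)"
    by (simp add: nn_integral_multc)
  also have "\<dots> = (\<integral>\<^sup>+x. \<integral>\<^sup>+y. h x y \<partial>cn n \<partial>cn n)" by (intro nn_integral_cong) (simp add: one)
  also have "\<dots> = (\<integral>\<^sup>+y. \<integral>\<^sup>+x. h x y \<partial>cn n \<partial>cn n)" using h by (rule Fubini'[symmetric])
  also have "\<dots> = (\<integral>\<^sup>+y. \<integral>\<^sup>+x. ?k x y \<partial>cn n \<partial>cn n)" by (intro nn_integral_cong two)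
  also have "\<dots> = (\<integral>\<^sup>+x. \<integral>\<^sup>+y. ?k x y \<partial>cn n \<partial>cn n)" using k by (rule Fubini')
  also have "\<dots> = (\<integral>\<^sup>+x. ?a * indicator B x \<partial>cn n)" by (intro nn_integral_cong three)
  also have "\<dots> = ?a * ennreal (vball n)" by (simp add: nn_integral_cmult b)
  finally have "ennreal (vball n) * emeasure (cn n) A = ennreal (vball n) * ?a" by (simp only: mult.commute)
  then show ?thesis using vball_pos[of n] by (auto simp: ennreal_mult_cancel_left)
qed

subsection \<open>Haar measure on the unitary group\<close>

definition hs :: "nat \<Rightarrow> (nat \<times> nat \<Rightarrow> complex) measure" where
  "hs n = restrict_space (mat_meas n) (umat n)"

lemma umat_subset: "umat n \<subseteq> space (mat_meas n)"
  by (auto simp: umat_def mat_meas_def space_PiM)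

lemma space_hs: "space (hs n) = umat n"
  using umat_subset[of n] by (auto simp: hs_def space_restrict_space)

lemma hs_entry [measurable (raw)]:
  assumes "f \<in> M \<rightarrow>\<^sub>M hs n" "i < n" "j < n"
  shows "(\<lambda>x. f x (i, j)) \<in> borel_measurable M"
proof -
  have "(\<lambda>A. A (i, j)) \<in> borel_measurable (mat_meas n)"
    unfolding mat_meas_def using assms by (intro measurable_component_singleton) auto
  then have "(\<lambda>A. A (i, j)) \<in> borel_measurable (hs n)"
    unfolding hs_def by (rule measurable_restrict_space1)
  from measurable_compose[OF assms(1) this] show ?thesis .
qed

lemma measurable_into_hs:
  assumes "\<And>x. x \<in> space M \<Longrightarrow> f x \<in> umat n" "\<And>i j. i < n \<Longrightarrow> j < n \<Longrightarrow> (\<lambda>x. f x (i, j)) \<in> borel_measurable M"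
  shows "f \<in> M \<rightarrow>\<^sub>M hs n"
  unfolding hs_def
proof (rule measurable_restrict_space2)
  show "f \<in> space M \<rightarrow> umat n" using assms(1) by auto
  have "(\<lambda>x. restrict (f x) ({..<n} \<times> {..<n})) \<in> M \<rightarrow>\<^sub>M mat_meas n"
    unfolding mat_meas_def by (intro measurable_restrict) (use assms(2) in auto)
  moreover have eq: "restrict (f x) ({..<n} \<times> {..<n}) = f x" if "x \<in> space M" for x
    using assms(1)[OF that] by (intro PiE_restrict[of _ _ "\<lambda>_. UNIV"]) (simp add: umat_def)
  ultimately show "f \<in> M \<rightarrow>\<^sub>M mat_meas n" 
    using measurable_cong[of M "\<lambda>x. restrict (f x) ({..<n} \<times> {..<n})" f "mat_meas n", OF eq] by blast
qed

lemma mmul_entry: "i < n \<Longrightarrow> j < n \<Longrightarrow> mmul n A B (i, j) = mult n A (\<lambda>l. B (l, j)) i"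
  by (simp add: mmul_def mult_def)

lemma mmul_umat:
  assumes "A \<in> umat n" "B \<in> umat n" shows "mmul n A B \<in> umat n"
proof -
  have "cinner n (\<lambda>l. mmul n A B (l, i)) (\<lambda>l. mmul n A B (l, j)) = (if i = j then 1 else 0)" if "i < n" "j < n" for i j
  proof -
    have "cinner n (\<lambda>l. mmul n A B (l, i)) (\<lambda>l. mmul n A B (l, j))
       = cinner n (mult n A (\<lambda>l. B (l, i))) (mult n A (\<lambda>l. B (l, j)))"
      using that by (intro cinner_cong) (auto simp: mmul_entry)
    then show ?thesis using umat_columns[OF assms(2)] that by (simp add: cinner_mult[OF assms(1)] orthon_def)
  qed
  then show ?thesis by (auto simp: umat_iff orthon_def mmul_def)
qed

lemma umat_ext:
  assumes "A \<in> umat n" "B \<in> umat n" "\<And>i j. i < n \<Longrightarrow> j < n \<Longrightarrow> A (i, j) = B (i, j)"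
  shows "A = B"
  using assms(1,2) unfolding umat_def
  by (intro PiE_ext[where k = "{..<n} \<times> {..<n}"]) (use assms(3) in auto)

lemma mmul_adj:
  assumes "A \<in> umat n" "B \<in> umat n"
  shows "mmul n (adj n B) (mmul n B A) = A" "mmul n B (mmul n (adj n B) A) = A"
proof -
  have "mmul n (adj n B) (mmul n B A) (i, j) = A (i, j) \<and> mmul n B (mmul n (adj n B) A) (i, j) = A (i, j)" if "i < n" "j < n" for i j
  proof -
    have "mmul n (adj n B) (mmul n B A) (i, j) = mult n (adj n B) (mult n B (\<lambda>l. A (l, j))) i"
      using that by (simp add: mmul_entry) (rule fun_cong[OF mult_cong], simp add: mmul_entry)
    moreover have "mmul n B (mmul n (adj n B) A) (i, j) = mult n B (mult n (adj n B) (\<lambda>l. A (l, j))) i"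
      using that by (simp add: mmul_entry) (rule fun_cong[OF mult_cong], simp add: mmul_entry)
    ultimately show ?thesis using adj_mult[OF assms(2) that(1)] by simp
  qed
  then show "mmul n (adj n B) (mmul n B A) = A" "mmul n B (mmul n (adj n B) A) = A"
    using assms by (auto intro!: umat_ext[of _ n] mmul_umat adj_umat)
qed

lemma adj_adj: "B \<in> umat n \<Longrightarrow> adj n (adj n B) = B"
  by (rule umat_ext[of _ n]) (intro adj_umat, assumption, assumption, simp add: adj_def)

lemma adj_mmul_adj: "A \<in> umat n \<Longrightarrow> B \<in> umat n \<Longrightarrow> adj n (mmul n (adj n B) A) = mmul n (adj n A) B"
proof (rule umat_ext[of _ n])
  fix i j assume "A \<in> umat n" "B \<in> umat n" "i < n" "j < n"
  then show "adj n (mmul n (adj n B) A) (i, j) = mmul n (adj n A) B (i, j)"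
    by (auto simp: adj_def mmul_def intro!: sum.cong)
qed (auto intro!: adj_umat mmul_umat)

text \<open>Stated with preimages, which suit measurability and integrals, while \<open>haar\<close>
  uses images. \<open>linvariant_iff\<close> passes between the two by replacing \<open>B\<close>
  with its adjoint.\<close>

definition linvariant :: "nat \<Rightarrow> (nat \<times> nat \<Rightarrow> complex) measure \<Rightarrow> bool" where
  "linvariant n M \<longleftrightarrow> sets M = sets (hs n) \<and> prob_space M \<and>
      (\<forall>B\<in>umat n. \<forall>X\<in>sets M. emeasure M {A \<in> space M. mmul n B A \<in> X} = emeasure M X)"

lemma mmul_image:
  assumes "B \<in> umat n" "X \<subseteq> umat n"
  shows "mmul n B ` X = {A \<in> umat n. mmul n (adj n B) A \<in> X}"
proof (intro set_eqI iffI)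
  fix A assume "A \<in> {A \<in> umat n. mmul n (adj n B) A \<in> X}"
  then show "A \<in> mmul n B ` X" using assms by (intro rev_image_eqI[of "mmul n (adj n B) A"]) (auto simp: mmul_adj)
qed (use assms in \<open>auto simp: mmul_adj subset_eq intro: mmul_umat\<close>)

lemma linvariant_iff:
  "linvariant n M \<longleftrightarrow> sets M = sets (restrict_space (mat_meas n) (umat n)) \<and> prob_space M \<and>
      (\<forall>B\<in>umat n. \<forall>X\<in>sets M. emeasure M (mmul n B ` X) = emeasure M X)"
proof (cases "sets M = sets (hs n)")
  case True
  then have sp: "space M = umat n" using sets_eq_imp_space_eq space_hs by metis
  have X: "X \<subseteq> umat n" if "X \<in> sets M" for X using sets.sets_into_space[OF that] sp by simp
  have adj_all: "(\<forall>B\<in>umat n. P B) \<longleftrightarrow> (\<forall>B\<in>umat n. P (adj n B))" for P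
    by (metis adj_umat adj_adj)
  have "(\<forall>B\<in>umat n. \<forall>X\<in>sets M. emeasure M {A \<in> space M. mmul n B A \<in> X} = emeasure M X)
    \<longleftrightarrow> (\<forall>B\<in>umat n. \<forall>X\<in>sets M. emeasure M {A \<in> umat n. mmul n (adj n B) A \<in> X} = emeasure M X)"
    unfolding sp by (rule adj_all)
  also have "\<dots> \<longleftrightarrow> (\<forall>B\<in>umat n. \<forall>X\<in>sets M. emeasure M (mmul n B ` X) = emeasure M X)"
    using X by (simp add: mmul_image)
  finally show ?thesis by (simp add: linvariant_def hs_def)
qed (simp add: linvariant_def hs_def)

section \<open>Uniqueness of Haar measure\<close>

text \<open>Integrate the indicator of \<open>adj B A\<close> being in \<open>X\<close> in both
  orders. Over \<open>A\<close> first, invariance of \<open>M\<close> removes \<open>B\<close>; over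
  \<open>B\<close> first, \<open>adj B A\<close> is the adjoint of \<open>adj A B\<close>, and
  invariance of \<open>N\<close> removes \<open>A\<close>.\<close>

lemma linvariant_unique_adj:
  assumes M: "linvariant n M" and N: "linvariant n N" and X: "X \<in> sets (hs n)"
  shows "emeasure M X = emeasure N {A \<in> umat n. adj n A \<in> X}"
proof -
  interpret M: prob_space M using M by (simp add: linvariant_def)
  interpret N: prob_space N using N by (simp add: linvariant_def)
  interpret pair_sigma_finite N M ..
  have sM [measurable_cong]: "sets M = sets (hs n)" and sN [measurable_cong]: "sets N = sets (hs n)"
    using M N by (auto simp: linvariant_def)
  have spM: "space M = umat n" and spN: "space N = umat n"
    using sM sN sets_eq_imp_space_eq space_hs by metis+
  define h where "h B A = (indicator X (mmul n (adj n B) A) :: ennreal)" for B A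
  have mm: "(\<lambda>(B, A). mmul n (adj n B) A) \<in> N \<Otimes>\<^sub>M M \<rightarrow>\<^sub>M hs n"
  proof (rule measurable_into_hs)
    fix i j assume ij: "i < n" "j < n"
    have eq: "mmul n (adj n B) A (i, j) = (\<Sum>l<n. cnj (B (l, i)) * A (l, j))" for A B
      using ij by (simp add: mmul_def adj_def)
    have "(\<lambda>x. \<Sum>l<n. cnj (fst x (l, i)) * snd x (l, j)) \<in> borel_measurable (N \<Otimes>\<^sub>M M)"
      using ij by measurable
    then show "(\<lambda>x. (case x of (B, A) \<Rightarrow> mmul n (adj n B) A) (i, j)) \<in> borel_measurable (N \<Otimes>\<^sub>M M)"
      by (simp add: split_def eq)
  qed (auto simp: space_pair_measure spM spN intro!: mmul_umat adj_umat)
  have h: "(\<lambda>(B, A). h B A) \<in> borel_measurable (N \<Otimes>\<^sub>M M)"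
    using measurable_compose[OF mm borel_measurable_indicator[OF X]] by (simp add: h_def split_def)
  have 1: "(\<integral>\<^sup>+A. h B A \<partial>M) = emeasure M X" if B: "B \<in> space N" for B
  proof -
    have BM: "(\<lambda>A. mmul n (adj n B) A) \<in> M \<rightarrow>\<^sub>M hs n" using measurable_Pair2[OF mm B] by simp
    have "(\<integral>\<^sup>+A. h B A \<partial>M) = (\<integral>\<^sup>+A. indicator {A \<in> space M. mmul n (adj n B) A \<in> X} A \<partial>M)"
      by (intro nn_integral_cong) (simp add: h_def indicator_def)
    also have "\<dots> = emeasure M {A \<in> space M. mmul n (adj n B) A \<in> X}"
      using measurable_sets[OF BM X] by (intro nn_integral_indicator) (simp add: vimage_def Int_def conj_commute)
    also have "\<dots> = emeasure M X" using M adj_umat B X sM unfolding linvariant_def spN by blast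
    finally show ?thesis .
  qed
  let ?Y = "{A \<in> umat n. adj n A \<in> X}"
  have Y: "?Y \<in> sets (hs n)"
  proof -
    have "adj n \<in> hs n \<rightarrow>\<^sub>M hs n"
      by (rule measurable_into_hs) (auto simp: space_hs adj_def intro: adj_umat[unfolded adj_def])
    from measurable_sets[OF this X] show ?thesis by (simp add: vimage_def Int_def space_hs conj_commute)
  qed
  have 2: "(\<integral>\<^sup>+B. h B A \<partial>N) = emeasure N ?Y" if A: "A \<in> space M" for A
  proof -
    have "(\<integral>\<^sup>+B. h B A \<partial>N) = (\<integral>\<^sup>+B. indicator {B \<in> space N. mmul n (adj n A) B \<in> ?Y} B \<partial>N)"
    proof (rule nn_integral_cong)
      fix B assume B: "B \<in> space N"
      have u: "A \<in> umat n" "B \<in> umat n" using A B spM spN by auto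
      have "adj n (mmul n (adj n A) B) = mmul n (adj n B) A" using u by (intro adj_mmul_adj)
      then show "h B A = indicator {B \<in> space N. mmul n (adj n A) B \<in> ?Y} B"
        using u B by (auto simp: h_def indicator_def mmul_umat adj_umat)
    qed
    also have "\<dots> = emeasure N {B \<in> space N. mmul n (adj n A) B \<in> ?Y}"
    proof (intro nn_integral_indicator)
      have "(\<lambda>B. mmul n (adj n A) B) \<in> N \<rightarrow>\<^sub>M hs n"
      proof (rule measurable_into_hs)
        fix i j assume ij: "i < n" "j < n"
        have eq: "mmul n (adj n A) B (i, j) = (\<Sum>l<n. cnj (A (l, i)) * B (l, j))" for B
          using ij by (simp add: mmul_def adj_def)
        show "(\<lambda>B. mmul n (adj n A) B (i, j)) \<in> borel_measurable N"
          unfolding eq using ij by measurable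
      qed (use A spM spN in \<open>auto intro!: mmul_umat adj_umat\<close>)
      from measurable_sets[OF this Y] show "{B \<in> space N. mmul n (adj n A) B \<in> ?Y} \<in> sets N"
        by (simp add: vimage_def Int_def conj_commute)
    qed
    also have "\<dots> = emeasure N ?Y" using N adj_umat A Y sN unfolding linvariant_def spM by blast
    finally show ?thesis .
  qed
  have "emeasure M X = (\<integral>\<^sup>+B. emeasure M X \<partial>N)" by (simp add: N.emeasure_space_1)
  also have "\<dots> = (\<integral>\<^sup>+B. \<integral>\<^sup>+A. h B A \<partial>M \<partial>N)" by (intro nn_integral_cong) (simp add: 1)
  also have "\<dots> = (\<integral>\<^sup>+A. \<integral>\<^sup>+B. h B A \<partial>N \<partial>M)" using h by (rule Fubini'[symmetric])
  also have "\<dots> = (\<integral>\<^sup>+A. emeasure N ?Y \<partial>M)" by (intro nn_integral_cong 2)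
  also have "\<dots> = emeasure N ?Y" by (simp add: M.emeasure_space_1)
  finally show ?thesis .
qed

text \<open>Both measures of \<open>X\<close> equal the \<open>N\<close>-measure of the set of
  adjoints, by the preceding lemma for the pairs \<open>M, N\<close> and
  \<open>N, N\<close>.\<close>

lemma linvariant_unique:
  assumes "linvariant n M" "linvariant n N" shows "M = N"
  using assms linvariant_unique_adj[OF assms] linvariant_unique_adj[OF assms(2) assms(2)]
  by (intro measure_eqI) (auto simp: linvariant_def)

section \<open>Existence of Haar measure by Gram-Schmidt\<close>

text \<open>Gram-Schmidt by recursion on the column. The test \<open>i < j\<close> makes the
  recursive calls visibly decreasing; \<open>gs_eq\<close> removes it.\<close>

function gs :: "nat \<Rightarrow> (nat \<Rightarrow> nat \<Rightarrow> complex) \<Rightarrow> nat \<Rightarrow> nat \<Rightarrow> complex" where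
  "gs n Y j = normalize_vec n (resid n {..<j} (\<lambda>i. if i < j then gs n Y i else (\<lambda>_. 0)) (Y j))"
  by auto
termination by (relation "Wellfounded.measure (\<lambda>(n, Y, j). j)") auto

declare gs.simps [simp del]

lemma resid_cong: "(\<And>j. j \<in> J \<Longrightarrow> q j = q' j) \<Longrightarrow> resid n J q x = resid n J q' x"
  unfolding resid_def by (intro ext arg_cong2[where f = minus] refl sum.cong) auto

lemma gs_eq: "gs n Y j = normalize_vec n (resid n {..<j} (gs n Y) (Y j))"
  by (subst gs.simps) (auto intro!: arg_cong[where f = "normalize_vec n"] resid_cong)

lemma gs_cong: "(\<And>i. i \<le> j \<Longrightarrow> Y i = Y' i) \<Longrightarrow> gs n Y j = gs n Y' j"
proof (induction j rule: less_induct)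
  case (less j)
  have "resid n {..<j} (gs n Y) (Y j) = resid n {..<j} (gs n Y') (Y' j)"
    using less by (auto intro!: resid_cong)
  then show ?case by (simp add: gs_eq[of n Y j] gs_eq[of n Y' j])
qed

lemma gs_measurable:
  "j < n \<Longrightarrow> l < n \<Longrightarrow> (\<lambda>Y. gs n Y j l) \<in> borel_measurable (tn {..<n} n)"
proof (induction j arbitrary: l rule: less_induct)
  case (less j)
  have r: "(\<lambda>Y. resid n {..<j} (gs n Y) (Y j) l) \<in> borel_measurable (tn {..<n} n)" if "l < n" for l
    unfolding resid_def using less that
    by (intro borel_measurable_diff borel_measurable_sum borel_measurable_times cinner_measurable) auto
  show ?case
    unfolding gs_eq[of n _ j] normalize_vec_def using r less.prems
    by (intro borel_measurable_times borel_measurable_divide borel_measurable_const borel_measurable_of_real nrm_measurable) auto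
qed

text \<open>Gram-Schmidt uses only inner products and linear combinations, which unitaries respect.
  Rotation-invariant independent columns therefore produce a left-invariant random unitary.\<close>

lemma gs_equivariant:
  assumes U: "U \<in> umat n"
  shows "j < n \<Longrightarrow> l < n \<Longrightarrow> gs n (\<lambda>j\<in>{..<n}. mv n U (Y j)) j l = mult n U (gs n Y j) l"
proof (induction j arbitrary: l rule: less_induct)
  case (less j)
  let ?Y = "\<lambda>j\<in>{..<n}. mv n U (Y j)"
  have r: "resid n {..<j} (gs n ?Y) (?Y j) l = mult n U (resid n {..<j} (gs n Y) (Y j)) l" if l: "l < n" for l
  proof -
    have c: "cinner n (?Y j) (gs n ?Y i) = cinner n (Y j) (gs n Y i)" if "i < j" for i
    proof -
      have "cinner n (?Y j) (gs n ?Y i) = cinner n (mult n U (Y j)) (mult n U (gs n Y i))"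
      proof (rule cinner_cong)
        show "?Y j l = mult n U (Y j) l" if "l < n" for l using that less.prems by (simp add: mv_def)
        show "gs n ?Y i l = mult n U (gs n Y i) l" if "l < n" for l
          using \<open>i < j\<close> that less.prems by (intro less.IH) auto
      qed
      then show ?thesis using cinner_mult[OF U] by simp
    qed
    have "resid n {..<j} (gs n ?Y) (?Y j) l = mult n U (Y j) l - (\<Sum>i<j. mult n U (gs n Y i) l * cinner n (Y j) (gs n Y i))"
    proof -
      have "(\<Sum>i<j. gs n ?Y i l * cinner n (?Y j) (gs n ?Y i)) = (\<Sum>i<j. mult n U (gs n Y i) l * cinner n (Y j) (gs n Y i))"
        using l less.prems by (intro sum.cong refl) (simp only: c less.IH lessThan_iff)
      moreover have "?Y j l = mult n U (Y j) l" using l less.prems by (simp add: mv_def)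
      ultimately show ?thesis by (simp only: resid_def)
    qed
    also have "\<dots> = mult n U (resid n {..<j} (gs n Y) (Y j)) l"
      by (simp add: resid_def mult_diff mult_sum mult_scale)
    finally show ?thesis .
  qed
  have "nrm n (resid n {..<j} (gs n ?Y) (?Y j)) = nrm n (mult n U (resid n {..<j} (gs n Y) (Y j)))"
    by (intro nrm_cong r)
  then have nr: "nrm n (resid n {..<j} (gs n ?Y) (?Y j)) = nrm n (resid n {..<j} (gs n Y) (Y j))"
    by (simp only: nrm_mult[OF U])
  show ?case
    by (simp only: gs_eq[of n ?Y j] gs_eq[of n Y j] normalize_vec_def nr r[OF less.prems(2)] mult_scale)
qed

text \<open>The law of one column fed to Gram-Schmidt: invariant under rotations and absolutely
  continuous, so that hyperplanes are null.\<close>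

definition bunif :: "nat \<Rightarrow> (nat \<Rightarrow> complex) measure" where
  "bunif n = uniform_measure (cn n) {x \<in> space (cn n). nrm n x \<le> 1}"

lemma unit_ball: "{x \<in> space (cn n). nrm n x \<le> 1} \<in> sets (cn n)"
  "emeasure (cn n) {x \<in> space (cn n). nrm n x \<le> 1} = ennreal (vball n)"
  using emeasure_ball[of 1 n "\<lambda>_. 0"] ball_sets[of n "\<lambda>_. 0" 1] by auto

lemma sets_bunif [measurable_cong]: "sets (bunif n) = sets (cn n)"
  by (simp add: bunif_def)

lemma prob_space_bunif: "prob_space (bunif n)"
  unfolding bunif_def by (rule prob_space_uniform_measure) (simp_all add: unit_ball ennreal_eq_0_iff not_le)

interpretation bunif: prob_space "bunif n" for n
  by (rule prob_space_bunif)

interpretation bprod: product_prob_space "\<lambda>_. bunif n" UNIV for n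
  by standard

lemma bunif_invariant:
  assumes U: "U \<in> umat n" and A: "A \<in> sets (bunif n)"
  shows "emeasure (bunif n) (mv n U -` A \<inter> space (bunif n)) = emeasure (bunif n) A"
proof -
  let ?B = "{x \<in> space (cn n). nrm n x \<le> 1}"
  have A': "A \<in> sets (cn n)" using A by (simp add: sets_bunif)
  have pre: "mv n U -` A \<inter> space (cn n) \<in> sets (cn n)" by (rule measurable_sets[OF mv_measurable A'])
  have "?B \<inter> (mv n U -` A \<inter> space (cn n)) = {y \<in> space (cn n). mv n U y \<in> ?B \<inter> A}"
    using mv_space by (auto simp: nrm_mv[OF U])
  then have "emeasure (cn n) (?B \<inter> (mv n U -` A \<inter> space (cn n))) = emeasure (cn n) (?B \<inter> A)"
    using cn_unitary_invariant[OF U, of "?B \<inter> A"] A' unit_ball by auto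
  then show ?thesis using A' pre unit_ball by (simp add: bunif_def)
qed

lemma bunif_null:
  assumes "A \<in> sets (cn n)" "emeasure (cn n) A = 0" shows "emeasure (bunif n) A = 0"
proof -
  have "emeasure (cn n) ({x \<in> space (cn n). nrm n x \<le> 1} \<inter> A) \<le> emeasure (cn n) A"
    using assms by (intro emeasure_mono) auto
  then show ?thesis using assms unit_ball by (simp add: bunif_def)
qed

abbreviation bcols :: "nat \<Rightarrow> (nat \<Rightarrow> nat \<Rightarrow> complex) measure" where
  "bcols n \<equiv> PiM {..<n} (\<lambda>_. bunif n)"

lemma sets_bcols [measurable_cong]: "sets (bcols n) = sets (tn {..<n} n)"
  unfolding tn_def by (intro sets_PiM_cong) (auto simp: sets_bunif)

lemma space_bcols: "space (bcols n) = space (tn {..<n} n)"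
  by (rule sets_eq_imp_space_eq[OF sets_bcols])

text \<open>Once the earlier columns are orthonormal, the residual of the next one vanishes only on
  their span. This lies in a hyperplane, a null set for the fresh column.\<close>

lemma gs_step_AE:
  assumes j: "j < n"
  shows "AE Y in bcols n. \<not> (orthon n {..<j} (gs n Y) \<and> nrm n (resid n {..<j} (gs n Y) (Y j)) = 0)"
proof -
  let ?J = "{..<n} - {j}"
  have S: "{..<n} = insert j ?J" using j by auto
  let ?N = "{Y \<in> space (tn {..<n} n). orthon n {..<j} (gs n Y) \<and> nrm n (resid n {..<j} (gs n Y) (Y j)) = 0}"
  have gm [measurable]: "(\<lambda>Y. gs n Y i l) \<in> borel_measurable (tn {..<n} n)" if "i < j" "l < n" for i l
    using gs_measurable[of i n l] that j by simp
  have N: "?N \<in> sets (tn {..<n} n)"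
  proof -
    have [measurable]: "(\<lambda>Y. cinner n (gs n Y i) (gs n Y k)) \<in> borel_measurable (tn {..<n} n)" if "i < j" "k < j" for i k
      using gm that by (intro cinner_measurable) auto
    have [measurable]: "(\<lambda>Y. nrm n (resid n {..<j} (gs n Y) (Y j))) \<in> borel_measurable (tn {..<n} n)"
      unfolding resid_def using gm j
      by (intro nrm_measurable borel_measurable_diff borel_measurable_sum borel_measurable_times cinner_measurable) auto
    show ?thesis unfolding orthon_def by measurable
  qed
  have N': "(indicator ?N :: _ \<Rightarrow> ennreal) \<in> borel_measurable (PiM (insert j ?J) (\<lambda>_. bunif n))"
    using N sets_bcols[of n] unfolding S[symmetric] by (intro borel_measurable_indicator) simp
  have "emeasure (bcols n) ?N = integral\<^sup>N (PiM (insert j ?J) (\<lambda>_. bunif n)) (indicator ?N)"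
    using N sets_bcols[of n] unfolding S[symmetric] by simp
  also have "\<dots> = (\<integral>\<^sup>+Y. \<integral>\<^sup>+y. indicator ?N (Y(j := y)) \<partial>bunif n \<partial>PiM ?J (\<lambda>_. bunif n))"
    using N' by (intro bprod.product_nn_integral_insert) auto
  also have "\<dots> = (\<integral>\<^sup>+Y. 0 \<partial>PiM ?J (\<lambda>_. bunif n))"
  proof (rule nn_integral_cong)
    fix Y assume Y: "Y \<in> space (PiM ?J (\<lambda>_. bunif n))"
    have g: "gs n (Y(j := y)) i = gs n Y i" if "i < j" for i y
      using that by (intro gs_cong) auto
    have o: "orthon n {..<j} (gs n (Y(j := y))) \<longleftrightarrow> orthon n {..<j} (gs n Y)" for y
      using g by (simp add: orthon_def)
    show "(\<integral>\<^sup>+y. indicator ?N (Y(j := y)) \<partial>bunif n) = 0"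
    proof (cases "orthon n {..<j} (gs n Y)")
      case False
      then have "indicator ?N (Y(j := y)) = (0 :: ennreal)" for y using o by (simp add: indicator_def)
      then show ?thesis by simp
    next
      case True
      obtain l where l: "l < n" "nrm n (resid n {..<j} (gs n Y) (unitv l)) \<noteq> 0"
        using orthon_incomplete[OF _ True] j by auto
      \<comment> \<open>\<open>z\<close> is orthogonal to the earlier columns, hence a normal vector
        of a hyperplane that contains their span; it is nonzero for a suitable \<open>l\<close>
        because \<open>j < n\<close>.\<close>
      define z where "z = resid n {..<j} (gs n Y) (unitv l)"
      obtain l0 where l0: "l0 < n" "z l0 \<noteq> 0" using l unfolding z_def nrm_eq_0 by auto
      let ?H = "{x \<in> space (cn n). cinner n x z = 0}"
      have H: "?H \<in> sets (cn n)" by measurable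
      have sub: "y \<in> ?H" if y: "Y(j := y) \<in> ?N" for y
      proof -
        have "nrm n (resid n {..<j} (gs n Y) y) = 0"
          using y resid_cong[of "{..<j}" "gs n (Y(j := y))" "gs n Y"] g by auto
        then have "y l = (\<Sum>i<j. gs n Y i l * cinner n y (gs n Y i))" if "l < n" for l
          using that by (simp add: nrm_eq_0 resid_def)
        then have "cinner n y z = cinner n (\<lambda>l. \<Sum>i<j. gs n Y i l * cinner n y (gs n Y i)) z"
          by (intro cinner_cong) auto
        also have "\<dots> = 0"
        proof -
          have "cinner n (gs n Y i) z = 0" if "i < j" for i
            using resid_orthogonal[OF _ True, of i "unitv l"] that cinner_commute[of n z "gs n Y i"]
            by (simp add: z_def)
          then show ?thesis by (simp add: cinner_sum_scaled_left)
        qed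
        finally have "cinner n y z = 0" .
        moreover have "y \<in> space (cn n)" using y j by (auto simp: space_tn PiE_iff dest!: bspec[of _ _ j])
        ultimately show ?thesis by simp
      qed
      have "(\<integral>\<^sup>+y. indicator ?N (Y(j := y)) \<partial>bunif n) \<le> (\<integral>\<^sup>+y. indicator ?H y \<partial>bunif n)"
        using sub by (intro nn_integral_mono) (auto simp: indicator_def)
      also have "\<dots> = emeasure (bunif n) ?H" using H by (intro nn_integral_indicator) (simp add: sets_bunif)
      also have "\<dots> = 0" using H emeasure_hyperplane[of l0 n z, OF l0] by (rule bunif_null)
      finally show ?thesis by simp
    qed
  qed
  finally have "emeasure (bcols n) ?N = 0" by simp
  then show ?thesis
    using N sets_bcols[of n] by (intro AE_I[of _ _ ?N]) (auto simp: space_bcols)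
qed

lemma gs_orthon_AE: "AE Y in bcols n. orthon n {..<n} (gs n Y)"
proof -
  have "j \<le> n \<Longrightarrow> AE Y in bcols n. orthon n {..<j} (gs n Y)" for j
  proof (induction j)
    case 0
    then show ?case by (simp add: orthon_def)
  next
    case (Suc j)
    then have "AE Y in bcols n. orthon n {..<j} (gs n Y)" by simp
    moreover have "AE Y in bcols n. \<not> (orthon n {..<j} (gs n Y) \<and> nrm n (resid n {..<j} (gs n Y) (Y j)) = 0)"
      using Suc by (intro gs_step_AE) simp
    ultimately show ?case
    proof eventually_elim
      case (elim Y)
      then show ?case unfolding lessThan_Suc
        by (intro orthon_insert[where q = "gs n Y" and x = "Y j"]) (auto simp: gs_eq[of n Y j])
    qed
  qed
  then show ?thesis by simp
qed

text \<open>The identity on the exceptional null set keeps every value unitary, so the map goes into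
  \<open>hs n\<close> everywhere.\<close>

definition gsmat :: "nat \<Rightarrow> (nat \<Rightarrow> nat \<Rightarrow> complex) \<Rightarrow> nat \<times> nat \<Rightarrow> complex" where
  "gsmat n Y = (if orthon n {..<n} (gs n Y) then restrict (\<lambda>(l, j). gs n Y j l) ({..<n} \<times> {..<n})
     else restrict (\<lambda>(l, j). if l = j then 1 else 0) ({..<n} \<times> {..<n}))"

lemma gsmat_umat: "gsmat n Y \<in> umat n"
proof (cases "orthon n {..<n} (gs n Y)")
  case True
  have "orthon n {..<n} (\<lambda>j l. gsmat n Y (l, j))"
    unfolding orthon_def
  proof (intro ballI)
    fix i j assume "i \<in> {..<n}" "j \<in> {..<n}"
    moreover from this have "cinner n (\<lambda>l. gsmat n Y (l, i)) (\<lambda>l. gsmat n Y (l, j)) = cinner n (gs n Y i) (gs n Y j)"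
      using True by (intro cinner_cong) (auto simp: gsmat_def)
    ultimately show "cinner n (\<lambda>l. gsmat n Y (l, i)) (\<lambda>l. gsmat n Y (l, j)) = (if i = j then 1 else 0)"
      using True by (simp add: orthon_def)
  qed
  then show ?thesis using True by (simp add: umat_iff) (simp add: gsmat_def)
next
  case False
  have "(\<Sum>l<n. cnj (if l = i then 1 else 0) * (if l = j then 1 else 0)) = (if i = j then 1 else (0::complex))" if "i < n" for i j
    using that by (simp add: if_distrib[of cnj] if_distrib[of "\<lambda>x. x * _"] cong: if_cong)
  then show ?thesis using False by (auto simp: umat_def gsmat_def)
qed

lemma gsmat_measurable: "gsmat n \<in> bcols n \<rightarrow>\<^sub>M hs n"
proof (rule measurable_into_hs[OF gsmat_umat])
  fix l j assume lj: "l < n" "j < n"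
  note [measurable] = gs_measurable
  have [measurable]: "(\<lambda>Y. cinner n (gs n Y i) (gs n Y k)) \<in> borel_measurable (tn {..<n} n)" if "i < n" "k < n" for i k
    using gs_measurable that by (intro cinner_measurable) auto
  have 1: "(\<lambda>Y. gsmat n Y (l, j)) = (\<lambda>Y. if orthon n {..<n} (gs n Y) then gs n Y j l else if l = j then 1 else 0)"
    using lj by (auto simp: gsmat_def)
  have "{Y \<in> space (tn {..<n} n). orthon n {..<n} (gs n Y)} \<in> sets (tn {..<n} n)"
    unfolding orthon_def by measurable
  then have "(\<lambda>Y. gsmat n Y (l, j)) \<in> borel_measurable (tn {..<n} n)"
    unfolding 1 using gs_measurable[OF lj(2,1)] by (intro measurable_If) auto
  then show "(\<lambda>Y. gsmat n Y (l, j)) \<in> borel_measurable (bcols n)"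
    using measurable_cong_sets[OF sets_bcols refl] by blast
qed

lemma linvariant_exists: "linvariant n (distr (bcols n) (hs n) (gsmat n))"
proof -
  interpret bc: prob_space "bcols n" by (intro prob_space_PiM prob_space_bunif)
  let ?M = "distr (bcols n) (hs n) (gsmat n)"
  have "emeasure ?M {A \<in> space ?M. mmul n B A \<in> X} = emeasure ?M X" if B: "B \<in> umat n" and X: "X \<in> sets ?M" for B X
  proof -
    have X': "X \<in> sets (hs n)" using X by simp
    let ?T = "\<lambda>Y. \<lambda>j\<in>{..<n}. mv n B (Y j)"
    have Bm: "mmul n B \<in> hs n \<rightarrow>\<^sub>M hs n"
    proof (rule measurable_into_hs)
      fix i j assume ij: "i < n" "j < n"
      have eq: "mmul n B A (i, j) = (\<Sum>l<n. B (i, l) * A (l, j))" for A using ij by (simp add: mmul_def)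
      show "(\<lambda>A. mmul n B A (i, j)) \<in> borel_measurable (hs n)" unfolding eq using ij by measurable
    qed (auto simp: space_hs intro: mmul_umat B)
    have Y: "{A \<in> space ?M. mmul n B A \<in> X} \<in> sets (hs n)"
      using measurable_sets[OF Bm X'] by (simp add: vimage_def Int_def conj_commute)
    then have Y': "{A \<in> space ?M. mmul n B A \<in> X} \<in> sets ?M" by (simp only: sets_distr)
    have "emeasure ?M {A \<in> space ?M. mmul n B A \<in> X} = integral\<^sup>N ?M (indicator {A \<in> space ?M. mmul n B A \<in> X})"
      by (rule nn_integral_indicator[OF Y', symmetric])
    also have "\<dots> = (\<integral>\<^sup>+Y. indicator {A \<in> space ?M. mmul n B A \<in> X} (gsmat n Y) \<partial>bcols n)"
      using Y' gsmat_measurable by (intro nn_integral_distr borel_measurable_indicator) (simp_all only: sets_distr)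
    also have "\<dots> = (\<integral>\<^sup>+Y. indicator X (gsmat n (?T Y)) \<partial>bcols n)"
    proof (rule nn_integral_cong_AE)
      show "AE Y in bcols n. indicator {A \<in> space ?M. mmul n B A \<in> X} (gsmat n Y) = (indicator X (gsmat n (?T Y)) :: ennreal)"
        using gs_orthon_AE
      proof eventually_elim
        case (elim Y)
        have c: "cinner n (gs n (?T Y) i) (gs n (?T Y) j) = cinner n (gs n Y i) (gs n Y j)" if "i < n" "j < n" for i j
        proof -
          have "cinner n (gs n (?T Y) i) (gs n (?T Y) j) = cinner n (mult n B (gs n Y i)) (mult n B (gs n Y j))"
            using that by (intro cinner_cong) (auto simp: gs_equivariant[OF B])
          then show ?thesis using cinner_mult[OF B] by simp
        qed
        have o: "orthon n {..<n} (gs n (?T Y))" using elim c unfolding orthon_def by simp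
        have "gsmat n (?T Y) = mmul n B (gsmat n Y)"
        proof (rule umat_ext[OF gsmat_umat mmul_umat[OF B gsmat_umat]])
          fix i j assume ij: "i < n" "j < n"
          have "mult n B (\<lambda>l. gsmat n Y (l, j)) i = mult n B (gs n Y j) i"
            using elim ij by (intro fun_cong[OF mult_cong]) (simp add: gsmat_def)
          then show "gsmat n (?T Y) (i, j) = mmul n B (gsmat n Y) (i, j)"
            using o ij gs_equivariant[OF B ij(2,1), of Y] by (simp add: mmul_entry) (simp add: gsmat_def)
        qed
        then show ?case using gsmat_umat[of n Y] by (simp add: indicator_def space_hs)
      qed
    qed
    also have "\<dots> = ennreal (\<Prod>j\<in>{..<n}. 1) * (\<integral>\<^sup>+Y. indicator X (gsmat n Y) \<partial>bcols n)"
      using bunif_invariant[OF B] X'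
      by (intro bprod.nn_integral_componentwise[where T = "\<lambda>_. mv n B" and f = "\<lambda>Y. indicator X (gsmat n Y)"])
         (auto intro!: measurable_compose[OF gsmat_measurable] simp: measurable_cong_sets[OF sets_bunif sets_bunif])
    also have "\<dots> = integral\<^sup>N ?M (indicator X)"
      using gsmat_measurable borel_measurable_indicator[OF X'] by (subst nn_integral_distr) simp_all
    also have "\<dots> = emeasure ?M X" using X' by simp
    finally show ?thesis .
  qed
  then show ?thesis
    unfolding linvariant_def using bc.prob_space_distr[OF gsmat_measurable] by auto
qed

lemma haar_linvariant: "linvariant n (haar n)"
  unfolding haar_def linvariant_iff[symmetric]
  by (rule theI[where a = "distr (bcols n) (hs n) (gsmat n)" and P = "linvariant n", OF linvariant_exists])
     (rule linvariant_unique[OF _ linvariant_exists])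

lemma sets_haar [measurable_cong]: "sets (haar n) = sets (hs n)"
  and prob_space_haar: "prob_space (haar n)"
  and haar_invariant: "B \<in> umat n \<Longrightarrow> X \<in> sets (haar n) \<Longrightarrow> emeasure (haar n) {A \<in> space (haar n). mmul n B A \<in> X} = emeasure (haar n) X"
  using haar_linvariant[of n] unfolding linvariant_def by auto

lemma space_haar: "space (haar n) = umat n"
  using sets_eq_imp_space_eq[OF sets_haar] space_hs by metis

subsection \<open>Gram kernels of tuples of vectors\<close>

lemma qf_chol:
  assumes "finite I" "chol I Q R S"
  shows "qf I Q a = complex_of_real (\<Sum>l\<in>I. (cmod (\<Sum>q\<in>I. R l q * a q))\<^sup>2)"
proof -
  have Q: "Q p q = (\<Sum>l\<in>I. cnj (R l p) * R l q)" if "p \<in> I" "q \<in> I" for p q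
    using assms(2) that by (simp add: chol_def)
  have "qf I Q a = (\<Sum>p\<in>I. \<Sum>q\<in>I. \<Sum>l\<in>I. (R l q * a q) * cnj (R l p * a p))"
    unfolding qf_def by (intro sum.cong refl) (simp add: Q sum_distrib_left mult_ac)
  also have "\<dots> = (\<Sum>p\<in>I. \<Sum>l\<in>I. \<Sum>q\<in>I. (R l q * a q) * cnj (R l p * a p))"
    by (rule sum.cong[OF refl], rule sum.swap)
  also have "\<dots> = (\<Sum>l\<in>I. \<Sum>p\<in>I. \<Sum>q\<in>I. (R l q * a q) * cnj (R l p * a p))"
    by (rule sum.swap)
  also have "\<dots> = (\<Sum>l\<in>I. (\<Sum>q\<in>I. R l q * a q) * cnj (\<Sum>q\<in>I. R l q * a q))"
    unfolding cnj_sum sum_product by (rule sum.cong[OF refl], rule sum.swap)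
  also have "\<dots> = complex_of_real (\<Sum>l\<in>I. (cmod (\<Sum>q\<in>I. R l q * a q))\<^sup>2)"
    by (simp only: complex_norm_square of_real_sum)
  finally show ?thesis .
qed

lemma qf_gram: "qf I (gram n X) a = complex_of_real ((nrm n (\<lambda>l. \<Sum>q\<in>I. X q l * a q))\<^sup>2)"
proof -
  have "cinner n (\<lambda>l. \<Sum>q\<in>I. X q l * a q) (\<lambda>l. \<Sum>q\<in>I. X q l * a q) = (\<Sum>q\<in>I. a q * (\<Sum>p\<in>I. cnj (a p) * gram n X p q))"
    unfolding cinner_sum_scaled_left cinner_sum_scaled_right gram_def ..
  also have "\<dots> = (\<Sum>q\<in>I. \<Sum>p\<in>I. cnj (a p) * a q * gram n X p q)"
    by (simp add: sum_distrib_left mult_ac)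
  also have "\<dots> = qf I (gram n X) a" unfolding qf_def by (rule sum.swap)
  finally show ?thesis by (simp add: cinner_self)
qed

lemma psd_gram: "psd I (gram n X)"
  by (simp add: psd_def qf_gram)

lemma sum_cmod_square_le:
  assumes "finite I" shows "(\<Sum>p\<in>I. cmod (a p))\<^sup>2 \<le> real (card I) * (\<Sum>p\<in>I. (cmod (a p))\<^sup>2)"
  using Cauchy_Schwarz_ineq_sum[of "\<lambda>_. 1" "\<lambda>p. cmod (a p)" I] by simp

lemma qf_perturb:
  assumes fin: "finite I" and close: "\<And>p q. p \<in> I \<Longrightarrow> q \<in> I \<Longrightarrow> cmod (Q' p q - Q p q) \<le> \<eta>"
  shows "\<bar>Re (qf I Q' a) - Re (qf I Q a)\<bar> \<le> \<eta> * real (card I) * (\<Sum>p\<in>I. (cmod (a p))\<^sup>2)"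
proof (cases "I = {}")
  case True then show ?thesis by (simp add: qf_def)
next
  case False
  then have \<eta>: "\<eta> \<ge> 0" using close norm_ge_zero by (meson ex_in_conv order_trans)
  have "qf I Q' a - qf I Q a = (\<Sum>p\<in>I. \<Sum>q\<in>I. cnj (a p) * a q * (Q' p q - Q p q))"
    by (simp add: qf_def sum_subtractf[symmetric] algebra_simps)
  then have "cmod (qf I Q' a - qf I Q a) \<le> (\<Sum>p\<in>I. \<Sum>q\<in>I. cmod (cnj (a p) * a q * (Q' p q - Q p q)))"
    by (simp only:) (intro order_trans[OF norm_sum] sum_mono norm_sum)
  also have "\<dots> \<le> (\<Sum>p\<in>I. \<Sum>q\<in>I. cmod (a p) * cmod (a q) * \<eta>)"
    using close by (intro sum_mono) (simp add: norm_mult mult_left_mono)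
  also have "\<dots> = \<eta> * (\<Sum>p\<in>I. cmod (a p))\<^sup>2"
    by (simp add: power2_eq_square sum_product sum_distrib_left mult_ac)
  also have "\<dots> \<le> \<eta> * (real (card I) * (\<Sum>p\<in>I. (cmod (a p))\<^sup>2))"
    using \<eta> sum_cmod_square_le[OF fin] by (intro mult_left_mono)
  finally have "cmod (qf I Q' a - qf I Q a) \<le> \<eta> * real (card I) * (\<Sum>p\<in>I. (cmod (a p))\<^sup>2)" by (simp add: mult_ac)
  moreover have "\<bar>Re (qf I Q' a - qf I Q a)\<bar> \<le> cmod (qf I Q' a - qf I Q a)" by (rule abs_Re_le_cmod)
  ultimately show ?thesis by simp
qed

text \<open>The Schur complement of each added index is the form at a vector with entry 1 there,
  hence positive, so \<open>chol_insert\<close> applies at every step.\<close>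

lemma strictly_pd_chol:
  assumes fin: "finite I" and psd: "psd I Q"
    and strict: "\<And>a. (\<exists>i\<in>I. a i \<noteq> 0) \<Longrightarrow> Re (qf I Q a) > 0"
  shows "\<exists>R S. chol I Q R S"
proof -
  have "A \<subseteq> I \<Longrightarrow> \<exists>R S. chol A Q R S" for A
  proof -
    assume "A \<subseteq> I"
    then have "finite A" using fin finite_subset by blast
    then show ?thesis using \<open>A \<subseteq> I\<close>
    proof (induction A rule: finite_induct)
      case empty
      then show ?case by (auto simp: chol_def intro: tri_empty)
    next
      case (insert x A)
      then obtain R S where c: "chol A Q R S" by auto
      have ps: "psd (insert x A) Q" using psd_mono[OF fin _ psd] insert.prems by blast
      obtain d where d: "det_on (insert x A) Q = qf (insert x A) Q (\<lambda>i. if i = x then 1 else - d i) * det_on A Q"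
        "\<And>e. Re (qf (insert x A) Q (\<lambda>i. if i = x then 1 else - d i))
          \<le> Re (qf (insert x A) Q (\<lambda>i. if i = x then 1 else - e i))"
        "\<And>p. p \<in> A \<Longrightarrow> (\<Sum>q\<in>insert x A. Q p q * (if q = x then 1 else - d q)) = 0"
        using that by (rule schur_complement[OF insert.hyps ps c])
      let ?u = "\<lambda>i. if i = x then 1 else if i \<in> A then - d i else 0"
      have "qf (insert x A) Q (\<lambda>i. if i = x then 1 else - d i) = qf (insert x A) Q ?u"
        by (intro qf_cong) auto
      also have "\<dots> = qf I Q ?u" using fin insert.prems by (intro qf_support[symmetric]) auto
      finally have "Re (qf (insert x A) Q (\<lambda>i. if i = x then 1 else - d i)) > 0"
        using strict[of ?u, OF bexI[of _ x]] insert.prems by auto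
      then have "det_on (insert x A) Q \<noteq> 0" using d(1) chol_det_nonzero[OF insert.hyps(1) c] by auto
      then show ?case by (intro chol_insert[OF insert.hyps ps c])
    qed
  qed
  then show ?thesis by blast
qed

text \<open>\<open>R\<close> maps column \<open>i\<close> of its inverse to a unit vector, and the
  form of \<open>Q\<close> is the squared norm after applying \<open>R\<close>.\<close>

lemma chol_column: 
  assumes "finite I" "chol I Q R S" "i \<in> I"
  shows "qf I Q (\<lambda>q. S q i) = 1"
proof -
  have "(\<Sum>l\<in>I. (cmod (\<Sum>q\<in>I. R l q * S q i))\<^sup>2) = (\<Sum>l\<in>I. if l = i then 1 else 0)"
    using assms by (intro sum.cong refl) (simp add: chol_def)
  then show ?thesis using assms by (simp add: qf_chol[OF assms(1,2)])
qed

section \<open>Cholesky bounds that are uniform near a kernel\<close>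

text \<open>Since \<open>a\<close> is \<open>S\<close> applied to \<open>R a\<close>, its squared
  norm is at most the squared Hilbert-Schmidt norm of \<open>S\<close> times the form.\<close>

lemma chol_coercive:
  assumes fin: "finite I" and ch: "chol I Q R S"
  obtains c where "c > 0" "\<And>a. c * (\<Sum>p\<in>I. (cmod (a p))\<^sup>2) \<le> Re (qf I Q a)"
proof -
  define s where "s = 1 + (\<Sum>p\<in>I. \<Sum>l\<in>I. (cmod (S p l))\<^sup>2)"
  have s: "s \<ge> 1" unfolding s_def by (simp add: sum_nonneg)
  have "1 / s * (\<Sum>p\<in>I. (cmod (a p))\<^sup>2) \<le> Re (qf I Q a)" for a
  proof -
    define b where "b l = (\<Sum>q\<in>I. R l q * a q)" for l
    have q: "Re (qf I Q a) = (\<Sum>l\<in>I. (cmod (b l))\<^sup>2)" by (simp add: qf_chol[OF fin ch] b_def)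
    have a: "a p = (\<Sum>l\<in>I. S p l * b l)" if "p \<in> I" for p
    proof -
      have "(\<Sum>l\<in>I. S p l * b l) = (\<Sum>l\<in>I. \<Sum>q\<in>I. S p l * R l q * a q)"
        by (simp add: b_def sum_distrib_left mult_ac)
      also have "\<dots> = (\<Sum>q\<in>I. (\<Sum>l\<in>I. S p l * R l q) * a q)"
        by (subst sum.swap) (simp add: sum_distrib_right)
      also have "\<dots> = (\<Sum>q\<in>I. if p = q then a p else 0)"
        using ch that by (intro sum.cong refl) (auto simp: chol_def)
      also have "\<dots> = a p" using fin that by simp
      finally show ?thesis by simp
    qed
    have "(cmod (a p))\<^sup>2 \<le> (\<Sum>l\<in>I. (cmod (S p l))\<^sup>2) * (\<Sum>l\<in>I. (cmod (b l))\<^sup>2)" if "p \<in> I" for p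
    proof -
      have "cmod (a p) \<le> (\<Sum>l\<in>I. cmod (S p l) * cmod (b l))"
        unfolding a[OF that] by (rule order_trans[OF norm_sum]) (simp add: norm_mult)
      then have "(cmod (a p))\<^sup>2 \<le> (\<Sum>l\<in>I. cmod (S p l) * cmod (b l))\<^sup>2" by (intro power_mono) auto
      also have "\<dots> \<le> (\<Sum>l\<in>I. (cmod (S p l))\<^sup>2) * (\<Sum>l\<in>I. (cmod (b l))\<^sup>2)" by (rule Cauchy_Schwarz_ineq_sum)
      finally show ?thesis .
    qed
    then have "(\<Sum>p\<in>I. (cmod (a p))\<^sup>2) \<le> (\<Sum>p\<in>I. (\<Sum>l\<in>I. (cmod (S p l))\<^sup>2) * (\<Sum>l\<in>I. (cmod (b l))\<^sup>2))"
      by (intro sum_mono)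
    also have "\<dots> = (s - 1) * (\<Sum>l\<in>I. (cmod (b l))\<^sup>2)" by (simp add: s_def sum_distrib_right)
    also have "\<dots> \<le> s * (\<Sum>l\<in>I. (cmod (b l))\<^sup>2)" by (intro mult_right_mono sum_nonneg) auto
    finally show ?thesis using s by (simp add: q field_simps)
  qed
  then show ?thesis using that[of "1 / s"] s by auto
qed

definition close_on :: "'i set \<Rightarrow> real \<Rightarrow> ('i \<Rightarrow> 'i \<Rightarrow> complex) \<Rightarrow> ('i \<Rightarrow> 'i \<Rightarrow> complex) \<Rightarrow> bool" where
  "close_on I \<eta> Q Q' \<longleftrightarrow> (\<forall>p\<in>I. \<forall>q\<in>I. cmod (Q' p q - Q p q) \<le> \<eta>)"

text \<open>Constants that depend on the kernel only through \<open>b\<close> are uniform over all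
  kernels with such a factor. This matters in \<open>pk_upper\<close>, where the kernel is that of
  an arbitrary tuple and varies with \<open>n\<close>.\<close>

definition bounded_chol :: "'i set \<Rightarrow> real \<Rightarrow> ('i \<Rightarrow> 'i \<Rightarrow> complex) \<Rightarrow> ('i \<Rightarrow> 'i \<Rightarrow> complex) \<Rightarrow> ('i \<Rightarrow> 'i \<Rightarrow> complex) \<Rightarrow> bool" where
  "bounded_chol I b Q R S \<longleftrightarrow> chol I Q R S \<and> (\<forall>p\<in>I. \<forall>q\<in>I. cmod (R p q) \<le> b \<and> cmod (S p q) \<le> b)"

lemma bounded_chol_nearby:
  assumes fin: "finite I" and ch: "chol I Q R S"
  obtains b \<theta> where "b \<ge> 1" "\<theta> > 0"
    "\<And>Q'. psd I Q' \<Longrightarrow> close_on I \<theta> Q Q' \<Longrightarrow> \<exists>R' S'. bounded_chol I b Q' R' S'"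
proof -
  obtain c where c: "c > 0" "\<And>a. c * (\<Sum>p\<in>I. (cmod (a p))\<^sup>2) \<le> Re (qf I Q a)"
    using that by (rule chol_coercive[OF fin ch])
  \<comment> \<open>An entrywise perturbation of this size keeps half of the coercivity
    constant.\<close>
  define \<theta> where "\<theta> = c / (2 * (real (card I) + 1))"
  have \<theta>: "\<theta> > 0" "\<theta> * real (card I) \<le> c / 2" using c by (auto simp: \<theta>_def field_simps)
  \<comment> \<open>Entries of \<open>R'\<close> are controlled by the diagonal of
    \<open>Q'\<close>, columns of \<open>S'\<close> by coercivity since the form is 1 on them. As
    \<open>b \<ge> 1\<close>, a bound \<open>b\<close> on the squares is also a bound on the
    entries.\<close>
  define b where "b = 1 + (\<Sum>p\<in>I. cmod (Q p p)) + \<theta> + 2 / c"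
  have b: "b \<ge> 1" using c \<theta> by (simp add: b_def sum_nonneg)
  have "\<exists>R' S'. bounded_chol I b Q' R' S'" if psd: "psd I Q'" and cl: "close_on I \<theta> Q Q'" for Q'
  proof -
    have low: "c / 2 * (\<Sum>p\<in>I. (cmod (a p))\<^sup>2) \<le> Re (qf I Q' a)" for a
    proof -
      have "\<bar>Re (qf I Q' a) - Re (qf I Q a)\<bar> \<le> \<theta> * real (card I) * (\<Sum>p\<in>I. (cmod (a p))\<^sup>2)"
        using cl by (intro qf_perturb[OF fin]) (auto simp: close_on_def)
      also have "\<dots> \<le> c / 2 * (\<Sum>p\<in>I. (cmod (a p))\<^sup>2)" using \<theta> by (intro mult_right_mono sum_nonneg) auto
      also have "\<dots> = (c * (\<Sum>p\<in>I. (cmod (a p))\<^sup>2)) / 2" by simp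
      finally show ?thesis using c(2)[of a] by linarith
    qed
    have "Re (qf I Q' a) > 0" if ex: "\<exists>i\<in>I. a i \<noteq> 0" for a
    proof -
      obtain i where i: "i \<in> I" "a i \<noteq> 0" using ex by auto
      then have "(\<Sum>p\<in>I. (cmod (a p))\<^sup>2) > 0" using fin by (intro sum_pos2[of _ i]) auto
      then have "0 < c / 2 * (\<Sum>p\<in>I. (cmod (a p))\<^sup>2)" using c by simp
      then show ?thesis using low[of a] by linarith
    qed
    then obtain R' S' where ch': "chol I Q' R' S'" using strictly_pd_chol[OF fin psd] by blast
    have R': "cmod (R' l p) \<le> b" if l: "l \<in> I" and p: "p \<in> I" for l p
    proof -
      have "Q' p p = (\<Sum>l\<in>I. cnj (R' l p) * R' l p)" using ch' p by (simp add: chol_def)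
      also have "\<dots> = (\<Sum>l\<in>I. complex_of_real ((cmod (R' l p))\<^sup>2))"
        by (intro sum.cong refl) (simp only: complex_norm_square mult.commute)
      finally have "cmod (Q' p p) = (\<Sum>l\<in>I. (cmod (R' l p))\<^sup>2)"
        by (simp only: of_real_sum[symmetric] norm_of_real abs_of_nonneg sum_nonneg zero_le_power2)
      moreover have "(cmod (R' l p))\<^sup>2 \<le> (\<Sum>l\<in>I. (cmod (R' l p))\<^sup>2)"
        using fin l by (intro member_le_sum) auto
      moreover have "cmod (Q' p p) \<le> cmod (Q p p) + \<theta>"
        using cl p norm_triangle_sub[of "Q' p p" "Q p p"] by (auto simp: close_on_def intro: order_trans)
      moreover have "cmod (Q p p) \<le> (\<Sum>p\<in>I. cmod (Q p p))" using fin p by (intro member_le_sum) auto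
      ultimately have "(cmod (R' l p))\<^sup>2 \<le> b" using c by (simp add: b_def) (smt (verit) divide_nonneg_pos)
      also have "b \<le> b\<^sup>2" using b by (simp add: power2_eq_square)
      finally show ?thesis using b by (simp add: abs_le_square_iff[symmetric])
    qed
    have S': "cmod (S' p i) \<le> b" if p: "p \<in> I" and i: "i \<in> I" for p i
    proof -
      have "c / 2 * (cmod (S' p i))\<^sup>2 \<le> c / 2 * (\<Sum>p\<in>I. (cmod (S' p i))\<^sup>2)"
        using fin p c by (intro mult_left_mono member_le_sum) auto
      also have "\<dots> \<le> 1" using low[of "\<lambda>q. S' q i"] chol_column[OF fin ch' i] by simp
      finally have "(cmod (S' p i))\<^sup>2 \<le> 2 / c" using c by (simp add: field_simps)
      also have "\<dots> \<le> b" using c \<theta> by (simp add: b_def sum_nonneg)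
      also have "b \<le> b\<^sup>2" using b by (simp add: power2_eq_square)
      finally show ?thesis using b by (simp add: abs_le_square_iff[symmetric])
    qed
    show ?thesis unfolding bounded_chol_def using ch' R' S' by (intro exI[of _ R'] exI[of _ S']) auto
  qed
  then show ?thesis using that[of b \<theta>] b \<theta> by blast
qed

definition comb :: "'i set \<Rightarrow> ('i \<Rightarrow> 'i \<Rightarrow> complex) \<Rightarrow> ('i \<Rightarrow> nat \<Rightarrow> complex) \<Rightarrow> 'i \<Rightarrow> nat \<Rightarrow> complex" where
  "comb I R X = (\<lambda>q l. \<Sum>p\<in>I. X p l * R p q)"

lemma gram_cong: "(\<And>i l. i \<in> {p, q} \<Longrightarrow> l < n \<Longrightarrow> X i l = Y i l) \<Longrightarrow> gram n X p q = gram n Y p q"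
  unfolding gram_def by (intro cinner_cong) auto

lemma gram_comb: "gram n (comb I R X) p q = (\<Sum>l\<in>I. \<Sum>k\<in>I. cnj (R l p) * R k q * gram n X l k)"
proof -
  have "gram n (comb I R X) p q = (\<Sum>k\<in>I. R k q * (\<Sum>l\<in>I. cnj (R l p) * gram n X l k))"
    unfolding gram_def comb_def cinner_sum_scaled_left cinner_sum_scaled_right ..
  also have "\<dots> = (\<Sum>k\<in>I. \<Sum>l\<in>I. cnj (R l p) * R k q * gram n X l k)"
    by (simp add: sum_distrib_left mult_ac)
  finally show ?thesis by (subst (asm) sum.swap)
qed

lemma gram_comb_close:
  assumes fin: "finite I" and b: "\<And>p q. p \<in> I \<Longrightarrow> q \<in> I \<Longrightarrow> cmod (R p q) \<le> b" and cl: "close_on I \<eta> Q (gram n X)"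
    and pq: "p \<in> I" "q \<in> I"
  shows "cmod (gram n (comb I R X) p q - (\<Sum>l\<in>I. \<Sum>k\<in>I. cnj (R l p) * R k q * Q l k)) \<le> (real (card I) * b)\<^sup>2 * \<eta>"
proof -
  have \<eta>: "0 \<le> \<eta>" using cl pq norm_ge_zero unfolding close_on_def by (meson order_trans)
  have b0: "0 \<le> b" using b[OF pq] norm_ge_zero by (meson order_trans)
  have "gram n (comb I R X) p q - (\<Sum>l\<in>I. \<Sum>k\<in>I. cnj (R l p) * R k q * Q l k)
     = (\<Sum>l\<in>I. \<Sum>k\<in>I. cnj (R l p) * R k q * (gram n X l k - Q l k))"
    by (simp add: gram_comb sum_subtractf[symmetric] algebra_simps)
  also have "cmod \<dots> \<le> (\<Sum>l\<in>I. \<Sum>k\<in>I. cmod (cnj (R l p) * R k q * (gram n X l k - Q l k)))"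
    by (intro order_trans[OF norm_sum] sum_mono norm_sum)
  also have "\<dots> \<le> (\<Sum>l\<in>I. \<Sum>k\<in>I. b * b * \<eta>)"
    unfolding norm_mult complex_mod_cnj using b cl pq \<eta> b0
    by (intro sum_mono mult_mono) (auto simp: close_on_def)
  also have "\<dots> = (real (card I) * b)\<^sup>2 * \<eta>" by (simp add: power2_eq_square)
  finally show ?thesis .
qed

lemma chol_conj_sum:
  assumes "finite I" "chol I Q R S" "p \<in> I" "q \<in> I"
  shows "(\<Sum>l\<in>I. \<Sum>k\<in>I. cnj (R l p) * R k q * (if l = k then 1 else 0)) = Q p q"
  using assms by (simp add: chol_def if_distrib[of "\<lambda>x. _ * x"] cong: if_cong)

lemma chol_conj_inverse:
  assumes fin: "finite I" and ch: "chol I Q R S" and p: "p \<in> I" and q: "q \<in> I"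
  shows "(\<Sum>l\<in>I. \<Sum>k\<in>I. cnj (S l p) * S k q * Q l k) = (if p = q then 1 else 0)"
proof -
  have "(\<Sum>l\<in>I. \<Sum>k\<in>I. cnj (S l p) * S k q * Q l k) = (\<Sum>l\<in>I. \<Sum>k\<in>I. \<Sum>m\<in>I. cnj (R m l * S l p) * (R m k * S k q))"
    using ch by (intro sum.cong refl) (simp add: chol_def sum_distrib_left mult_ac)
  also have "\<dots> = (\<Sum>l\<in>I. \<Sum>m\<in>I. \<Sum>k\<in>I. cnj (R m l * S l p) * (R m k * S k q))"
    by (rule sum.cong[OF refl], rule sum.swap)
  also have "\<dots> = (\<Sum>m\<in>I. \<Sum>l\<in>I. \<Sum>k\<in>I. cnj (R m l * S l p) * (R m k * S k q))"
    by (rule sum.swap)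
  also have "\<dots> = (\<Sum>m\<in>I. cnj (\<Sum>l\<in>I. R m l * S l p) * (\<Sum>k\<in>I. R m k * S k q))"
    unfolding cnj_sum sum_product ..
  also have "\<dots> = (\<Sum>m\<in>I. if m = p then (if p = q then 1 else 0) else 0)"
    using ch p q by (intro sum.cong refl) (simp add: chol_def)
  also have "\<dots> = (if p = q then 1 else 0)" using fin p by simp
  finally show ?thesis .
qed

section \<open>Nearly orthonormal tuples and approximate transitivity\<close>

abbreviation kron :: "'i \<Rightarrow> 'i \<Rightarrow> complex" where
  "kron \<equiv> \<lambda>p q. if p = q then 1 else 0"

lemma abs_nrm_minus_one_le:
  assumes "cmod (gram n X p p - 1) \<le> \<eta>"
  shows "\<bar>nrm n (X p) - 1\<bar> \<le> \<eta>"
proof -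
  have "gram n X p p - 1 = complex_of_real ((nrm n (X p))\<^sup>2 - 1)" by (simp add: gram_def cinner_self)
  then have "\<bar>(nrm n (X p))\<^sup>2 - 1\<bar> \<le> \<eta>" using assms by (simp only: norm_of_real)
  moreover have "(nrm n (X p))\<^sup>2 - 1 = (nrm n (X p) - 1) * (nrm n (X p) + 1)" by (simp add: power2_eq_square algebra_simps)
  ultimately have "\<bar>nrm n (X p) - 1\<bar> * (nrm n (X p) + 1) \<le> \<eta>" using nrm_nonneg[of n "X p"] by (simp add: abs_mult)
  moreover have "\<bar>nrm n (X p) - 1\<bar> * 1 \<le> \<bar>nrm n (X p) - 1\<bar> * (nrm n (X p) + 1)"
    by (intro mult_left_mono) auto
  ultimately show ?thesis by simp
qed

lemma orthon_nrm: "orthon n J q \<Longrightarrow> j \<in> J \<Longrightarrow> nrm n (q j) = 1"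
proof -
  assume "orthon n J q" "j \<in> J"
  then have "complex_of_real ((nrm n (q j))\<^sup>2) = 1" unfolding cinner_self[symmetric] orthon_def by simp
  then have "(nrm n (q j))\<^sup>2 = 1" by (simp only: of_real_eq_1_iff)
  then show ?thesis using nrm_nonneg[of n "q j"] by (simp add: power2_eq_1_iff)
qed

text \<open>Gram-Schmidt with linear error control: if the earlier vectors are O(\<eta>) from an
  orthonormal family, the projection removed from the next one is O(\<eta>), and so is the change by
  normalization. The constants do not depend on \<open>n\<close>.\<close>

lemma nearly_orthonormal:
  assumes "finite I"
  shows "\<exists>K \<eta>0. K \<ge> 0 \<and> \<eta>0 > 0 \<and> \<eta>0 \<le> 1 \<and> (\<forall>n X \<eta>. \<eta> \<le> \<eta>0 \<longrightarrow> close_on I \<eta> kron (gram n X) \<longrightarrow>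
     (\<exists>O'. orthon n I O' \<and> (\<forall>i\<in>I. nrm n (\<lambda>l. X i l - O' i l) \<le> K * \<eta>)))"
  using assms
proof (induction I rule: finite_induct)
  case empty
  show ?case by (intro exI[of _ 0] exI[of _ 1]) (auto simp: orthon_def)
next
  case (insert x A)
  then obtain K \<eta>0 where K: "K \<ge> 0" "\<eta>0 > 0" "\<eta>0 \<le> 1"
    and IH': "\<forall>n X \<eta>. \<eta> \<le> \<eta>0 \<longrightarrow> close_on A \<eta> kron (gram n X) \<longrightarrow>
     (\<exists>O'. orthon n A O' \<and> (\<forall>i\<in>A. nrm n (\<lambda>l. X i l - O' i l) \<le> K * \<eta>))" by blast
  note IH = IH'[rule_format]
  \<comment> \<open>\<open>K1 * \<eta>\<close> bounds the removed projection: each of the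
    \<open>card A\<close> inner products is at most \<open>\<eta> + 2 * K * \<eta>\<close>, as the
    new vector has norm at most 2.\<close>
  define K1 where "K1 = real (card A) * (1 + 2 * K)"
  have K1: "K1 \<ge> 0" using K by (simp add: K1_def)
  define K' where "K' = K + (2 * K1 + 1)"
  \<comment> \<open>Small enough for the residual to keep norm at least 1/2.\<close>
  define \<eta>1 where "\<eta>1 = min \<eta>0 (1 / (2 * (K1 + 1)))"
  have \<eta>1: "\<eta>1 > 0" "\<eta>1 \<le> \<eta>0" "\<eta>1 * (K1 + 1) \<le> 1 / 2"
    using K K1 by (auto simp: \<eta>1_def min_def field_simps)
  have "\<exists>O'. orthon n (insert x A) O' \<and> (\<forall>i\<in>insert x A. nrm n (\<lambda>l. X i l - O' i l) \<le> K' * \<eta>)"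
    if \<eta>: "\<eta> \<le> \<eta>1" and cl: "close_on (insert x A) \<eta> kron (gram n X)" for n X \<eta>
  proof -
    have \<eta>0: "0 \<le> \<eta>" using cl norm_ge_zero unfolding close_on_def by (meson insertI1 order_trans)
    have "close_on A \<eta> kron (gram n X)" using cl by (auto simp: close_on_def)
    then obtain O' where O': "orthon n A O'" "\<And>i. i \<in> A \<Longrightarrow> nrm n (\<lambda>l. X i l - O' i l) \<le> K * \<eta>"
      using IH[of \<eta> n X] \<eta> \<eta>1 by force
    have xn: "\<bar>nrm n (X x) - 1\<bar> \<le> \<eta>" using cl by (intro abs_nrm_minus_one_le) (auto simp: close_on_def)
    have "\<eta> \<le> 1" using \<eta> \<eta>1 K by linarith
    then have xn2: "nrm n (X x) \<le> 2" using xn by linarith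
    let ?w = "resid n A O' (X x)"
    have c: "cmod (cinner n (X x) (O' a)) \<le> (1 + 2 * K) * \<eta>" if a: "a \<in> A" for a
    proof -
      have "cinner n (X x) (O' a) = cinner n (X x) (X a) - cinner n (X x) (\<lambda>l. X a l - O' a l)"
        by (simp add: cinner_diff_right)
      then have "cmod (cinner n (X x) (O' a)) \<le> cmod (cinner n (X x) (X a)) + cmod (cinner n (X x) (\<lambda>l. X a l - O' a l))"
        by (simp only: norm_triangle_ineq4)
      also have "cmod (cinner n (X x) (X a)) \<le> \<eta>"
      proof -
        have "a \<noteq> x" using a insert.hyps by auto
        moreover have "cmod (gram n X a x - kron a x) \<le> \<eta>" using cl a by (auto simp: close_on_def)
        ultimately show ?thesis by (simp add: gram_def)
      qed
      also have "cmod (cinner n (X x) (\<lambda>l. X a l - O' a l)) \<le> 2 * (K * \<eta>)"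
        using xn2 O'(2)[OF a] by (intro order_trans[OF cinner_le] mult_mono) auto
      finally show ?thesis by (simp add: algebra_simps)
    qed
    have xw: "nrm n (\<lambda>l. X x l - ?w l) \<le> K1 * \<eta>"
    proof -
      have "nrm n (\<lambda>l. X x l - ?w l) = nrm n (\<lambda>l. \<Sum>a\<in>A. O' a l * cinner n (X x) (O' a))"
        by (simp add: resid_def)
      also have "\<dots> \<le> (\<Sum>a\<in>A. nrm n (\<lambda>l. O' a l * cinner n (X x) (O' a)))" by (rule nrm_sum[OF insert.hyps(1)])
      also have "\<dots> \<le> (\<Sum>a\<in>A. (1 + 2 * K) * \<eta>)"
        using c by (intro sum_mono) (simp add: nrm_scale orthon_nrm[OF O'(1)])
      also have "\<dots> = K1 * \<eta>" by (simp add: K1_def)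
      finally show ?thesis .
    qed
    have wn: "\<bar>nrm n ?w - 1\<bar> \<le> (K1 + 1) * \<eta>"
    proof -
      have "nrm n (X x) \<le> nrm n (\<lambda>l. X x l - ?w l) + nrm n ?w"
        using nrm_add[of n "\<lambda>l. X x l - ?w l" ?w] by simp
      moreover have "nrm n ?w \<le> nrm n (\<lambda>l. X x l - ?w l) + nrm n (X x)"
        using nrm_diff[of n "X x" "\<lambda>l. X x l - ?w l"] by simp
      ultimately show ?thesis using xw xn by (simp add: algebra_simps abs_le_iff)
    qed
    have "(K1 + 1) * \<eta> \<le> \<eta>1 * (K1 + 1)" using \<eta> K1 by (simp add: mult.commute mult_left_mono)
    then have w0: "nrm n ?w \<ge> 1 / 2" using wn \<eta>1(3) by linarith
    let ?O = "O'(x := normalize_vec n ?w)"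
    have "orthon n (insert x A) ?O"
      using insert.hyps w0 by (intro orthon_insert[OF O'(1)]) auto
    moreover have "nrm n (\<lambda>l. X i l - ?O i l) \<le> K' * \<eta>" if "i \<in> insert x A" for i
    proof (cases "i = x")
      case True
      have "nrm n (\<lambda>l. ?w l - normalize_vec n ?w l) = nrm n (\<lambda>l. ?w l * (1 - 1 / complex_of_real (nrm n ?w)))"
        by (simp add: normalize_vec_def algebra_simps)
      also have "\<dots> = nrm n ?w * cmod (1 - 1 / complex_of_real (nrm n ?w))" by (rule nrm_scale)
      also have "\<dots> = cmod (complex_of_real (nrm n ?w) * (1 - 1 / complex_of_real (nrm n ?w)))"
        by (simp add: norm_mult)
      also have "complex_of_real (nrm n ?w) * (1 - 1 / complex_of_real (nrm n ?w)) = complex_of_real (nrm n ?w - 1)"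
        using w0 by (simp add: right_diff_distrib)
      also have "cmod \<dots> = \<bar>nrm n ?w - 1\<bar>" by (rule norm_of_real)
      finally have "nrm n (\<lambda>l. ?w l - normalize_vec n ?w l) \<le> (K1 + 1) * \<eta>" using wn by simp
      then have "nrm n (\<lambda>l. X x l - normalize_vec n ?w l) \<le> K1 * \<eta> + (K1 + 1) * \<eta>"
        using nrm_triangle[of n "X x" "normalize_vec n ?w" ?w] xw by linarith
      also have "\<dots> \<le> K' * \<eta>" using K \<eta>0 by (simp add: K'_def algebra_simps)
      finally show ?thesis using True by simp
    next
      case False
      then have "nrm n (\<lambda>l. X i l - ?O i l) \<le> K * \<eta>" using that O'(2) by auto
      also have "\<dots> \<le> K' * \<eta>" using K1 \<eta>0 by (intro mult_right_mono) (auto simp: K'_def)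
      finally show ?thesis .
    qed
    ultimately show ?thesis by blast
  qed
  moreover have "K' \<ge> 0" "\<eta>1 \<le> 1" using K K1 \<eta>1 by (auto simp: K'_def)
  ultimately show ?case using \<eta>1 by (intro exI[of _ K'] exI[of _ \<eta>1]) auto
qed

text \<open>Complete both families to orthonormal bases; the second basis matrix times the adjoint
  of the first maps one family to the other.\<close>

lemma orthon_transport:
  assumes fin: "finite I" and O1: "orthon n I O1" and O2: "orthon n I O2"
  obtains W where "W \<in> umat n" "\<And>i l. i \<in> I \<Longrightarrow> l < n \<Longrightarrow> mult n W (O1 i) l = O2 i l"
proof -
  obtain h where h: "bij_betw h {..<card I} I" using fin ex_bij_betw_nat_finite[of I] by (auto simp: lessThan_atLeast0)
  have m: "card I \<le> n" using orthon_card_le[OF fin O1] .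
  have re: "orthon n {..<card I} (\<lambda>j. q (h j))" if "orthon n I q" for q
    unfolding orthon_def
  proof (intro ballI)
    fix i j assume "i \<in> {..<card I}" "j \<in> {..<card I}"
    then have "h i \<in> I" "h j \<in> I" "h i = h j \<longleftrightarrow> i = j"
      using h by (auto simp: bij_betw_def inj_on_def)
    then show "cinner n (q (h i)) (q (h j)) = kron i j" using that by (simp add: orthon_def)
  qed
  obtain B where B: "orthon n {..<n} B" "\<And>i. i < card I \<Longrightarrow> B i = O1 (h i)"
    using orthon_extend[OF m re[OF O1]] by blast
  obtain C where C: "orthon n {..<n} C" "\<And>i. i < card I \<Longrightarrow> C i = O2 (h i)"
    using orthon_extend[OF m re[OF O2]] by blast
  define mat where "mat q = restrict (\<lambda>(l, j). q j l) ({..<n} \<times> {..<n})" for q :: "nat \<Rightarrow> nat \<Rightarrow> complex"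
  have mat: "mat q \<in> umat n" if "orthon n {..<n} q" for q
  proof -
    have "cinner n (\<lambda>l. mat q (l, i)) (\<lambda>l. mat q (l, j)) = cinner n (q i) (q j)" if "i < n" "j < n" for i j
      using that by (intro cinner_cong) (auto simp: mat_def)
    then show ?thesis using that by (simp add: umat_iff orthon_def) (simp add: mat_def)
  qed
  let ?W = "mmul n (mat C) (adj n (mat B))"
  have "mult n ?W (O1 i) l = O2 i l" if i: "i \<in> I" and l: "l < n" for i l
  proof -
    obtain k where k: "k < card I" "h k = i" using h i by (metis bij_betw_imp_surj_on imageE lessThan_iff)
    have kn: "k < n" using k m by simp
    have "mult n ?W (O1 i) l = (\<Sum>t<n. \<Sum>j<n. C j l * (O1 i t * cnj (B j t)))"
      using l by (simp add: mult_def mmul_def mat_def adj_def sum_distrib_left sum_distrib_right mult_ac)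
    also have "\<dots> = (\<Sum>j<n. C j l * cinner n (O1 i) (B j))"
      by (subst sum.swap) (simp add: cinner_def sum_distrib_left)
    also have "\<dots> = (\<Sum>j<n. C j l * cinner n (B k) (B j))" using B(2)[OF k(1)] k by simp
    also have "\<dots> = (\<Sum>j<n. if j = k then C k l else 0)"
      using B(1) kn by (intro sum.cong refl) (auto simp: orthon_def)
    also have "\<dots> = O2 i l" using kn C(2)[OF k(1)] k by simp
    finally show ?thesis .
  qed
  moreover have "?W \<in> umat n" by (intro mmul_umat adj_umat mat B C)
  ultimately show ?thesis using that by blast
qed

text \<open>The unitary group acts approximately transitively on tuples with nearly equal Gram kernels,
  with a modulus that is linear and locally uniform in the kernel.\<close>

lemma approximately_transitive:
  assumes fin: "finite I" and b: "b \<ge> 1"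
  obtains K \<eta>0 where "K > 0" "\<eta>0 > 0"
    "\<And>Q R S n X Z \<eta>. bounded_chol I b Q R S \<Longrightarrow> 0 \<le> \<eta> \<Longrightarrow> \<eta> \<le> \<eta>0 \<Longrightarrow> close_on I \<eta> Q (gram n X) \<Longrightarrow> close_on I \<eta> Q (gram n Z) \<Longrightarrow>
      \<exists>W\<in>umat n. \<forall>i\<in>I. nrm n (\<lambda>l. mult n W (X i) l - Z i l) \<le> K * \<eta>"
proof -
  obtain K0 \<eta>0 where K0: "K0 \<ge> 0" "\<eta>0 > 0"
    and near': "\<forall>n X \<eta>. \<eta> \<le> \<eta>0 \<longrightarrow> close_on I \<eta> kron (gram n X) \<longrightarrow>
     (\<exists>O'. orthon n I O' \<and> (\<forall>i\<in>I. nrm n (\<lambda>l. X i l - O' i l) \<le> K0 * \<eta>))"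
    using nearly_orthonormal[OF fin] by blast
  note near = near'[rule_format]
  \<comment> \<open>Applying \<open>S\<close> makes a tuple with kernel near \<open>Q\<close> nearly
    orthonormal and multiplies the error by at most \<open>B\<close>; applying \<open>R\<close>
    brings it back at the cost of a factor \<open>card I * b\<close>.\<close>
  define B where "B = (real (card I) * b)\<^sup>2 + 1"
  have B: "B \<ge> 1" by (simp add: B_def)
  define K where "K = 1 + real (card I) * b * (2 * K0 * B)"
  have K: "K > 0" using K0 b B by (simp add: K_def add_pos_nonneg)
  have "\<exists>W\<in>umat n. \<forall>i\<in>I. nrm n (\<lambda>l. mult n W (X i) l - Z i l) \<le> K * \<eta>"
    if bc: "bounded_chol I b Q R S" and \<eta>: "0 \<le> \<eta>" "\<eta> \<le> \<eta>0 / B"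
      and cX: "close_on I \<eta> Q (gram n X)" and cZ: "close_on I \<eta> Q (gram n Z)" for Q R S n X Z \<eta>
  proof -
    have ch: "chol I Q R S" and Rb: "\<And>p q. p \<in> I \<Longrightarrow> q \<in> I \<Longrightarrow> cmod (R p q) \<le> b"
      and Sb: "\<And>p q. p \<in> I \<Longrightarrow> q \<in> I \<Longrightarrow> cmod (S p q) \<le> b"
      using bc by (auto simp: bounded_chol_def)
    have nrml: "\<exists>O'. orthon n I O' \<and> (\<forall>i\<in>I. nrm n (\<lambda>l. comb I S Y i l - O' i l) \<le> K0 * (B * \<eta>))"
      if "close_on I \<eta> Q (gram n Y)" for Y
    proof (rule near)
      show "B * \<eta> \<le> \<eta>0" using \<eta> B by (simp add: field_simps)
      show "close_on I (B * \<eta>) kron (gram n (comb I S Y))"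
        unfolding close_on_def
      proof (intro ballI)
        fix p q assume pq: "p \<in> I" "q \<in> I"
        have "cmod (gram n (comb I S Y) p q - kron p q) \<le> (real (card I) * b)\<^sup>2 * \<eta>"
          using gram_comb_close[of I S b \<eta> Q n Y p q, OF fin Sb that pq] chol_conj_inverse[OF fin ch pq] by simp
        also have "\<dots> \<le> B * \<eta>" using \<eta> by (intro mult_right_mono) (auto simp: B_def)
        finally show "cmod (gram n (comb I S Y) p q - kron p q) \<le> B * \<eta>" .
      qed
    qed
    obtain O1 where O1: "orthon n I O1" "\<And>i. i \<in> I \<Longrightarrow> nrm n (\<lambda>l. comb I S X i l - O1 i l) \<le> K0 * (B * \<eta>)"
      using nrml[OF cX] by blast
    obtain O2 where O2: "orthon n I O2" "\<And>i. i \<in> I \<Longrightarrow> nrm n (\<lambda>l. comb I S Z i l - O2 i l) \<le> K0 * (B * \<eta>)"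
      using nrml[OF cZ] by blast
    obtain W where W: "W \<in> umat n" "\<And>i l. i \<in> I \<Longrightarrow> l < n \<Longrightarrow> mult n W (O1 i) l = O2 i l"
      using that by (rule orthon_transport[OF fin O1(1) O2(1)])
    have recon: "Y i l = (\<Sum>p\<in>I. comb I S Y p l * R p i)" if i: "i \<in> I" for Y i l
    proof -
      have "(\<Sum>p\<in>I. comb I S Y p l * R p i) = (\<Sum>p\<in>I. \<Sum>q\<in>I. Y q l * (S q p * R p i))"
        by (simp add: comb_def sum_distrib_left sum_distrib_right mult_ac)
      also have "\<dots> = (\<Sum>q\<in>I. Y q l * (\<Sum>p\<in>I. S q p * R p i))"
        by (subst sum.swap) (simp add: sum_distrib_left)
      also have "\<dots> = (\<Sum>q\<in>I. if q = i then Y i l else 0)"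
        using ch i by (intro sum.cong refl) (auto simp: chol_def)
      also have "\<dots> = Y i l" using fin i by simp
      finally show ?thesis by simp
    qed
    have "nrm n (\<lambda>l. mult n W (X i) l - Z i l) \<le> K * \<eta>" if i: "i \<in> I" for i
    proof -
      have "nrm n (\<lambda>l. mult n W (X i) l - Z i l)
        = nrm n (\<lambda>l. \<Sum>p\<in>I. (mult n W (comb I S X p) l - comb I S Z p l) * R p i)"
      proof (rule nrm_cong)
        fix l
        have "mult n W (X i) l = mult n W (\<lambda>l. \<Sum>p\<in>I. comb I S X p l * R p i) l"
          using recon[OF i, of X] by presburger
        also have "\<dots> = (\<Sum>p\<in>I. mult n W (comb I S X p) l * R p i)" by (simp add: mult_sum mult_scale)
        finally show "mult n W (X i) l - Z i l = (\<Sum>p\<in>I. (mult n W (comb I S X p) l - comb I S Z p l) * R p i)"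
          by (simp add: recon[OF i, of Z l] sum_subtractf left_diff_distrib)
      qed
      also have "\<dots> \<le> (\<Sum>p\<in>I. nrm n (\<lambda>l. (mult n W (comb I S X p) l - comb I S Z p l) * R p i))"
        by (rule nrm_sum[OF fin])
      also have "\<dots> \<le> (\<Sum>p\<in>I. (2 * K0 * B * \<eta>) * b)"
      proof (rule sum_mono)
        fix p assume p: "p \<in> I"
        have "nrm n (\<lambda>l. mult n W (comb I S X p) l - O2 p l) = nrm n (mult n W (\<lambda>l. comb I S X p l - O1 p l))"
          by (rule nrm_cong) (simp add: mult_diff W(2)[OF p])
        also have "\<dots> \<le> K0 * (B * \<eta>)" using O1(2)[OF p] by (simp add: nrm_mult[OF W(1)])
        finally have "nrm n (\<lambda>l. mult n W (comb I S X p) l - comb I S Z p l) \<le> K0 * (B * \<eta>) + K0 * (B * \<eta>)"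
          using nrm_triangle[of n "mult n W (comb I S X p)" "comb I S Z p" "O2 p"] O2(2)[OF p]
            nrm_diff_commute[of n "O2 p" "comb I S Z p"] by linarith
        then show "nrm n (\<lambda>l. (mult n W (comb I S X p) l - comb I S Z p l) * R p i) \<le> (2 * K0 * B * \<eta>) * b"
          unfolding nrm_scale using Rb[OF p i] K0 B \<eta> by (intro mult_mono) (auto simp: algebra_simps)
      qed
      also have "\<dots> = real (card I) * b * (2 * K0 * B) * \<eta>" by simp
      also have "\<dots> \<le> K * \<eta>" using \<eta> by (intro mult_right_mono) (auto simp: K_def)
      finally show ?thesis .
    qed
    then show ?thesis using W(1) by blast
  qed
  then show ?thesis using that[of K "\<eta>0 / B"] K K0 B by auto
qed

subsection \<open>Random vectors in the unit ball are nearly orthonormal\<close>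

lemma nn_integral_mv:
  assumes U: "U \<in> umat n" and f: "f \<in> borel_measurable (cn n)"
  shows "(\<integral>\<^sup>+x. f (mv n U x) \<partial>cn n) = integral\<^sup>N (cn n) f"
proof -
  have "distr (cn n) (cn n) (mv n U) = cn n"
  proof (rule measure_eqI)
    fix A assume "A \<in> sets (distr (cn n) (cn n) (mv n U))"
    then have A: "A \<in> sets (cn n)" by simp
    have "emeasure (distr (cn n) (cn n) (mv n U)) A = emeasure (cn n) {y \<in> space (cn n). mv n U y \<in> A}"
      using A by (subst emeasure_distr) (auto intro: arg_cong2[where f = emeasure])
    then show "emeasure (distr (cn n) (cn n) (mv n U)) A = emeasure (cn n) A"
      using cn_unitary_invariant[OF U A] by simp
  qed simp
  then have "integral\<^sup>N (cn n) f = integral\<^sup>N (distr (cn n) (cn n) (mv n U)) f" by simp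
  also have "\<dots> = (\<integral>\<^sup>+x. f (mv n U x) \<partial>cn n)" using f by (intro nn_integral_distr) auto
  finally show ?thesis by simp
qed

definition uball :: "nat \<Rightarrow> (nat \<Rightarrow> complex) set" where
  "uball n = {x \<in> space (cn n). nrm n x \<le> 1}"

lemma uball_sets [measurable]: "uball n \<in> sets (cn n)"
  and uball_emeasure: "emeasure (cn n) (uball n) = ennreal (vball n)"
  using unit_ball by (auto simp: uball_def)

text \<open>By unitary invariance every coordinate has the same second moment as the direction
  \<open>u\<close>, and the \<open>n\<close> of them add up to at most the volume of the
  ball.\<close>

lemma second_moment:
  assumes u: "nrm n u = 1"
  shows "(\<integral>\<^sup>+x. indicator (uball n) x * ennreal ((cmod (cinner n x u))\<^sup>2) \<partial>cn n) \<le> ennreal (vball n / n)"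
proof -
  have n: "0 < n" using u by (cases n) (auto simp: nrm_def)
  have "orthon n {..<1::nat} (\<lambda>_. u)" by (auto simp: orthon_def cinner_self u)
  then obtain q where q: "orthon n {..<n} q" "q 0 = u" using orthon_extend[of 1 n "\<lambda>_. u"] n by auto
  have coord: "(\<integral>\<^sup>+x. indicator (uball n) x * ennreal ((cmod (cinner n x u))\<^sup>2) \<partial>cn n)
      = (\<integral>\<^sup>+x. indicator (uball n) x * ennreal ((cmod (x j))\<^sup>2) \<partial>cn n)" if j: "j < n" for j
  proof -
    \<comment> \<open>Exchanging columns 0 and \<open>j\<close> puts \<open>u\<close> into column
      \<open>j\<close>, so the adjoint matrix has the inner product with \<open>u\<close> as its
      coordinate \<open>j\<close>.\<close>
    let ?t = "Transposition.transpose 0 j"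
    have tt: "?t i < n" if "i < n" for i using that j n by (auto simp: Transposition.transpose_def)
    have o: "orthon n {..<n} (\<lambda>i. q (?t i))"
    proof -
      have "?t i = ?t k \<longleftrightarrow> i = k" for i k by (metis transpose_involutory)
      then show ?thesis using q(1) tt unfolding orthon_def by simp
    qed
    define U where "U = restrict (\<lambda>(l, k). q (?t k) l) ({..<n} \<times> {..<n})"
    have "cinner n (\<lambda>l. U (l, i)) (\<lambda>l. U (l, k)) = cinner n (q (?t i)) (q (?t k))" if "i < n" "k < n" for i k
      using that by (intro cinner_cong) (auto simp: U_def)
    then have "U \<in> umat n" using o by (simp add: umat_iff orthon_def) (simp add: U_def)
    then have V: "adj n U \<in> umat n" by (rule adj_umat)
    have c: "mv n (adj n U) x j = cinner n x u" for x
      using j q(2) by (simp add: mv_def mult_def adj_def U_def cinner_def mult.commute)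
    have "(\<integral>\<^sup>+x. indicator (uball n) x * ennreal ((cmod (x j))\<^sup>2) \<partial>cn n)
      = (\<integral>\<^sup>+x. indicator (uball n) (mv n (adj n U) x) * ennreal ((cmod (mv n (adj n U) x j))\<^sup>2) \<partial>cn n)"
      using j by (intro nn_integral_mv[OF V, symmetric]) measurable
    also have "\<dots> = (\<integral>\<^sup>+x. indicator (uball n) x * ennreal ((cmod (cinner n x u))\<^sup>2) \<partial>cn n)"
      by (intro nn_integral_cong) (simp add: c uball_def indicator_def nrm_mv[OF V] mv_space)
    finally show ?thesis by simp
  qed
  let ?L = "\<integral>\<^sup>+x. indicator (uball n) x * ennreal ((cmod (cinner n x u))\<^sup>2) \<partial>cn n"
  have "ennreal n * ?L = (\<Sum>j<n. ?L)" by (simp add: ennreal_of_nat_eq_real_of_nat)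
  also have "\<dots> = (\<Sum>j<n. \<integral>\<^sup>+x. indicator (uball n) x * ennreal ((cmod (x j))\<^sup>2) \<partial>cn n)"
    by (intro sum.cong refl) (simp add: coord)
  also have "\<dots> = (\<integral>\<^sup>+x. (\<Sum>j<n. indicator (uball n) x * ennreal ((cmod (x j))\<^sup>2)) \<partial>cn n)"
    by (intro nn_integral_sum[symmetric]) measurable
  also have "\<dots> \<le> (\<integral>\<^sup>+x. indicator (uball n) x \<partial>cn n)"
  proof (rule nn_integral_mono)
    fix x
    have "(\<Sum>j<n. indicator (uball n) x * ennreal ((cmod (x j))\<^sup>2)) = indicator (uball n) x * ennreal ((nrm n x)\<^sup>2)"
      by (simp add: sum_distrib_left[symmetric] nrm_sq sum_ennreal)
    also have "\<dots> \<le> indicator (uball n) x"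
      by (auto simp: indicator_def uball_def power_le_one)
    finally show "(\<Sum>j<n. indicator (uball n) x * ennreal ((cmod (x j))\<^sup>2)) \<le> indicator (uball n) x" .
  qed
  also have "\<dots> = ennreal (vball n)" by (simp add: uball_emeasure)
  finally have *: "ennreal n * ?L \<le> ennreal (vball n)" .
  have "?L = ennreal (1 / n) * (ennreal n * ?L)"
    using n by (simp add: mult.assoc[symmetric] ennreal_mult[symmetric] del: ennreal_of_nat_eq_real_of_nat flip: ennreal_of_nat_eq_real_of_nat)
      (simp add: ennreal_of_nat_eq_real_of_nat ennreal_mult[symmetric])
  also have "\<dots> \<le> ennreal (1 / n) * ennreal (vball n)" using * by (rule mult_left_mono) simp
  also have "\<dots> = ennreal (vball n / n)" by (simp add: ennreal_mult[symmetric] less_imp_le)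
  finally show ?thesis .
qed

text \<open>Chebyshev's inequality in the direction of \<open>y\<close>; the factor
  \<open>1 / n\<close> comes from \<open>second_moment\<close>.\<close>

lemma inner_product_tail:
  assumes y: "nrm n y \<le> C" and C: "C > 0" and a: "a > 0" and n: "n > 0"
  shows "emeasure (cn n) {x \<in> uball n. a \<le> cmod (cinner n x y)} \<le> ennreal (vball n * C\<^sup>2 / (n * a\<^sup>2))"
proof (cases "nrm n y = 0")
  case True
  have "cinner n x y = 0" for x using cinner_le[of n x y] True by simp
  then have "{x \<in> uball n. a \<le> cmod (cinner n x y)} = {}" using a by auto
  then show ?thesis by (simp only: emeasure_empty zero_le)
next
  case False
  define u where "u = (\<lambda>l. y l * complex_of_real (1 / nrm n y))"
  have u: "nrm n u = 1" using False unfolding u_def nrm_scale norm_of_real by simp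
  have yu: "cinner n x y = complex_of_real (nrm n y) * cinner n x u" for x
    using False unfolding u_def cinner_scale_right by simp
  have sub: "{x \<in> uball n. a \<le> cmod (cinner n x y)} \<subseteq> {x \<in> uball n. 1 \<le> ennreal (C\<^sup>2 / a\<^sup>2) * ennreal ((cmod (cinner n x u))\<^sup>2)}"
  proof safe
    fix x assume "a \<le> cmod (cinner n x y)"
    then have "a \<le> nrm n y * cmod (cinner n x u)" by (simp add: yu norm_mult)
    also have "\<dots> \<le> C * cmod (cinner n x u)" using y by (intro mult_right_mono) auto
    finally have "a\<^sup>2 \<le> (C * cmod (cinner n x u))\<^sup>2" using a by (intro power_mono) auto
    then have "1 \<le> C\<^sup>2 / a\<^sup>2 * (cmod (cinner n x u))\<^sup>2" using a by (simp add: field_simps power_mult_distrib)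
    then show "1 \<le> ennreal (C\<^sup>2 / a\<^sup>2) * ennreal ((cmod (cinner n x u))\<^sup>2)"
      by (simp add: ennreal_mult[symmetric])
  qed
  have [measurable]: "(\<lambda>x. cinner n x u) \<in> borel_measurable (cn n)" by measurable
  have ms: "{x \<in> uball n. 1 \<le> ennreal (C\<^sup>2 / a\<^sup>2) * ennreal ((cmod (cinner n x u))\<^sup>2)} \<in> sets (cn n)"
  proof -
    have "{x \<in> uball n. 1 \<le> ennreal (C\<^sup>2 / a\<^sup>2) * ennreal ((cmod (cinner n x u))\<^sup>2)}
      = uball n \<inter> {x \<in> space (cn n). 1 \<le> ennreal (C\<^sup>2 / a\<^sup>2) * ennreal ((cmod (cinner n x u))\<^sup>2)}"
      by (auto simp: uball_def)
    also have "\<dots> \<in> sets (cn n)" by measurable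
    finally show ?thesis .
  qed
  have "emeasure (cn n) {x \<in> uball n. a \<le> cmod (cinner n x y)}
     \<le> emeasure (cn n) {x \<in> uball n. 1 \<le> ennreal (C\<^sup>2 / a\<^sup>2) * ennreal ((cmod (cinner n x u))\<^sup>2)}"
    using sub ms by (rule emeasure_mono)
  also have "\<dots> \<le> ennreal (C\<^sup>2 / a\<^sup>2) * (\<integral>\<^sup>+x. ennreal ((cmod (cinner n x u))\<^sup>2) * indicator (uball n) x \<partial>cn n)"
    by (intro nn_integral_Markov_inequality) measurable
  also have "\<dots> \<le> ennreal (C\<^sup>2 / a\<^sup>2) * ennreal (vball n / n)"
    using second_moment[OF u] by (intro mult_left_mono) (simp_all add: mult.commute)
  also have "\<dots> = ennreal (vball n * C\<^sup>2 / (n * a\<^sup>2))"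
    using less_imp_le[OF vball_pos[of n]] by (simp add: ennreal_mult[symmetric] mult_ac)
  finally show ?thesis .
qed

text \<open>The vectors \<open>y\<close> stand for those drawn before and, in
  \<open>gnb_box_volume\<close>, for the centre of a box. Near-orthogonality to them keeps the cross
  terms of Gram kernels small.\<close>

definition goodv :: "nat \<Rightarrow> real \<Rightarrow> 'j set \<Rightarrow> ('j \<Rightarrow> nat \<Rightarrow> complex) \<Rightarrow> (nat \<Rightarrow> complex) \<Rightarrow> bool" where
  "goodv n \<eta> J y x \<longleftrightarrow> nrm n x \<le> 1 \<and> 1 - \<eta> \<le> (nrm n x)\<^sup>2 \<and> (\<forall>j\<in>J. cmod (cinner n x (y j)) \<le> \<eta>)"

definition goodt :: "'i set \<Rightarrow> nat \<Rightarrow> real \<Rightarrow> 'j set \<Rightarrow> ('j \<Rightarrow> nat \<Rightarrow> complex) \<Rightarrow> ('i \<Rightarrow> nat \<Rightarrow> complex) \<Rightarrow> bool" where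
  "goodt I n \<eta> J y X \<longleftrightarrow> (\<forall>i\<in>I. goodv n \<eta> J y (X i)) \<and> (\<forall>i\<in>I. \<forall>k\<in>I. i \<noteq> k \<longrightarrow> cmod (cinner n (X i) (X k)) \<le> \<eta>)"

lemma goodv_sets:
  assumes "finite J" shows "{x \<in> space (cn n). goodv n \<eta> J y x} \<in> sets (cn n)"
proof -
  have [measurable]: "(\<lambda>x. cinner n x (y j)) \<in> borel_measurable (cn n)" for j by measurable
  show ?thesis unfolding goodv_def using assms by measurable
qed

lemma goodt_sets:
  assumes "finite J" "finite I" shows "{X \<in> space (tn I n). goodt I n \<eta> J y X} \<in> sets (tn I n)"
proof -
  have [measurable]: "(\<lambda>X. cinner n (X i) (y j)) \<in> borel_measurable (tn I n)" if "i \<in> I" for i j using that by measurable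
  have [measurable]: "(\<lambda>X. cinner n (X i) (X k)) \<in> borel_measurable (tn I n)" if "i \<in> I" "k \<in> I" for i k using that by measurable
  have [measurable]: "(\<lambda>X. nrm n (X i)) \<in> borel_measurable (tn I n)" if "i \<in> I" for i using that by measurable
  show ?thesis unfolding goodt_def goodv_def using assms by measurable
qed

text \<open>Union bound: the smaller ball removes a fraction \<open>(1 - \<eta>) ^ n\<close> of the
  volume, and each vector of \<open>J\<close> a fraction of order \<open>1 / n\<close>.\<close>

lemma goodv_volume:
  assumes J: "finite J" and \<eta>: "0 < \<eta>" "\<eta> \<le> 1" and C: "C > 0" and y: "\<And>j. j \<in> J \<Longrightarrow> nrm n (y j) \<le> C" and n: "n > 0"
  shows "ennreal (vball n * (1 - (1 - \<eta>) ^ n - real (card J) * C\<^sup>2 / (n * \<eta>\<^sup>2))) \<le> emeasure (cn n) {x \<in> space (cn n). goodv n \<eta> J y x}"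
proof -
  let ?G = "{x \<in> space (cn n). goodv n \<eta> J y x}"
  let ?S = "{x \<in> space (cn n). (nrm n x)\<^sup>2 \<le> 1 - \<eta>}"
  let ?T = "\<lambda>j. {x \<in> uball n. \<eta> \<le> cmod (cinner n x (y j))}"
  have [measurable]: "(\<lambda>x. cinner n x (y j)) \<in> borel_measurable (cn n)" for j by measurable
  have G: "?G \<in> sets (cn n)" by (rule goodv_sets[OF J])
  have S: "?S \<in> sets (cn n)" by measurable
  have T: "?T j \<in> sets (cn n)" for j
  proof -
    have "?T j = uball n \<inter> {x \<in> space (cn n). \<eta> \<le> cmod (cinner n x (y j))}" by (auto simp: uball_def)
    also have "\<dots> \<in> sets (cn n)" by measurable
    finally show ?thesis .
  qed
  have v: "0 \<le> vball n" by (simp add: less_imp_le)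
  have "uball n \<subseteq> ?G \<union> (?S \<union> (\<Union>j\<in>J. ?T j))"
    by (auto simp: uball_def goodv_def not_le)
  then have "emeasure (cn n) (uball n) \<le> emeasure (cn n) (?G \<union> (?S \<union> (\<Union>j\<in>J. ?T j)))"
    using G S T J by (intro emeasure_mono sets.Un sets.finite_UN) auto
  also have "\<dots> \<le> emeasure (cn n) ?G + emeasure (cn n) (?S \<union> (\<Union>j\<in>J. ?T j))"
    using G S T J by (intro emeasure_subadditive sets.Un sets.finite_UN) auto
  also have "emeasure (cn n) (?S \<union> (\<Union>j\<in>J. ?T j)) \<le> emeasure (cn n) ?S + emeasure (cn n) (\<Union>j\<in>J. ?T j)"
    using S T J by (intro emeasure_subadditive sets.finite_UN) auto
  also have "emeasure (cn n) (\<Union>j\<in>J. ?T j) \<le> (\<Sum>j\<in>J. emeasure (cn n) (?T j))"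
    using T J by (intro emeasure_subadditive_finite) auto
  also have "\<dots> \<le> (\<Sum>j\<in>J. ennreal (vball n * C\<^sup>2 / (n * \<eta>\<^sup>2)))"
    using y C \<eta> n by (intro sum_mono inner_product_tail) auto
  also have "\<dots> = ennreal (real (card J) * (vball n * C\<^sup>2 / (n * \<eta>\<^sup>2)))"
    using v ennreal_mult[of "real (card J)" "vball n * C\<^sup>2 / (n * \<eta>\<^sup>2)"] by (simp add: ennreal_of_nat_eq_real_of_nat)
  also have "emeasure (cn n) ?S = ennreal (vball n * (1 - \<eta>) ^ n)" using \<eta> by (intro emeasure_ball_sq) simp
  finally have "ennreal (vball n) \<le> emeasure (cn n) ?G + (ennreal (vball n * (1 - \<eta>) ^ n) + ennreal (real (card J) * (vball n * C\<^sup>2 / (n * \<eta>\<^sup>2))))"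
    by (simp add: uball_emeasure add_left_mono)
  also have "ennreal (vball n * (1 - \<eta>) ^ n) + ennreal (real (card J) * (vball n * C\<^sup>2 / (n * \<eta>\<^sup>2)))
     = ennreal (vball n * (1 - \<eta>) ^ n + real (card J) * (vball n * C\<^sup>2 / (n * \<eta>\<^sup>2)))"
    using v \<eta> by (intro ennreal_plus[symmetric]) auto
  finally have "ennreal (vball n) - ennreal (vball n * (1 - \<eta>) ^ n + real (card J) * (vball n * C\<^sup>2 / (n * \<eta>\<^sup>2))) \<le> emeasure (cn n) ?G"
    by (subst ennreal_minus_le_iff) (auto simp: add.commute)
  also have "ennreal (vball n) - ennreal (vball n * (1 - \<eta>) ^ n + real (card J) * (vball n * C\<^sup>2 / (n * \<eta>\<^sup>2)))
     = ennreal (vball n * (1 - (1 - \<eta>) ^ n - real (card J) * C\<^sup>2 / (n * \<eta>\<^sup>2)))"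
    using v \<eta> by (subst ennreal_minus) (auto simp: algebra_simps)
  finally show ?thesis .
qed

text \<open>Vectors are added one at a time, and those already present join \<open>J\<close> through
  the sum type. \<open>M\<close> bounds the number of constraints at every stage, so that one factor
  \<open>\<kappa>\<close> serves throughout.\<close>

lemma goodt_volume:
  fixes I :: "'i set" and J :: "'j set"
  assumes I: "finite I" and J: "finite J" and \<eta>: "0 < \<eta>" "\<eta> \<le> 1" and C: "C \<ge> 1"
    and y: "\<And>j. j \<in> J \<Longrightarrow> nrm n (y j) \<le> C" and n: "n > 0" and M: "card I + card J \<le> M"
    and \<kappa>: "\<kappa> = 1 - (1 - \<eta>) ^ n - real M * C\<^sup>2 / (n * \<eta>\<^sup>2)" "\<kappa> \<ge> 0"
  shows "ennreal ((vball n * \<kappa>) ^ card I) \<le> emeasure (tn I n) {X \<in> space (tn I n). goodt I n \<eta> J y X}"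
  using I M
proof (induction I rule: finite_induct)
  case empty
  have "{X \<in> space (tn ({} :: 'i set) n). goodt {} n \<eta> J y X} = {\<lambda>_. undefined}" by (auto simp: space_tn goodt_def)
  then show ?case by (simp add: tn_def)
next
  case (insert x A)
  let ?G = "\<lambda>A. {X \<in> space (tn A n). goodt A n \<eta> J y X}"
  have G: "?G (insert x A) \<in> sets (tn (insert x A) n)" "?G A \<in> sets (tn A n)"
    using insert J by (auto intro!: goodt_sets)
  have v: "0 \<le> vball n * \<kappa>" using \<kappa> by (simp add: less_imp_le)
  have step: "indicator (?G A) X * ennreal (vball n * \<kappa>) \<le> (\<integral>\<^sup>+z. indicator (?G (insert x A)) (X(x := z)) \<partial>cn n)"
    if X: "X \<in> space (tn A n)" for X
  proof (cases "goodt A n \<eta> J y X")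
    case False
    then show ?thesis by (simp add: indicator_def)
  next
    case True
    let ?y = "case_sum y X"
    let ?V = "{z \<in> space (cn n). goodv n \<eta> (J <+> A) ?y z}"
    have V: "?V \<in> sets (cn n)" using J insert by (intro goodv_sets) auto
    have "real (card (J <+> A)) * C\<^sup>2 / (n * \<eta>\<^sup>2) \<le> real M * C\<^sup>2 / (n * \<eta>\<^sup>2)"
      using insert J n \<eta> by (intro divide_right_mono mult_right_mono) (auto simp: card_Plus)
    then have "vball n * \<kappa> \<le> vball n * (1 - (1 - \<eta>) ^ n - real (card (J <+> A)) * C\<^sup>2 / (n * \<eta>\<^sup>2))"
      unfolding \<kappa> by (intro mult_left_mono) (auto simp: less_imp_le)
    then have "ennreal (vball n * \<kappa>) \<le> ennreal (vball n * (1 - (1 - \<eta>) ^ n - real (card (J <+> A)) * C\<^sup>2 / (n * \<eta>\<^sup>2)))"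
      by (rule ennreal_leI)
    also have "\<dots> \<le> emeasure (cn n) ?V"
    proof (rule goodv_volume)
      show "nrm n (?y j) \<le> C" if "j \<in> J <+> A" for j
        using that y True C by (auto simp: goodt_def goodv_def intro: order_trans)
    qed (use insert J \<eta> C n in auto)
    also have "\<dots> = (\<integral>\<^sup>+z. indicator ?V z \<partial>cn n)" using V by simp
    also have "\<dots> \<le> (\<integral>\<^sup>+z. indicator (?G (insert x A)) (X(x := z)) \<partial>cn n)"
    proof (rule nn_integral_mono)
      fix z assume z: "z \<in> space (cn n)"
      have "X(x := z) \<in> ?G (insert x A)" if "z \<in> ?V"
      proof -
        have gz: "goodv n \<eta> J y z" "\<And>a. a \<in> A \<Longrightarrow> cmod (cinner n z (X a)) \<le> \<eta>"
          using that by (auto simp: goodv_def dest!: bspec)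
        have gz': "cmod (cinner n (X a) z) \<le> \<eta>" if "a \<in> A" for a
          using gz(2)[OF that] by (subst cinner_commute) simp
        have "X(x := z) \<in> space (tn (insert x A) n)"
          using X z by (auto simp: space_tn PiE_iff extensional_def)
        moreover have "goodt (insert x A) n \<eta> J y (X(x := z))"
          using True gz gz' insert.hyps by (auto simp: goodt_def)
        ultimately show ?thesis by simp
      qed
      then show "indicator ?V z \<le> (indicator (?G (insert x A)) (X(x := z)) :: ennreal)"
        by (auto simp: indicator_def)
    qed
    finally show ?thesis using True X by (simp add: indicator_def)
  qed
  have "ennreal ((vball n * \<kappa>) ^ card (insert x A)) = ennreal ((vball n * \<kappa>) ^ card A) * ennreal (vball n * \<kappa>)"
    using insert v by (simp add: ennreal_mult mult.commute)
  also have "\<dots> \<le> emeasure (tn A n) (?G A) * ennreal (vball n * \<kappa>)"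
    using insert by (intro mult_right_mono) auto
  also have "\<dots> = (\<integral>\<^sup>+X. indicator (?G A) X * ennreal (vball n * \<kappa>) \<partial>tn A n)"
    using G by (simp add: nn_integral_multc)
  also have "\<dots> \<le> (\<integral>\<^sup>+X. \<integral>\<^sup>+z. indicator (?G (insert x A)) (X(x := z)) \<partial>cn n \<partial>tn A n)"
    by (intro nn_integral_mono step)
  also have "\<dots> = integral\<^sup>N (tn (insert x A) n) (indicator (?G (insert x A)))"
    using insert.hyps G(1) unfolding tn_def
    by (intro tprod.product_nn_integral_insert[symmetric]) auto
  also have "\<dots> = emeasure (tn (insert x A) n) (?G (insert x A))" using G by simp
  finally show ?case .
qed

text \<open>The factor \<kappa> tends to 1. The threshold in \<open>n\<close> does not depend on
  \<open>y\<close>, as is needed for centres that vary with \<open>n\<close>.\<close>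

lemma goodt_volume_eventually:
  fixes I :: "'i set" and J :: "'j set"
  assumes I: "finite I" and J: "finite J" and \<eta>: "0 < \<eta>" "\<eta> \<le> 1" and C: "C \<ge> 1"
  shows "\<forall>\<^sub>F n in sequentially. \<forall>y. (\<forall>j\<in>J. nrm n (y j) \<le> C) \<longrightarrow>
    ennreal (vball n ^ card I / 2) \<le> emeasure (tn I n) {X \<in> space (tn I n). goodt I n \<eta> J y X}"
proof -
  define M where "M = card I + card J"
  define \<kappa> where "\<kappa> n = 1 - (1 - \<eta>) ^ n - real M * C\<^sup>2 / (real n * \<eta>\<^sup>2)" for n
  have 1: "(\<lambda>n. (1 - \<eta>) ^ n) \<longlonglongrightarrow> 0" using \<eta> by (intro LIMSEQ_power_zero) (auto simp: abs_if)
  have 2: "(\<lambda>n. real M * C\<^sup>2 / (real n * \<eta>\<^sup>2)) \<longlonglongrightarrow> 0"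
  proof -
    have "(\<lambda>n. (real M * C\<^sup>2 / \<eta>\<^sup>2) / real n) \<longlonglongrightarrow> 0" by (rule lim_const_over_n)
    then show ?thesis by (simp add: mult.commute)
  qed
  have lim: "\<kappa> \<longlonglongrightarrow> 1 - 0 - 0" unfolding \<kappa>_def by (rule tendsto_diff[OF tendsto_diff[OF tendsto_const 1] 2])
  then have "(\<lambda>n. \<kappa> n ^ card I) \<longlonglongrightarrow> 1" using tendsto_power[OF lim, of "card I"] by simp
  then have "\<forall>\<^sub>F n in sequentially. \<kappa> n ^ card I > 1 / 2" by (rule order_tendstoD) simp
  moreover have "\<forall>\<^sub>F n in sequentially. \<kappa> n > 0" using lim by (rule order_tendstoD) simp
  moreover have "\<forall>\<^sub>F n in sequentially. n > 0" by (rule eventually_gt_at_top)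
  ultimately show ?thesis
  proof eventually_elim
    case (elim n)
    show ?case
    proof (intro allI impI)
      fix y assume y: "\<forall>j\<in>J. nrm n (y j) \<le> C"
      have "vball n ^ card I / 2 \<le> vball n ^ card I * \<kappa> n ^ card I"
        using elim mult_left_mono[of "1/2" "\<kappa> n ^ card I" "vball n ^ card I"] by (simp add: less_imp_le)
      then have "ennreal (vball n ^ card I / 2) \<le> ennreal ((vball n * \<kappa> n) ^ card I)"
        by (intro ennreal_leI) (simp add: power_mult_distrib)
      also have "\<dots> \<le> emeasure (tn I n) {X \<in> space (tn I n). goodt I n \<eta> J y X}"
        using y elim by (intro goodt_volume[OF I J \<eta> C _ _ _ \<kappa>_def]) (auto simp: M_def)
      finally show "ennreal (vball n ^ card I / 2) \<le> emeasure (tn I n) {X \<in> space (tn I n). goodt I n \<eta> J y X}" .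
    qed
  qed
qed

lemma goodt_close:
  assumes "goodt I n \<eta> J y X" shows "close_on I \<eta> kron (gram n X)"
  unfolding close_on_def
proof (intro ballI)
  fix p q assume pq: "p \<in> I" "q \<in> I"
  show "cmod (gram n X p q - kron p q) \<le> \<eta>"
  proof (cases "p = q")
    case True
    have g: "nrm n (X q) \<le> 1" "1 - \<eta> \<le> (nrm n (X q))\<^sup>2" using assms pq by (auto simp: goodt_def goodv_def)
    have "gram n X q q - 1 = complex_of_real ((nrm n (X q))\<^sup>2 - 1)" by (simp add: gram_def cinner_self)
    then have "cmod (gram n X q q - 1) = \<bar>(nrm n (X q))\<^sup>2 - 1\<bar>" by (simp only: norm_of_real)
    moreover have "(nrm n (X q))\<^sup>2 \<le> 1" using g by (simp add: power_le_one)
    ultimately show ?thesis using True g by simp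
  next
    case False
    then show ?thesis using assms pq by (auto simp: goodt_def gram_def)
  qed
qed

subsection \<open>Volumes of Gram neighbourhoods\<close>

definition gnb :: "'i set \<Rightarrow> nat \<Rightarrow> ('i \<Rightarrow> 'i \<Rightarrow> complex) \<Rightarrow> real \<Rightarrow> ('i \<Rightarrow> nat \<Rightarrow> complex) set" where
  "gnb I n Q \<eta> = {X \<in> space (tn I n). close_on I \<eta> Q (gram n X)}"

lemma gram_measurable [measurable]: "p \<in> I \<Longrightarrow> q \<in> I \<Longrightarrow> (\<lambda>X. gram n X p q) \<in> borel_measurable (tn I n)"
  unfolding gram_def by measurable

lemma gnb_sets [measurable]: "finite I \<Longrightarrow> gnb I n Q \<eta> \<in> sets (tn I n)"
  unfolding gnb_def close_on_def by measurable

text \<open>The Jacobian of the Cholesky factor is the power \<open>n\<close> of the determinant,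
  because the squared diagonal moduli multiply to the determinant.\<close>

lemma emeasure_cmb:
  assumes fin: "finite I" and ch: "chol I Q R S" and A: "A \<in> sets (tn I n)"
  shows "emeasure (tn I n) A = ennreal (Re (det_on I Q) ^ n) * emeasure (tn I n) {X \<in> space (tn I n). cmb I n R X \<in> A}"
proof -
  have "Re (det_on I Q) ^ n = (\<Prod>l\<in>I. (cmod (R l l)) ^ (2 * n))"
  proof -
    have "Re (det_on I Q) = (\<Prod>l\<in>I. (cmod (R l l))\<^sup>2)"
      using ch unfolding chol_def by (metis Re_complex_of_real)
    then show ?thesis by (simp add: prod_power_distrib power_mult)
  qed
  moreover have "ennreal (\<Prod>l\<in>I. (cmod (R l l)) ^ (2 * n)) * (\<integral>\<^sup>+X. indicator A (cmb I n R X) \<partial>tn I n) = integral\<^sup>N (tn I n) (indicator A)"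
    using ch A by (intro tri_change_of_variables) (auto simp: chol_def)
  moreover have "(\<integral>\<^sup>+X. indicator A (cmb I n R X) \<partial>tn I n) = (\<integral>\<^sup>+X. indicator {X \<in> space (tn I n). cmb I n R X \<in> A} X \<partial>tn I n)"
    by (intro nn_integral_cong) (simp add: indicator_def)
  moreover have "{X \<in> space (tn I n). cmb I n R X \<in> A} \<in> sets (tn I n)"
    using measurable_sets[OF cmb_measurable A] by (simp add: vimage_def Int_def conj_commute)
  ultimately show ?thesis using A by simp
qed

lemma gram_cmb: "p \<in> I \<Longrightarrow> q \<in> I \<Longrightarrow> gram n (cmb I n R X) p q = gram n (comb I R X) p q"
  by (intro gram_cong) (auto simp: cmb_def comb_def)

text \<open>A positive diagonal shift makes every positive semidefinite kernel invertible. Upper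
  volume bounds pass through it, so they hold for singular kernels too.\<close>

definition shiftdiag :: "real \<Rightarrow> ('i \<Rightarrow> 'i \<Rightarrow> complex) \<Rightarrow> 'i \<Rightarrow> 'i \<Rightarrow> complex" where
  "shiftdiag t Q = (\<lambda>p q. Q p q + (if p = q then complex_of_real t else 0))"

lemma qf_shiftdiag:
  assumes "finite I" shows "qf I (shiftdiag t Q) a = qf I Q a + complex_of_real (t * (\<Sum>p\<in>I. (cmod (a p))\<^sup>2))"
proof -
  have "qf I (shiftdiag t Q) a = qf I Q a + (\<Sum>p\<in>I. \<Sum>q\<in>I. if p = q then complex_of_real t * (a p * cnj (a p)) else 0)"
    unfolding qf_def shiftdiag_def sum.distrib[symmetric] by (intro sum.cong refl) (simp add: algebra_simps)
  also have "(\<Sum>p\<in>I. \<Sum>q\<in>I. if p = q then complex_of_real t * (a p * cnj (a p)) else 0) = (\<Sum>p\<in>I. complex_of_real t * (a p * cnj (a p)))"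
    using assms by simp
  also have "\<dots> = complex_of_real (t * (\<Sum>p\<in>I. (cmod (a p))\<^sup>2))"
    by (simp only: complex_norm_square[symmetric] of_real_sum of_real_mult sum_distrib_left)
  finally show ?thesis .
qed

lemma shiftdiag_chol:
  assumes fin: "finite I" and psd: "psd I Q" and t: "t > 0"
  shows "\<exists>R S. chol I (shiftdiag t Q) R S"
proof (rule strictly_pd_chol[OF fin])
  have s: "0 \<le> (\<Sum>p\<in>I. (cmod (a p))\<^sup>2)" for a :: "'a \<Rightarrow> complex" by (intro sum_nonneg) auto
  show "psd I (shiftdiag t Q)" using psd t s by (auto simp: psd_def qf_shiftdiag[OF fin])
  fix a :: "'a \<Rightarrow> complex" assume ex: "\<exists>i\<in>I. a i \<noteq> 0"
  obtain i where i: "i \<in> I" "a i \<noteq> 0" using ex by auto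
  then have "(\<Sum>p\<in>I. (cmod (a p))\<^sup>2) > 0" using fin by (intro sum_pos2[of _ i]) auto
  then have "t * (\<Sum>p\<in>I. (cmod (a p))\<^sup>2) > 0" using t by simp
  moreover have "Re (qf I Q a) \<ge> 0" using psd by (auto simp: psd_def)
  ultimately show "0 < Re (qf I (shiftdiag t Q) a)" unfolding qf_shiftdiag[OF fin] by simp
qed

definition tbox :: "'i set \<Rightarrow> nat \<Rightarrow> ('i \<Rightarrow> nat \<Rightarrow> complex) \<Rightarrow> real \<Rightarrow> ('i \<Rightarrow> nat \<Rightarrow> complex) set" where
  "tbox I n c \<epsilon> = {Z \<in> space (tn I n). \<forall>i\<in>I. nrm n (\<lambda>l. Z i l - c i l) \<le> \<epsilon>}"

lemma tbox_sets [measurable]: "finite I \<Longrightarrow> tbox I n c \<epsilon> \<in> sets (tn I n)"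
  unfolding tbox_def by measurable

lemma emeasure_tbox:
  assumes fin: "finite I" and \<epsilon>: "0 \<le> \<epsilon>"
  shows "emeasure (tn I n) (tbox I n c \<epsilon>) = ennreal ((vball n * \<epsilon> ^ (2 * n)) ^ card I)"
proof -
  have "tbox I n c \<epsilon> = PiE I (\<lambda>i. {x \<in> space (cn n). nrm n (\<lambda>l. x l - c i l) \<le> \<epsilon>})"
    by (auto simp: tbox_def space_tn PiE_iff extensional_def)
  then have "emeasure (tn I n) (tbox I n c \<epsilon>) = (\<Prod>i\<in>I. emeasure (cn n) {x \<in> space (cn n). nrm n (\<lambda>l. x l - c i l) \<le> \<epsilon>})"
    unfolding tn_def using fin by (simp add: tprod.emeasure_PiM)
  also have "\<dots> = ennreal ((vball n * \<epsilon> ^ (2 * n)) ^ card I)"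
    using \<epsilon> by (simp add: emeasure_ball ennreal_power less_imp_le)
  finally show ?thesis .
qed

text \<open>In coordinates normalized by the factor of the shifted kernel, every tuple of the
  neighbourhood lies in a product of unit balls: the squared norm of a normalized vector is the Gram
  form at a column of \<open>S\<close>, and the shift \<open>t\<close> absorbs the error
  \<open>\<eta> * card I\<close>.\<close>

lemma gnb_volume_upper:
  assumes fin: "finite I" and psd: "psd I Q" and t: "t > 0" and \<eta>: "\<eta> * real (card I) \<le> t"
  shows "emeasure (tn I n) (gnb I n Q \<eta>) \<le> ennreal (Re (det_on I (shiftdiag t Q)) ^ n * vball n ^ card I)"
proof -
  obtain R S where ch: "chol I (shiftdiag t Q) R S" using shiftdiag_chol[OF fin psd t] by blast
  have sub: "{X \<in> space (tn I n). cmb I n R X \<in> gnb I n Q \<eta>} \<subseteq> tbox I n (\<lambda>_ _. 0) 1"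
  proof
    fix E assume "E \<in> {X \<in> space (tn I n). cmb I n R X \<in> gnb I n Q \<eta>}"
    then have E: "E \<in> space (tn I n)" and cl: "close_on I \<eta> Q (gram n (cmb I n R E))" by (auto simp: gnb_def)
    have "nrm n (E i) \<le> 1" if i: "i \<in> I" for i
    proof -
      have "(\<Sum>q\<in>I. cmb I n R E q l * S q i) = E i l" if l: "l < n" for l
      proof -
        have "(\<Sum>q\<in>I. cmb I n R E q l * S q i) = (\<Sum>q\<in>I. \<Sum>p\<in>I. E p l * (R p q * S q i))"
          using l by (simp add: cmb_def sum_distrib_left sum_distrib_right mult_ac)
        also have "\<dots> = (\<Sum>p\<in>I. E p l * (\<Sum>q\<in>I. R p q * S q i))"
          by (subst sum.swap) (simp add: sum_distrib_left)
        also have "\<dots> = (\<Sum>p\<in>I. if p = i then E i l else 0)"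
          using ch i by (intro sum.cong refl) (auto simp: chol_def)
        also have "\<dots> = E i l" using fin i by simp
        finally show ?thesis .
      qed
      then have "nrm n (E i) = nrm n (\<lambda>l. \<Sum>q\<in>I. cmb I n R E q l * S q i)" by (intro nrm_cong) simp
      then have "(nrm n (E i))\<^sup>2 = Re (qf I (gram n (cmb I n R E)) (\<lambda>q. S q i))" by (simp add: qf_gram)
      also have "\<dots> \<le> Re (qf I Q (\<lambda>q. S q i)) + \<eta> * real (card I) * (\<Sum>p\<in>I. (cmod (S p i))\<^sup>2)"
        using qf_perturb[OF fin, of "gram n (cmb I n R E)" Q \<eta> "\<lambda>q. S q i"] cl by (auto simp: close_on_def abs_le_iff)
      also have "\<dots> \<le> Re (qf I Q (\<lambda>q. S q i)) + t * (\<Sum>p\<in>I. (cmod (S p i))\<^sup>2)"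
        using \<eta> by (intro add_left_mono mult_right_mono sum_nonneg) auto
      also have "\<dots> = Re (qf I (shiftdiag t Q) (\<lambda>q. S q i))" by (simp add: qf_shiftdiag[OF fin])
      also have "\<dots> = 1" using chol_column[OF fin ch i] by simp
      finally have "(nrm n (E i))\<^sup>2 \<le> 1\<^sup>2" by simp
      then show ?thesis by (rule power2_le_imp_le) simp
    qed
    then show "E \<in> tbox I n (\<lambda>_ _. 0) 1" using E by (simp add: tbox_def)
  qed
  have "emeasure (tn I n) (gnb I n Q \<eta>) = ennreal (Re (det_on I (shiftdiag t Q)) ^ n) * emeasure (tn I n) {X \<in> space (tn I n). cmb I n R X \<in> gnb I n Q \<eta>}"
    using fin by (intro emeasure_cmb[OF fin ch]) auto
  also have "\<dots> \<le> ennreal (Re (det_on I (shiftdiag t Q)) ^ n) * ennreal (vball n ^ card I)"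
    using emeasure_mono[OF sub tbox_sets[OF fin]] emeasure_tbox[OF fin, of 1 n "\<lambda>_ _. 0"] by (intro mult_left_mono) simp_all
  also have "\<dots> = ennreal (Re (det_on I (shiftdiag t Q)) ^ n * vball n ^ card I)"
    by (intro ennreal_mult''[symmetric]) (simp add: less_imp_le)
  finally show ?thesis .
qed

lemma bounded_chol_det_pos: "finite I \<Longrightarrow> bounded_chol I b Q R S \<Longrightarrow> Re (det_on I Q) > 0"
proof -
  assume "finite I" "bounded_chol I b Q R S"
  then have "chol I Q R S" and pos: "(\<Prod>l\<in>I. (cmod (R l l))\<^sup>2) > 0"
    using chol_nonzero[of I Q R S] by (auto simp: bounded_chol_def)
  then have "det_on I Q = complex_of_real (\<Prod>l\<in>I. (cmod (R l l))\<^sup>2)" by (simp add: chol_def)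
  then show ?thesis using pos by (simp only: Re_complex_of_real)
qed

text \<open>The Cholesky factor maps nearly orthonormal tuples, which have at least half the volume
  of a product of unit balls, into the neighbourhood. The threshold in \<open>n\<close> is the same
  for all \<open>Q\<close> with bound \<open>b\<close>.\<close>

lemma gnb_volume_lower:
  assumes fin: "finite I" and b: "b \<ge> 1" and \<eta>: "\<eta> > 0"
  shows "\<forall>\<^sub>F n in sequentially. \<forall>Q R S. bounded_chol I b Q R S \<longrightarrow>
    ennreal (Re (det_on I Q) ^ n * vball n ^ card I / 2) \<le> emeasure (tn I n) (gnb I n Q \<eta>)"
proof -
  define \<eta>' where "\<eta>' = min 1 (\<eta> / ((real (card I) * b)\<^sup>2 + 1))"
  have pos: "(real (card I) * b)\<^sup>2 + 1 > 0" by (simp add: add_nonneg_pos)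
  have \<eta>': "\<eta>' > 0" "\<eta>' \<le> 1" using \<eta> pos by (auto simp: \<eta>'_def)
  have \<eta>'': "(real (card I) * b)\<^sup>2 * \<eta>' \<le> \<eta>"
  proof -
    have "(real (card I) * b)\<^sup>2 * \<eta>' \<le> ((real (card I) * b)\<^sup>2 + 1) * \<eta>'" using \<eta>' by (intro mult_right_mono) auto
    also have "\<dots> \<le> ((real (card I) * b)\<^sup>2 + 1) * (\<eta> / ((real (card I) * b)\<^sup>2 + 1))"
      using pos by (intro mult_left_mono) (auto simp: \<eta>'_def)
    also have "\<dots> = \<eta>" using pos by simp
    finally show ?thesis .
  qed
  have "\<forall>\<^sub>F n in sequentially. \<forall>y. (\<forall>j\<in>({}::nat set). nrm n (y j) \<le> 1) \<longrightarrow>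
    ennreal (vball n ^ card I / 2) \<le> emeasure (tn I n) {X \<in> space (tn I n). goodt I n \<eta>' ({}::nat set) y X}"
    using fin \<eta>' by (intro goodt_volume_eventually) auto
  then show ?thesis
  proof eventually_elim
    case (elim n)
    let ?G = "{X \<in> space (tn I n). goodt I n \<eta>' ({}::nat set) (\<lambda>_ _. 0) X}"
    have G: "ennreal (vball n ^ card I / 2) \<le> emeasure (tn I n) ?G" using elim by simp
    show ?case
    proof (intro allI impI)
      fix Q R S assume bc: "bounded_chol I b Q R S"
      have ch: "chol I Q R S" and Rb: "\<And>p q. p \<in> I \<Longrightarrow> q \<in> I \<Longrightarrow> cmod (R p q) \<le> b"
        using bc by (auto simp: bounded_chol_def)
      have sub: "?G \<subseteq> {X \<in> space (tn I n). cmb I n R X \<in> gnb I n Q \<eta>}"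
      proof safe
        fix E assume E: "E \<in> space (tn I n)" "goodt I n \<eta>' ({}::nat set) (\<lambda>_ _. 0) E"
        have "close_on I \<eta> Q (gram n (cmb I n R E))"
          unfolding close_on_def
        proof (intro ballI)
          fix p q assume pq: "p \<in> I" "q \<in> I"
          have "cmod (gram n (comb I R E) p q - Q p q) \<le> (real (card I) * b)\<^sup>2 * \<eta>'"
            using gram_comb_close[of I R b \<eta>' kron n E p q, OF fin Rb goodt_close[OF E(2)] pq] chol_conj_sum[OF fin ch pq] by simp
          then show "cmod (gram n (cmb I n R E) p q - Q p q) \<le> \<eta>" using \<eta>'' pq by (simp add: gram_cmb)
        qed
        then show "cmb I n R E \<in> gnb I n Q \<eta>"
          using measurable_space[OF cmb_measurable E(1)] by (simp add: gnb_def)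
      qed
      have ms: "{X \<in> space (tn I n). cmb I n R X \<in> gnb I n Q \<eta>} \<in> sets (tn I n)"
        using measurable_sets[OF cmb_measurable gnb_sets[OF fin]] by (simp add: vimage_def Int_def conj_commute)
      have "ennreal (Re (det_on I Q) ^ n * vball n ^ card I / 2) = ennreal (Re (det_on I Q) ^ n) * ennreal (vball n ^ card I / 2)"
        using bounded_chol_det_pos[OF fin bc] by (subst ennreal_mult[symmetric]) (auto simp: less_imp_le)
      also have "\<dots> \<le> ennreal (Re (det_on I Q) ^ n) * emeasure (tn I n) {X \<in> space (tn I n). cmb I n R X \<in> gnb I n Q \<eta>}"
        using order_trans[OF G emeasure_mono[OF sub ms]] by (intro mult_left_mono) auto
      also have "\<dots> = emeasure (tn I n) (gnb I n Q \<eta>)"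
        using fin by (intro emeasure_cmb[OF fin ch, symmetric]) auto
      finally show "ennreal (Re (det_on I Q) ^ n * vball n ^ card I / 2) \<le> emeasure (tn I n) (gnb I n Q \<eta>)" .
    qed
  qed
qed

subsection \<open>The transition kernel of a Haar unitary\<close>

definition pk :: "'i set \<Rightarrow> nat \<Rightarrow> real \<Rightarrow> ('i \<Rightarrow> nat \<Rightarrow> complex) \<Rightarrow> ('i \<Rightarrow> nat \<Rightarrow> complex) \<Rightarrow> ennreal" where
  "pk I n \<epsilon> A Z = emeasure (haar n) {U \<in> umat n. \<forall>i\<in>I. nrm n (\<lambda>l. mult n U (A i) l - Z i l) \<le> \<epsilon>}"

interpretation haar: prob_space "haar n" for n
  by (rule prob_space_haar)

lemma mult_haar_measurable [measurable (raw)]: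
  assumes "f \<in> M \<rightarrow>\<^sub>M haar n" "\<And>l. l < n \<Longrightarrow> (\<lambda>x. g x l) \<in> borel_measurable M" "i < n"
  shows "(\<lambda>x. mult n (f x) (g x) i) \<in> borel_measurable M"
proof -
  have f: "f \<in> M \<rightarrow>\<^sub>M hs n" using assms(1) measurable_cong_sets[OF refl sets_haar] by blast
  show ?thesis unfolding mult_def
    using hs_entry[OF f] assms(2,3) by (intro borel_measurable_sum borel_measurable_times) auto
qed

lemma pk_set:
  assumes fin: "finite I"
  shows "{U \<in> umat n. \<forall>i\<in>I. nrm n (\<lambda>l. mult n U (A i) l - Z i l) \<le> \<epsilon>} \<in> sets (haar n)"
proof -
  have [measurable]: "(\<lambda>U. nrm n (\<lambda>l. mult n U (A i) l - Z i l)) \<in> borel_measurable (haar n)" for i by measurable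
  have "{U \<in> space (haar n). \<forall>i\<in>I. nrm n (\<lambda>l. mult n U (A i) l - Z i l) \<le> \<epsilon>} \<in> sets (haar n)"
    using fin by measurable
  then show ?thesis by (simp add: space_haar)
qed

lemma mult_mmul: "mult n (mmul n W U) x l = mult n W (mult n U x) l" if "l < n"
proof -
  have "mult n (mmul n W U) x l = (\<Sum>j<n. \<Sum>k<n. W (l, k) * (U (k, j) * x j))"
    using that by (simp add: mult_def mmul_def sum_distrib_left sum_distrib_right mult_ac)
  also have "\<dots> = (\<Sum>k<n. \<Sum>j<n. W (l, k) * (U (k, j) * x j))" by (rule sum.swap)
  also have "\<dots> = mult n W (mult n U x) l" by (simp add: mult_def sum_distrib_left)
  finally show ?thesis .
qed

text \<open>Left multiplication by \<open>W\<close> preserves Haar measure and moves the target by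
  \<open>W\<close>, so targets that \<open>W\<close> nearly maps to one another have comparable
  probabilities.\<close>

lemma pk_compare:
  assumes fin: "finite I" and W: "W \<in> umat n" and d: "\<And>i. i \<in> I \<Longrightarrow> nrm n (\<lambda>l. mult n W (Z i) l - Z' i l) \<le> \<delta>"
  shows "pk I n \<epsilon> A Z \<le> pk I n (\<epsilon> + \<delta>) A Z'"
proof -
  let ?X = "{U \<in> umat n. \<forall>i\<in>I. nrm n (\<lambda>l. mult n U (A i) l - Z' i l) \<le> \<epsilon> + \<delta>}"
  have X: "?X \<in> sets (haar n)" by (rule pk_set[OF fin])
  have Y: "{U \<in> space (haar n). mmul n W U \<in> ?X} \<in> sets (haar n)"
  proof -
    have "(\<lambda>U. mmul n W U) \<in> haar n \<rightarrow>\<^sub>M hs n"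
    proof (rule measurable_into_hs)
      fix i j assume ij: "i < n" "j < n"
      have eq: "mmul n W U (i, j) = (\<Sum>l<n. W (i, l) * U (l, j))" for U using ij by (simp add: mmul_def)
      show "(\<lambda>U. mmul n W U (i, j)) \<in> borel_measurable (haar n)"
        unfolding eq measurable_cong_sets[OF sets_haar refl] using ij by measurable
    qed (auto simp: space_haar intro: mmul_umat W)
    from measurable_sets[OF this, of ?X] X show ?thesis
      by (simp add: vimage_def Int_def conj_commute sets_haar)
  qed
  have "{U \<in> umat n. \<forall>i\<in>I. nrm n (\<lambda>l. mult n U (A i) l - Z i l) \<le> \<epsilon>} \<subseteq> {U \<in> space (haar n). mmul n W U \<in> ?X}"
  proof safe
    fix U assume U: "U \<in> umat n" and c: "\<forall>i\<in>I. nrm n (\<lambda>l. mult n U (A i) l - Z i l) \<le> \<epsilon>"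
    show "U \<in> space (haar n)" using U by (simp add: space_haar)
    show "mmul n W U \<in> umat n" using W U by (rule mmul_umat)
    fix i assume i: "i \<in> I"
    have "nrm n (\<lambda>l. mult n (mmul n W U) (A i) l - mult n W (Z i) l) = nrm n (mult n W (\<lambda>l. mult n U (A i) l - Z i l))"
      by (rule nrm_cong) (simp add: mult_mmul mult_diff)
    also have "\<dots> \<le> \<epsilon>" using c i by (simp add: nrm_mult[OF W])
    finally have "nrm n (\<lambda>l. mult n (mmul n W U) (A i) l - mult n W (Z i) l) \<le> \<epsilon>" .
    then show "nrm n (\<lambda>l. mult n (mmul n W U) (A i) l - Z' i l) \<le> \<epsilon> + \<delta>"
      using nrm_triangle[of n "mult n (mmul n W U) (A i)" "Z' i" "mult n W (Z i)"] d[OF i] by linarith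
  qed
  then have "pk I n \<epsilon> A Z \<le> emeasure (haar n) {U \<in> space (haar n). mmul n W U \<in> ?X}"
    unfolding pk_def using Y by (intro emeasure_mono)
  also have "\<dots> = pk I n (\<epsilon> + \<delta>) A Z'" unfolding pk_def by (rule haar_invariant[OF W X])
  finally show ?thesis .
qed

text \<open>Tonelli. It converts averages of transition probabilities over targets into volumes
  around the random image of \<open>A\<close>, which can be estimated for each \<open>U\<close>
  separately.\<close>

lemma pk_integral:
  assumes fin: "finite I" and G: "G \<in> sets (tn I n)"
  shows "(\<integral>\<^sup>+Z. pk I n \<epsilon> A Z * indicator G Z \<partial>tn I n) = (\<integral>\<^sup>+U. emeasure (tn I n) (G \<inter> tbox I n (\<lambda>i. mult n U (A i)) \<epsilon>) \<partial>haar n)"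
proof -
  interpret tn: sigma_finite_measure "tn I n" by (rule sigma_finite_tn[OF fin])
  interpret pair_sigma_finite "haar n" "tn I n" ..
  define h where "h U Z = (indicator {x \<in> space (haar n \<Otimes>\<^sub>M tn I n). snd x \<in> G \<and> (\<forall>i\<in>I. nrm n (\<lambda>l. mult n (fst x) (A i) l - snd x i l) \<le> \<epsilon>)} (U, Z) :: ennreal)" for U Z
  have [measurable]: "(\<lambda>x. nrm n (\<lambda>l. mult n (fst x) (A i) l - snd x i l)) \<in> borel_measurable (haar n \<Otimes>\<^sub>M tn I n)" if "i \<in> I" for i
    using that by measurable
  have S: "{x \<in> space (haar n \<Otimes>\<^sub>M tn I n). snd x \<in> G \<and> (\<forall>i\<in>I. nrm n (\<lambda>l. mult n (fst x) (A i) l - snd x i l) \<le> \<epsilon>)} \<in> sets (haar n \<Otimes>\<^sub>M tn I n)"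
    using fin G by measurable
  have h: "(\<lambda>(U, Z). h U Z) \<in> borel_measurable (haar n \<Otimes>\<^sub>M tn I n)"
    unfolding h_def using S by simp
  have "(\<integral>\<^sup>+Z. pk I n \<epsilon> A Z * indicator G Z \<partial>tn I n) = (\<integral>\<^sup>+Z. \<integral>\<^sup>+U. h U Z \<partial>haar n \<partial>tn I n)"
  proof (rule nn_integral_cong)
    fix Z assume Z: "Z \<in> space (tn I n)"
    have "(\<integral>\<^sup>+U. h U Z \<partial>haar n) = (\<integral>\<^sup>+U. indicator {U \<in> umat n. \<forall>i\<in>I. nrm n (\<lambda>l. mult n U (A i) l - Z i l) \<le> \<epsilon>} U * indicator G Z \<partial>haar n)"
      using Z by (intro nn_integral_cong) (auto simp: h_def indicator_def space_pair_measure space_haar)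
    also have "\<dots> = pk I n \<epsilon> A Z * indicator G Z"
      unfolding pk_def using pk_set[OF fin] by (simp add: nn_integral_multc)
    finally show "pk I n \<epsilon> A Z * indicator G Z = (\<integral>\<^sup>+U. h U Z \<partial>haar n)" by simp
  qed
  also have "\<dots> = (\<integral>\<^sup>+U. \<integral>\<^sup>+Z. h U Z \<partial>tn I n \<partial>haar n)" using h by (rule Fubini')
  also have "\<dots> = (\<integral>\<^sup>+U. emeasure (tn I n) (G \<inter> tbox I n (\<lambda>i. mult n U (A i)) \<epsilon>) \<partial>haar n)"
  proof (rule nn_integral_cong)
    fix U assume U: "U \<in> space (haar n)"
    have "(\<integral>\<^sup>+Z. h U Z \<partial>tn I n) = (\<integral>\<^sup>+Z. indicator (G \<inter> tbox I n (\<lambda>i. mult n U (A i)) \<epsilon>) Z \<partial>tn I n)"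
      using U by (intro nn_integral_cong) (auto simp: h_def indicator_def space_pair_measure tbox_def nrm_diff_commute)
    also have "\<dots> = emeasure (tn I n) (G \<inter> tbox I n (\<lambda>i. mult n U (A i)) \<epsilon>)"
      using fin G by (intro nn_integral_indicator) auto
    finally show "(\<integral>\<^sup>+Z. h U Z \<partial>tn I n) = emeasure (tn I n) (G \<inter> tbox I n (\<lambda>i. mult n U (A i)) \<epsilon>)" .
  qed
  finally show ?thesis .
qed

lemma ennreal_le_divideI:
  assumes "x * ennreal g \<le> ennreal h" "g > 0" "h \<ge> 0" shows "x \<le> ennreal (h / g)"
proof -
  have "x = x * ennreal g * ennreal (1 / g)"
    using assms by (simp add: mult.assoc ennreal_mult[symmetric])
  also have "\<dots> \<le> ennreal h * ennreal (1 / g)" using assms by (intro mult_right_mono) auto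
  also have "\<dots> = ennreal (h / g)" using assms by (simp add: ennreal_mult[symmetric])
  finally show ?thesis .
qed

lemma ennreal_divide_leI:
  assumes "ennreal h \<le> x * ennreal g" "g > 0" "h \<ge> 0" shows "ennreal (h / g) \<le> x"
proof -
  have "ennreal (h / g) = ennreal h * ennreal (1 / g)" using assms by (simp add: ennreal_mult[symmetric])
  also have "\<dots> \<le> x * ennreal g * ennreal (1 / g)" using assms by (intro mult_right_mono) auto
  also have "\<dots> = x" using assms by (simp add: mult.assoc ennreal_mult[symmetric])
  finally show ?thesis .
qed

text \<open>On the Gram neighbourhood of \<open>Z\<close> the transition probability is almost
  constant by approximate transitivity, and its integral there is at most the volume of a box.
  Division by the volume of the neighbourhood cancels the powers of \<open>vball n\<close>.\<close>

lemma pk_upper: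
  assumes fin: "finite I" and b: "b \<ge> 1" and \<delta>: "\<delta> > 0" and \<epsilon>: "\<epsilon> > 0"
  shows "\<forall>\<^sub>F n in sequentially. \<forall>A Z R S. bounded_chol I b (gram n Z) R S \<longrightarrow>
    pk I n \<epsilon> A Z \<le> ennreal (2 * (((1 + \<delta>) * \<epsilon>) ^ (2 * n)) ^ card I / Re (det_on I (gram n Z)) ^ n)"
proof -
  obtain K \<eta>0 where K: "K > 0" "\<eta>0 > 0"
    and trans: "\<And>Q R S n X Z \<eta>. bounded_chol I b Q R S \<Longrightarrow> 0 \<le> \<eta> \<Longrightarrow> \<eta> \<le> \<eta>0 \<Longrightarrow> close_on I \<eta> Q (gram n X) \<Longrightarrow> close_on I \<eta> Q (gram n Z) \<Longrightarrow>
      \<exists>W\<in>umat n. \<forall>i\<in>I. nrm n (\<lambda>l. mult n W (X i) l - Z i l) \<le> K * \<eta>"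
    using that by (rule approximately_transitive[OF fin b]) 
  \<comment> \<open>Transport then costs at most \<open>\<delta> * \<epsilon>\<close>, which
    enlarges the radius to \<open>(1 + \<delta>) * \<epsilon>\<close>.\<close>
  define \<eta> where "\<eta> = min \<eta>0 (\<delta> * \<epsilon> / K)"
  have \<eta>: "\<eta> > 0" "\<eta> \<le> \<eta>0" "K * \<eta> \<le> \<delta> * \<epsilon>"
    using K \<delta> \<epsilon> by (auto simp: \<eta>_def min_def field_simps)
  have "\<forall>\<^sub>F n in sequentially. \<forall>Q R S. bounded_chol I b Q R S \<longrightarrow>
    ennreal (Re (det_on I Q) ^ n * vball n ^ card I / 2) \<le> emeasure (tn I n) (gnb I n Q \<eta>)"
    by (rule gnb_volume_lower[OF fin b \<eta>(1)])
  then show ?thesis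
  proof eventually_elim
    case (elim n)
    show ?case
    proof (intro allI impI)
      fix A Z R S assume bc: "bounded_chol I b (gram n Z) R S"
      let ?G = "gnb I n (gram n Z) \<eta>"
      let ?D = "Re (det_on I (gram n Z))"
      have G: "?G \<in> sets (tn I n)" using fin by simp
      have D: "?D > 0" by (rule bounded_chol_det_pos[OF fin bc])
      have le: "pk I n \<epsilon> A Z * indicator ?G X \<le> pk I n ((1 + \<delta>) * \<epsilon>) A X * indicator ?G X" if X: "X \<in> space (tn I n)" for X
      proof (cases "X \<in> ?G")
        case True
        have "close_on I \<eta> (gram n Z) (gram n Z)" using \<eta> by (simp add: close_on_def)
        then obtain W where W: "W \<in> umat n" "\<forall>i\<in>I. nrm n (\<lambda>l. mult n W (Z i) l - X i l) \<le> K * \<eta>"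
          using trans[OF bc, of \<eta> n Z X] True \<eta> by (auto simp: gnb_def)
        have "nrm n (\<lambda>l. mult n W (Z i) l - X i l) \<le> \<delta> * \<epsilon>" if "i \<in> I" for i using W(2) that \<eta>(3) by force
        then have "pk I n \<epsilon> A Z \<le> pk I n (\<epsilon> + \<delta> * \<epsilon>) A X" by (intro pk_compare[OF fin W(1)])
        moreover have "\<epsilon> + \<delta> * \<epsilon> = (1 + \<delta>) * \<epsilon>" by (simp add: algebra_simps)
        ultimately show ?thesis by (intro mult_right_mono) simp_all
      qed (simp add: indicator_def)
      have "pk I n \<epsilon> A Z * ennreal (?D ^ n * vball n ^ card I / 2) \<le> pk I n \<epsilon> A Z * emeasure (tn I n) ?G"
        using elim bc by (intro mult_left_mono) auto
      also have "\<dots> = (\<integral>\<^sup>+X. pk I n \<epsilon> A Z * indicator ?G X \<partial>tn I n)" using G by (simp add: nn_integral_cmult)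
      also have "\<dots> \<le> (\<integral>\<^sup>+X. pk I n ((1 + \<delta>) * \<epsilon>) A X * indicator ?G X \<partial>tn I n)"
        by (intro nn_integral_mono le)
      also have "\<dots> = (\<integral>\<^sup>+U. emeasure (tn I n) (?G \<inter> tbox I n (\<lambda>i. mult n U (A i)) ((1 + \<delta>) * \<epsilon>)) \<partial>haar n)"
        by (rule pk_integral[OF fin G])
      also have "\<dots> \<le> (\<integral>\<^sup>+U. ennreal ((vball n * ((1 + \<delta>) * \<epsilon>) ^ (2 * n)) ^ card I) \<partial>haar n)"
      proof (rule nn_integral_mono)
        fix U :: "nat \<times> nat \<Rightarrow> complex"
        have "emeasure (tn I n) (?G \<inter> tbox I n (\<lambda>i. mult n U (A i)) ((1 + \<delta>) * \<epsilon>)) \<le> emeasure (tn I n) (tbox I n (\<lambda>i. mult n U (A i)) ((1 + \<delta>) * \<epsilon>))"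
          using fin by (intro emeasure_mono) auto
        also have "\<dots> = ennreal ((vball n * ((1 + \<delta>) * \<epsilon>) ^ (2 * n)) ^ card I)"
          using fin \<delta> \<epsilon> by (intro emeasure_tbox) auto
        finally show "emeasure (tn I n) (?G \<inter> tbox I n (\<lambda>i. mult n U (A i)) ((1 + \<delta>) * \<epsilon>)) \<le> ennreal ((vball n * ((1 + \<delta>) * \<epsilon>) ^ (2 * n)) ^ card I)" .
      qed
      also have "\<dots> = ennreal ((vball n * ((1 + \<delta>) * \<epsilon>) ^ (2 * n)) ^ card I)" by (simp add: haar.emeasure_space_1)
      finally have "pk I n \<epsilon> A Z \<le> ennreal ((vball n * ((1 + \<delta>) * \<epsilon>) ^ (2 * n)) ^ card I / (?D ^ n * vball n ^ card I / 2))"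
        using D \<delta> \<epsilon> by (intro ennreal_le_divideI) (auto simp: less_imp_le)
      also have "(vball n * ((1 + \<delta>) * \<epsilon>) ^ (2 * n)) ^ card I / (?D ^ n * vball n ^ card I / 2) = 2 * (((1 + \<delta>) * \<epsilon>) ^ (2 * n)) ^ card I / ?D ^ n"
        using less_imp_neq[OF vball_pos[of n]] by (simp add: power_mult_distrib[of "vball n"])
      finally show "pk I n \<epsilon> A Z \<le> ennreal (2 * (((1 + \<delta>) * \<epsilon>) ^ (2 * n)) ^ card I / ?D ^ n)" .
    qed
  qed
qed

section \<open>Lower bound for the transition probability\<close>

lemma affine_volume:
  assumes fin: "finite I" and \<rho>: "\<rho> > 0" and A: "A \<in> sets (tn I n)"
  shows "emeasure (tn I n) A = ennreal ((\<rho> ^ (2 * n)) ^ card I) * emeasure (tn I n) {E \<in> space (tn I n). (\<lambda>i\<in>I. \<lambda>l\<in>{..<n}. B i l + complex_of_real \<rho> * E i l) \<in> A}"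
proof -
  let ?T = "\<lambda>i x. \<lambda>l\<in>{..<n}. B i l + complex_of_real \<rho> * x l"
  have T: "?T i \<in> cn n \<rightarrow>\<^sub>M cn n" for i by measurable
  have em: "emeasure (cn n) (?T i -` X \<inter> space (cn n)) = ennreal (1 / \<rho> ^ (2 * n)) * emeasure (cn n) X" if X: "X \<in> sets (cn n)" for i X
  proof -
    have "ennreal (\<rho> ^ (2 * n)) * (\<integral>\<^sup>+x. indicator X (?T i x) \<partial>cn n) = integral\<^sup>N (cn n) (indicator X)"
      using X \<rho> by (intro cn_affine) auto
    moreover have "(\<integral>\<^sup>+x. indicator X (?T i x) \<partial>cn n) = (\<integral>\<^sup>+x. indicator (?T i -` X \<inter> space (cn n)) x \<partial>cn n)"
      by (intro nn_integral_cong) (simp add: indicator_def)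
    ultimately have "ennreal (\<rho> ^ (2 * n)) * emeasure (cn n) (?T i -` X \<inter> space (cn n)) = emeasure (cn n) X"
      using X measurable_sets[OF T X] by simp
    then have "ennreal (1 / \<rho> ^ (2 * n)) * emeasure (cn n) X = ennreal (1 / \<rho> ^ (2 * n)) * ennreal (\<rho> ^ (2 * n)) * emeasure (cn n) (?T i -` X \<inter> space (cn n))"
      by (simp add: mult.assoc)
    also have "ennreal (1 / \<rho> ^ (2 * n)) * ennreal (\<rho> ^ (2 * n)) = 1" using \<rho> by (simp add: ennreal_mult[symmetric])
    finally show ?thesis by (simp only: mult_1_left)
  qed
  have m: "(\<lambda>E. \<lambda>i\<in>I. ?T i (E i)) \<in> tn I n \<rightarrow>\<^sub>M tn I n" by measurable
  have "(\<integral>\<^sup>+E. indicator A (\<lambda>i\<in>I. ?T i (E i)) \<partial>tn I n) = ennreal (\<Prod>i\<in>I. 1 / \<rho> ^ (2 * n)) * integral\<^sup>N (tn I n) (indicator A)"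
    unfolding tn_def
  proof (rule tprod.nn_integral_componentwise[OF fin])
    show "indicator A \<in> borel_measurable (PiM I (\<lambda>_. cn n))"
      using A unfolding tn_def by (rule borel_measurable_indicator)
    show "0 < 1 / \<rho> ^ (2 * n)" for i :: 'a using \<rho> by simp
  qed (rule T, rule em)
  moreover have "(\<integral>\<^sup>+E. indicator A (\<lambda>i\<in>I. ?T i (E i)) \<partial>tn I n) = (\<integral>\<^sup>+E. indicator {E \<in> space (tn I n). (\<lambda>i\<in>I. ?T i (E i)) \<in> A} E \<partial>tn I n)"
    by (intro nn_integral_cong) (simp add: indicator_def)
  moreover have "{E \<in> space (tn I n). (\<lambda>i\<in>I. ?T i (E i)) \<in> A} \<in> sets (tn I n)"
    using measurable_sets[OF m A] by (simp add: vimage_def Int_def conj_commute)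
  ultimately have "emeasure (tn I n) {E \<in> space (tn I n). (\<lambda>i\<in>I. ?T i (E i)) \<in> A} = ennreal (\<Prod>i\<in>I. 1 / \<rho> ^ (2 * n)) * emeasure (tn I n) A"
    using A by simp
  then have "ennreal ((\<rho> ^ (2 * n)) ^ card I) * emeasure (tn I n) {E \<in> space (tn I n). (\<lambda>i\<in>I. ?T i (E i)) \<in> A}
    = ennreal ((\<rho> ^ (2 * n)) ^ card I) * ennreal (\<Prod>i\<in>I. 1 / \<rho> ^ (2 * n)) * emeasure (tn I n) A"
    by (simp add: mult.assoc)
  also have "ennreal ((\<rho> ^ (2 * n)) ^ card I) * ennreal (\<Prod>i\<in>I. 1 / \<rho> ^ (2 * n)) = 1"
    using \<rho> by (simp add: ennreal_mult[symmetric] power_one_over[symmetric] power_mult_distrib[symmetric])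
  finally show ?thesis by (simp only: mult_1_left)
qed

text \<open>A typical point at distance \<open>\<rho>\<close> from \<open>A\<close> has Gram kernel \<open>gram A + \<rho>\<^sup>2\<close>; contracting \<open>A\<close>
  by \<open>1 - (\<rho>\<^sup>2/2) P\<close>, \<open>P\<close> the inverse of \<open>Q\<close>, restores \<open>Q\<close> up to order \<open>\<rho>\<^sup>4\<close>.\<close>

lemma contracted_gram:
  assumes fin: "finite I" and bc: "bounded_chol I b Q R S" and b: "b \<ge> 1" and \<rho>: "0 < \<rho>" "\<rho> \<le> 1"
  obtains C where
    "\<And>p q. p \<in> I \<Longrightarrow> q \<in> I \<Longrightarrow> cmod (C p q) \<le> real (card I) * b\<^sup>2 + 1"
    "\<And>p q. p \<in> I \<Longrightarrow> q \<in> I \<Longrightarrow> cmod (C p q - kron p q) \<le> \<rho>\<^sup>2 * (real (card I) * b\<^sup>2)"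
    "\<And>p q. p \<in> I \<Longrightarrow> q \<in> I \<Longrightarrow> cmod ((\<Sum>l\<in>I. \<Sum>k\<in>I. cnj (C l p) * C k q * Q l k) + complex_of_real (\<rho>\<^sup>2) * kron p q - Q p q) \<le> \<rho> ^ 4 / 4 * (real (card I) * b\<^sup>2)"
proof -
  have ch: "chol I Q R S" and Sb: "\<And>p q. p \<in> I \<Longrightarrow> q \<in> I \<Longrightarrow> cmod (S p q) \<le> b"
    using bc by (auto simp: bounded_chol_def)
  \<comment> \<open>\<open>P\<close> is the product of \<open>S\<close> with its adjoint, the
    inverse of \<open>Q\<close>.\<close>
  define P where "P p q = (\<Sum>l\<in>I. S p l * cnj (S q l))" for p q
  have herm: "cnj (P p q) = P q p" for p q by (simp add: P_def mult.commute)
  have Pb: "cmod (P p q) \<le> real (card I) * b\<^sup>2" if "p \<in> I" "q \<in> I" for p q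
  proof -
    have "cmod (P p q) \<le> (\<Sum>l\<in>I. cmod (S p l * cnj (S q l)))" unfolding P_def by (rule norm_sum)
    also have "\<dots> \<le> (\<Sum>l\<in>I. b * b)" unfolding norm_mult complex_mod_cnj using Sb that b by (intro sum_mono mult_mono) auto
    finally show ?thesis by (simp add: power2_eq_square)
  qed
  have QP: "(\<Sum>k\<in>I. Q l k * P k q) = kron l q" if lq: "l \<in> I" "q \<in> I" for l q
  proof -
    have "(\<Sum>k\<in>I. Q l k * P k q) = (\<Sum>k\<in>I. \<Sum>m\<in>I. \<Sum>t\<in>I. cnj (R m l) * cnj (S q t) * (R m k * S k t))"
      using ch lq by (intro sum.cong refl) (simp add: P_def chol_def sum_product mult_ac)
    also have "\<dots> = (\<Sum>m\<in>I. \<Sum>k\<in>I. \<Sum>t\<in>I. cnj (R m l) * cnj (S q t) * (R m k * S k t))" by (rule sum.swap)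
    also have "\<dots> = (\<Sum>m\<in>I. \<Sum>t\<in>I. \<Sum>k\<in>I. cnj (R m l) * cnj (S q t) * (R m k * S k t))"
      by (rule sum.cong[OF refl], rule sum.swap)
    also have "\<dots> = (\<Sum>m\<in>I. \<Sum>t\<in>I. if m = t then cnj (S q m * R m l) else 0)"
    proof (intro sum.cong refl)
      fix m t assume "m \<in> I" "t \<in> I"
      then have "(\<Sum>k\<in>I. R m k * S k t) = kron m t" using ch by (simp add: chol_def)
      then show "(\<Sum>k\<in>I. cnj (R m l) * cnj (S q t) * (R m k * S k t)) = (if m = t then cnj (S q m * R m l) else 0)"
        unfolding sum_distrib_left[symmetric] by (simp add: mult.commute)
    qed
    also have "\<dots> = cnj (\<Sum>m\<in>I. S q m * R m l)" using fin by simp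
    also have "\<dots> = kron l q" using ch lq by (simp add: chol_def)
    finally show ?thesis .
  qed
  have qherm: "Q q p = cnj (Q p q)" if "p \<in> I" "q \<in> I" for p q
    using ch that by (simp add: chol_def mult.commute)
  have PQ: "(\<Sum>l\<in>I. cnj (P l p) * Q l q) = kron p q" if pq: "p \<in> I" "q \<in> I" for p q
  proof -
    have "(\<Sum>l\<in>I. cnj (P l p) * Q l q) = cnj (\<Sum>l\<in>I. Q q l * P l p)"
    proof -
      have "cnj (Q q l) = Q l q" if "l \<in> I" for l using qherm[OF pq(2) that] by simp
      then show ?thesis unfolding cnj_sum complex_cnj_mult by (intro sum.cong refl) (simp add: mult.commute)
    qed
    then show ?thesis using QP[OF pq(2,1)] by auto
  qed
  define r where "r = complex_of_real (\<rho>\<^sup>2 / 2)"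
  have r: "cmod r = \<rho>\<^sup>2 / 2" "cnj r = r" unfolding r_def by (simp_all only: norm_of_real complex_cnj_complex_of_real) simp
  \<comment> \<open>Conjugating \<open>Q\<close> by \<open>C\<close> gives
    \<open>Q - 2 * r + r * r * P\<close>, so adding \<rho> squared to the diagonal cancels the term
    linear in \<open>r\<close>.\<close>
  define C where "C p q = kron p q - r * P p q" for p q
  have C1: "cmod (C p q - kron p q) \<le> \<rho>\<^sup>2 * (real (card I) * b\<^sup>2)" if "p \<in> I" "q \<in> I" for p q
  proof -
    have "cmod (C p q - kron p q) = \<rho>\<^sup>2 / 2 * cmod (P p q)" by (simp add: C_def norm_mult r)
    also have "\<dots> \<le> \<rho>\<^sup>2 * (real (card I) * b\<^sup>2)" using Pb[OF that] by (intro mult_mono) auto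
    finally show ?thesis .
  qed
  have C0: "cmod (C p q) \<le> real (card I) * b\<^sup>2 + 1" if "p \<in> I" "q \<in> I" for p q
  proof -
    have "cmod (C p q) \<le> cmod (C p q - kron p q) + cmod (kron p q)" by (metis diff_add_cancel norm_triangle_ineq)
    also have "cmod (C p q - kron p q) \<le> 1 * (real (card I) * b\<^sup>2)"
      using \<rho> by (intro order_trans[OF C1[OF that]] mult_right_mono) (auto simp: power_le_one)
    finally show ?thesis by (auto split: if_splits)
  qed
  have C2: "(\<Sum>l\<in>I. \<Sum>k\<in>I. cnj (C l p) * C k q * Q l k) = Q p q - 2 * r * kron p q + r * r * P p q" if pq: "p \<in> I" "q \<in> I" for p q
  proof -
    have "(\<Sum>l\<in>I. \<Sum>k\<in>I. cnj (C l p) * C k q * Q l k) = (\<Sum>l\<in>I. cnj (C l p) * (\<Sum>k\<in>I. Q l k * C k q))"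
      by (simp add: sum_distrib_left mult_ac)
    also have "\<dots> = (\<Sum>l\<in>I. cnj (C l p) * (Q l q - r * kron l q))"
    proof (intro sum.cong refl arg_cong2[where f = "(*)"])
      fix l assume l: "l \<in> I"
      have "(\<Sum>k\<in>I. Q l k * C k q) = (\<Sum>k\<in>I. Q l k * kron k q) - r * (\<Sum>k\<in>I. Q l k * P k q)"
        by (simp add: C_def right_diff_distrib sum_subtractf sum_distrib_left mult_ac)
      also have "(\<Sum>k\<in>I. Q l k * kron k q) = Q l q"
        using fin pq by (simp add: if_distrib[of "\<lambda>x. _ * x"] cong: if_cong)
      finally show "(\<Sum>k\<in>I. Q l k * C k q) = Q l q - r * kron l q" using QP[OF l pq(2)] by simp
    qed
    also have "\<dots> = (\<Sum>l\<in>I. kron l p * (Q l q - r * kron l q)) - r * (\<Sum>l\<in>I. cnj (P l p) * Q l q) + r * r * (\<Sum>l\<in>I. cnj (P l p) * kron l q)"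
      unfolding sum_distrib_left sum_subtractf[symmetric] sum.distrib[symmetric]
      by (intro sum.cong refl) (auto simp: C_def r algebra_simps)
    also have "(\<Sum>l\<in>I. kron l p * (Q l q - r * kron l q)) = Q p q - r * kron p q"
      using fin pq by (simp add: if_distrib[of "\<lambda>x. x * _"] cong: if_cong)
    also have "(\<Sum>l\<in>I. cnj (P l p) * kron l q) = P p q"
      using fin pq by (simp add: if_distrib[of "\<lambda>x. _ * x"] herm cong: if_cong)
    finally show ?thesis unfolding PQ[OF pq] by (simp add: algebra_simps)
  qed
  have "cmod ((\<Sum>l\<in>I. \<Sum>k\<in>I. cnj (C l p) * C k q * Q l k) + complex_of_real (\<rho>\<^sup>2) * kron p q - Q p q) \<le> \<rho> ^ 4 / 4 * (real (card I) * b\<^sup>2)"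
    if pq: "p \<in> I" "q \<in> I" for p q
  proof -
    have "2 * r = complex_of_real (\<rho>\<^sup>2)" by (simp add: r_def)
    then have "(\<Sum>l\<in>I. \<Sum>k\<in>I. cnj (C l p) * C k q * Q l k) + complex_of_real (\<rho>\<^sup>2) * kron p q - Q p q = r * r * P p q"
      unfolding C2[OF pq] by (simp add: algebra_simps)
    then have "cmod ((\<Sum>l\<in>I. \<Sum>k\<in>I. cnj (C l p) * C k q * Q l k) + complex_of_real (\<rho>\<^sup>2) * kron p q - Q p q) = (\<rho>\<^sup>2 / 2 * (\<rho>\<^sup>2 / 2)) * cmod (P p q)"
      by (simp only: norm_mult r)
    also have "\<dots> \<le> (\<rho>\<^sup>2 / 2 * (\<rho>\<^sup>2 / 2)) * (real (card I) * b\<^sup>2)" using Pb[OF pq] by (intro mult_left_mono) auto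
    also have "\<rho>\<^sup>2 / 2 * (\<rho>\<^sup>2 / 2) = \<rho> ^ 4 / 4" by (simp add: power2_eq_square power4_eq_xxxx)
    finally show ?thesis .
  qed
  then show ?thesis using that[of C] C0 C1 by blast
qed

text \<open>The points are the contracted centre plus \<open>\<rho> * E\<close>, with
  \<open>E\<close> nearly orthonormal and nearly orthogonal to \<open>B\<close>: cross terms are
  small, and the contraction offsets the growth of the diagonal. The centre has moved by order
  \<rho> squared, which is the excess of the radius over \<rho>.\<close>

lemma gnb_box_volume:
  assumes fin: "finite I" and bc: "bounded_chol I b Q R S" and b: "b \<ge> 1" and \<rho>: "0 < \<rho>" "\<rho> \<le> 1"
    and \<eta>: "\<eta> > 0" and small: "\<rho> ^ 4 * (real (card I) * b\<^sup>2) \<le> \<eta>"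
  obtains \<eta>A where "\<eta>A > 0" "\<forall>\<^sub>F n in sequentially. \<forall>B. close_on I \<eta>A Q (gram n B) \<longrightarrow>
     ennreal ((\<rho> ^ (2 * n)) ^ card I * (vball n ^ card I / 2))
       \<le> emeasure (tn I n) (gnb I n Q \<eta> \<inter> tbox I n B (\<rho> + \<rho>\<^sup>2 * (real (card I) * b\<^sup>2 * (\<Sum>p\<in>I. 2 + cmod (Q p p)))))"
proof -
  define m where "m = real (card I)"
  define c where "c = m * b\<^sup>2 + 1"
  have m: "m \<ge> 0" "c \<ge> 1" by (auto simp: m_def c_def)
  obtain C where C: "\<And>p q. p \<in> I \<Longrightarrow> q \<in> I \<Longrightarrow> cmod (C p q) \<le> c"
    "\<And>p q. p \<in> I \<Longrightarrow> q \<in> I \<Longrightarrow> cmod (C p q - kron p q) \<le> \<rho>\<^sup>2 * (m * b\<^sup>2)"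
    "\<And>p q. p \<in> I \<Longrightarrow> q \<in> I \<Longrightarrow> cmod ((\<Sum>l\<in>I. \<Sum>k\<in>I. cnj (C l p) * C k q * Q l k) + complex_of_real (\<rho>\<^sup>2) * kron p q - Q p q) \<le> \<rho> ^ 4 / 4 * (m * b\<^sup>2)"
    using that unfolding m_def c_def by (rule contracted_gram[OF fin bc b \<rho>])
  \<comment> \<open>The error inherited from \<open>B\<close> and the error from \<open>E\<close>,
    cross terms included, become at most \<open>\<eta> / 4\<close> each; \<open>small\<close> gives
    the same bound for the contraction error.\<close>
  define \<eta>A where "\<eta>A = min 1 (\<eta> / (4 * ((m * c)\<^sup>2 + 1)))"
  define \<eta>E where "\<eta>E = min 1 (\<eta> / (4 * (2 * (m * c) + 1)))"
  have p1: "(m * c)\<^sup>2 + 1 > 0" and p2: "2 * (m * c) + 1 > 0" using m by (auto simp: add_nonneg_pos)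
  have \<eta>A: "\<eta>A > 0" "\<eta>A \<le> 1" using \<eta> p1 by (auto simp: \<eta>A_def)
  have \<eta>E: "\<eta>E > 0" "\<eta>E \<le> 1" using \<eta> p2 by (auto simp: \<eta>E_def)
  have eA: "(m * c)\<^sup>2 * \<eta>A \<le> \<eta> / 4"
  proof -
    have cancel: "x * (\<eta> / (4 * x)) = \<eta> / 4" if "x > 0" for x :: real using that by simp
    have "(m * c)\<^sup>2 * \<eta>A \<le> ((m * c)\<^sup>2 + 1) * (\<eta> / (4 * ((m * c)\<^sup>2 + 1)))"
      using \<eta>A p1 by (intro mult_mono) (auto simp: \<eta>A_def)
    also have "\<dots> = \<eta> / 4" using p1 by (rule cancel)
    finally show ?thesis .
  qed
  have eE: "(2 * (m * c) + 1) * \<eta>E \<le> \<eta> / 4"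
  proof -
    have "(2 * (m * c) + 1) * \<eta>E \<le> (2 * (m * c) + 1) * (\<eta> / (4 * (2 * (m * c) + 1)))"
      using p2 by (intro mult_left_mono) (auto simp: \<eta>E_def)
    also have "\<dots> = \<eta> / 4" using p2 by (simp add: field_simps)
    finally show ?thesis .
  qed
  define L where "L = 1 + (\<Sum>p\<in>I. 2 + cmod (Q p p))"
  have L: "L \<ge> 1" by (simp add: L_def sum_nonneg)
  have nb: "nrm n (B i) \<le> 2 + cmod (Q i i)" if "close_on I \<eta>A Q (gram n B)" "i \<in> I" for B n i
  proof -
    have "cmod (gram n B i i - Q i i) \<le> 1" using that \<eta>A by (force simp: close_on_def)
    then have "cmod (gram n B i i) \<le> 1 + cmod (Q i i)" using norm_triangle_sub[of "gram n B i i" "Q i i"] by linarith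
    moreover have "cmod (gram n B i i) = (nrm n (B i))\<^sup>2" by (simp only: gram_def cinner_self norm_of_real) simp
    ultimately have "(nrm n (B i))\<^sup>2 \<le> 1 + cmod (Q i i)" by simp
    also have "\<dots> \<le> (2 + cmod (Q i i))\<^sup>2" by (simp add: power2_eq_square algebra_simps)
    finally show ?thesis by (rule power2_le_imp_le) simp
  qed
  have nL: "2 + cmod (Q i i) \<le> L" if "i \<in> I" for i
  proof -
    have "2 + cmod (Q i i) \<le> (\<Sum>p\<in>I. 2 + cmod (Q p p))" using fin that by (intro member_le_sum) auto
    then show ?thesis by (simp add: L_def)
  qed
  have "\<forall>\<^sub>F n in sequentially. \<forall>y. (\<forall>j\<in>I. nrm n (y j) \<le> L) \<longrightarrow>
    ennreal (vball n ^ card I / 2) \<le> emeasure (tn I n) {X \<in> space (tn I n). goodt I n \<eta>E I y X}"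
    using fin \<eta>E L by (intro goodt_volume_eventually) auto
  then have "\<forall>\<^sub>F n in sequentially. \<forall>B. close_on I \<eta>A Q (gram n B) \<longrightarrow>
     ennreal ((\<rho> ^ (2 * n)) ^ card I * (vball n ^ card I / 2))
       \<le> emeasure (tn I n) (gnb I n Q \<eta> \<inter> tbox I n B (\<rho> + \<rho>\<^sup>2 * (real (card I) * b\<^sup>2 * (\<Sum>p\<in>I. 2 + cmod (Q p p)))))"
  proof eventually_elim
    case (elim n)
    show ?case
    proof (intro allI impI)
      fix B assume cB: "close_on I \<eta>A Q (gram n B)"
      let ?G = "{X \<in> space (tn I n). goodt I n \<eta>E I B X}"
      let ?T = "gnb I n Q \<eta> \<inter> tbox I n B (\<rho> + \<rho>\<^sup>2 * (real (card I) * b\<^sup>2 * (\<Sum>p\<in>I. 2 + cmod (Q p p))))"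
      let ?B' = "comb I C B"
      let ?X = "\<lambda>E. \<lambda>i\<in>I. \<lambda>l\<in>{..<n}. ?B' i l + complex_of_real \<rho> * E i l"
      have T: "?T \<in> sets (tn I n)" using fin by auto
      have G: "ennreal (vball n ^ card I / 2) \<le> emeasure (tn I n) ?G"
        using elim order_trans[OF nb[OF cB] nL] by blast
      have mX: "?X \<in> tn I n \<rightarrow>\<^sub>M tn I n" by measurable
      have sub: "?G \<subseteq> {E \<in> space (tn I n). ?X E \<in> ?T}"
      proof safe
        fix E assume E: "E \<in> space (tn I n)" and g: "goodt I n \<eta>E I B E"
        have EB: "cmod (cinner n (E p) (?B' q)) \<le> m * c * \<eta>E" if pq: "p \<in> I" "q \<in> I" for p q
        proof -
          have "cmod (cinner n (E p) (?B' q)) \<le> (\<Sum>r\<in>I. cmod (cnj (C r q) * cinner n (E p) (B r)))"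
            unfolding comb_def cinner_sum_scaled_right by (rule norm_sum)
          also have "\<dots> \<le> (\<Sum>r\<in>I. c * \<eta>E)"
            unfolding norm_mult complex_mod_cnj using C(1) pq g m by (intro sum_mono mult_mono) (auto simp: goodt_def goodv_def)
          finally show ?thesis by (simp add: m_def)
        qed
        have gE: "cmod (gram n E p q - kron p q) \<le> \<eta>E" if "p \<in> I" "q \<in> I" for p q
          using goodt_close[OF g] that by (auto simp: close_on_def)
        show "?X E \<in> gnb I n Q \<eta>"
          unfolding gnb_def close_on_def
        proof (intro CollectI conjI ballI)
          show "?X E \<in> space (tn I n)" using measurable_space[OF mX E] .
          fix p q assume pq: "p \<in> I" "q \<in> I"
          have "gram n (?X E) p q = cinner n (\<lambda>l. ?B' q l + E q l * complex_of_real \<rho>) (\<lambda>l. ?B' p l + E p l * complex_of_real \<rho>)"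
            unfolding gram_def using pq by (intro cinner_cong) auto
          also have "\<dots> = gram n ?B' p q + of_real \<rho> * cinner n (?B' q) (E p) + of_real \<rho> * cinner n (E q) (?B' p) + of_real (\<rho>\<^sup>2) * gram n E p q"
            unfolding cinner_add_left cinner_add_right cinner_scale_left cinner_scale_right gram_def
            by (simp add: power2_eq_square algebra_simps)
          finally have "gram n (?X E) p q - Q p q
            = (gram n ?B' p q - (\<Sum>l\<in>I. \<Sum>k\<in>I. cnj (C l p) * C k q * Q l k))
             + ((\<Sum>l\<in>I. \<Sum>k\<in>I. cnj (C l p) * C k q * Q l k) + complex_of_real (\<rho>\<^sup>2) * kron p q - Q p q)
             + of_real \<rho> * cinner n (?B' q) (E p) + of_real \<rho> * cinner n (E q) (?B' p)
             + of_real (\<rho>\<^sup>2) * (gram n E p q - kron p q)"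
            by (simp add: algebra_simps)
          also have "cmod \<dots> \<le> (m * c)\<^sup>2 * \<eta>A + \<rho> ^ 4 / 4 * (m * b\<^sup>2) + 1 * (m * c * \<eta>E) + 1 * (m * c * \<eta>E) + 1 * \<eta>E"
          proof (intro norm_triangle_mono)
            show "cmod (gram n ?B' p q - (\<Sum>l\<in>I. \<Sum>k\<in>I. cnj (C l p) * C k q * Q l k)) \<le> (m * c)\<^sup>2 * \<eta>A"
              unfolding m_def by (rule gram_comb_close[OF fin C(1) cB pq])
            show "cmod ((\<Sum>l\<in>I. \<Sum>k\<in>I. cnj (C l p) * C k q * Q l k) + complex_of_real (\<rho>\<^sup>2) * kron p q - Q p q) \<le> \<rho> ^ 4 / 4 * (m * b\<^sup>2)"
              by (rule C(3)[OF pq])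
            show "cmod (complex_of_real \<rho> * cinner n (?B' q) (E p)) \<le> 1 * (m * c * \<eta>E)"
              unfolding norm_mult norm_of_real using EB[OF pq] \<rho> cinner_commute[of n "?B' q" "E p"]
              by (intro mult_mono) auto
            show "cmod (complex_of_real \<rho> * cinner n (E q) (?B' p)) \<le> 1 * (m * c * \<eta>E)"
              unfolding norm_mult norm_of_real using EB[OF pq(2,1)] \<rho> by (intro mult_mono) auto
            show "cmod (complex_of_real (\<rho>\<^sup>2) * (gram n E p q - kron p q)) \<le> 1 * \<eta>E"
              unfolding norm_mult norm_of_real using gE[OF pq] \<rho> by (intro mult_mono) (auto simp: power_le_one)
          qed
          also have "\<dots> \<le> \<eta>" using eA eE small \<eta> by (simp add: m_def algebra_simps)
          finally show "cmod (gram n (?X E) p q - Q p q) \<le> \<eta>" .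
        qed
        show "?X E \<in> tbox I n B (\<rho> + \<rho>\<^sup>2 * (real (card I) * b\<^sup>2 * (\<Sum>p\<in>I. 2 + cmod (Q p p))))"
          unfolding tbox_def
        proof (intro CollectI conjI ballI)
          show "?X E \<in> space (tn I n)" using measurable_space[OF mX E] .
          fix i assume i: "i \<in> I"
          have "nrm n (\<lambda>l. ?X E i l - B i l) = nrm n (\<lambda>l. E i l * complex_of_real \<rho> + (\<Sum>r\<in>I. B r l * (C r i - kron r i)))"
          proof (rule nrm_cong)
            fix l assume l: "l < n"
            have "(\<Sum>r\<in>I. B r l * (C r i - kron r i)) = ?B' i l - B i l"
              using fin i by (simp add: comb_def right_diff_distrib sum_subtractf if_distrib[of "\<lambda>x. _ * x"] cong: if_cong)
            then show "?X E i l - B i l = E i l * complex_of_real \<rho> + (\<Sum>r\<in>I. B r l * (C r i - kron r i))"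
              using i l by simp
          qed
          also have "\<dots> \<le> nrm n (\<lambda>l. E i l * complex_of_real \<rho>) + nrm n (\<lambda>l. \<Sum>r\<in>I. B r l * (C r i - kron r i))" by (rule nrm_add)
          also have "nrm n (\<lambda>l. E i l * complex_of_real \<rho>) \<le> 1 * \<rho>"
            unfolding nrm_scale norm_of_real using g i \<rho> by (intro mult_mono) (auto simp: goodt_def goodv_def)
          also have "nrm n (\<lambda>l. \<Sum>r\<in>I. B r l * (C r i - kron r i)) \<le> (\<Sum>r\<in>I. nrm n (\<lambda>l. B r l * (C r i - kron r i)))" by (rule nrm_sum[OF fin])
          also have "\<dots> \<le> (\<Sum>r\<in>I. (2 + cmod (Q r r)) * (\<rho>\<^sup>2 * (m * b\<^sup>2)))"
            unfolding nrm_scale using nb[OF cB] C(2) i by (intro sum_mono mult_mono) auto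
          also have "\<dots> = \<rho>\<^sup>2 * (real (card I) * b\<^sup>2 * (\<Sum>p\<in>I. 2 + cmod (Q p p)))"
            unfolding sum_distrib_right[symmetric] m_def by (simp add: mult_ac)
          finally show "nrm n (\<lambda>l. ?X E i l - B i l) \<le> \<rho> + \<rho>\<^sup>2 * (real (card I) * b\<^sup>2 * (\<Sum>p\<in>I. 2 + cmod (Q p p)))" by (simp only: mult_1_left)
        qed
      qed
      have ms: "{E \<in> space (tn I n). ?X E \<in> ?T} \<in> sets (tn I n)"
        using measurable_sets[OF mX T] by (simp add: vimage_def Int_def conj_commute)
      have "ennreal ((\<rho> ^ (2 * n)) ^ card I * (vball n ^ card I / 2)) = ennreal ((\<rho> ^ (2 * n)) ^ card I) * ennreal (vball n ^ card I / 2)"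
        using \<rho> by (intro ennreal_mult) (auto simp: less_imp_le)
      also have "\<dots> \<le> ennreal ((\<rho> ^ (2 * n)) ^ card I) * emeasure (tn I n) {E \<in> space (tn I n). ?X E \<in> ?T}"
        using order_trans[OF G emeasure_mono[OF sub ms]] by (intro mult_left_mono) auto
      also have "\<dots> = emeasure (tn I n) ?T" by (rule affine_volume[OF fin \<rho>(1) T, symmetric])
      finally show "ennreal ((\<rho> ^ (2 * n)) ^ card I * (vball n ^ card I / 2)) \<le> emeasure (tn I n) ?T" .
    qed
  qed
  then show ?thesis using that \<eta>A(1) by blast
qed

lemma close_on_mono: "close_on I \<eta> Q Q' \<Longrightarrow> \<eta> \<le> \<eta>' \<Longrightarrow> close_on I \<eta>' Q Q'"
  by (force simp: close_on_def)

text \<open>The averaging argument in reverse: the box around every image of \<open>A\<close> meets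
  the Gram neighbourhood in a large set, on which the transition probability is almost constant.
  Dividing by the upper volume bound of the neighbourhood brings in
  \<open>shiftdiag\<close>.\<close>

lemma pk_lower:
  assumes fin: "finite I" and b: "b \<ge> 1" and bc: "bounded_chol I b Q R S" and psd: "psd I Q"
    and \<delta>: "0 < \<delta>" "\<delta> < 1" and t: "t > 0"
  obtains \<epsilon>1 where "\<epsilon>1 > 0" "\<And>\<epsilon>. 0 < \<epsilon> \<Longrightarrow> \<epsilon> \<le> \<epsilon>1 \<Longrightarrow> \<exists>\<eta>A>0. \<forall>\<^sub>F n in sequentially. \<forall>A Z.
     close_on I \<eta>A Q (gram n A) \<longrightarrow> close_on I \<eta>A Q (gram n Z) \<longrightarrow>
     ennreal ((((1 - \<delta>) * \<epsilon>) ^ (2 * n)) ^ card I / (2 * Re (det_on I (shiftdiag t Q)) ^ n)) \<le> pk I n \<epsilon> A Z"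
proof -
  obtain K \<eta>0 where K: "K > 0" "\<eta>0 > 0"
    and trans: "\<And>Q R S n X Z \<eta>. bounded_chol I b Q R S \<Longrightarrow> 0 \<le> \<eta> \<Longrightarrow> \<eta> \<le> \<eta>0 \<Longrightarrow> close_on I \<eta> Q (gram n X) \<Longrightarrow> close_on I \<eta> Q (gram n Z) \<Longrightarrow>
      \<exists>W\<in>umat n. \<forall>i\<in>I. nrm n (\<lambda>l. mult n W (X i) l - Z i l) \<le> K * \<eta>"
    using that by (rule approximately_transitive[OF fin b])
  define m where "m = real (card I)"
  define P where "P = m * b\<^sup>2 + 1"
  define L where "L = m * b\<^sup>2 * (\<Sum>p\<in>I. 2 + cmod (Q p p)) + 1"
  have m: "m \<ge> 0" and P: "P \<ge> 1" by (auto simp: m_def P_def)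
  have L: "L \<ge> 1" using m by (auto simp: L_def intro!: mult_nonneg_nonneg sum_nonneg)
  \<comment> \<open>The entries ensure in turn \<open>\<epsilon> \<le> 1\<close>, \<eta> below the
    transport threshold, \<open>\<eta> * m \<le> t\<close>, and that transport and the shift of the
    box centre cost at most \<open>\<delta> * \<epsilon> / 2\<close> each.\<close>
  define \<epsilon>1 where "\<epsilon>1 = Min {1, \<eta>0 / P, t / ((m + 1) * P), \<delta> / (2 * K * P), \<delta> / (2 * L)}"
  have e1pos: "\<epsilon>1 > 0" using K t \<delta> P L m by (auto simp: \<epsilon>1_def)
  have e1le: "\<epsilon>1 \<le> 1" "\<epsilon>1 \<le> \<eta>0 / P" "\<epsilon>1 \<le> t / ((m + 1) * P)" "\<epsilon>1 \<le> \<delta> / (2 * K * P)" "\<epsilon>1 \<le> \<delta> / (2 * L)"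
    by (auto simp: \<epsilon>1_def)
  have "\<exists>\<eta>A>0. \<forall>\<^sub>F n in sequentially. \<forall>A Z.
     close_on I \<eta>A Q (gram n A) \<longrightarrow> close_on I \<eta>A Q (gram n Z) \<longrightarrow>
     ennreal ((((1 - \<delta>) * \<epsilon>) ^ (2 * n)) ^ card I / (2 * Re (det_on I (shiftdiag t Q)) ^ n)) \<le> pk I n \<epsilon> A Z"
    if \<epsilon>: "0 < \<epsilon>" "\<epsilon> \<le> \<epsilon>1" for \<epsilon>
  proof -
    \<comment> \<open>This leaves \<open>\<delta> * \<epsilon>\<close> to spend on transport and on
      moving the centre.\<close>
    define \<rho> where "\<rho> = (1 - \<delta>) * \<epsilon>"
    have \<epsilon>le: "\<epsilon> \<le> 1" "\<epsilon> * P \<le> \<eta>0" "\<epsilon> * P * (m + 1) \<le> t" "\<epsilon> * P * (2 * K) \<le> \<delta>" "\<epsilon> * (2 * L) \<le> \<delta>"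
    proof -
      show "\<epsilon> \<le> 1" using \<epsilon> e1le by simp
      have "\<epsilon> \<le> \<eta>0 / P" "\<epsilon> \<le> t / ((m + 1) * P)" "\<epsilon> \<le> \<delta> / (2 * K * P)" "\<epsilon> \<le> \<delta> / (2 * L)" using \<epsilon> e1le by simp_all
      then show "\<epsilon> * P \<le> \<eta>0" "\<epsilon> * P * (m + 1) \<le> t" "\<epsilon> * P * (2 * K) \<le> \<delta>" "\<epsilon> * (2 * L) \<le> \<delta>"
        using P K m L by (auto simp: pos_le_divide_eq mult_ac)
    qed
    have \<rho>: "0 < \<rho>" "\<rho> \<le> \<epsilon>" "\<rho> \<le> 1" using \<epsilon> \<delta> \<epsilon>le by (auto simp: \<rho>_def mult_le_one intro: mult_left_le_one_le)
    \<comment> \<open>Order \<epsilon> squared: enough room for the Gram error of displaced tuples,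
      yet transport at cost \<open>K * \<eta>\<close> is small against \<epsilon>.\<close>
    define \<eta> where "\<eta> = \<epsilon>\<^sup>2 * P"
    have \<epsilon>2: "\<epsilon>\<^sup>2 \<le> \<epsilon>" using \<epsilon> \<epsilon>le by (simp add: power2_eq_square mult_left_le_one_le)
    have \<eta>e: "\<eta> \<le> \<epsilon> * P" using \<epsilon>2 P by (simp add: \<eta>_def mult_right_mono)
    have \<eta>: "\<eta> > 0" "\<eta> \<le> \<eta>0" "\<eta> * m \<le> t"
    proof -
      show "\<eta> > 0" using \<epsilon> P by (simp add: \<eta>_def)
      show "\<eta> \<le> \<eta>0" using \<eta>e \<epsilon>le by linarith
      have "\<eta> * m \<le> \<epsilon> * P * (m + 1)" using \<eta>e m \<open>\<eta> > 0\<close> by (intro mult_mono) auto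
      then show "\<eta> * m \<le> t" using \<epsilon>le by linarith
    qed
    have K\<eta>: "K * \<eta> \<le> \<delta> * \<epsilon> / 2"
    proof -
      have "K * \<eta> = \<epsilon> * (\<epsilon> * P * (2 * K)) / 2" by (simp add: \<eta>_def power2_eq_square)
      also have "\<dots> \<le> \<epsilon> * \<delta> / 2" using \<epsilon> \<epsilon>le by (intro divide_right_mono mult_left_mono) auto
      finally show ?thesis by (simp add: mult.commute)
    qed
    have small: "\<rho> ^ 4 * (real (card I) * b\<^sup>2) \<le> \<eta>"
    proof -
      have "\<rho> ^ 4 = \<rho>\<^sup>2 * \<rho>\<^sup>2" by (simp add: power2_eq_square power4_eq_xxxx)
      also have "\<dots> \<le> \<epsilon>\<^sup>2 * 1" using \<rho> by (intro mult_mono power_mono) (auto simp: power_le_one)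
      finally have "\<rho> ^ 4 \<le> \<epsilon>\<^sup>2" by simp
      then show ?thesis unfolding \<eta>_def P_def m_def by (intro mult_mono) auto
    qed
    have rad: "\<rho> + \<rho>\<^sup>2 * (real (card I) * b\<^sup>2 * (\<Sum>p\<in>I. 2 + cmod (Q p p))) \<le> \<epsilon> - K * \<eta>"
    proof -
      have "\<rho>\<^sup>2 * (real (card I) * b\<^sup>2 * (\<Sum>p\<in>I. 2 + cmod (Q p p))) \<le> \<epsilon>\<^sup>2 * L"
        using \<rho> by (intro mult_mono power_mono) (auto simp: L_def m_def intro!: mult_nonneg_nonneg sum_nonneg)
      also have "\<dots> = \<epsilon> * (\<epsilon> * (2 * L)) / 2" by (simp add: power2_eq_square)
      also have "\<dots> \<le> \<epsilon> * \<delta> / 2" using \<epsilon> \<epsilon>le by (intro divide_right_mono mult_left_mono) auto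
      finally show ?thesis using K\<eta> by (simp add: \<rho>_def algebra_simps)
    qed
    obtain \<eta>A' where \<eta>A': "\<eta>A' > 0" and ev: "\<forall>\<^sub>F n in sequentially. \<forall>B. close_on I \<eta>A' Q (gram n B) \<longrightarrow>
     ennreal ((\<rho> ^ (2 * n)) ^ card I * (vball n ^ card I / 2))
       \<le> emeasure (tn I n) (gnb I n Q \<eta> \<inter> tbox I n B (\<rho> + \<rho>\<^sup>2 * (real (card I) * b\<^sup>2 * (\<Sum>p\<in>I. 2 + cmod (Q p p)))))"
      using that by (rule gnb_box_volume[OF fin bc b \<rho>(1,3) \<eta>(1) small])
    define \<eta>A where "\<eta>A = min \<eta>A' \<eta>"
    have \<eta>A: "\<eta>A > 0" using \<eta>A' \<eta> by (simp add: \<eta>A_def)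
    show ?thesis
    proof (intro exI[of _ \<eta>A] conjI \<eta>A)
      show "\<forall>\<^sub>F n in sequentially. \<forall>A Z.
     close_on I \<eta>A Q (gram n A) \<longrightarrow> close_on I \<eta>A Q (gram n Z) \<longrightarrow>
     ennreal ((((1 - \<delta>) * \<epsilon>) ^ (2 * n)) ^ card I / (2 * Re (det_on I (shiftdiag t Q)) ^ n)) \<le> pk I n \<epsilon> A Z"
        using ev
      proof eventually_elim
        case (elim n)
        show ?case
        proof (intro allI impI)
          fix A Z assume cA: "close_on I \<eta>A Q (gram n A)" and cZ: "close_on I \<eta>A Q (gram n Z)"
          let ?G = "gnb I n Q \<eta>"
          let ?D = "Re (det_on I (shiftdiag t Q))"
          let ?h = "(\<rho> ^ (2 * n)) ^ card I * (vball n ^ card I / 2)"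
          have G: "?G \<in> sets (tn I n)" using fin by simp
          have D: "?D > 0"
            using shiftdiag_chol[OF fin psd t] bounded_chol_det_pos[OF fin, of "1 + (\<Sum>p\<in>I. \<Sum>q\<in>I. cmod (R p q) + cmod (S p q))"]
          proof -
            obtain R' S' where c': "chol I (shiftdiag t Q) R' S'" using shiftdiag_chol[OF fin psd t] by blast
            then have "det_on I (shiftdiag t Q) = complex_of_real (\<Prod>l\<in>I. (cmod (R' l l))\<^sup>2)" by (simp add: chol_def)
            then show ?thesis using chol_nonzero[OF fin c'] by (simp only: Re_complex_of_real)
          qed
          have cZ': "close_on I \<eta> Q (gram n Z)" using cZ by (rule close_on_mono) (simp add: \<eta>A_def)
          have le: "pk I n (\<epsilon> - K * \<eta>) A X * indicator ?G X \<le> pk I n \<epsilon> A Z * indicator ?G X" for X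
          proof (cases "X \<in> ?G")
            case True
            then have "\<exists>W\<in>umat n. \<forall>i\<in>I. nrm n (\<lambda>l. mult n W (X i) l - Z i l) \<le> K * \<eta>"
              using trans[OF bc, of \<eta> n X Z] cZ' \<eta> by (auto simp: gnb_def)
            then obtain W where W: "W \<in> umat n" "\<And>i. i \<in> I \<Longrightarrow> nrm n (\<lambda>l. mult n W (X i) l - Z i l) \<le> K * \<eta>" by blast
            have "pk I n (\<epsilon> - K * \<eta>) A X \<le> pk I n (\<epsilon> - K * \<eta> + K * \<eta>) A Z" by (rule pk_compare[OF fin W])
            then show ?thesis by (simp add: mult_right_mono)
          qed (simp add: indicator_def)
          \<comment> \<open>Every image of \<open>A\<close> under a unitary has the Gram kernel of
            \<open>A\<close>, so one lower bound serves all \<open>U\<close>.\<close>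
          have "ennreal ?h = (\<integral>\<^sup>+U. ennreal ?h \<partial>haar n)" by (simp add: haar.emeasure_space_1)
          also have "\<dots> \<le> (\<integral>\<^sup>+U. emeasure (tn I n) (?G \<inter> tbox I n (\<lambda>i. mult n U (A i)) (\<epsilon> - K * \<eta>)) \<partial>haar n)"
          proof (rule nn_integral_mono)
            fix U assume "U \<in> space (haar n)"
            then have U: "U \<in> umat n" by (simp add: space_haar)
            have "gram n (\<lambda>i. mult n U (A i)) p q = gram n A p q" for p q by (simp add: gram_def cinner_mult[OF U])
            then have "close_on I \<eta>A' Q (gram n (\<lambda>i. mult n U (A i)))"
              using cA by (auto simp: close_on_def \<eta>A_def)
            then have "ennreal ?h \<le> emeasure (tn I n) (?G \<inter> tbox I n (\<lambda>i. mult n U (A i)) (\<rho> + \<rho>\<^sup>2 * (real (card I) * b\<^sup>2 * (\<Sum>p\<in>I. 2 + cmod (Q p p)))))"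
              using elim by blast
            also have "\<dots> \<le> emeasure (tn I n) (?G \<inter> tbox I n (\<lambda>i. mult n U (A i)) (\<epsilon> - K * \<eta>))"
              using fin rad by (intro emeasure_mono) (force simp: tbox_def)+
            finally show "ennreal ?h \<le> emeasure (tn I n) (?G \<inter> tbox I n (\<lambda>i. mult n U (A i)) (\<epsilon> - K * \<eta>))" .
          qed
          also have "\<dots> = (\<integral>\<^sup>+X. pk I n (\<epsilon> - K * \<eta>) A X * indicator ?G X \<partial>tn I n)"
            by (rule pk_integral[OF fin G, symmetric])
          also have "\<dots> \<le> (\<integral>\<^sup>+X. pk I n \<epsilon> A Z * indicator ?G X \<partial>tn I n)" by (intro nn_integral_mono le)
          also have "\<dots> = pk I n \<epsilon> A Z * emeasure (tn I n) ?G" using G by (simp add: nn_integral_cmult)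
          also have "\<dots> \<le> pk I n \<epsilon> A Z * ennreal (?D ^ n * vball n ^ card I)"
            using \<eta> by (intro mult_left_mono gnb_volume_upper[OF fin psd t]) (auto simp: m_def)
          finally have "ennreal (?h / (?D ^ n * vball n ^ card I)) \<le> pk I n \<epsilon> A Z"
            using D \<rho> by (intro ennreal_divide_leI) (auto simp: less_imp_le)
          also have "?h / (?D ^ n * vball n ^ card I) = (\<rho> ^ (2 * n)) ^ card I / (2 * ?D ^ n)"
            using less_imp_neq[OF vball_pos[of n]] by (simp add: field_simps)
          finally show "ennreal ((((1 - \<delta>) * \<epsilon>) ^ (2 * n)) ^ card I / (2 * ?D ^ n)) \<le> pk I n \<epsilon> A Z"
            by (simp add: \<rho>_def)
        qed
      qed
    qed
  qed
  then show ?thesis using that[of \<epsilon>1] e1pos by blast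
qed

subsection \<open>Orbits of tuples under a representation\<close>

definition lmat :: "nat \<Rightarrow> ('s \<Rightarrow> nat \<times> nat \<Rightarrow> complex) \<Rightarrow> 's \<times> bool \<Rightarrow> nat \<times> nat \<Rightarrow> complex" where
  "lmat n U x = (if snd x then adj n (U (fst x)) else U (fst x))"

lemma act_letter_mult: "l < n \<Longrightarrow> act_letter n U x v l = mult n (lmat n U x) v l"
  unfolding act_letter_def mult_def lmat_def by (intro sum.cong refl) (simp add: adj_def)

lemma act_letter_cong: "(\<And>l. l < n \<Longrightarrow> v l = w l) \<Longrightarrow> act_letter n U x v = act_letter n U x w"
  unfolding act_letter_def by (intro ext sum.cong) auto

lemma lmat_umat: "\<forall>s. U s \<in> umat n \<Longrightarrow> lmat n U x \<in> umat n"
  by (simp add: lmat_def adj_umat)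

lemma act_letter_linv:
  assumes "\<forall>s. U s \<in> umat n" "l < n"
  shows "act_letter n U x (act_letter n U (linv x) v) l = v l"
proof -
  have "act_letter n U x (act_letter n U (linv x) v) l = mult n (lmat n U x) (mult n (lmat n U (linv x)) v) l"
    unfolding act_letter_mult[OF assms(2)] by (rule fun_cong[OF mult_cong]) (rule act_letter_mult)
  then show ?thesis 
    using adj_mult[OF assms(1)[rule_format, of "fst x"] assms(2)] by (simp add: lmat_def linv_def)
qed

text \<open>A cancelled pair of letters acts trivially because the matrices are unitary. Hence the
  action of letters respects reduction, and \<open>rep_act\<close> is a representation.\<close>

lemma foldr_red_cons_act:
  assumes U: "\<forall>s. U s \<in> umat n" and l: "l < n"
  shows "foldr (act_letter n U) (red_cons x ys) v l = act_letter n U x (foldr (act_letter n U) ys v) l"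
proof (cases "ys \<noteq> [] \<and> hd ys = linv x")
  case True
  then obtain ys' where ys: "ys = linv x # ys'" by (cases ys) auto
  then show ?thesis using act_letter_linv[OF U l] by (simp add: red_cons_eq)
qed (auto simp: red_cons_eq)

lemma foldr_act_append:
  assumes U: "\<forall>s. U s \<in> umat n"
  shows "l < n \<Longrightarrow> foldr (act_letter n U) (foldr red_cons us ws) v l = foldr (act_letter n U) us (foldr (act_letter n U) ws v) l"
proof (induction us arbitrary: l)
  case (Cons x us)
  then show ?case using foldr_red_cons_act[OF U Cons.prems]
    by (simp add: act_letter_cong[of n "foldr (act_letter n U) (foldr red_cons us ws) v" "foldr (act_letter n U) us (foldr (act_letter n U) ws v)"])
qed simp

lemma rep_act_fmul:
  "\<forall>s. U s \<in> umat n \<Longrightarrow> l < n \<Longrightarrow> rep_act n U (fmul g h) v l = rep_act n U g (rep_act n U h v) l"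
  unfolding rep_act_def word_fmul by (rule foldr_act_append)

lemma cinner_act_letter:
  assumes U: "\<forall>s. U s \<in> umat n"
  shows "cinner n (act_letter n U x v) (act_letter n U x w) = cinner n v w"
proof -
  have "cinner n (act_letter n U x v) (act_letter n U x w) = cinner n (mult n (lmat n U x) v) (mult n (lmat n U x) w)"
    by (intro cinner_cong act_letter_mult)
  then show ?thesis using cinner_mult[OF lmat_umat[OF U]] by simp
qed

lemma cinner_rep_act:
  assumes U: "\<forall>s. U s \<in> umat n"
  shows "cinner n (rep_act n U g v) (rep_act n U g w) = cinner n v w"
proof -
  have "cinner n (foldr (act_letter n U) xs v) (foldr (act_letter n U) xs w) = cinner n v w" for xs
    by (induction xs) (simp_all add: cinner_act_letter[OF U])
  then show ?thesis by (simp add: rep_act_def)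
qed

lemma nrm_act_letter_diff:
  assumes U: "\<forall>s. U s \<in> umat n"
  shows "nrm n (\<lambda>l. act_letter n U x v l - act_letter n U x w l) = nrm n (\<lambda>l. v l - w l)"
proof -
  have "nrm n (\<lambda>l. act_letter n U x v l - act_letter n U x w l) = nrm n (mult n (lmat n U x) (\<lambda>l. v l - w l))"
    by (rule nrm_cong) (simp add: act_letter_mult mult_diff)
  then show ?thesis using nrm_mult[OF lmat_umat[OF U]] by simp
qed

lemma nrm_eqI: "cinner n v v = cinner n w w \<Longrightarrow> nrm n v = nrm n w"
  unfolding cinner_self of_real_eq_iff by (simp add: power2_eq_iff_nonneg)

lemma nrm_rep_act: "\<forall>s. U s \<in> umat n \<Longrightarrow> nrm n (rep_act n U g v) = nrm n v"
  by (intro nrm_eqI cinner_rep_act)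

definition orb :: "nat \<Rightarrow> ('s \<Rightarrow> nat \<times> nat \<Rightarrow> complex) \<Rightarrow> ('k \<Rightarrow> nat \<Rightarrow> complex) \<Rightarrow> 's fword \<times> 'k \<Rightarrow> nat \<Rightarrow> complex" where
  "orb n U X = (\<lambda>(g, i). rep_act n U g (X i))"

text \<open>Unitarity of \<open>g\<close> lets it act on both sides of the inner product, where it
  cancels the inverse inside the coefficient.\<close>

lemma gramker_coeff_map:
  assumes U: "\<forall>s. U s \<in> umat n"
  shows "gramker (coeff_map n U V) p q = gram n (orb n U (\<lambda>i l. V (i, l))) p q"
proof -
  obtain g i h j where pq: "p = (g, i)" "q = (h, j)" by (cases p, cases q)
  let ?v = "\<lambda>j l. V (j, l)"
  have "gramker (coeff_map n U V) p q = cinner n (rep_act n U (fmul (finv g) h) (?v j)) (?v i)"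
    by (simp add: pq gramker_def coeff_map_def)
  also have "\<dots> = cinner n (rep_act n U g (rep_act n U (fmul (finv g) h) (?v j))) (rep_act n U g (?v i))"
    by (rule cinner_rep_act[OF U, symmetric])
  also have "\<dots> = cinner n (rep_act n U h (?v j)) (rep_act n U g (?v i))"
    using rep_act_fmul[OF U, of _ g "fmul (finv g) h" "?v j"] by (intro cinner_cong) (simp_all add: fmul_cancel)
  finally show ?thesis by (simp add: pq gram_def orb_def)
qed

lemma psd_cong: "(\<And>p q. p \<in> I \<Longrightarrow> q \<in> I \<Longrightarrow> Q p q = Q' p q) \<Longrightarrow> psd I Q = psd I Q'"
proof -
  assume "\<And>p q. p \<in> I \<Longrightarrow> q \<in> I \<Longrightarrow> Q p q = Q' p q"
  then have "qf I Q a = qf I Q' a" for a unfolding qf_def by (intro sum.cong refl) auto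
  then show ?thesis by (simp add: psd_def)
qed

text \<open>Since coefficient maps are always positive definite, a relatively open set of maps can
  be tested by the open set that cuts it out, as \<open>Xset_sets\<close> does.\<close>

lemma posdef_coeff_map:
  fixes V :: "'k::finite \<times> nat \<Rightarrow> complex"
  assumes U: "\<forall>s. U s \<in> umat n"
  shows "posdef (coeff_map n U V)"
proof -
  let ?v = "\<lambda>j l. V (j, l)"
  let ?C = "(\<Sum>i\<in>UNIV. nrm n (?v i)) * (\<Sum>i\<in>UNIV. nrm n (?v i))"
  have "cmod (coeff_map n U V g $ i $ j) \<le> ?C" for g i j
  proof -
    have "cmod (coeff_map n U V g $ i $ j) \<le> nrm n (?v j) * nrm n (?v i)"
      using cinner_le[of n "rep_act n U g (?v j)" "?v i"] by (simp add: coeff_map_def nrm_rep_act[OF U])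
    also have "\<dots> \<le> ?C" by (intro mult_mono member_le_sum sum_nonneg) auto
    finally show ?thesis .
  qed
  moreover have "psd (F \<times> UNIV) (gramker (coeff_map n U V))" for F
    using psd_gram[of "F \<times> UNIV" n "orb n U ?v"] by (subst psd_cong[OF gramker_coeff_map[OF U]]) 
  then have "Im (qf (F \<times> UNIV) (gramker (coeff_map n U V)) (\<lambda>(g, i). a i g)) = 0
      \<and> 0 \<le> Re (qf (F \<times> UNIV) (gramker (coeff_map n U V)) (\<lambda>(g, i). a i g))" for F and a :: "'k \<Rightarrow> 'a fword \<Rightarrow> complex"
    unfolding psd_def by blast
  ultimately show ?thesis unfolding posdef_def Let_def qf_gramker by auto
qed

lemma act_letter_measurable:
  assumes "\<And>l. l < n \<Longrightarrow> (\<lambda>x. f x l) \<in> borel_measurable M"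
  shows "(\<lambda>x. act_letter n U a (f x) l) \<in> borel_measurable M"
  unfolding act_letter_def using assms by (intro borel_measurable_sum borel_measurable_times) auto

lemma rep_act_measurable:
  assumes "\<And>l. l < n \<Longrightarrow> (\<lambda>x. f x l) \<in> borel_measurable M" "l < n"
  shows "(\<lambda>x. rep_act n U g (f x) l) \<in> borel_measurable M"
proof -
  have "l < n \<Longrightarrow> (\<lambda>x. foldr (act_letter n U) w (f x) l) \<in> borel_measurable M" for w l
    by (induction w arbitrary: l) (auto intro: assms(1) act_letter_measurable)
  then show ?thesis using assms(2) by (simp add: rep_act_def)
qed

section \<open>Flattening of tuples, measurability, and basic neighbourhoods\<close>

definition vflat :: "nat \<Rightarrow> ('k \<Rightarrow> nat \<Rightarrow> complex) \<Rightarrow> 'k \<times> nat \<Rightarrow> complex" where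
  "vflat n X = (\<lambda>(i, l)\<in>UNIV \<times> {..<n}. X i l)"

lemma vflat_measurable: "vflat n \<in> tn (UNIV :: 'k::finite set) n \<rightarrow>\<^sub>M vec_meas n"
proof -
  have "(\<lambda>X. \<lambda>p\<in>UNIV \<times> {..<n}. X (fst p) (snd p)) \<in> tn (UNIV :: 'k set) n \<rightarrow>\<^sub>M vec_meas n"
    unfolding vec_meas_def by (intro measurable_restrict) auto
  moreover have "(\<lambda>X. \<lambda>p\<in>UNIV \<times> {..<n}. X (fst p) (snd p)) = (vflat n :: ('k \<Rightarrow> nat \<Rightarrow> complex) \<Rightarrow> _)"
    by (auto simp: vflat_def fun_eq_iff)
  ultimately show ?thesis by simp
qed

lemma distr_flat: "distr (tn (UNIV :: 'k::finite set) n) (vec_meas n) (vflat n) = vec_meas n"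
proof -
  have "distr (tn (UNIV :: 'k set) n) (vec_meas n) (vflat n) = PiM (UNIV \<times> {..<n}) (\<lambda>_. lborel)"
  proof (rule cprod.PiM_eqI)
    fix A :: "'k \<times> nat \<Rightarrow> complex set" assume A: "\<And>i. i \<in> UNIV \<times> {..<n} \<Longrightarrow> A i \<in> sets lborel"
    have box: "PiE (UNIV \<times> {..<n}) A \<in> sets (vec_meas n)"
      unfolding vec_meas_def using A by (intro sets_PiM_I_finite) auto
    have "emeasure (distr (tn UNIV n) (vec_meas n) (vflat n)) (PiE (UNIV \<times> {..<n}) A)
       = emeasure (tn (UNIV :: 'k set) n) (vflat n -` PiE (UNIV \<times> {..<n}) A \<inter> space (tn UNIV n))"
      by (intro emeasure_distr vflat_measurable box)
    also have "vflat n -` PiE (UNIV \<times> {..<n}) A \<inter> space (tn (UNIV :: 'k set) n) = PiE UNIV (\<lambda>i. PiE {..<n} (\<lambda>l. A (i, l)))"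
      by (auto simp: vflat_def space_tn space_cn PiE_iff)
    also have "emeasure (tn (UNIV :: 'k set) n) \<dots> = (\<Prod>i\<in>UNIV. emeasure (cn n) (PiE {..<n} (\<lambda>l. A (i, l))))"
      unfolding tn_def using A by (intro tprod.emeasure_PiM) (auto simp: cn_def intro!: sets_PiM_I_finite)
    also have "\<dots> = (\<Prod>i\<in>UNIV. \<Prod>l\<in>{..<n}. emeasure lborel (A (i, l)))"
      unfolding cn_def using A by (intro prod.cong refl cprod.emeasure_PiM) auto
    also have "\<dots> = (\<Prod>p\<in>UNIV \<times> {..<n}. emeasure lborel (A p))"
      by (simp add: prod.cartesian_product')
    finally show "emeasure (distr (tn UNIV n) (vec_meas n) (vflat n)) (PiE (UNIV \<times> {..<n}) A) = (\<Prod>p\<in>UNIV \<times> {..<n}. emeasure lborel (A p))" .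
  qed (simp_all add: vec_meas_def)
  then show ?thesis by (simp add: vec_meas_def)
qed

lemma emeasure_vec_meas:
  fixes S :: "('k::finite \<times> nat \<Rightarrow> complex) set"
  assumes "S \<in> sets (vec_meas n)"
  shows "emeasure (vec_meas n) S = emeasure (tn UNIV n) {X \<in> space (tn UNIV n). vflat n X \<in> S}"
proof -
  have "emeasure (vec_meas n) S = emeasure (distr (tn UNIV n) (vec_meas n) (vflat n)) S" by (simp add: distr_flat)
  also have "\<dots> = emeasure (tn UNIV n) (vflat n -` S \<inter> space (tn UNIV n))"
    by (intro emeasure_distr vflat_measurable assms)
  finally show ?thesis by (simp add: vimage_def Int_def conj_commute)
qed

lemma vec_component_measurable: "l < n \<Longrightarrow> (\<lambda>V. V (i, l)) \<in> borel_measurable (vec_meas n :: ('k \<times> nat \<Rightarrow> complex) measure)"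
proof -
  assume "l < n"
  then have "(\<lambda>V. V (i, l)) \<in> measurable (vec_meas n :: ('k \<times> nat \<Rightarrow> complex) measure) lborel"
    unfolding vec_meas_def by (intro measurable_component_singleton) auto
  then show ?thesis by simp
qed

lemma coeff_map_measurable:
  "(\<lambda>V. coeff_map n U V :: 's::finite fword \<Rightarrow> complex^'k::finite^'k) \<in> borel_measurable (vec_meas n)"
proof (rule measurable_coordinatewise_then_product)
  fix g :: "'s fword"
  show "(\<lambda>V. coeff_map n U V g :: complex^'k^'k) \<in> borel_measurable (vec_meas n)"
  proof (rule borel_measurable_euclidean_space[THEN iffD2], rule ballI)
    fix b :: "complex^'k^'k" assume "b \<in> Basis"
    then obtain i j c where b: "b = axis i (axis j c)" by (auto simp: Basis_vec_def)
    have "(\<lambda>V. cinner n (rep_act n U g (\<lambda>l. V (j, l))) (\<lambda>l. V (i, l))) \<in> borel_measurable (vec_meas n)"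
      by (intro cinner_measurable rep_act_measurable vec_component_measurable)
    then show "(\<lambda>V. coeff_map n U V g \<bullet> b) \<in> borel_measurable (vec_meas n)"
      unfolding b inner_axis coeff_map_def by simp
  qed
qed

lemma Xset_sets:
  fixes W :: "('s::finite fword \<Rightarrow> complex^'k::finite^'k) set"
  assumes U: "\<forall>s. U s \<in> umat n" and W: "openin (top_of_set {\<psi>. posdef \<psi>}) W"
  shows "Xset n U W \<in> sets (vec_meas n)"
proof -
  obtain T where T: "open T" "W = {\<psi>. posdef \<psi>} \<inter> T" using W by (auto simp: openin_open)
  have "Xset n U W = {V \<in> space (vec_meas n). coeff_map n U V \<in> T}"
    using posdef_coeff_map[OF U] by (auto simp: Xset_def T)
  moreover have "(\<lambda>V. coeff_map n U V) -` T \<inter> space (vec_meas n) \<in> sets (vec_meas n)"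
    using T(1) by (intro measurable_sets[OF coeff_map_measurable]) auto
  ultimately show ?thesis by (simp add: vimage_def Int_def conj_commute)
qed

text \<open>Strict inequalities make these sets relatively open. They are compared with the closed
  conditions of \<open>gnb\<close> by a slight change of radius.\<close>

definition wnb :: "'s fword set \<Rightarrow> real \<Rightarrow> ('s fword \<Rightarrow> complex^'k^'k) \<Rightarrow> ('s fword \<Rightarrow> complex^'k^'k) set" where
  "wnb F \<eta> \<phi> = {\<psi>. posdef \<psi> \<and> (\<forall>p\<in>F \<times> UNIV. \<forall>q\<in>F \<times> UNIV. cmod (gramker \<psi> p q - gramker \<phi> p q) < \<eta>)}"

lemma wnb_open:
  fixes \<phi> :: "'s fword \<Rightarrow> complex^'k::finite^'k"
  assumes "finite F" shows "openin (top_of_set {\<psi>. posdef \<psi>}) (wnb F \<eta> \<phi>)"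
proof -
  have "open {\<psi> :: 's fword \<Rightarrow> complex^'k^'k. cmod (gramker \<psi> p q - gramker \<phi> p q) < \<eta>}" for p q
  proof -
    have "continuous_on UNIV (\<lambda>\<psi> :: 's fword \<Rightarrow> complex^'k^'k. gramker \<psi> p q)"
      unfolding gramker_def split_def by (intro continuous_intros continuous_on_product_coordinates)
    then have "continuous_on UNIV (\<lambda>\<psi> :: 's fword \<Rightarrow> complex^'k^'k. cmod (gramker \<psi> p q - gramker \<phi> p q))"
      by (intro continuous_intros)
    then show ?thesis by (intro open_Collect_less continuous_on_const)
  qed
  then have "open (\<Inter>p\<in>F \<times> UNIV. \<Inter>q\<in>F \<times> UNIV. {\<psi> :: 's fword \<Rightarrow> complex^'k^'k. cmod (gramker \<psi> p q - gramker \<phi> p q) < \<eta>})"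
    using assms by (intro open_INT) auto
  moreover have "wnb F \<eta> \<phi> = {\<psi>. posdef \<psi>} \<inter> (\<Inter>p\<in>F \<times> UNIV. \<Inter>q\<in>F \<times> UNIV. {\<psi>. cmod (gramker \<psi> p q - gramker \<phi> p q) < \<eta>})"
    by (auto simp: wnb_def)
  ultimately show ?thesis by (auto simp: openin_open)
qed

lemma mem_wnb: "posdef \<phi> \<Longrightarrow> \<eta> > 0 \<Longrightarrow> \<phi> \<in> wnb F \<eta> \<phi>"
  by (simp add: wnb_def)

text \<open>A basic neighbourhood for pointwise convergence constrains finitely many values of the
  map. These are kernel entries in the rows of \<open>fone\<close>, and finitely many group elements
  fit into one ball.\<close>

lemma wnb_basis:
  fixes \<phi> :: "'s::finite fword \<Rightarrow> complex^'k::finite^'k"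
  assumes W: "openin (top_of_set {\<psi>. posdef \<psi>}) W" "\<phi> \<in> W"
  obtains N \<eta> where "\<eta> > 0" "wnb (fball N) \<eta> \<phi> \<subseteq> W"
proof -
  obtain T where T: "open T" "W = {\<psi>. posdef \<psi>} \<inter> T" using W by (auto simp: openin_open)
  then have "\<phi> \<in> T" using W by auto
  then obtain X where X: "\<phi> \<in> Pi\<^sub>E UNIV X" "\<And>g. open (X g)" "finite {g. X g \<noteq> UNIV}" "Pi\<^sub>E UNIV X \<subseteq> T"
    using T(1) unfolding open_fun_def
    by (auto dest!: product_topology_open_contains_basis)
  have "\<exists>e>0. \<forall>v. (\<forall>i j. cmod (v $ i $ j - \<phi> g $ i $ j) < e) \<longrightarrow> v \<in> X g" for g
  proof -
    have "\<phi> g \<in> X g" using X(1) by auto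
    then obtain r where r: "r > 0" "\<And>v. dist v (\<phi> g) < r \<Longrightarrow> v \<in> X g"
      using X(2)[of g] unfolding open_dist by metis
    define e where "e = r / (real CARD('k) * real CARD('k))"
    have e: "e > 0" using r by (simp add: e_def)
    have "v \<in> X g" if v: "\<forall>i j. cmod (v $ i $ j - \<phi> g $ i $ j) < e" for v
    proof -
      have "norm (v - \<phi> g) \<le> (\<Sum>i\<in>UNIV. norm ((v - \<phi> g) $ i))"
        unfolding norm_vec_def by (rule L2_set_le_sum_abs[THEN order_trans]) simp
      also have "\<dots> \<le> (\<Sum>i\<in>UNIV. \<Sum>j\<in>UNIV. cmod ((v - \<phi> g) $ i $ j))"
        by (intro sum_mono) (unfold norm_vec_def, rule L2_set_le_sum_abs[THEN order_trans], simp)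
      also have "\<dots> < (\<Sum>i\<in>(UNIV::'k set). \<Sum>j\<in>(UNIV::'k set). e)"
        using v by (intro sum_strict_mono) auto
      also have "\<dots> = r" by (simp add: e_def)
      finally show ?thesis using r(2) by (simp add: dist_norm)
    qed
    then show ?thesis using e by blast
  qed
  then obtain e where e: "\<And>g. e g > 0" "\<And>g v. (\<And>i j. cmod (v $ i $ j - \<phi> g $ i $ j) < e g) \<Longrightarrow> v \<in> X g"
    by metis
  define G where "G = {g. X g \<noteq> UNIV}"
  define N where "N = Max (insert 0 ((\<lambda>g. length (word g)) ` G))"
  define \<eta> where "\<eta> = Min (insert 1 (e ` G))"
  have \<eta>: "\<eta> > 0" using e(1) X(3) by (auto simp: \<eta>_def G_def)
  have "wnb (fball N) \<eta> \<phi> \<subseteq> W"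
  proof
    fix \<psi> assume \<psi>: "\<psi> \<in> wnb (fball N) \<eta> \<phi>"
    have "\<psi> g \<in> X g" for g
    proof (cases "g \<in> G")
      case True
      have "length (word g) \<le> N" unfolding N_def using True X(3) by (intro Max_ge) (auto simp: G_def)
      then have g: "g \<in> fball N" "fone \<in> fball N" by (auto simp: fball_def)
      have le: "\<eta> \<le> e g" unfolding \<eta>_def using True X(3) by (intro Min_le) (auto simp: G_def)
      have f: "fmul (finv fone) g = g" by (metis fmul_cancel(1) fmul_fone(1))
      have "cmod (\<psi> g $ i $ j - \<phi> g $ i $ j) < e g" for i j
      proof -
        have "(fone, i) \<in> fball N \<times> UNIV" "(g, j) \<in> fball N \<times> UNIV" using g by auto
        then have "cmod (gramker \<psi> (fone, i) (g, j) - gramker \<phi> (fone, i) (g, j)) < \<eta>"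
          using \<psi> unfolding wnb_def by blast
        then show ?thesis using le by (simp add: gramker_def f)
      qed
      then show ?thesis by (rule e(2))
    next
      case False
      then show ?thesis by (simp add: G_def)
    qed
    then show "\<psi> \<in> W" using \<psi> X(4) by (auto simp: T(2) wnb_def)
  qed
  then show ?thesis using that \<eta> by blast
qed

subsection \<open>Thickened orbits\<close>

text \<open>Orbits are a null set; \<open>fz\<close> thickens them by allowing an error \<open>\<epsilon>\<close> along every edge of the tree.\<close>

definition fz :: "'s fword set \<Rightarrow> nat \<Rightarrow> real \<Rightarrow> ('s \<Rightarrow> nat \<times> nat \<Rightarrow> complex) \<Rightarrow> ('s fword \<times> 'k \<Rightarrow> nat \<Rightarrow> complex) \<Rightarrow> bool" where
  "fz F n \<epsilon> U Y \<longleftrightarrow> (\<forall>h\<in>F - {fone}. \<forall>i. nrm n (\<lambda>l. Y (h, i) l - act_letter n U (hd (word h)) (Y (fparent h, i)) l) \<le> \<epsilon>)"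

definition root :: "('s fword \<times> 'k \<Rightarrow> nat \<Rightarrow> complex) \<Rightarrow> 'k \<Rightarrow> nat \<Rightarrow> complex" where
  "root Y = (\<lambda>i. Y (fone, i))"

lemma root_measurable [measurable]:
  "fone \<in> F \<Longrightarrow> root \<in> tn (F \<times> UNIV) n \<rightarrow>\<^sub>M tn (UNIV :: 'k::finite set) n"
proof -
  assume "fone \<in> F"
  then have "(\<lambda>Y. \<lambda>i\<in>UNIV. Y (fone, i)) \<in> tn (F \<times> UNIV) n \<rightarrow>\<^sub>M tn (UNIV :: 'k set) n"
    unfolding tn_def by (intro measurable_restrict measurable_component_singleton) auto
  then show ?thesis by (simp only: root_def[abs_def] restrict_UNIV)
qed

lemma fz_sets:
  assumes fin: "finite F" and sc: "suffix_closed F"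
  shows "{Y \<in> space (tn (F \<times> (UNIV :: 'k::finite set)) n). fz F n \<epsilon> U Y} \<in> sets (tn (F \<times> UNIV) n)"
proof -
  have [measurable]: "(\<lambda>Y. nrm n (\<lambda>l. Y (h, i) l - act_letter n U (hd (word h)) (Y (fparent h, i)) l)) \<in> borel_measurable (tn (F \<times> (UNIV :: 'k set)) n)"
    if "h \<in> F - {fone}" for h i
  proof -
    have c: "(\<lambda>Y. Y (g, i) l) \<in> borel_measurable (tn (F \<times> (UNIV :: 'k set)) n)" if "g \<in> F" "l < n" for g l
      by (rule cn_component[OF tn_component[OF measurable_ident_sets[OF refl]]]) (use that in auto)
    show ?thesis using that sc
      by (intro nrm_measurable borel_measurable_diff act_letter_measurable c) (auto simp: suffix_closed_def)
  qed
  have f: "finite (F - {fone})" using fin by simp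
  have eq: "fz F n \<epsilon> U Y \<longleftrightarrow> (\<forall>h\<in>F - {fone}. \<forall>i\<in>UNIV. nrm n (\<lambda>l. Y (h, i) l - act_letter n U (hd (word h)) (Y (fparent h, i)) l) \<le> \<epsilon>)"
    for Y :: "'a fword \<times> 'k \<Rightarrow> nat \<Rightarrow> complex" by (simp add: fz_def)
  show ?thesis unfolding eq using f by measurable
qed

lemma emeasure_root:
  assumes S: "S \<in> sets (tn (UNIV :: 'k::finite set) n)"
  shows "emeasure (tn ({fone} \<times> UNIV) n) {Y \<in> space (tn ({fone :: 's fword} \<times> UNIV) n). root Y \<in> S} = emeasure (tn UNIV n) S"
proof -
  let ?I = "{fone :: 's fword} \<times> (UNIV :: 'k set)"
  have m: "root \<in> tn ?I n \<rightarrow>\<^sub>M tn (UNIV :: 'k set) n" by measurable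
  have "distr (tn ?I n) (tn (UNIV :: 'k set) n) root = PiM UNIV (\<lambda>_. cn n)"
  proof (rule tprod.PiM_eqI)
    fix A :: "'k \<Rightarrow> (nat \<Rightarrow> complex) set" assume A: "\<And>i. i \<in> UNIV \<Longrightarrow> A i \<in> sets (cn n)"
    have box: "PiE UNIV A \<in> sets (tn UNIV n)" unfolding tn_def using A by (intro sets_PiM_I_finite) auto
    have "emeasure (distr (tn ?I n) (tn UNIV n) root) (PiE UNIV A) = emeasure (tn ?I n) (root -` PiE UNIV A \<inter> space (tn ?I n))"
      by (intro emeasure_distr m box)
    also have "root -` PiE UNIV A \<inter> space (tn ?I n) = PiE ?I (\<lambda>(g, i). A i)"
      using sets.sets_into_space[OF A] by (auto simp: root_def space_tn PiE_iff)
    also have "emeasure (tn ?I n) \<dots> = (\<Prod>p\<in>?I. emeasure (cn n) (case p of (g, i) \<Rightarrow> A i))"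
      unfolding tn_def using A by (intro tprod.emeasure_PiM) auto
    also have "\<dots> = (\<Prod>i\<in>UNIV. emeasure (cn n) (A i))"
      by (simp add: prod.cartesian_product')
    finally show "emeasure (distr (tn ?I n) (tn UNIV n) root) (PiE UNIV A) = (\<Prod>i\<in>UNIV. emeasure (cn n) (A i))" .
  qed (simp_all add: tn_def)
  then have "emeasure (tn UNIV n) S = emeasure (distr (tn ?I n) (tn UNIV n) root) S" by (simp add: tn_def)
  also have "\<dots> = emeasure (tn ?I n) (root -` S \<inter> space (tn ?I n))" by (intro emeasure_distr m S)
  finally show ?thesis by (simp add: vimage_def Int_def conj_commute)
qed

text \<open>Prune a longest word \<open>x\<close>: it is nobody's parent, so given the other vectors
  those at \<open>x\<close> range freely over a product of balls whose centres depend on the parent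
  of \<open>x\<close> only.\<close>

lemma emeasure_fz:
  assumes "finite F" "suffix_closed F" "fone \<in> F" "0 \<le> \<epsilon>" and S: "S \<in> sets (tn (UNIV :: 'k::finite set) n)"
  shows "emeasure (tn (F \<times> UNIV) n) {Y \<in> space (tn (F \<times> UNIV) n). fz F n \<epsilon> U Y \<and> root Y \<in> S}
     = ennreal ((vball n * \<epsilon> ^ (2 * n)) ^ (CARD('k) * (card F - 1))) * emeasure (tn UNIV n) S"
  using assms(1-3)
proof (induction "card F" arbitrary: F rule: less_induct)
  case (less F)
  let ?v = "vball n * \<epsilon> ^ (2 * n)"
  have v0: "0 \<le> ?v" using assms(4) by (simp add: less_imp_le)
  show ?case
  proof (cases "F = {fone}")
    case True
    then show ?thesis using emeasure_root[OF S] by (simp add: fz_def)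
  next
    case False
    define len where "len = (\<lambda>g :: 'a fword. length (word g))"
    obtain x where x: "x \<in> F" "\<And>g. g \<in> F \<Longrightarrow> len g \<le> len x"
    proof -
      have "Max (len ` F) \<in> len ` F" using less.prems by (intro Max_in) auto
      then obtain x where "x \<in> F" "len x = Max (len ` F)" by auto
      then show ?thesis using that less.prems by (auto intro: Max_ge)
    qed
    have xne: "x \<noteq> fone"
    proof
      assume "x = fone"
      then have "g = fone" if "g \<in> F" for g using x(2)[OF that] by (simp add: len_def fone_iff)
      then show False using False less.prems by auto
    qed
    define F' where "F' = F - {x}"
    have F': "F = insert x F'" "x \<notin> F'" "finite F'" "fone \<in> F'" using x less.prems xne by (auto simp: F'_def)
    have sc': "suffix_closed F'" unfolding F'_def using less.prems x xne by (intro suffix_closed_remove) (auto simp: len_def)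
    have px: "fparent x \<in> F'"
    proof -
      have "fparent x \<in> F" using less.prems x by (simp add: suffix_closed_def)
      moreover have "fparent x \<noteq> x"
        using xne word_fparent[of x] by (metis fone_iff length_tl length_0_conv diff_Suc_1 diff_less less_irrefl length_greater_0_conv zero_less_one)
      ultimately show ?thesis by (simp add: F'_def)
    qed
    have card: "card F = Suc (card F')" "card F' > 0" using F' by (auto simp: card_gt_0_iff)
    let ?J = "F' \<times> (UNIV :: 'k set)" and ?K = "{x} \<times> (UNIV :: 'k set)"
    have un: "F \<times> (UNIV :: 'k set) = ?J \<union> ?K" "?J \<inter> ?K = {}" using F' by auto
    let ?A = "{Y \<in> space (tn (F \<times> UNIV) n). fz F n \<epsilon> U Y \<and> root Y \<in> S}"
    let ?B = "{Y \<in> space (tn ?J n). fz F' n \<epsilon> U Y \<and> root Y \<in> S}"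
    have A: "?A \<in> sets (tn (F \<times> UNIV) n)" and B: "?B \<in> sets (tn ?J n)"
    proof -
      have "{Y \<in> space (tn (F \<times> UNIV) n). fz F n \<epsilon> U Y} \<inter> (root -` S \<inter> space (tn (F \<times> UNIV) n)) \<in> sets (tn (F \<times> UNIV) n)"
        using less.prems S by (intro sets.Int fz_sets measurable_sets[OF root_measurable]) auto
      also have "{Y \<in> space (tn (F \<times> UNIV) n). fz F n \<epsilon> U Y} \<inter> (root -` S \<inter> space (tn (F \<times> UNIV) n)) = ?A" by auto
      finally show "?A \<in> sets (tn (F \<times> UNIV) n)" .
      have "{Y \<in> space (tn ?J n). fz F' n \<epsilon> U Y} \<inter> (root -` S \<inter> space (tn ?J n)) \<in> sets (tn ?J n)"
        using F' sc' S by (intro sets.Int fz_sets measurable_sets[OF root_measurable]) auto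
      also have "{Y \<in> space (tn ?J n). fz F' n \<epsilon> U Y} \<inter> (root -` S \<inter> space (tn ?J n)) = ?B" by auto
      finally show "?B \<in> sets (tn ?J n)" .
    qed
    have inner: "(\<integral>\<^sup>+Z. indicator ?A (merge ?J ?K (Y, Z)) \<partial>tn ?K n) = ennreal (?v ^ CARD('k)) * indicator ?B Y"
      if Y: "Y \<in> space (tn ?J n)" for Y
    proof -
      let ?c = "\<lambda>(g, i). act_letter n U (hd (word x)) (Y (fparent x, i))"
      have "(\<integral>\<^sup>+Z. indicator ?A (merge ?J ?K (Y, Z)) \<partial>tn ?K n) = (\<integral>\<^sup>+Z. indicator (tbox ?K n ?c \<epsilon>) Z * indicator ?B Y \<partial>tn ?K n)"
      proof (rule nn_integral_cong)
        fix Z assume Z: "Z \<in> space (tn ?K n)"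
        let ?M = "merge ?J ?K (Y, Z)"
        have sp: "?M \<in> space (tn (F \<times> UNIV) n)"
          using Y Z un by (auto simp: space_tn PiE_iff merge_def extensional_def)
        have MY: "?M (g, i) = Y (g, i)" if "g \<in> F'" for g i using that by (simp add: merge_def)
        have MZ: "?M (x, i) = Z (x, i)" for i using F' by (simp add: merge_def)
        have rt: "root ?M = root Y" using MY[OF F'(4)] by (simp add: root_def)
        have "fz F n \<epsilon> U ?M \<longleftrightarrow> fz F' n \<epsilon> U Y \<and> (\<forall>i. nrm n (\<lambda>l. Z (x, i) l - act_letter n U (hd (word x)) (Y (fparent x, i)) l) \<le> \<epsilon>)"
        proof -
          have "F - {fone} = insert x (F' - {fone})" using F' xne by auto
          moreover have "fparent h \<in> F'" if "h \<in> F'" for h using sc' that by (simp add: suffix_closed_def)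
          ultimately show ?thesis unfolding fz_def using MY MZ px by auto
        qed
        then show "indicator ?A ?M = (indicator (tbox ?K n ?c \<epsilon>) Z * indicator ?B Y :: ennreal)"
          using sp rt Y Z by (auto simp: indicator_def tbox_def)
      qed
      also have "\<dots> = emeasure (tn ?K n) (tbox ?K n ?c \<epsilon>) * indicator ?B Y" by (simp add: nn_integral_multc)
      also have "emeasure (tn ?K n) (tbox ?K n ?c \<epsilon>) = ennreal (?v ^ CARD('k))"
        using assms(4) by (subst emeasure_tbox) (auto simp: card_cartesian_product)
      finally show ?thesis .
    qed
    have "emeasure (tn (F \<times> UNIV) n) ?A = integral\<^sup>N (PiM (?J \<union> ?K) (\<lambda>_. cn n)) (indicator ?A)"
      using A unfolding un(1)[symmetric] tn_def[symmetric] by simp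
    also have "\<dots> = (\<integral>\<^sup>+Y. \<integral>\<^sup>+Z. indicator ?A (merge ?J ?K (Y, Z)) \<partial>tn ?K n \<partial>tn ?J n)"
      unfolding tn_def
    proof (rule tprod.product_nn_integral_fold)
      show "(indicator {Y \<in> space (PiM (F \<times> UNIV) (\<lambda>_. cn n)). fz F n \<epsilon> U Y \<and> root Y \<in> S} :: _ \<Rightarrow> ennreal) \<in> borel_measurable (PiM (?J \<union> ?K) (\<lambda>_. cn n))"
        using A unfolding un(1)[symmetric] tn_def by (rule borel_measurable_indicator)
    qed (use un F' in auto)
    also have "\<dots> = (\<integral>\<^sup>+Y. ennreal (?v ^ CARD('k)) * indicator ?B Y \<partial>tn ?J n)" by (intro nn_integral_cong inner)
    also have "\<dots> = ennreal (?v ^ CARD('k)) * emeasure (tn ?J n) ?B" using B by (rule nn_integral_cmult_indicator)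
    also have "emeasure (tn ?J n) ?B = ennreal (?v ^ (CARD('k) * (card F' - 1))) * emeasure (tn UNIV n) S"
      using card F' sc' by (intro less.hyps) auto
    also have "ennreal (?v ^ CARD('k)) * (ennreal (?v ^ (CARD('k) * (card F' - 1))) * emeasure (tn UNIV n) S)
      = ennreal (?v ^ CARD('k) * ?v ^ (CARD('k) * (card F' - 1))) * emeasure (tn UNIV n) S"
      using v0 by (simp add: ennreal_mult mult.assoc)
    also have "?v ^ CARD('k) * ?v ^ (CARD('k) * (card F' - 1)) = ?v ^ (CARD('k) * (card F - 1))"
    proof -
      have "CARD('k) * (card F - 1) = CARD('k) + CARD('k) * (card F' - 1)"
        using card by (cases "card F'") auto
      then show ?thesis by (simp only: power_add)
    qed
    finally show ?thesis .
  qed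
qed

text \<open>Each letter on the path to the identity contributes one error \<epsilon>, and unitaries
  transport the errors without loss.\<close>

lemma fz_orbit_close:
  assumes U: "\<forall>s. U s \<in> umat n" and sc: "suffix_closed F" and fz: "fz F n \<epsilon> U Y" and h: "h \<in> F"
  shows "nrm n (\<lambda>l. Y (h, i) l - orb n U (root Y) (h, i) l) \<le> real (length (word h)) * \<epsilon>"
  using h
proof (induction "length (word h)" arbitrary: h)
  case 0
  then have "h = fone" by (simp add: fone_iff)
  then show ?case by (simp add: orb_def root_def rep_act_def)
next
  case (Suc m)
  then obtain a w where w: "word h = a # w" by (cases "word h") auto
  have p: "fparent h \<in> F" "word (fparent h) = w" using Suc.prems sc w by (auto simp: suffix_closed_def word_fparent)
  have len: "m = length (word (fparent h))" using Suc.hyps(2) w p by simp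
  have o: "orb n U (root Y) (h, i) = act_letter n U a (orb n U (root Y) (fparent h, i))"
    by (simp add: orb_def rep_act_def w p(2))
  have 1: "nrm n (\<lambda>l. Y (h, i) l - act_letter n U a (Y (fparent h, i)) l) \<le> \<epsilon>"
  proof -
    have "h \<in> F - {fone}" using Suc.prems w by (simp add: fone_iff)
    then have "nrm n (\<lambda>l. Y (h, i) l - act_letter n U (hd (word h)) (Y (fparent h, i)) l) \<le> \<epsilon>"
      using fz unfolding fz_def by blast
    then show ?thesis by (simp add: w)
  qed
  have 2: "nrm n (\<lambda>l. act_letter n U a (Y (fparent h, i)) l - orb n U (root Y) (h, i) l) \<le> real m * \<epsilon>"
    unfolding o nrm_act_letter_diff[OF U] using Suc.hyps(1)[OF len p(1)] len by simp
  have "nrm n (\<lambda>l. Y (h, i) l - orb n U (root Y) (h, i) l) \<le> \<epsilon> + real m * \<epsilon>"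
    using nrm_triangle[of n "Y (h, i)" "orb n U (root Y) (h, i)" "act_letter n U a (Y (fparent h, i))"] 1 2 by linarith
  then show ?case using Suc.hyps(2) by (simp flip: Suc.hyps(2) add: algebra_simps)
qed

lemma gram_diff_le:
  assumes "nrm n (\<lambda>l. Y p l - Z p l) \<le> e" "nrm n (\<lambda>l. Y q l - Z q l) \<le> e" "nrm n (Z p) \<le> B" "nrm n (Z q) \<le> B" "0 \<le> e" "0 \<le> B"
  shows "cmod (gram n Y p q - gram n Z p q) \<le> e * (2 * B + e)"
proof -
  have Yp: "nrm n (Y p) \<le> B + e"
    using nrm_add[of n "\<lambda>l. Y p l - Z p l" "Z p"] assms by simp
  have "gram n Y p q - gram n Z p q = cinner n (\<lambda>l. Y q l - Z q l) (Y p) + cinner n (Z q) (\<lambda>l. Y p l - Z p l)"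
    by (simp add: gram_def cinner_diff_left cinner_diff_right)
  then have "cmod (gram n Y p q - gram n Z p q) \<le> cmod (cinner n (\<lambda>l. Y q l - Z q l) (Y p)) + cmod (cinner n (Z q) (\<lambda>l. Y p l - Z p l))"
    by (simp only: norm_triangle_ineq)
  also have "cmod (cinner n (\<lambda>l. Y q l - Z q l) (Y p)) \<le> e * (B + e)"
    using assms Yp by (intro order_trans[OF cinner_le] mult_mono) auto
  also have "cmod (cinner n (Z q) (\<lambda>l. Y p l - Z p l)) \<le> B * e"
    using assms by (intro order_trans[OF cinner_le] mult_mono) auto
  finally show ?thesis by (simp add: algebra_simps)
qed

text \<open>Orbit vectors have the norms of the root vectors, so control of the diagonal entries at
  the root bounds everything. \<open>C\<close> depends on \<open>F\<close> and \<open>Q\<close> but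
  not on \<open>n\<close>.\<close>

lemma fz_gram_close:
  fixes F :: "'s fword set" and Q :: "'s fword \<times> 'k::finite \<Rightarrow> 's fword \<times> 'k \<Rightarrow> complex"
  assumes fin: "finite F" and sc: "suffix_closed F" and one: "fone \<in> F"
  obtains C where "C \<ge> 0" "\<And>n U \<epsilon> Y p q. \<forall>s. U s \<in> umat n \<Longrightarrow> 0 \<le> \<epsilon> \<Longrightarrow> \<epsilon> \<le> 1 \<Longrightarrow> fz F n \<epsilon> U Y \<Longrightarrow>
     \<forall>i. cmod (gram n Y (fone, i) (fone, i) - Q (fone, i) (fone, i)) \<le> 1 \<Longrightarrow>
     p \<in> F \<times> UNIV \<Longrightarrow> q \<in> F \<times> UNIV \<Longrightarrow> cmod (gram n Y p q - gram n (orb n U (root Y)) p q) \<le> C * \<epsilon>"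
proof -
  define D where "D = (\<Sum>h\<in>F. real (length (word h)))"
  define B where "B = (\<Sum>i\<in>(UNIV :: 'k set). 2 + cmod (Q (fone, i) (fone, i)))"
  have D: "D \<ge> 0" and B: "B \<ge> 0" by (auto simp: D_def B_def intro!: sum_nonneg)
  have "cmod (gram n Y p q - gram n (orb n U (root Y)) p q) \<le> (D * (2 * B + D)) * \<epsilon>"
    if U: "\<forall>s. U s \<in> umat n" and \<epsilon>: "0 \<le> \<epsilon>" "\<epsilon> \<le> 1" and fz: "fz F n \<epsilon> U Y"
      and g: "\<forall>i. cmod (gram n Y (fone, i) (fone, i) - Q (fone, i) (fone, i)) \<le> 1"
      and p: "p \<in> F \<times> UNIV" and q: "q \<in> F \<times> UNIV" for n U \<epsilon> Y p q
  proof -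
    have n: "nrm n (orb n U (root Y) (h, i)) \<le> B" for h i
    proof -
      have "(nrm n (Y (fone, i)))\<^sup>2 = cmod (gram n Y (fone, i) (fone, i))" by (simp only: gram_def cinner_self norm_of_real) simp
      also have "\<dots> \<le> 1 + cmod (Q (fone, i) (fone, i))"
        using g[THEN spec, of i] norm_triangle_sub[of "gram n Y (fone, i) (fone, i)" "Q (fone, i) (fone, i)"] by linarith
      also have "\<dots> \<le> (2 + cmod (Q (fone, i) (fone, i)))\<^sup>2" by (simp add: power2_eq_square algebra_simps)
      finally have "nrm n (Y (fone, i)) \<le> 2 + cmod (Q (fone, i) (fone, i))" by (rule power2_le_imp_le) simp
      also have "\<dots> \<le> B" unfolding B_def by (intro member_le_sum) auto
      finally show ?thesis by (simp add: orb_def nrm_rep_act[OF U] root_def)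
    qed
    have c: "nrm n (\<lambda>l. Y r l - orb n U (root Y) r l) \<le> D * \<epsilon>" if r: "r \<in> F \<times> UNIV" for r
    proof -
      obtain h i where r': "r = (h, i)" "h \<in> F" using r by auto
      have "real (length (word h)) \<le> D" unfolding D_def using fin r' by (intro member_le_sum) auto
      then show ?thesis using fz_orbit_close[OF U sc fz r'(2), of i] \<epsilon> unfolding r'
        by (meson mult_right_mono order_trans)
    qed
    have "cmod (gram n Y p q - gram n (orb n U (root Y)) p q) \<le> (D * \<epsilon>) * (2 * B + D * \<epsilon>)"
      using c p q n \<epsilon> D B by (intro gram_diff_le) (auto simp: split_paired_all)
    also have "\<dots> \<le> (D * \<epsilon>) * (2 * B + D)" using \<epsilon> D by (intro mult_left_mono) (auto simp: mult_left_le)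
    finally show ?thesis by (simp add: mult_ac)
  qed
  then show ?thesis using that[of "D * (2 * B + D)"] D B by simp
qed

section \<open>Averaging thickened orbits over the random unitaries\<close>

lemma sets_rand: "U \<in> space (rand_meas n) \<Longrightarrow> \<forall>s. U s \<in> umat n"
  by (auto simp: rand_meas_def space_PiM space_haar)

interpretation hprod: product_sigma_finite "\<lambda>_. haar n" for n
  by standard

lemma sigma_finite_rand: "sigma_finite_measure (rand_meas n :: ('s::finite \<Rightarrow> _) measure)"
  unfolding rand_meas_def by (intro hprod.sigma_finite) simp

text \<open>Unitarity moves an inverse letter to the other end of its edge, so that every edge
  constrains some \<open>U s\<close> directly. For fixed \<open>Y\<close> the conditions then
  separate by generator.\<close>

lemma fz_iff_edges:
  fixes F :: "'s fword set" and Y :: "'s fword \<times> 'k \<Rightarrow> nat \<Rightarrow> complex"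
  assumes U: "\<forall>s. U s \<in> umat n" and sc: "suffix_closed F"
  shows "fz F n \<epsilon> U Y \<longleftrightarrow> (\<forall>s. \<forall>g\<in>fdom F s. \<forall>i. nrm n (\<lambda>l. mult n (U s) (Y (g, i)) l - Y (fmul (fgen s) g, i) l) \<le> \<epsilon>)"
proof -
  define P where "P s g g' \<longleftrightarrow> (\<forall>i. nrm n (\<lambda>l. mult n (U s) (Y (g, i)) l - Y (g', i) l) \<le> \<epsilon>)" for s g g'
  have key: "(\<forall>i. nrm n (\<lambda>l. Y (h, i) l - act_letter n U (hd (word h)) (Y (fparent h, i)) l) \<le> \<epsilon>)
      \<longleftrightarrow> (if snd (hd (word h)) then P (fst (hd (word h))) h (fparent h) else P (fst (hd (word h))) (fparent h) h)" for h
  proof (cases "snd (hd (word h))")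
    case True
    let ?u = "U (fst (hd (word h)))"
    have u: "?u \<in> umat n" using U by blast
    have "nrm n (\<lambda>l. Y (h, i) l - act_letter n U (hd (word h)) (Y (fparent h, i)) l)
      = nrm n (\<lambda>l. mult n ?u (Y (h, i)) l - Y (fparent h, i) l)" for i
    proof -
      have "nrm n (\<lambda>l. Y (h, i) l - act_letter n U (hd (word h)) (Y (fparent h, i)) l)
        = nrm n (mult n ?u (\<lambda>l. Y (h, i) l - mult n (adj n ?u) (Y (fparent h, i)) l))"
        unfolding nrm_mult[OF u] by (rule nrm_cong) (simp add: act_letter_mult lmat_def True)
      also have "\<dots> = nrm n (\<lambda>l. mult n ?u (Y (h, i)) l - Y (fparent h, i) l)"
        by (rule nrm_cong) (simp add: mult_diff adj_mult[OF u])
      finally show ?thesis .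
    qed
    then show ?thesis using True by (simp add: P_def)
  next
    case False
    have "nrm n (\<lambda>l. Y (h, i) l - act_letter n U (hd (word h)) (Y (fparent h, i)) l)
      = nrm n (\<lambda>l. mult n (U (fst (hd (word h)))) (Y (fparent h, i)) l - Y (h, i) l)" for i
      by (subst nrm_diff_commute) (rule nrm_cong, simp add: act_letter_mult lmat_def False)
    then show ?thesis using False by (simp add: P_def)
  qed
  have "fz F n \<epsilon> U Y \<longleftrightarrow> (\<forall>h\<in>F - {fone}. if snd (hd (word h)) then P (fst (hd (word h))) h (fparent h) else P (fst (hd (word h))) (fparent h) h)"
    unfolding fz_def using key by blast
  also have "\<dots> \<longleftrightarrow> (\<forall>s. \<forall>g\<in>fdom F s. P s g (fmul (fgen s) g))" by (rule edges_parent[OF sc, symmetric])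
  finally show ?thesis by (simp add: P_def)
qed

text \<open>The vectors at the targets of the edges labelled \<open>s\<close>, indexed by the
  sources so as to pair with \<open>Y\<close> on \<open>fdom F s\<close>.\<close>

definition shiftY :: "'s \<Rightarrow> ('s fword \<times> 'k \<Rightarrow> nat \<Rightarrow> complex) \<Rightarrow> 's fword \<times> 'k \<Rightarrow> nat \<Rightarrow> complex" where
  "shiftY s Y = (\<lambda>(g, i). Y (fmul (fgen s) g, i))"

lemma rand_component [measurable (raw)]:
  "f \<in> M \<rightarrow>\<^sub>M rand_meas n \<Longrightarrow> (\<lambda>x. f x s) \<in> M \<rightarrow>\<^sub>M haar n"
  unfolding rand_meas_def using measurable_compose[OF _ measurable_component_singleton[of s UNIV]] by blast

lemma fz_joint_sets:
  fixes F :: "'s::finite fword set"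
  assumes fin: "finite F" and sc: "suffix_closed F" and G: "G \<in> sets (tn (F \<times> (UNIV :: 'k::finite set)) n)"
  shows "{x \<in> space (rand_meas n \<Otimes>\<^sub>M tn (F \<times> UNIV) n). snd x \<in> G \<and> fz F n \<epsilon> (fst x) (snd x)} \<in> sets (rand_meas n \<Otimes>\<^sub>M tn (F \<times> UNIV) n)"
proof -
  let ?M = "rand_meas n \<Otimes>\<^sub>M tn (F \<times> (UNIV :: 'k set)) n"
  have [measurable]: "(\<lambda>x. nrm n (\<lambda>l. mult n (fst x s) (snd x (g, i)) l - snd x (fmul (fgen s) g, i) l)) \<in> borel_measurable ?M"
    if "g \<in> fdom F s" for s g i
  proof -
    have m1: "(\<lambda>x. fst x s) \<in> ?M \<rightarrow>\<^sub>M haar n" by measurable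
    have m2: "(\<lambda>x. snd x (g, i) l) \<in> borel_measurable ?M" if "g \<in> F" "l < n" for g l
      by (rule cn_component[OF tn_component[OF measurable_snd]]) (use that in auto)
    show ?thesis using that
      by (intro nrm_measurable borel_measurable_diff mult_haar_measurable m1 m2) (auto simp: fdom_def)
  qed
  have fd: "finite (fdom F s)" for s using fin by (auto simp: fdom_def)
  have "{x \<in> space ?M. snd x \<in> G \<and> fz F n \<epsilon> (fst x) (snd x)}
    = {x \<in> space ?M. snd x \<in> G \<and> (\<forall>s. \<forall>g\<in>fdom F s. \<forall>i. nrm n (\<lambda>l. mult n (fst x s) (snd x (g, i)) l - snd x (fmul (fgen s) g, i) l) \<le> \<epsilon>)}"
  proof (rule Collect_cong)
    fix x :: "('s \<Rightarrow> nat \<times> nat \<Rightarrow> complex) \<times> ('s fword \<times> 'k \<Rightarrow> nat \<Rightarrow> complex)"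
    show "x \<in> space ?M \<and> snd x \<in> G \<and> fz F n \<epsilon> (fst x) (snd x) \<longleftrightarrow>
      x \<in> space ?M \<and> snd x \<in> G \<and> (\<forall>s. \<forall>g\<in>fdom F s. \<forall>i. nrm n (\<lambda>l. mult n (fst x s) (snd x (g, i)) l - snd x (fmul (fgen s) g, i) l) \<le> \<epsilon>)"
    proof (cases "x \<in> space ?M")
      case True
      then have "fst x \<in> space (rand_meas n)" by (auto simp: space_pair_measure)
      then show ?thesis using fz_iff_edges[OF sets_rand sc, of "fst x" n \<epsilon> "snd x"] by auto
    qed simp
  qed
  also have "\<dots> = {x \<in> space ?M. snd x \<in> G \<and> (\<forall>s\<in>UNIV. \<forall>g\<in>fdom F s. \<forall>i\<in>UNIV. nrm n (\<lambda>l. mult n (fst x s) (snd x (g, i)) l - snd x (fmul (fgen s) g, i) l) \<le> \<epsilon>)}" by simp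
  also have "\<dots> \<in> sets ?M" using fd G by measurable
  finally show ?thesis .
qed

text \<open>For a fixed tuple the admissible matrices form a product set over the generators, and
  independence turns its probability into a product of transition probabilities.\<close>

lemma fz_integral:
  fixes F :: "'s::finite fword set"
  assumes fin: "finite F" and sc: "suffix_closed F" and G: "G \<in> sets (tn (F \<times> (UNIV :: 'k::finite set)) n)"
  shows "(\<integral>\<^sup>+U. emeasure (tn (F \<times> UNIV) n) {Y \<in> G. fz F n \<epsilon> U Y} \<partial>rand_meas n)
     = (\<integral>\<^sup>+Y. (\<Prod>s\<in>UNIV. pk (fdom F s \<times> UNIV) n \<epsilon> Y (shiftY s Y)) * indicator G Y \<partial>tn (F \<times> UNIV) n)" (is "?L = ?R")
    and "(\<lambda>U. emeasure (tn (F \<times> UNIV) n) {Y \<in> G. fz F n \<epsilon> U Y}) \<in> borel_measurable (rand_meas n)"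
proof -
  let ?I = "F \<times> (UNIV :: 'k set)"
  interpret tn: sigma_finite_measure "tn ?I n" using fin by (intro sigma_finite_tn) auto
  interpret rm: sigma_finite_measure "rand_meas n :: ('s \<Rightarrow> _) measure" by (rule sigma_finite_rand)
  interpret pair_sigma_finite "rand_meas n :: ('s \<Rightarrow> _) measure" "tn ?I n" ..
  let ?S = "{x \<in> space (rand_meas n \<Otimes>\<^sub>M tn ?I n). snd x \<in> G \<and> fz F n \<epsilon> (fst x) (snd x)}"
  have S: "?S \<in> sets (rand_meas n \<Otimes>\<^sub>M tn ?I n)" by (rule fz_joint_sets[OF fin sc G])
  have sec: "{Y \<in> G. fz F n \<epsilon> U Y} = Pair U -` ?S" if "U \<in> space (rand_meas n)" for U
    using that sets.sets_into_space[OF G] by (auto simp: space_pair_measure)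
  have "(\<lambda>U. emeasure (tn ?I n) (Pair U -` ?S)) \<in> borel_measurable (rand_meas n)"
    using S by (rule tn.measurable_emeasure_Pair)
  then show "(\<lambda>U. emeasure (tn ?I n) {Y \<in> G. fz F n \<epsilon> U Y}) \<in> borel_measurable (rand_meas n)"
    by (subst measurable_cong[OF arg_cong[where f = "emeasure (tn ?I n)", OF sec]])
  have "?L = (\<integral>\<^sup>+U. emeasure (tn ?I n) (Pair U -` ?S) \<partial>rand_meas n)"
    by (intro nn_integral_cong) (simp add: sec)
  also have "\<dots> = emeasure (rand_meas n \<Otimes>\<^sub>M tn ?I n) ?S" using S by (rule tn.emeasure_pair_measure_alt[symmetric])
  also have "\<dots> = (\<integral>\<^sup>+Y. emeasure (rand_meas n) ((\<lambda>U. (U, Y)) -` ?S) \<partial>tn ?I n)" using S by (rule emeasure_pair_measure_alt2)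
  also have "\<dots> = ?R"
  proof (rule nn_integral_cong)
    fix Y assume Y: "Y \<in> space (tn ?I n)"
    let ?E = "\<lambda>s. {u \<in> umat n. \<forall>p\<in>fdom F s \<times> UNIV. nrm n (\<lambda>l. mult n u (Y p) l - shiftY s Y p l) \<le> \<epsilon>}"
    show "emeasure (rand_meas n) ((\<lambda>U. (U, Y)) -` ?S) = (\<Prod>s\<in>UNIV. pk (fdom F s \<times> UNIV) n \<epsilon> Y (shiftY s Y)) * indicator G Y"
    proof (cases "Y \<in> G")
      case False
      then have "(\<lambda>U. (U, Y)) -` ?S = {}" by auto
      then have "emeasure (rand_meas n) ((\<lambda>U. (U, Y)) -` ?S) = 0" by (simp only: emeasure_empty)
      then show ?thesis using False by (simp add: indicator_def)
    next
      case True
      have "(\<lambda>U. (U, Y)) -` ?S = PiE UNIV ?E"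
      proof (rule set_eqI)
        fix U :: "'s \<Rightarrow> nat \<times> nat \<Rightarrow> complex"
        have sp: "U \<in> space (rand_meas n) \<longleftrightarrow> (\<forall>s. U s \<in> umat n)" by (auto simp: rand_meas_def space_PiM space_haar)
        show "U \<in> (\<lambda>U. (U, Y)) -` ?S \<longleftrightarrow> U \<in> PiE UNIV ?E"
        proof (cases "\<forall>s. U s \<in> umat n")
          case u: True
          have "U \<in> (\<lambda>U. (U, Y)) -` ?S \<longleftrightarrow> fz F n \<epsilon> U Y" using u sp True Y by (simp add: space_pair_measure)
          also have "\<dots> \<longleftrightarrow> U \<in> PiE UNIV ?E" unfolding fz_iff_edges[OF u sc] using u by (auto simp: PiE_iff shiftY_def)
          finally show ?thesis .
        next
          case u: False
          then show ?thesis using sp by (auto simp: space_pair_measure PiE_iff)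
        qed
      qed
      then have "emeasure (rand_meas n) ((\<lambda>U. (U, Y)) -` ?S) = (\<Prod>s\<in>UNIV. emeasure (haar n) (?E s))"
        unfolding rand_meas_def using fin
        by (simp only:) (intro hprod.emeasure_PiM pk_set, auto simp: fdom_def)
      then show ?thesis using True by (simp add: pk_def)
    qed
  qed
  finally show "?L = ?R" .
qed

subsection \<open>Continuity of determinants\<close>

lemma det_on_tendsto:
  assumes "\<And>p q. p \<in> I \<Longrightarrow> q \<in> I \<Longrightarrow> ((\<lambda>x. Q' x p q) \<longlongrightarrow> Q p q) F"
  shows "((\<lambda>x. det_on I (Q' x)) \<longlongrightarrow> det_on I Q) F"
  unfolding det_on_def
  by (intro tendsto_sum tendsto_mult tendsto_const tendsto_prod assms) (auto simp: permutes_in_image)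

lemma det_on_close:
  assumes fin: "finite I" and e: "e > 0"
  shows "\<exists>\<theta>>0. \<forall>Q'. close_on I \<theta> Q Q' \<longrightarrow> cmod (det_on I Q' - det_on I Q) \<le> e"
proof (rule ccontr)
  assume "\<not> ?thesis"
  then have "\<exists>Q'. close_on I (1 / real (Suc m)) Q Q' \<and> \<not> cmod (det_on I Q' - det_on I Q) \<le> e" for m
    by (auto dest!: spec[of _ "1 / real (Suc m)"])
  then obtain Q' where Q': "\<And>m. close_on I (1 / real (Suc m)) Q (Q' m)" "\<And>m. \<not> cmod (det_on I (Q' m) - det_on I Q) \<le> e"
    by metis
  have "(\<lambda>m. Q' m p q) \<longlonglongrightarrow> Q p q" if "p \<in> I" "q \<in> I" for p q
  proof -
    have "(\<lambda>m. Q' m p q - Q p q) \<longlonglongrightarrow> 0"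
    proof (rule Lim_null_comparison)
      show "\<forall>\<^sub>F m in sequentially. cmod (Q' m p q - Q p q) \<le> 1 / real (Suc m)"
        using Q'(1) that by (intro always_eventually) (auto simp: close_on_def)
      show "(\<lambda>m. 1 / real (Suc m)) \<longlonglongrightarrow> 0" using LIMSEQ_inverse_real_of_nat by (simp add: inverse_eq_divide)
    qed
    then show ?thesis by (rule LIM_zero_cancel)
  qed
  then have "(\<lambda>m. det_on I (Q' m)) \<longlonglongrightarrow> det_on I Q" by (rule det_on_tendsto)
  then have "\<forall>\<^sub>F m in sequentially. dist (det_on I (Q' m)) (det_on I Q) < e" using e by (rule tendstoD)
  then obtain m where "dist (det_on I (Q' m)) (det_on I Q) < e" by (auto simp: eventually_sequentially)
  then show False using Q'(2)[of m] by (simp add: dist_norm)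
qed

lemma det_shiftdiag_tendsto:
  "((\<lambda>t. Re (det_on I (shiftdiag t Q))) \<longlongrightarrow> Re (det_on I Q)) (at_right 0)"
proof (intro tendsto_Re det_on_tendsto)
  fix p q
  have "((\<lambda>t. Q p q + (if p = q then complex_of_real t else 0)) \<longlongrightarrow> Q p q + (if p = q then complex_of_real 0 else 0)) (at_right 0)"
    by (cases "p = q") (simp_all only: if_True if_False simp_thms tendsto_const tendsto_add[OF tendsto_const tendsto_of_real[OF tendsto_ident_at]])
  then show "((\<lambda>t. shiftdiag t Q p q) \<longlongrightarrow> Q p q) (at_right 0)"
    unfolding shiftdiag_def by (cases "p = q") simp_all
qed

subsection \<open>The average volume of the orbit set\<close>

lemma rep_act_cong:
  assumes "\<And>l. l < n \<Longrightarrow> v l = w l" "l < n"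
  shows "rep_act n U g v l = rep_act n U g w l"
proof -
  have "l < n \<Longrightarrow> foldr (act_letter n U) xs v l = foldr (act_letter n U) xs w l" for xs l
  proof (induction xs arbitrary: l)
    case (Cons x xs)
    then show ?case using act_letter_cong[of n "foldr (act_letter n U) xs v" "foldr (act_letter n U) xs w" U x] by simp
  qed (use assms in simp)
  then show ?thesis using assms(2) by (simp add: rep_act_def)
qed

text \<open>The set \<open>Xset\<close> of the neighbourhood \<open>wnb F \<eta> \<phi>\<close>,
  transferred from flat tuples to tuples of vectors.\<close>

definition SU :: "'s fword set \<Rightarrow> real \<Rightarrow> ('s fword \<Rightarrow> complex^'k^'k) \<Rightarrow> nat \<Rightarrow> ('s \<Rightarrow> nat \<times> nat \<Rightarrow> complex) \<Rightarrow> ('k \<Rightarrow> nat \<Rightarrow> complex) set" where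
  "SU F \<eta> \<phi> n U = {X \<in> space (tn UNIV n). \<forall>p\<in>F \<times> UNIV. \<forall>q\<in>F \<times> UNIV. cmod (gram n (orb n U X) p q - gramker \<phi> p q) < \<eta>}"

lemma SU_Xset:
  fixes \<phi> :: "'s::finite fword \<Rightarrow> complex^'k::finite^'k"
  assumes U: "\<forall>s. U s \<in> umat n" and fin: "finite F"
  shows "SU F \<eta> \<phi> n U \<in> sets (tn UNIV n)"
    and "emeasure (vec_meas n) (Xset n U (wnb F \<eta> \<phi>)) = emeasure (tn UNIV n) (SU F \<eta> \<phi> n U)"
proof -
  have X: "Xset n U (wnb F \<eta> \<phi>) \<in> sets (vec_meas n)" by (rule Xset_sets[OF U wnb_open[OF fin]])
  have eq: "{X \<in> space (tn UNIV n). vflat n X \<in> Xset n U (wnb F \<eta> \<phi>)} = SU F \<eta> \<phi> n U"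
  proof (rule set_eqI)
    fix X :: "'k \<Rightarrow> nat \<Rightarrow> complex"
    have "gramker (coeff_map n U (vflat n X)) p q = gram n (orb n U X) p q" for p q
      unfolding gramker_coeff_map[OF U] by (intro gram_cong) (auto simp: orb_def vflat_def split_paired_all intro!: rep_act_cong)
    then show "X \<in> {X \<in> space (tn UNIV n). vflat n X \<in> Xset n U (wnb F \<eta> \<phi>)} \<longleftrightarrow> X \<in> SU F \<eta> \<phi> n U"
      using measurable_space[OF vflat_measurable, of X n] posdef_coeff_map[OF U]
      by (auto simp: SU_def Xset_def wnb_def)
  qed
  show "emeasure (vec_meas n) (Xset n U (wnb F \<eta> \<phi>)) = emeasure (tn UNIV n) (SU F \<eta> \<phi> n U)"
    using emeasure_vec_meas[OF X] eq by simp
  show "SU F \<eta> \<phi> n U \<in> sets (tn UNIV n)"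
    using measurable_sets[OF vflat_measurable X] unfolding eq[symmetric] by (simp add: vimage_def Int_def conj_commute)
qed

text \<open>The factor by which thickening multiplies volumes of root tuples; the type argument
  supplies \<open>CARD('k)\<close>.\<close>

definition edge_vol :: "'s fword set \<Rightarrow> 'k::finite itself \<Rightarrow> nat \<Rightarrow> real \<Rightarrow> real" where
  "edge_vol F _ n \<epsilon> = (vball n * \<epsilon> ^ (2 * n)) ^ (CARD('k) * (card F - 1))"

text \<open>Thickened orbits of good root tuples and thickened orbits with good Gram kernel differ
  only by a change \<open>C * \<epsilon>\<close> of the Gram radius. Averaging over \<open>U\<close>
  and dividing out \<open>edge_vol\<close> gives both bounds, with one \<open>C\<close> for all
  \<open>n\<close>.\<close>

lemma average_volume_bounds:
  fixes \<phi> :: "'s::finite fword \<Rightarrow> complex^'k::finite^'k"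
  assumes fin: "finite F" and sc: "suffix_closed F" and one: "fone \<in> F"
  obtains C where "C \<ge> 0" "\<And>n \<epsilon> \<eta>1 \<eta>2. 0 < \<epsilon> \<Longrightarrow> \<epsilon> \<le> 1 \<Longrightarrow> 0 < \<eta>1 \<Longrightarrow> \<eta>1 \<le> 1 \<Longrightarrow> \<eta>1 + C * \<epsilon> \<le> \<eta>2 \<Longrightarrow>
     (\<integral>\<^sup>+U. emeasure (vec_meas n) (Xset n U (wnb F \<eta>1 \<phi>)) \<partial>rand_meas n) \<le> ennreal (1 / edge_vol F TYPE('k) n \<epsilon>) *
       (\<integral>\<^sup>+Y. (\<Prod>s\<in>UNIV. pk (fdom F s \<times> UNIV) n \<epsilon> Y (shiftY s Y)) * indicator (gnb (F \<times> UNIV) n (gramker \<phi>) \<eta>2) Y \<partial>tn (F \<times> UNIV) n)"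
    "\<And>n \<epsilon> \<eta>1 \<eta>2. 0 < \<epsilon> \<Longrightarrow> \<epsilon> \<le> 1 \<Longrightarrow> 0 < \<eta>2 \<Longrightarrow> \<eta>2 \<le> 1 \<Longrightarrow> \<eta>2 + C * \<epsilon> < \<eta>1 \<Longrightarrow> ennreal (1 / edge_vol F TYPE('k) n \<epsilon>) *
       (\<integral>\<^sup>+Y. (\<Prod>s\<in>UNIV. pk (fdom F s \<times> UNIV) n \<epsilon> Y (shiftY s Y)) * indicator (gnb (F \<times> UNIV) n (gramker \<phi>) \<eta>2) Y \<partial>tn (F \<times> UNIV) n)
      \<le> (\<integral>\<^sup>+U. emeasure (vec_meas n) (Xset n U (wnb F \<eta>1 \<phi>)) \<partial>rand_meas n)"
proof -
  let ?I = "F \<times> (UNIV :: 'k set)"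
  let ?Q = "gramker \<phi>"
  obtain C where C: "C \<ge> 0" and cl: "\<And>n U \<epsilon> (Y :: 's fword \<times> 'k \<Rightarrow> nat \<Rightarrow> complex) p q. \<forall>s. U s \<in> umat n \<Longrightarrow> 0 \<le> \<epsilon> \<Longrightarrow> \<epsilon> \<le> 1 \<Longrightarrow> fz F n \<epsilon> U Y \<Longrightarrow>
     \<forall>i. cmod (gram n Y (fone, i) (fone, i) - ?Q (fone, i) (fone, i)) \<le> 1 \<Longrightarrow>
     p \<in> F \<times> UNIV \<Longrightarrow> q \<in> F \<times> UNIV \<Longrightarrow> cmod (gram n Y p q - gram n (orb n U (root Y)) p q) \<le> C * \<epsilon>"
    using that by (rule fz_gram_close[OF fin sc one, of ?Q])
  have fI: "finite ?I" using fin by simp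
  have fzG: "{Y \<in> gnb ?I n ?Q \<eta>. fz F n \<epsilon> U Y} \<in> sets (tn ?I n)" for n \<eta> \<epsilon> and U :: "'s \<Rightarrow> nat \<times> nat \<Rightarrow> complex"
  proof -
    have "gnb ?I n ?Q \<eta> \<inter> {Y \<in> space (tn ?I n). fz F n \<epsilon> U Y} \<in> sets (tn ?I n)"
      using fI fin sc by (intro sets.Int fz_sets gnb_sets)
    also have "gnb ?I n ?Q \<eta> \<inter> {Y \<in> space (tn ?I n). fz F n \<epsilon> U Y} = {Y \<in> gnb ?I n ?Q \<eta>. fz F n \<epsilon> U Y}"
      by (auto simp: gnb_def)
    finally show ?thesis .
  qed
  let ?fS = "\<lambda>n \<epsilon> \<eta> U. {Y \<in> space (tn ?I n). fz F n \<epsilon> U Y \<and> root Y \<in> SU F \<eta> \<phi> n U}"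
  have fS: "?fS n \<epsilon> \<eta> U \<in> sets (tn ?I n)" if "\<forall>s. U s \<in> umat n" for n \<epsilon> \<eta> and U :: "'s \<Rightarrow> nat \<times> nat \<Rightarrow> complex"
  proof -
    have "{Y \<in> space (tn ?I n). fz F n \<epsilon> U Y} \<inter> (root -` SU F \<eta> \<phi> n U \<inter> space (tn ?I n)) \<in> sets (tn ?I n)"
      using fin sc one that by (intro sets.Int fz_sets measurable_sets[OF root_measurable] SU_Xset)
    also have "{Y \<in> space (tn ?I n). fz F n \<epsilon> U Y} \<inter> (root -` SU F \<eta> \<phi> n U \<inter> space (tn ?I n)) = ?fS n \<epsilon> \<eta> U" by auto
    finally show ?thesis .
  qed
  \<comment> \<open>At the identity vertex a thickened orbit carries the root without error; in the
    upper bound this supplies the diagonal control that \<open>cl\<close> asks for.\<close>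
  have orb1: "gram n (orb n U (root Y)) (fone, i) (fone, j) = gram n Y (fone, i) (fone, j)" for n U i j and Y :: "'s fword \<times> 'k \<Rightarrow> nat \<Rightarrow> complex"
    by (simp add: gram_def orb_def root_def rep_act_def)
  have ev: "edge_vol F TYPE('k) n \<epsilon> > 0" if "\<epsilon> > 0" for n \<epsilon> using that by (simp add: edge_vol_def)
  have vol: "emeasure (vec_meas n) (Xset n U (wnb F \<eta> \<phi>)) = ennreal (1 / edge_vol F TYPE('k) n \<epsilon>) * emeasure (tn ?I n) (?fS n \<epsilon> \<eta> U)"
    if U: "\<forall>s. U s \<in> umat n" and e: "\<epsilon> > 0" for n \<epsilon> \<eta> and U :: "'s \<Rightarrow> nat \<times> nat \<Rightarrow> complex"
  proof -
    have "emeasure (tn ?I n) (?fS n \<epsilon> \<eta> U) = ennreal (edge_vol F TYPE('k) n \<epsilon>) * emeasure (tn UNIV n) (SU F \<eta> \<phi> n U)"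
      unfolding edge_vol_def using e by (intro emeasure_fz fin sc one SU_Xset U) auto
    then have "ennreal (1 / edge_vol F TYPE('k) n \<epsilon>) * emeasure (tn ?I n) (?fS n \<epsilon> \<eta> U)
      = ennreal (1 / edge_vol F TYPE('k) n \<epsilon>) * ennreal (edge_vol F TYPE('k) n \<epsilon>) * emeasure (tn UNIV n) (SU F \<eta> \<phi> n U)"
      by (simp only: mult.assoc)
    also have "ennreal (1 / edge_vol F TYPE('k) n \<epsilon>) * ennreal (edge_vol F TYPE('k) n \<epsilon>) = 1"
      using ev[OF e, of n] by (subst ennreal_mult[symmetric]) auto
    finally show ?thesis using SU_Xset(2)[OF U fin] by simp
  qed
  have int: "(\<integral>\<^sup>+U. ennreal c * emeasure (tn ?I n) {Y \<in> gnb ?I n ?Q \<eta>. fz F n \<epsilon> U Y} \<partial>rand_meas n)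
     = ennreal c * (\<integral>\<^sup>+Y. (\<Prod>s\<in>UNIV. pk (fdom F s \<times> UNIV) n \<epsilon> Y (shiftY s Y)) * indicator (gnb ?I n ?Q \<eta>) Y \<partial>tn ?I n)" for c n \<eta> \<epsilon>
    using fz_integral[OF fin sc gnb_sets[OF fI, of n ?Q \<eta>], of \<epsilon>] by (subst nn_integral_cmult) auto
  have up: "(\<integral>\<^sup>+U. emeasure (vec_meas n) (Xset n U (wnb F \<eta>1 \<phi>)) \<partial>rand_meas n) \<le> ennreal (1 / edge_vol F TYPE('k) n \<epsilon>) *
       (\<integral>\<^sup>+Y. (\<Prod>s\<in>UNIV. pk (fdom F s \<times> UNIV) n \<epsilon> Y (shiftY s Y)) * indicator (gnb ?I n ?Q \<eta>2) Y \<partial>tn ?I n)"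
    if \<epsilon>: "0 < \<epsilon>" "\<epsilon> \<le> 1" and \<eta>: "0 < \<eta>1" "\<eta>1 \<le> 1" "\<eta>1 + C * \<epsilon> \<le> \<eta>2" for n \<epsilon> \<eta>1 \<eta>2
    unfolding int[symmetric]
  proof (rule nn_integral_mono)
    fix U :: "'s \<Rightarrow> nat \<times> nat \<Rightarrow> complex" assume "U \<in> space (rand_meas n)"
    then have U: "\<forall>s. U s \<in> umat n" by (rule sets_rand)
    have "?fS n \<epsilon> \<eta>1 U \<subseteq> {Y \<in> gnb ?I n ?Q \<eta>2. fz F n \<epsilon> U Y}"
    proof safe
      fix Y assume Y: "Y \<in> space (tn ?I n)" "fz F n \<epsilon> U Y" "root Y \<in> SU F \<eta>1 \<phi> n U"
      have o: "cmod (gram n (orb n U (root Y)) p q - ?Q p q) < \<eta>1" if "p \<in> ?I" "q \<in> ?I" for p q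
        using Y(3) that unfolding SU_def by blast
      have b: "\<forall>i. cmod (gram n Y (fone, i) (fone, i) - ?Q (fone, i) (fone, i)) \<le> 1"
      proof
        fix i
        show "cmod (gram n Y (fone, i) (fone, i) - ?Q (fone, i) (fone, i)) \<le> 1"
          using o[of "(fone, i)" "(fone, i)"] one \<eta> unfolding orb1 by simp
      qed
      show "Y \<in> gnb ?I n ?Q \<eta>2"
        unfolding gnb_def close_on_def
      proof (intro CollectI conjI ballI Y(1))
        fix p q assume pq: "p \<in> ?I" "q \<in> ?I"
        have "cmod (gram n Y p q - ?Q p q) \<le> cmod (gram n Y p q - gram n (orb n U (root Y)) p q) + cmod (gram n (orb n U (root Y)) p q - ?Q p q)"
          using norm_triangle_ineq[of "gram n Y p q - gram n (orb n U (root Y)) p q" "gram n (orb n U (root Y)) p q - ?Q p q"] by simp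
        also have "\<dots> \<le> C * \<epsilon> + \<eta>1"
          using cl[OF U _ \<epsilon>(2) Y(2) b pq] o[OF pq] \<epsilon> by (intro add_mono) auto
        finally show "cmod (gram n Y p q - ?Q p q) \<le> \<eta>2" using \<eta> by simp
      qed
    qed
    then have "emeasure (tn ?I n) (?fS n \<epsilon> \<eta>1 U) \<le> emeasure (tn ?I n) {Y \<in> gnb ?I n ?Q \<eta>2. fz F n \<epsilon> U Y}"
      using fzG by (intro emeasure_mono)
    then show "emeasure (vec_meas n) (Xset n U (wnb F \<eta>1 \<phi>)) \<le> ennreal (1 / edge_vol F TYPE('k) n \<epsilon>) * emeasure (tn ?I n) {Y \<in> gnb ?I n ?Q \<eta>2. fz F n \<epsilon> U Y}"
      unfolding vol[OF U \<epsilon>(1)] by (rule mult_left_mono) simp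
  qed
  have low: "ennreal (1 / edge_vol F TYPE('k) n \<epsilon>) *
       (\<integral>\<^sup>+Y. (\<Prod>s\<in>UNIV. pk (fdom F s \<times> UNIV) n \<epsilon> Y (shiftY s Y)) * indicator (gnb ?I n ?Q \<eta>2) Y \<partial>tn ?I n)
      \<le> (\<integral>\<^sup>+U. emeasure (vec_meas n) (Xset n U (wnb F \<eta>1 \<phi>)) \<partial>rand_meas n)"
    if \<epsilon>: "0 < \<epsilon>" "\<epsilon> \<le> 1" and \<eta>: "0 < \<eta>2" "\<eta>2 \<le> 1" "\<eta>2 + C * \<epsilon> < \<eta>1" for n \<epsilon> \<eta>1 \<eta>2
    unfolding int[symmetric]
  proof (rule nn_integral_mono)
    fix U :: "'s \<Rightarrow> nat \<times> nat \<Rightarrow> complex" assume "U \<in> space (rand_meas n)"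
    then have U: "\<forall>s. U s \<in> umat n" by (rule sets_rand)
    have "{Y \<in> gnb ?I n ?Q \<eta>2. fz F n \<epsilon> U Y} \<subseteq> ?fS n \<epsilon> \<eta>1 U"
    proof safe
      fix Y assume Y: "Y \<in> gnb ?I n ?Q \<eta>2" "fz F n \<epsilon> U Y"
      then show sp: "Y \<in> space (tn ?I n)" by (simp add: gnb_def)
      have g: "cmod (gram n Y p q - ?Q p q) \<le> \<eta>2" if "p \<in> ?I" "q \<in> ?I" for p q
        using Y(1) that unfolding gnb_def close_on_def by blast
      have b: "\<forall>i. cmod (gram n Y (fone, i) (fone, i) - ?Q (fone, i) (fone, i)) \<le> 1"
      proof
        fix i
        show "cmod (gram n Y (fone, i) (fone, i) - ?Q (fone, i) (fone, i)) \<le> 1"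
          using g[of "(fone, i)" "(fone, i)"] one \<eta> by simp
      qed
      show "root Y \<in> SU F \<eta>1 \<phi> n U"
        unfolding SU_def
      proof (intro CollectI conjI ballI)
        show "root Y \<in> space (tn UNIV n)" using measurable_space[OF root_measurable[OF one] sp] .
        fix p q assume pq: "p \<in> ?I" "q \<in> ?I"
        have "cmod (gram n (orb n U (root Y)) p q - ?Q p q) \<le> cmod (gram n Y p q - ?Q p q) + cmod (gram n Y p q - gram n (orb n U (root Y)) p q)"
          using norm_triangle_ineq4[of "gram n Y p q - ?Q p q" "gram n Y p q - gram n (orb n U (root Y)) p q"] by simp
        also have "\<dots> \<le> \<eta>2 + C * \<epsilon>"
          using cl[OF U _ \<epsilon>(2) Y(2) b pq] g[OF pq] \<epsilon> by (intro add_mono) auto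
        finally show "cmod (gram n (orb n U (root Y)) p q - ?Q p q) < \<eta>1" using \<eta> by simp
      qed
    qed
    then have "emeasure (tn ?I n) {Y \<in> gnb ?I n ?Q \<eta>2. fz F n \<epsilon> U Y} \<le> emeasure (tn ?I n) (?fS n \<epsilon> \<eta>1 U)"
      using fS[OF U] by (intro emeasure_mono)
    then show "ennreal (1 / edge_vol F TYPE('k) n \<epsilon>) * emeasure (tn ?I n) {Y \<in> gnb ?I n ?Q \<eta>2. fz F n \<epsilon> U Y} \<le> emeasure (vec_meas n) (Xset n U (wnb F \<eta>1 \<phi>))"
      unfolding vol[OF U \<epsilon>(1)] by (rule mult_left_mono) simp
  qed
  show ?thesis using that[of C] C up low by blast
qed

subsection \<open>Exponential rates\<close>

lemma elog_mono: "a \<le> b \<Longrightarrow> elog a \<le> elog b"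
proof -
  assume ab: "a \<le> b"
  show ?thesis
  proof (cases "a = 0 \<or> b = \<top>")
    case False
    then have b: "b < \<top>" "a < \<top>" "a > 0" using ab by (auto simp: less_top zero_less_iff_neq_zero intro: le_less_trans)
    have "enn2real a > 0" using b by (simp add: enn2real_positive_iff)
    moreover have "enn2real a \<le> enn2real b" using ab b by (intro enn2real_mono) auto
    ultimately show ?thesis using False b ab by (auto simp: elog_def)
  qed (use ab in \<open>auto simp: elog_def top_unique\<close>)
qed

lemma elog_ennreal: "y > 0 \<Longrightarrow> elog (ennreal y) = ereal (ln y)"
  by (simp add: elog_def)

abbreviation avol :: "nat \<Rightarrow> ('s::finite fword \<Rightarrow> complex^'k::finite^'k) set \<Rightarrow> ennreal" where
  "avol n W \<equiv> \<integral>\<^sup>+U. emeasure (vec_meas n) (Xset n U W) \<partial>rand_meas n"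

text \<open>The prefactor disappears after division by \<open>n\<close>, so volume estimates are
  needed only up to a constant.\<close>

lemma rate_limit:
  assumes "c > 0" "x > 0"
  shows "(\<lambda>n. ereal (1 / real n * ln (c * x ^ n))) \<longlonglongrightarrow> ereal (ln x)"
proof -
  have "(\<lambda>n. ln c / real n + ln x) \<longlonglongrightarrow> 0 + ln x" by (intro tendsto_intros lim_const_over_n)
  moreover have "\<forall>\<^sub>F n in sequentially. ln c / real n + ln x = 1 / real n * ln (c * x ^ n)"
    using eventually_gt_at_top[of 0]
  proof eventually_elim
    case (elim n)
    have "ln (c * x ^ n) = ln c + real n * ln x" using assms by (simp add: ln_mult_pos ln_realpow)
    then show ?case using elim by (simp add: field_simps)
  qed
  ultimately have "(\<lambda>n. 1 / real n * ln (c * x ^ n)) \<longlonglongrightarrow> ln x" using tendsto_cong by force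
  then show ?thesis by (simp add: tendsto_ereal)
qed

lemma ann_term_upper:
  fixes W :: "('s::finite fword \<Rightarrow> complex^'k::finite^'k) set"
  assumes c: "c > 0" and x: "x > 0"
    and le: "\<forall>\<^sub>F n in sequentially. avol n W \<le> ennreal (c * vball n ^ CARD('k) * x ^ n)"
  shows "limsup (\<lambda>n. ann_term n W) \<le> ereal (ln x)"
proof -
  have "limsup (\<lambda>n. ann_term n W) \<le> limsup (\<lambda>n. ereal (1 / real n * ln (c * x ^ n)))"
  proof (rule Limsup_mono)
    show "\<forall>\<^sub>F n in sequentially. ann_term n W \<le> ereal (1 / real n * ln (c * x ^ n))"
      using le
    proof eventually_elim
      case (elim n)
      have v: "vball n ^ CARD('k) > 0" by simp
      have "avol n W / ennreal (vball n ^ CARD('k)) \<le> ennreal (c * vball n ^ CARD('k) * x ^ n) / ennreal (vball n ^ CARD('k))"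
        using elim by (rule divide_right_mono_ennreal)
      also have "\<dots> = ennreal (c * x ^ n)" using v c x less_imp_neq[OF vball_pos[of n]] by (subst divide_ennreal) (auto intro!: mult_nonneg_nonneg less_imp_le)
      finally have "elog (avol n W / ennreal (vball n ^ CARD('k))) \<le> elog (ennreal (c * x ^ n))" by (rule elog_mono)
      also have "\<dots> = ereal (ln (c * x ^ n))" using c x by (intro elog_ennreal) simp
      finally have "ereal (1 / real n) * elog (avol n W / ennreal (vball n ^ CARD('k))) \<le> ereal (1 / real n) * ereal (ln (c * x ^ n))"
        by (rule ereal_mult_left_mono) simp
      then show ?case by (simp add: ann_term_def)
    qed
  qed
  also have "\<dots> = ereal (ln x)" by (rule lim_imp_Limsup[OF _ rate_limit[OF c x]]) simp
  finally show ?thesis .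
qed

lemma ann_term_lower:
  fixes W :: "('s::finite fword \<Rightarrow> complex^'k::finite^'k) set"
  assumes c: "c > 0" and x: "x > 0"
    and le: "\<forall>\<^sub>F n in sequentially. ennreal (c * vball n ^ CARD('k) * x ^ n) \<le> avol n W"
  shows "ereal (ln x) \<le> limsup (\<lambda>n. ann_term n W)"
proof -
  have "ereal (ln x) = limsup (\<lambda>n. ereal (1 / real n * ln (c * x ^ n)))"
    by (rule lim_imp_Limsup[OF _ rate_limit[OF c x], symmetric]) simp
  also have "\<dots> \<le> limsup (\<lambda>n. ann_term n W)"
  proof (rule Limsup_mono)
    show "\<forall>\<^sub>F n in sequentially. ereal (1 / real n * ln (c * x ^ n)) \<le> ann_term n W"
      using le
    proof eventually_elim
      case (elim n)
      have v: "vball n ^ CARD('k) > 0" by simp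
      have "ereal (ln (c * x ^ n)) = elog (ennreal (c * x ^ n))" using c x by (intro elog_ennreal[symmetric]) simp
      also have "ennreal (c * x ^ n) = ennreal (c * vball n ^ CARD('k) * x ^ n) / ennreal (vball n ^ CARD('k))"
        using v c x less_imp_neq[OF vball_pos[of n]] by (subst divide_ennreal) (auto intro!: mult_nonneg_nonneg less_imp_le)
      also have "elog \<dots> \<le> elog (avol n W / ennreal (vball n ^ CARD('k)))"
        using elim by (intro elog_mono divide_right_mono_ennreal)
      finally have "ereal (1 / real n) * ereal (ln (c * x ^ n)) \<le> ereal (1 / real n) * elog (avol n W / ennreal (vball n ^ CARD('k)))"
        by (rule ereal_mult_left_mono) simp
      then show ?case by (simp add: ann_term_def)
    qed
  qed
  finally show ?thesis .
qed

text \<open>The kernel of \<phi> is invariant under left translation, so closeness at the targets is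
  closeness on \<open>F\<close> read at translated indices.\<close>

lemma close_shiftY:
  assumes "close_on (F \<times> UNIV) \<eta> (gramker \<phi>) (gram n Y)"
  shows "close_on (fdom F s \<times> UNIV) \<eta> (gramker \<phi>) (gram n (shiftY s Y))" "close_on (fdom F s \<times> UNIV) \<eta> (gramker \<phi>) (gram n Y)"
proof -
  have "gram n (shiftY s Y) (g, i) (h, j) = gram n Y (fmul (fgen s) g, i) (fmul (fgen s) h, j)" for g h i j
    by (simp add: gram_def shiftY_def)
  moreover have "gramker \<phi> (g, i) (h, j) = gramker \<phi> (fmul (fgen s) g, i) (fmul (fgen s) h, j)" for g h i j
    by (simp add: gramker_def finv_translate)
  ultimately have e: "gram n (shiftY s Y) p q - gramker \<phi> p q
      = gram n Y (fmul (fgen s) (fst p), snd p) (fmul (fgen s) (fst q), snd q) - gramker \<phi> (fmul (fgen s) (fst p), snd p) (fmul (fgen s) (fst q), snd q)" for p q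
    by (metis prod.collapse)
  show "close_on (fdom F s \<times> UNIV) \<eta> (gramker \<phi>) (gram n (shiftY s Y))"
    using assms unfolding close_on_def e by (auto simp: fdom_def)
  show "close_on (fdom F s \<times> UNIV) \<eta> (gramker \<phi>) (gram n Y)" using assms by (auto simp: close_on_def fdom_def)
qed

lemma edge_card:
  assumes fin: "finite F" and sc: "suffix_closed F" and one: "fone \<in> F"
  shows "(\<Sum>s\<in>UNIV. card (fdom F (s :: 's::finite) \<times> (UNIV :: 'k::finite set))) = CARD('k) * (card F - 1)"
    "card (F \<times> (UNIV :: 'k set)) = CARD('k) * (card F - 1) + CARD('k)"
proof -
  show "(\<Sum>s\<in>UNIV. card (fdom F (s :: 's) \<times> (UNIV :: 'k set))) = CARD('k) * (card F - 1)"
    using card_fdom[OF assms] by (simp add: card_cartesian_product sum_distrib_right[symmetric] mult.commute[of "CARD('k)"])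
  have "card F > 0" using fin one by (auto simp: card_gt_0_iff)
  then show "card (F \<times> (UNIV :: 'k set)) = CARD('k) * (card F - 1) + CARD('k)"
    by (cases "card F") (auto simp: card_cartesian_product mult.commute)
qed

section \<open>Upper and lower bounds at a finite scale\<close>

text \<open>Shared by both bounds, with \<open>b\<close> equal to \<open>1 + \<delta>\<close> or
  \<open>1 - \<delta>\<close>. The powers of \<epsilon> and, up to \<open>v ^ k\<close>, of
  \<open>v\<close> cancel because the numbers of edge vectors sum to the exponent \<open>M\<close>
  of the thickening.\<close>

lemma rate_algebra:
  fixes m :: "'s::finite \<Rightarrow> nat" and c :: "'s \<Rightarrow> real"
  assumes "\<epsilon> > 0" "v > 0" "\<And>s. c s > 0" "(\<Sum>s\<in>UNIV. m s) = M"
  shows "1 / (v * \<epsilon> ^ (2 * n)) ^ M * (\<Prod>s\<in>UNIV. a * (((b * \<epsilon>) ^ (2 * n)) ^ m s) / c s ^ n) * (D ^ n * v ^ (M + k))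
     = a ^ CARD('s) * v ^ k * (D * b ^ (2 * M) / (\<Prod>s\<in>UNIV. c s)) ^ n"
proof -
  have "(\<Prod>s\<in>UNIV. a * (((b * \<epsilon>) ^ (2 * n)) ^ m s) / c s ^ n) = a ^ CARD('s) * ((b * \<epsilon>) ^ (2 * n)) ^ M / (\<Prod>s\<in>UNIV. c s) ^ n"
    unfolding prod_dividef prod.distrib prod_constant power_sum[symmetric] assms(4) prod_power_distrib ..
  moreover have "((b * \<epsilon>) ^ (2 * n)) ^ M = (b ^ (2 * M)) ^ n * (\<epsilon> ^ (2 * n)) ^ M"
  proof -
    have "((b * \<epsilon>) ^ (2 * n)) ^ M = (b ^ (2 * n)) ^ M * (\<epsilon> ^ (2 * n)) ^ M" by (simp only: power_mult_distrib)
    moreover have "(b ^ (2 * n)) ^ M = (b ^ (2 * M)) ^ n" by (simp only: power_mult[symmetric] ac_simps)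
    ultimately show ?thesis by simp
  qed
  ultimately show ?thesis using assms(1,2)
    by (simp add: power_mult_distrib power_divide power_add)
qed

text \<open>Only edge determinants are inverted, and the volume for \<open>F\<close> is bounded
  through \<open>shiftdiag\<close>, so the determinant of \<open>F\<close> may be 0. Then every
  positive \<open>x\<close> qualifies.\<close>

lemma hann_le:
  fixes \<phi> :: "'s::finite fword \<Rightarrow> complex^'k::finite^'k"
  assumes pd: "posdef \<phi>" and fin: "finite F" and sc: "suffix_closed F" and one: "fone \<in> F"
    and nz: "\<And>s. blockdet \<phi> (fdom F s) \<noteq> 0"
    and x: "x > Re (blockdet \<phi> F) / (\<Prod>s\<in>UNIV. Re (blockdet \<phi> (fdom F s)))"
  shows "hann \<phi> \<le> ereal (ln x)"
proof -
  let ?I = "F \<times> (UNIV :: 'k set)"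
  let ?T = "\<lambda>s. fdom F s \<times> (UNIV :: 'k set)"
  let ?Q = "gramker \<phi>"
  define M where "M = CARD('k) * (card F - 1)"
  define d where "d s = Re (blockdet \<phi> (fdom F s))" for s
  have fI: "finite ?I" and fT: "finite (?T s)" for s using fin by (auto simp: fdom_def)
  have psd: "psd ?I ?Q" "psd (?T s) ?Q" for s
    using posdef_psd[OF pd] fin by (auto simp: fdom_def)
  have d: "d s > 0" "det_on (?T s) ?Q = complex_of_real (d s)" for s
    using psd_det_real[OF fT psd(2)] nz[of s] by (auto simp: d_def blockdet_gramker)
  have D0: "Re (blockdet \<phi> F) \<ge> 0" using psd_det_real(2)[OF fI psd(1)] by (simp add: blockdet_gramker)
  have xpos: "x > 0"
  proof -
    have "0 \<le> Re (blockdet \<phi> F) / (\<Prod>s\<in>UNIV. d s)" using D0 d by (intro divide_nonneg_pos prod_pos) auto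
    then show ?thesis using x by (simp add: d_def)
  qed
  \<comment> \<open>The exponential base with all losses: the shifted determinant, the radius factor
    \<open>1 + \<delta>\<close>, and edge determinants lowered by a factor
    \<open>1 - \<delta>\<close>. It tends to the ratio as \<delta> tends to 0.\<close>
  define G where "G \<delta> = Re (det_on ?I (shiftdiag \<delta> ?Q)) * (1 + \<delta>) ^ (2 * M) / (\<Prod>s\<in>UNIV. (1 - \<delta>) * d s)" for \<delta>
  have "(G \<longlongrightarrow> Re (det_on ?I ?Q) * (1 + 0) ^ (2 * M) / (\<Prod>s\<in>UNIV. (1 - 0) * d s)) (at_right 0)"
    unfolding G_def using d by (intro tendsto_intros det_shiftdiag_tendsto) (auto simp: less_imp_neq[symmetric])
  then have "\<forall>\<^sub>F \<delta> in at_right 0. G \<delta> < x"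
    using x by (intro order_tendstoD(2)) (auto simp: blockdet_gramker d_def)
  moreover have "\<forall>\<^sub>F \<delta> in at_right 0. \<delta> < (1::real)" by (rule order_tendstoD(2)[OF tendsto_ident_at]) simp
  moreover have "\<forall>\<^sub>F \<delta> in at_right 0. \<delta> > (0::real)" by (rule eventually_at_right_less)
  ultimately have "\<forall>\<^sub>F \<delta> in at_right 0. G \<delta> < x \<and> 0 < \<delta> \<and> \<delta> < (1::real)" by eventually_elim auto
  then obtain \<delta> where \<delta>: "0 < \<delta>" "\<delta> < 1" "G \<delta> < x"
    using eventually_happens'[OF trivial_limit_at_right_real] by blast
  have "\<exists>b \<theta>. b \<ge> 1 \<and> \<theta> > 0 \<and> (\<forall>Q'. psd (?T s) Q' \<longrightarrow> close_on (?T s) \<theta> ?Q Q' \<longrightarrow> (\<exists>R' S'. bounded_chol (?T s) b Q' R' S'))" for s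
  proof -
    obtain R S where "chol (?T s) ?Q R S" using psd_chol[OF fT psd(2)] nz[of s] by (auto simp: blockdet_gramker)
    then show ?thesis using bounded_chol_nearby[OF fT] by metis
  qed
  then obtain b \<theta> where b: "\<And>s. b s \<ge> 1" and \<theta>: "\<And>s. \<theta> s > 0"
    and bc: "\<And>s Q'. psd (?T s) Q' \<Longrightarrow> close_on (?T s) (\<theta> s) ?Q Q' \<Longrightarrow> \<exists>R' S'. bounded_chol (?T s) (b s) Q' R' S'"
    by metis
  have "\<exists>\<theta>>0. \<forall>Q'. close_on (?T s) \<theta> ?Q Q' \<longrightarrow> cmod (det_on (?T s) Q' - det_on (?T s) ?Q) \<le> \<delta> * d s" for s
    using \<delta> d(1)[of s] by (intro det_on_close fT) simp
  then obtain \<theta>' where \<theta>': "\<And>s. \<theta>' s > 0"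
    and dc: "\<And>s Q'. close_on (?T s) (\<theta>' s) ?Q Q' \<Longrightarrow> cmod (det_on (?T s) Q' - det_on (?T s) ?Q) \<le> \<delta> * d s" by metis
  \<comment> \<open>Small enough for the volume bound with shift \<delta>, for bounded Cholesky
    factors on all edge sets, and for edge determinants within
    \<open>\<delta> * d s\<close>.\<close>
  define \<eta>2 where "\<eta>2 = Min (insert (\<delta> / real (card ?I)) (insert 1 (\<theta> ` UNIV \<union> \<theta>' ` UNIV)))"
  have cI: "card ?I > 0" using fI one by (auto simp: card_gt_0_iff)
  have \<eta>2: "\<eta>2 > 0" using \<delta> \<theta> \<theta>' cI unfolding \<eta>2_def by (subst Min_gr_iff) auto
  have \<eta>2_le: "\<eta>2 \<le> \<delta> / real (card ?I)" "\<eta>2 \<le> \<theta> s" "\<eta>2 \<le> \<theta>' s" "\<eta>2 \<le> 1" for s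
    unfolding \<eta>2_def by (intro Min_le; simp)+
  obtain C where C: "C \<ge> 0" and up: "\<And>n \<epsilon> \<eta>1 \<eta>2. 0 < \<epsilon> \<Longrightarrow> \<epsilon> \<le> 1 \<Longrightarrow> 0 < \<eta>1 \<Longrightarrow> \<eta>1 \<le> 1 \<Longrightarrow> \<eta>1 + C * \<epsilon> \<le> \<eta>2 \<Longrightarrow>
     avol n (wnb F \<eta>1 \<phi>) \<le> ennreal (1 / edge_vol F TYPE('k) n \<epsilon>) *
       (\<integral>\<^sup>+Y. (\<Prod>s\<in>UNIV. pk (?T s) n \<epsilon> Y (shiftY s Y)) * indicator (gnb ?I n ?Q \<eta>2) Y \<partial>tn ?I n)"
    by (rule average_volume_bounds[OF fin sc one, of \<phi>]) blast
  \<comment> \<open>\<open>C * \<epsilon>\<close> is then at most half of \<open>\<eta>2\<close>,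
    and \<open>\<eta>1\<close> takes the other half.\<close>
  define \<epsilon> where "\<epsilon> = min 1 (\<eta>2 / (2 * (C + 1)))"
  define \<eta>1 where "\<eta>1 = \<eta>2 / 2"
  have \<epsilon>: "\<epsilon> > 0" "\<epsilon> \<le> 1" using \<eta>2 C by (auto simp: \<epsilon>_def)
  have "(C + 1) * \<epsilon> \<le> (C + 1) * (\<eta>2 / (2 * (C + 1)))" using C by (intro mult_left_mono) (auto simp: \<epsilon>_def)
  also have "\<dots> = \<eta>2 / 2" using C mult_divide_mult_cancel_left[of "C + 1" \<eta>2 2] by (simp add: mult.commute[of 2])
  finally have \<eta>1: "\<eta>1 > 0" "\<eta>1 \<le> 1" "\<eta>1 + C * \<epsilon> \<le> \<eta>2"
    using \<eta>2 \<eta>2_le(4) \<epsilon> by (auto simp: \<eta>1_def algebra_simps)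
  have "\<forall>\<^sub>F n in sequentially. \<forall>s. \<forall>A Z R S. bounded_chol (?T s) (b s) (gram n Z) R S \<longrightarrow>
    pk (?T s) n \<epsilon> A Z \<le> ennreal (2 * (((1 + \<delta>) * \<epsilon>) ^ (2 * n)) ^ card (?T s) / Re (det_on (?T s) (gram n Z)) ^ n)"
    by (intro eventually_all_finite pk_upper fT b \<delta> \<epsilon>)
  then have bound: "\<forall>\<^sub>F n in sequentially. avol n (wnb F \<eta>1 \<phi>) \<le> ennreal (2 ^ CARD('s) * vball n ^ CARD('k) * x ^ n)"
  proof eventually_elim
    case (elim n)
    let ?p = "\<lambda>s. 2 * (((1 + \<delta>) * \<epsilon>) ^ (2 * n)) ^ card (?T s) / ((1 - \<delta>) * d s) ^ n"
    have p0: "?p s \<ge> 0" for s using \<delta> \<epsilon> d[of s] by (intro divide_nonneg_nonneg mult_nonneg_nonneg) auto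
    have pk: "pk (?T s) n \<epsilon> Y (shiftY s Y) \<le> ennreal (?p s)" if Y: "Y \<in> gnb ?I n ?Q \<eta>2" for Y s
    proof -
      have "close_on ?I \<eta>2 ?Q (gram n Y)" using Y by (simp add: gnb_def)
      then have cl: "close_on (?T s) \<eta>2 ?Q (gram n (shiftY s Y))" by (rule close_shiftY)
      obtain R S where RS: "bounded_chol (?T s) (b s) (gram n (shiftY s Y)) R S"
        using bc[OF psd_gram close_on_mono[OF cl \<eta>2_le(2)]] by blast
      have "cmod (det_on (?T s) (gram n (shiftY s Y)) - complex_of_real (d s)) \<le> \<delta> * d s"
        using dc[OF close_on_mono[OF cl \<eta>2_le(3)]] d(2) by simp
      then have "\<bar>Re (det_on (?T s) (gram n (shiftY s Y))) - d s\<bar> \<le> \<delta> * d s"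
        using abs_Re_le_cmod[of "det_on (?T s) (gram n (shiftY s Y)) - complex_of_real (d s)"] by simp
      then have low: "(1 - \<delta>) * d s \<le> Re (det_on (?T s) (gram n (shiftY s Y)))" by (simp add: algebra_simps abs_le_iff)
      have "pk (?T s) n \<epsilon> Y (shiftY s Y) \<le> ennreal (2 * (((1 + \<delta>) * \<epsilon>) ^ (2 * n)) ^ card (?T s) / Re (det_on (?T s) (gram n (shiftY s Y))) ^ n)"
        using elim RS by blast
      also have "\<dots> \<le> ennreal (?p s)"
        using low less_le_trans[OF mult_pos_pos[of "1 - \<delta>" "d s"] low] d[of s] \<delta> \<epsilon> by (intro ennreal_leI divide_left_mono power_mono mult_pos_pos zero_less_power) auto
      finally show ?thesis .
    qed
    have "avol n (wnb F \<eta>1 \<phi>) \<le> ennreal (1 / edge_vol F TYPE('k) n \<epsilon>) *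
       (\<integral>\<^sup>+Y. (\<Prod>s\<in>UNIV. pk (?T s) n \<epsilon> Y (shiftY s Y)) * indicator (gnb ?I n ?Q \<eta>2) Y \<partial>tn ?I n)"
      by (rule up[OF \<epsilon> \<eta>1])
    also have "\<dots> \<le> ennreal (1 / edge_vol F TYPE('k) n \<epsilon>) * (\<integral>\<^sup>+Y. ennreal (\<Prod>s\<in>UNIV. ?p s) * indicator (gnb ?I n ?Q \<eta>2) Y \<partial>tn ?I n)"
    proof (intro mult_left_mono nn_integral_mono)
      fix Y
      show "(\<Prod>s\<in>UNIV. pk (?T s) n \<epsilon> Y (shiftY s Y)) * indicator (gnb ?I n ?Q \<eta>2) Y \<le> ennreal (\<Prod>s\<in>UNIV. ?p s) * indicator (gnb ?I n ?Q \<eta>2) Y"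
      proof (cases "Y \<in> gnb ?I n ?Q \<eta>2")
        case True
        have "(\<Prod>s\<in>UNIV. pk (?T s) n \<epsilon> Y (shiftY s Y)) \<le> (\<Prod>s\<in>UNIV. ennreal (?p s))"
          by (intro prod_mono_ennreal pk True)
        also have "\<dots> = ennreal (\<Prod>s\<in>UNIV. ?p s)" using p0 by (intro prod_ennreal) auto
        finally show ?thesis by (rule mult_right_mono) simp
      qed (simp add: indicator_def)
    qed simp
    also have "(\<integral>\<^sup>+Y. ennreal (\<Prod>s\<in>UNIV. ?p s) * indicator (gnb ?I n ?Q \<eta>2) Y \<partial>tn ?I n) = ennreal (\<Prod>s\<in>UNIV. ?p s) * emeasure (tn ?I n) (gnb ?I n ?Q \<eta>2)"
      by (rule nn_integral_cmult_indicator[OF gnb_sets[OF fI]])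
    also have "emeasure (tn ?I n) (gnb ?I n ?Q \<eta>2) \<le> ennreal (Re (det_on ?I (shiftdiag \<delta> ?Q)) ^ n * vball n ^ card ?I)"
      using \<eta>2_le(1) cI by (intro gnb_volume_upper[OF fI psd(1) \<delta>(1)]) (simp add: field_simps)
    finally have "avol n (wnb F \<eta>1 \<phi>) \<le> ennreal (1 / edge_vol F TYPE('k) n \<epsilon>) * (ennreal (\<Prod>s\<in>UNIV. ?p s) * ennreal (Re (det_on ?I (shiftdiag \<delta> ?Q)) ^ n * vball n ^ card ?I))"
      by (simp add: mult_left_mono)
    also have "\<dots> = ennreal (1 / edge_vol F TYPE('k) n \<epsilon> * (\<Prod>s\<in>UNIV. ?p s) * (Re (det_on ?I (shiftdiag \<delta> ?Q)) ^ n * vball n ^ card ?I))"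
    proof -
      have "1 / edge_vol F TYPE('k) n \<epsilon> \<ge> 0" using \<epsilon> by (simp add: edge_vol_def less_imp_le)
      moreover have "(\<Prod>s\<in>UNIV. ?p s) \<ge> 0" using p0 by (intro prod_nonneg) auto
      ultimately show ?thesis by (simp only: ennreal_mult'[symmetric] mult_nonneg_nonneg mult.assoc[symmetric])
    qed
    also have "1 / edge_vol F TYPE('k) n \<epsilon> * (\<Prod>s\<in>UNIV. ?p s) * (Re (det_on ?I (shiftdiag \<delta> ?Q)) ^ n * vball n ^ card ?I)
       = 2 ^ CARD('s) * vball n ^ CARD('k) * G \<delta> ^ n"
      unfolding edge_vol_def edge_card(2)[OF fin sc one] G_def M_def[symmetric]
      using \<epsilon> d \<delta> edge_card(1)[OF fin sc one, where 'k = 'k] by (intro rate_algebra) (auto simp: M_def)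
    also have "ennreal (2 ^ CARD('s) * vball n ^ CARD('k) * G \<delta> ^ n) \<le> ennreal (2 ^ CARD('s) * vball n ^ CARD('k) * x ^ n)"
    proof -
      obtain R S where c: "chol ?I (shiftdiag \<delta> ?Q) R S" using shiftdiag_chol[OF fI psd(1) \<delta>(1)] by blast
      then have "det_on ?I (shiftdiag \<delta> ?Q) = complex_of_real (\<Prod>l\<in>?I. (cmod (R l l))\<^sup>2)" by (simp add: chol_def)
      then have "Re (det_on ?I (shiftdiag \<delta> ?Q)) \<ge> 0" by (simp only: Re_complex_of_real) (simp add: prod_nonneg)
      then have "G \<delta> \<ge> 0" unfolding G_def using d \<delta> by (intro divide_nonneg_pos mult_nonneg_nonneg prod_pos) auto
      then show ?thesis using \<delta> by (intro ennreal_leI mult_left_mono power_mono) (auto intro: less_imp_le)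
    qed
    finally show ?case .
  qed
  have "limsup (\<lambda>n. ann_term n (wnb F \<eta>1 \<phi>)) \<le> ereal (ln x)"
    by (rule ann_term_upper[OF _ xpos bound]) simp
  moreover have "hann \<phi> \<le> limsup (\<lambda>n. ann_term n (wnb F \<eta>1 \<phi>))"
    unfolding hann_def by (intro INF_lower CollectI conjI wnb_open fin mem_wnb pd \<eta>1)
  ultimately show ?thesis by simp
qed

text \<open>Here \<epsilon> is fixed before the Gram radius, because the radius allowed by
  \<open>pk_lower\<close> depends on \<epsilon>. The bound holds for every neighbourhood that
  contains a basic one, so it survives the infimum.\<close>

lemma limsup_ann_term_ge:
  fixes \<phi> :: "'s::finite fword \<Rightarrow> complex^'k::finite^'k"
  assumes pd: "posdef \<phi>" and fin: "finite F" and sc: "suffix_closed F" and one: "fone \<in> F"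
    and nz: "\<And>s. blockdet \<phi> (fdom F s) \<noteq> 0" "blockdet \<phi> F \<noteq> 0"
    and x: "x < Re (blockdet \<phi> F) / (\<Prod>s\<in>UNIV. Re (blockdet \<phi> (fdom F s)))" "x > 0"
    and W: "openin (top_of_set {\<psi>. posdef \<psi>}) W" "wnb F \<eta>1 \<phi> \<subseteq> W" "\<eta>1 > 0"
  shows "ereal (ln x) \<le> limsup (\<lambda>n. ann_term n W)"
proof -
  let ?I = "F \<times> (UNIV :: 'k set)"
  let ?T = "\<lambda>s. fdom F s \<times> (UNIV :: 'k set)"
  let ?Q = "gramker \<phi>"
  define M where "M = CARD('k) * (card F - 1)"
  define d where "d s = Re (blockdet \<phi> (fdom F s))" for s
  define D where "D = Re (blockdet \<phi> F)"
  have fI: "finite ?I" and fT: "finite (?T s)" for s using fin by (auto simp: fdom_def)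
  have psd: "psd ?I ?Q" "psd (?T s) ?Q" for s
    using posdef_psd[OF pd] fin by (auto simp: fdom_def)
  have d: "d s > 0" for s
    using psd_det_real[OF fT psd(2)] nz(1)[of s] by (auto simp: d_def blockdet_gramker)
  have D: "D > 0" using psd_det_real[OF fI psd(1)] nz(2) by (auto simp: D_def blockdet_gramker)
  define c where "c \<delta> s = Re (det_on (?T s) (shiftdiag \<delta> ?Q))" for \<delta> s
  \<comment> \<open>Now the edge determinants are the shifted ones, from the upper volume bound
    inside \<open>pk_lower\<close>, while the determinant of \<open>F\<close> enters without
    loss.\<close>
  define G where "G \<delta> = D * (1 - \<delta>) ^ (2 * M) / (\<Prod>s\<in>UNIV. c \<delta> s)" for \<delta>
  have "(G \<longlongrightarrow> D * (1 - 0) ^ (2 * M) / (\<Prod>s\<in>UNIV. Re (det_on (?T s) ?Q))) (at_right 0)"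
    unfolding G_def c_def using d by (intro tendsto_intros det_shiftdiag_tendsto) (auto simp: d_def blockdet_gramker less_imp_neq[symmetric])
  then have "\<forall>\<^sub>F \<delta> in at_right 0. G \<delta> > x"
    using x by (intro order_tendstoD(1)) (auto simp: blockdet_gramker D_def)
  moreover have "\<forall>\<^sub>F \<delta> in at_right 0. \<delta> < (1::real)" by (rule order_tendstoD(2)[OF tendsto_ident_at]) simp
  moreover have "\<forall>\<^sub>F \<delta> in at_right 0. \<delta> > (0::real)" by (rule eventually_at_right_less)
  ultimately have "\<forall>\<^sub>F \<delta> in at_right 0. G \<delta> > x \<and> 0 < \<delta> \<and> \<delta> < (1::real)" by eventually_elim auto
  then obtain \<delta> where \<delta>: "0 < \<delta>" "\<delta> < 1" "x < G \<delta>"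
    using eventually_happens'[OF trivial_limit_at_right_real] by blast
  have c: "c \<delta> s > 0" for s
  proof -
    obtain R S where ch: "chol (?T s) (shiftdiag \<delta> ?Q) R S" using shiftdiag_chol[OF fT psd(2) \<delta>(1)] by blast
    then have "det_on (?T s) (shiftdiag \<delta> ?Q) = complex_of_real (\<Prod>l\<in>?T s. (cmod (R l l))\<^sup>2)" by (simp add: chol_def)
    then show ?thesis using chol_nonzero[OF fT ch] by (simp only: c_def Re_complex_of_real)
  qed
  have bex: "\<exists>b R S. b \<ge> 1 \<and> bounded_chol J b ?Q R S" if J: "finite J" "psd J ?Q" "det_on J ?Q \<noteq> 0" for J
  proof -
    obtain R S where ch: "chol J ?Q R S" using psd_chol[OF J] .
    obtain b \<theta> where "b \<ge> 1" "\<theta> > 0" "\<And>Q'. psd J Q' \<Longrightarrow> close_on J \<theta> ?Q Q' \<Longrightarrow> \<exists>R' S'. bounded_chol J b Q' R' S'"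
      using that by (rule bounded_chol_nearby[OF J(1) ch])
    moreover from this have "close_on J \<theta> ?Q ?Q" by (simp add: close_on_def)
    ultimately show ?thesis using J(2) by blast
  qed
  have low: "\<exists>\<epsilon>1>0. \<forall>\<epsilon>. 0 < \<epsilon> \<longrightarrow> \<epsilon> \<le> \<epsilon>1 \<longrightarrow> (\<exists>\<eta>A>0. \<forall>\<^sub>F n in sequentially. \<forall>A Z.
     close_on (?T s) \<eta>A ?Q (gram n A) \<longrightarrow> close_on (?T s) \<eta>A ?Q (gram n Z) \<longrightarrow>
     ennreal ((((1 - \<delta>) * \<epsilon>) ^ (2 * n)) ^ card (?T s) / (2 * c \<delta> s ^ n)) \<le> pk (?T s) n \<epsilon> A Z)" for s
  proof -
    obtain b R S where b: "b \<ge> 1" "bounded_chol (?T s) b ?Q R S"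
      using bex[OF fT psd(2), of s] nz(1)[of s] unfolding blockdet_gramker by blast
    obtain \<epsilon>1 where "\<epsilon>1 > 0" "\<And>\<epsilon>. 0 < \<epsilon> \<Longrightarrow> \<epsilon> \<le> \<epsilon>1 \<Longrightarrow> \<exists>\<eta>A>0. \<forall>\<^sub>F n in sequentially. \<forall>A Z.
     close_on (?T s) \<eta>A ?Q (gram n A) \<longrightarrow> close_on (?T s) \<eta>A ?Q (gram n Z) \<longrightarrow>
     ennreal ((((1 - \<delta>) * \<epsilon>) ^ (2 * n)) ^ card (?T s) / (2 * Re (det_on (?T s) (shiftdiag \<delta> ?Q)) ^ n)) \<le> pk (?T s) n \<epsilon> A Z"
      using that by (rule pk_lower[OF fT b psd(2) \<delta>(1,2,1)])
    then show ?thesis unfolding c_def by blast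
  qed
  obtain \<epsilon>1 where \<epsilon>1: "\<forall>s. \<epsilon>1 s > 0 \<and> (\<forall>\<epsilon>. 0 < \<epsilon> \<longrightarrow> \<epsilon> \<le> \<epsilon>1 s \<longrightarrow> (\<exists>\<eta>A>0. \<forall>\<^sub>F n in sequentially. \<forall>A Z.
     close_on (?T s) \<eta>A ?Q (gram n A) \<longrightarrow> close_on (?T s) \<eta>A ?Q (gram n Z) \<longrightarrow>
     ennreal ((((1 - \<delta>) * \<epsilon>) ^ (2 * n)) ^ card (?T s) / (2 * c \<delta> s ^ n)) \<le> pk (?T s) n \<epsilon> A Z))"
    using choice[OF allI, OF low] by (rule exE)
  obtain C where C: "C \<ge> 0" and av: "\<And>n \<epsilon> \<eta>1 \<eta>2. 0 < \<epsilon> \<Longrightarrow> \<epsilon> \<le> 1 \<Longrightarrow> 0 < \<eta>2 \<Longrightarrow> \<eta>2 \<le> 1 \<Longrightarrow> \<eta>2 + C * \<epsilon> < \<eta>1 \<Longrightarrow>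
     ennreal (1 / edge_vol F TYPE('k) n \<epsilon>) *
       (\<integral>\<^sup>+Y. (\<Prod>s\<in>UNIV. pk (?T s) n \<epsilon> Y (shiftY s Y)) * indicator (gnb ?I n ?Q \<eta>2) Y \<partial>tn ?I n) \<le> avol n (wnb F \<eta>1 \<phi>)"
    by (rule average_volume_bounds[OF fin sc one, of \<phi>]) blast
  define \<epsilon> where "\<epsilon> = Min (insert 1 (insert (\<eta>1 / (4 * (C + 1))) (\<epsilon>1 ` UNIV)))"
  have \<epsilon>: "\<epsilon> > 0" using C W conjunct1[OF \<epsilon>1[THEN spec]] unfolding \<epsilon>_def by (subst Min_gr_iff) auto
  have \<epsilon>_le: "\<epsilon> \<le> 1" "\<epsilon> \<le> \<eta>1 / (4 * (C + 1))" "\<epsilon> \<le> \<epsilon>1 s" for s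
    unfolding \<epsilon>_def by (intro Min_le; simp)+
  have low': "\<exists>\<eta>A>0. \<forall>\<^sub>F n in sequentially. \<forall>A Z.
     close_on (?T s) \<eta>A ?Q (gram n A) \<longrightarrow> close_on (?T s) \<eta>A ?Q (gram n Z) \<longrightarrow>
     ennreal ((((1 - \<delta>) * \<epsilon>) ^ (2 * n)) ^ card (?T s) / (2 * c \<delta> s ^ n)) \<le> pk (?T s) n \<epsilon> A Z" for s
    using \<epsilon>1[THEN spec, THEN conjunct2, rule_format, OF \<epsilon> \<epsilon>_le(3)] .
  obtain \<eta>A where \<eta>A_all: "\<forall>s. \<eta>A s > 0 \<and> (\<forall>\<^sub>F n in sequentially. \<forall>A Z.
     close_on (?T s) (\<eta>A s) ?Q (gram n A) \<longrightarrow> close_on (?T s) (\<eta>A s) ?Q (gram n Z) \<longrightarrow>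
     ennreal ((((1 - \<delta>) * \<epsilon>) ^ (2 * n)) ^ card (?T s) / (2 * c \<delta> s ^ n)) \<le> pk (?T s) n \<epsilon> A Z)"
    using choice[OF allI, OF low'] by (rule exE)
  note \<eta>A = conjunct1[OF \<eta>A_all[THEN spec]] and ev = conjunct2[OF \<eta>A_all[THEN spec]]
  define \<eta>2 where "\<eta>2 = Min (insert 1 (insert (\<eta>1 / 2) (\<eta>A ` UNIV)))"
  have \<eta>2: "\<eta>2 > 0" using W \<eta>A unfolding \<eta>2_def by (subst Min_gr_iff) auto
  have \<eta>2_le: "\<eta>2 \<le> 1" "\<eta>2 \<le> \<eta>1 / 2" "\<eta>2 \<le> \<eta>A s" for s
    unfolding \<eta>2_def by (intro Min_le; simp)+
  have "(C + 1) * \<epsilon> \<le> (C + 1) * (\<eta>1 / (4 * (C + 1)))" using C \<epsilon>_le by (intro mult_left_mono) auto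
  also have "\<dots> = \<eta>1 / 4" using C mult_divide_mult_cancel_left[of "C + 1" \<eta>1 4] by (simp add: mult.commute[of 4])
  finally have sum: "\<eta>2 + C * \<epsilon> < \<eta>1" using \<epsilon> \<eta>2_le(2) W(3) by (simp add: algebra_simps)
  obtain b R S where b: "b \<ge> 1" "bounded_chol ?I b ?Q R S"
    using bex[OF fI psd(1)] nz(2) unfolding blockdet_gramker by blast
  have "\<forall>\<^sub>F n in sequentially. \<forall>Q R S. bounded_chol ?I b Q R S \<longrightarrow>
    ennreal (Re (det_on ?I Q) ^ n * vball n ^ card ?I / 2) \<le> emeasure (tn ?I n) (gnb ?I n Q \<eta>2)"
    by (rule gnb_volume_lower[OF fI b(1) \<eta>2])
  moreover have "\<forall>\<^sub>F n in sequentially. \<forall>s. \<forall>A Z.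
     close_on (?T s) (\<eta>A s) ?Q (gram n A) \<longrightarrow> close_on (?T s) (\<eta>A s) ?Q (gram n Z) \<longrightarrow>
     ennreal ((((1 - \<delta>) * \<epsilon>) ^ (2 * n)) ^ card (?T s) / (2 * c \<delta> s ^ n)) \<le> pk (?T s) n \<epsilon> A Z"
    by (intro eventually_all_finite ev)
  ultimately have bound: "\<forall>\<^sub>F n in sequentially. ennreal (((1 / 2) ^ CARD('s) / 2) * vball n ^ CARD('k) * x ^ n) \<le> avol n W"
  proof eventually_elim
    case (elim n)
    let ?p = "\<lambda>s. 1 / 2 * (((1 - \<delta>) * \<epsilon>) ^ (2 * n)) ^ card (?T s) / c \<delta> s ^ n"
    let ?v = "D ^ n * vball n ^ card ?I"
    have p0: "?p s \<ge> 0" for s using \<delta> \<epsilon> c[of s] by (intro divide_nonneg_nonneg mult_nonneg_nonneg) auto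
    have pk: "ennreal (?p s) \<le> pk (?T s) n \<epsilon> Y (shiftY s Y)" if Y: "Y \<in> gnb ?I n ?Q \<eta>2" for Y s
    proof -
      have "close_on ?I \<eta>2 ?Q (gram n Y)" using Y by (simp add: gnb_def)
      then have "close_on (?T s) (\<eta>A s) ?Q (gram n (shiftY s Y))" "close_on (?T s) (\<eta>A s) ?Q (gram n Y)"
        by (rule close_on_mono[OF close_shiftY(1) \<eta>2_le(3)], rule close_on_mono[OF close_shiftY(2) \<eta>2_le(3)])
      then have "ennreal ((((1 - \<delta>) * \<epsilon>) ^ (2 * n)) ^ card (?T s) / (2 * c \<delta> s ^ n)) \<le> pk (?T s) n \<epsilon> Y (shiftY s Y)"
        using elim(2) by blast
      then show ?thesis by simp
    qed
    have gv: "ennreal (?v / 2) \<le> emeasure (tn ?I n) (gnb ?I n ?Q \<eta>2)"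
      using elim(1) b(2) by (auto simp: D_def blockdet_gramker)
    have "ennreal (((1 / 2) ^ CARD('s) / 2) * vball n ^ CARD('k) * x ^ n) \<le> ennreal (((1 / 2) ^ CARD('s) / 2) * vball n ^ CARD('k) * G \<delta> ^ n)"
      using \<delta> x by (intro ennreal_leI mult_left_mono power_mono) (auto intro: less_imp_le)
    also have "((1 / 2) ^ CARD('s) / 2) * vball n ^ CARD('k) * G \<delta> ^ n = (1 / edge_vol F TYPE('k) n \<epsilon> * (\<Prod>s\<in>UNIV. ?p s) * ?v) / 2"
    proof -
      have "1 / edge_vol F TYPE('k) n \<epsilon> * (\<Prod>s\<in>UNIV. ?p s) * ?v = (1 / 2) ^ CARD('s) * vball n ^ CARD('k) * G \<delta> ^ n"
        unfolding edge_vol_def edge_card(2)[OF fin sc one] G_def M_def[symmetric]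
        using \<epsilon> c edge_card(1)[OF fin sc one, where 'k = 'k] by (intro rate_algebra) (auto simp: M_def)
      then show ?thesis by simp
    qed
    also have "\<dots> = 1 / edge_vol F TYPE('k) n \<epsilon> * ((\<Prod>s\<in>UNIV. ?p s) * (?v / 2))" by simp
    also have "ennreal \<dots> = ennreal (1 / edge_vol F TYPE('k) n \<epsilon>) * (ennreal (\<Prod>s\<in>UNIV. ?p s) * ennreal (?v / 2))"
    proof -
      have "1 / edge_vol F TYPE('k) n \<epsilon> \<ge> 0" using \<epsilon> by (simp add: edge_vol_def less_imp_le)
      moreover have "(\<Prod>s\<in>UNIV. ?p s) \<ge> 0" using p0 by (intro prod_nonneg) auto
      ultimately show ?thesis by (simp only: ennreal_mult' )
    qed
    also have "\<dots> \<le> ennreal (1 / edge_vol F TYPE('k) n \<epsilon>) * (ennreal (\<Prod>s\<in>UNIV. ?p s) * emeasure (tn ?I n) (gnb ?I n ?Q \<eta>2))"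
      using gv by (intro mult_left_mono) auto
    also have "ennreal (\<Prod>s\<in>UNIV. ?p s) * emeasure (tn ?I n) (gnb ?I n ?Q \<eta>2) = (\<integral>\<^sup>+Y. ennreal (\<Prod>s\<in>UNIV. ?p s) * indicator (gnb ?I n ?Q \<eta>2) Y \<partial>tn ?I n)"
      by (rule nn_integral_cmult_indicator[OF gnb_sets[OF fI], symmetric])
    also have "\<dots> \<le> (\<integral>\<^sup>+Y. (\<Prod>s\<in>UNIV. pk (?T s) n \<epsilon> Y (shiftY s Y)) * indicator (gnb ?I n ?Q \<eta>2) Y \<partial>tn ?I n)"
    proof (rule nn_integral_mono)
      fix Y
      show "ennreal (\<Prod>s\<in>UNIV. ?p s) * indicator (gnb ?I n ?Q \<eta>2) Y \<le> (\<Prod>s\<in>UNIV. pk (?T s) n \<epsilon> Y (shiftY s Y)) * indicator (gnb ?I n ?Q \<eta>2) Y"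
      proof (cases "Y \<in> gnb ?I n ?Q \<eta>2")
        case True
        have "ennreal (\<Prod>s\<in>UNIV. ?p s) = (\<Prod>s\<in>UNIV. ennreal (?p s))" using p0 by (intro prod_ennreal[symmetric]) auto
        also have "\<dots> \<le> (\<Prod>s\<in>UNIV. pk (?T s) n \<epsilon> Y (shiftY s Y))"
          by (intro prod_mono_ennreal pk True)
        finally show ?thesis by (rule mult_right_mono) simp
      qed (simp add: indicator_def)
    qed
    also have "ennreal (1 / edge_vol F TYPE('k) n \<epsilon>) * \<dots> \<le> avol n (wnb F \<eta>1 \<phi>)"
      by (rule av[OF \<epsilon> \<epsilon>_le(1) \<eta>2 \<eta>2_le(1) sum])
    also have "\<dots> \<le> avol n W"
    proof (rule nn_integral_mono)
      fix U :: "'s \<Rightarrow> nat \<times> nat \<Rightarrow> complex" assume "U \<in> space (rand_meas n)"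
      then have "Xset n U W \<in> sets (vec_meas n)" by (intro Xset_sets sets_rand W)
      then show "emeasure (vec_meas n) (Xset n U (wnb F \<eta>1 \<phi>)) \<le> emeasure (vec_meas n) (Xset n U W)"
        using W(2) by (intro emeasure_mono) (auto simp: Xset_def)
    qed
    finally show ?case by (simp add: mult_left_mono)
  qed
  show ?thesis by (rule ann_term_lower[OF _ x(2) bound]) simp
qed

section \<open>Passage from finite scales to the limit\<close>

lemma blockdet_fdom:
  fixes \<phi> :: "'s fword \<Rightarrow> complex^'k::finite^'k"
  assumes "finite F" shows "blockdet \<phi> (F \<inter> fmul (fgen s) ` F) = blockdet \<phi> (fdom F s)"
  using blockdet_translate[of "fdom F s" \<phi> "fgen s"] assms by (simp add: fdom_image) (simp add: fdom_def)

lemma blockdet_subset_nonzero: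
  fixes \<phi> :: "'s fword \<Rightarrow> complex^'k::finite^'k"
  assumes "posdef \<phi>" "finite F" "F' \<subseteq> F" "blockdet \<phi> F \<noteq> 0"
  shows "blockdet \<phi> F' \<noteq> 0"
  using psd_det_mono[of "F \<times> UNIV" "gramker \<phi>" "F' \<times> (UNIV :: 'k set)"] posdef_psd[of \<phi> F] assms
  by (auto simp: blockdet_gramker)

lemma ereal_le_all_reals:
  assumes "\<And>y. b < y \<Longrightarrow> z \<le> ereal y" shows "z \<le> ereal b"
proof (rule ccontr)
  assume "\<not> ?thesis"
  then obtain y where "ereal b < ereal y" "ereal y < z" using ereal_dense2[of "ereal b" z] that by (auto simp: not_le)
  then show False using assms[of y] by simp
qed

lemma ereal_ge_all_reals:
  assumes "\<And>y. y < b \<Longrightarrow> ereal y \<le> z" shows "ereal b \<le> z"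
proof (rule ccontr)
  assume "\<not> ?thesis"
  then obtain y where "z < ereal y" "ereal y < ereal b" using ereal_dense2[of z "ereal b"] that by (auto simp: not_le)
  then show False using assms[of y] by simp
qed

lemma fone_fball: "fone \<in> fball n" by (simp add: fball_def)

text \<open>A minimal singular suffix-closed set has nonsingular edge sets, since its longest word is a leaf.\<close>

lemma hann_singular:
  fixes \<phi> :: "'s::finite fword \<Rightarrow> complex^'k::finite^'k"
  assumes pd: "posdef \<phi>" and sing: "blockdet \<phi> (fball N) = 0"
  shows "hann \<phi> = -\<infinity>"
proof -
  define P where "P F \<longleftrightarrow> finite F \<and> suffix_closed F \<and> blockdet \<phi> F = 0" for F
  have "P (fball N)" using sing finite_fball suffix_closed_fball by (auto simp: P_def)
  then obtain F where F: "P F" "\<And>F'. P F' \<Longrightarrow> card F \<le> card F'" using ex_has_least_nat[of P "fball N" card] by blast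
  have fin: "finite F" and sc: "suffix_closed F" and z: "blockdet \<phi> F = 0" using F(1) by (auto simp: P_def)
  have ne: "F \<noteq> {}" using z by (auto simp: blockdet_gramker)
  have one: "fone \<in> F" by (rule fone_in_suffix_closed[OF sc ne])
  define len where "len = (\<lambda>g :: 's fword. length (word g))"
  obtain x where x: "x \<in> F" "\<And>g. g \<in> F \<Longrightarrow> len g \<le> len x"
  proof -
    have "Max (len ` F) \<in> len ` F" using fin ne by (intro Max_in) auto
    then obtain x where "x \<in> F" "len x = Max (len ` F)" by auto
    then show ?thesis using that fin by (auto intro: Max_ge)
  qed
  \<comment> \<open>Either \<open>x\<close> is the identity and nothing remains, with determinant 1,
    or pruning \<open>x\<close> leaves a smaller suffix-closed set, nonsingular by
    minimality.\<close>
  have nz': "blockdet \<phi> (F - {x}) \<noteq> 0"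
  proof (cases "x = fone")
    case True
    then have "g = fone" if "g \<in> F" for g using x(2)[OF that] by (simp add: len_def fone_iff)
    then have "F - {x} = {}" using True by auto
    then show ?thesis by (simp only: blockdet_gramker) simp
  next
    case False
    have "suffix_closed (F - {x})" using sc x False by (intro suffix_closed_remove) (auto simp: len_def)
    moreover have "card (F - {x}) < card F" using x fin by (intro psubset_card_mono) auto
    ultimately show ?thesis using F(2)[of "F - {x}"] fin by (auto simp: P_def)
  qed
  have nz: "blockdet \<phi> (fdom F s) \<noteq> 0" for s
  proof (cases "x \<in> fdom F s")
    case False
    then have "fdom F s \<subseteq> F - {x}" by (auto simp: fdom_def)
    then show ?thesis using blockdet_subset_nonzero[OF pd _ _ nz'] fin by blast
  next
    case True
    then have "x \<notin> fmul (fgen s) ` fdom F s" using fdom_leaf[of F x s] x by (auto simp: len_def)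
    then have "fmul (fgen s) ` fdom F s \<subseteq> F - {x}" by (auto simp: fdom_def)
    then have "blockdet \<phi> (fmul (fgen s) ` fdom F s) \<noteq> 0" using blockdet_subset_nonzero[OF pd _ _ nz'] fin by blast
    then show ?thesis using blockdet_translate[of "fdom F s" \<phi> "fgen s"] fin by (simp add: fdom_def)
  qed
  \<comment> \<open>The ratio is 0, so every positive number exceeds it.\<close>
  have "hann \<phi> \<le> ereal y" for y
    using hann_le[OF pd fin sc one nz, of "exp y"] z by simp
  then show ?thesis by (rule ereal_bot)
qed

theorem theoremA:
  fixes \<phi> :: "'s::finite fword \<Rightarrow> complex^'k::finite^'k"
  assumes "posdef \<phi>"
  shows "hann \<phi> < \<infinity> \<and> (seq1 \<phi> \<longlonglongrightarrow> hann \<phi>) \<and> (seq2 \<phi> \<longlonglongrightarrow> hann \<phi>)"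
proof (cases "\<exists>N. blockdet \<phi> (fball N) = 0")
  case True
  then obtain N where N: "blockdet \<phi> (fball N) = 0" by auto
  have h: "hann \<phi> = -\<infinity>" by (rule hann_singular[OF assms N])
  \<comment> \<open>Singularity passes to larger balls, so both sequences are eventually -infinity
    by convention.\<close>
  have "blockdet \<phi> (fball n) = 0" if "N \<le> n" for n
    using blockdet_subset_nonzero[OF assms finite_fball fball_mono[OF that]] N by blast
  then have "\<forall>\<^sub>F n in sequentially. seq1 \<phi> n = -\<infinity>" "\<forall>\<^sub>F n in sequentially. seq2 \<phi> n = -\<infinity>"
    by (auto simp: eventually_sequentially seq1_def seq2_def intro!: exI[of _ N])
  then show ?thesis unfolding h by (auto intro: tendsto_eventually)
next
  case False
  have nz: "blockdet \<phi> F \<noteq> 0" if "finite F" for F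
  proof -
    define N where "N = Max (insert 0 ((\<lambda>g. length (word g)) ` F))"
    have "F \<subseteq> fball N" using that by (auto simp: fball_def N_def intro!: Max_ge)
    then show ?thesis using blockdet_subset_nonzero[OF assms finite_fball] False by blast
  qed
  have finu: "finite (fball n \<union> fmul (fgen s) ` fball n)" "finite (fball n \<inter> fmul (fgen s) ` fball n)" "finite (fdom (fball n) s)"
    for n and s :: 's using finite_fball by (auto intro: finite_subset[OF _ finite_fball] simp: fdom_def[of "fball n" s])
  have s1: "seq1 \<phi> n = ereal (bseq \<phi> n)" for n
    using nz finite_fball finu by (auto simp: seq1_def bseq_def bent_def)
  have s2: "seq2 \<phi> n = ereal (bseq' \<phi> n)" for n
    using nz finite_fball finu by (auto simp: seq2_def bseq'_def bent_def)
  have pos: "Re (blockdet \<phi> F) > 0" if "finite F" for F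
    using psd_det_real(3)[OF _ posdef_psd[OF assms that]] nz[OF that] that by (simp add: blockdet_gramker)
  have ratio: "Re (blockdet \<phi> (fball n)) / (\<Prod>s\<in>UNIV. Re (blockdet \<phi> (fdom (fball n) s))) = exp (bseq \<phi> n)" for n
    using pos[OF finite_fball[of n]] pos[OF finu(3)[of n]]
    by (simp add: bseq_def bent_def blockdet_fdom[OF finite_fball] exp_diff exp_sum)
  have up: "hann \<phi> \<le> ereal (bseq \<phi> n)" for n
  proof (rule ereal_le_all_reals)
    fix y assume "bseq \<phi> n < y"
    then have "hann \<phi> \<le> ereal (ln (exp y))"
      using nz finu by (intro hann_le[OF assms finite_fball suffix_closed_fball fone_fball, of n]) (auto simp: ratio)
    then show "hann \<phi> \<le> ereal y" by simp
  qed
  \<comment> \<open>Every neighbourhood contains a basic one of some radius \<open>N\<close>, and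
    its rate is at least term \<open>N\<close> of the sequence.\<close>
  have low: "(INF n. ereal (bseq \<phi> n)) \<le> hann \<phi>"
    unfolding hann_def
  proof (rule INF_greatest)
    fix W assume "W \<in> {W. openin (top_of_set {\<psi>. posdef \<psi>}) W \<and> \<phi> \<in> W}"
    then have W: "openin (top_of_set {\<psi>. posdef \<psi>}) W" "\<phi> \<in> W" by auto
    obtain N \<eta> where N: "\<eta> > 0" "wnb (fball N) \<eta> \<phi> \<subseteq> W" using that by (rule wnb_basis[OF W])
    have "ereal (bseq \<phi> N) \<le> limsup (\<lambda>n. ann_term n W)"
    proof (rule ereal_ge_all_reals)
      fix y assume "y < bseq \<phi> N"
      then have "ereal (ln (exp y)) \<le> limsup (\<lambda>n. ann_term n W)"
        using nz finu finite_fball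
        by (intro limsup_ann_term_ge[OF assms finite_fball suffix_closed_fball fone_fball _ _ _ _ W(1) N(2,1)]) (auto simp: ratio)
      then show "ereal y \<le> limsup (\<lambda>n. ann_term n W)" by simp
    qed
    then show "(INF n. ereal (bseq \<phi> n)) \<le> limsup (\<lambda>n. ann_term n W)" by (rule INF_lower2[OF UNIV_I])
  qed
  have h: "hann \<phi> = (INF n. ereal (bseq \<phi> n))"
    using up low by (intro antisym INF_greatest) auto
  \<comment> \<open>The chain from term \<open>n + 1\<close> of \<open>bseq\<close> through term
    \<open>n\<close> of \<open>bseq'\<close> to term \<open>n\<close> of \<open>bseq\<close> gives
    monotonicity here and the sandwich for \<open>bseq'\<close> below.\<close>
  have dec: "decseq (\<lambda>n. ereal (bseq \<phi> n))"
    using bseq_Suc_le[OF assms nz] bseq'_le[OF assms nz] by (intro decseq_SucI) (metis ereal_less_eq(3) order_trans)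
  have lim: "(\<lambda>n. ereal (bseq \<phi> n)) \<longlonglongrightarrow> hann \<phi>" unfolding h by (rule LIMSEQ_INF[OF dec])
  have "(\<lambda>n. ereal (bseq' \<phi> n)) \<longlonglongrightarrow> hann \<phi>"
  proof (rule tendsto_sandwich)
    show "(\<lambda>n. ereal (bseq \<phi> (Suc n))) \<longlonglongrightarrow> hann \<phi>" using lim by (rule LIMSEQ_Suc)
    show "\<forall>\<^sub>F n in sequentially. ereal (bseq \<phi> (Suc n)) \<le> ereal (bseq' \<phi> n)"
      using bseq_Suc_le[OF assms nz] by (simp add: always_eventually)
    show "\<forall>\<^sub>F n in sequentially. ereal (bseq' \<phi> n) \<le> ereal (bseq \<phi> n)"
      using bseq'_le[OF assms nz] by (simp add: always_eventually)
  qed (rule lim)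
  moreover have "hann \<phi> < \<infinity>" using up[of 0] by (rule le_less_trans) simp
  ultimately show ?thesis using lim by (simp add: s1[abs_def] s2[abs_def])
qed

end
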